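(* Let $k$ be a field (of arbitrary characteristic), let $n\leq m$, and let $X=(x_{ij})$ be a generic $n\times m$ matrix with coordinate ring $R=k[x_{ij}]_{1\leq i\leq n,\,1\leq j\leq m}$. Let $X'$ be any matrix obtained from $X$ by setting entries equal to $0$ in such a way that the nonzero entries form a two-sided ladder, and let $I_n(X')\subset R$ be the ideal of $n\times n$ (maximal) minors of $X'$. Then $I_n(X')^t$ is Golod for all $t\geq 1$.
   Context: Two-sided ladder: the set of positions of the nonzero entries of $X'$ is a staircase-shaped region, i.e. for each row $i$ the nonzero entries are exactly those in columns $\alpha_i\leq j\leq\beta_i$, where the sequences $(\alpha_i)_i$ and $(\beta_i)_i$ are both weakly increasing or both weakly decreasing in $i$ (the two conventions differ by reversing the order of the columns, which does not change $I_n(X')$ up to relabelling variables). The fully generic matrix $X'=X$ is included. Golod: Let $J\subset R$ be a proper homogeneous ideal of the standard graded polynomial ring $R$. Let $K^{R/J}$ be the Koszul complex on a minimal generating set of the graded maximal ideal of $R/J$, viewed as a DG-algebra (exterior algebra with the Koszul differential $d$). The ring $R/J$ (equivalently, the ideal $J$) is called Golod if $A=K^{R/J}$ admits a trivial Massey operation: for some homogeneous $k$-basis $\mathcal{B}=\{h_\lambda\}_{\lambda\in\Lambda}$ of $H_{\geq 1}(A)$ there is a function $\mu:\coprod_{i=1}^\infty\mathcal{B}^i\to A$ (with homogeneous values) such that $\mu(h_\lambda)$ is a cycle with homology class $h_\lambda$, and $$d\mu(h_{\lambda_1},\dots,h_{\lambda_p})=\sum_{j=1}^{p-1}\overline{\mu(h_{\lambda_1},\dots,h_{\lambda_j})}\,\mu(h_{\lambda_{j+1}},\dots,h_{\lambda_p}),$$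 where $\overline{a}:=(-1)^{|a|+1}a$ and $|a|$ is the homological degree of $a$. *)

theory Defs
  imports
    "HOL-Library.Poly_Mapping"
    "HOL-Algebra.Ideal_Product"
    "HOL-Algebra.QuotRing"
    "HOL-Algebra.Embedded_Algebras"
    "HOL-Algebra.Algebraic_Closure_Type"
    "Jordan_Normal_Form.Determinant"
    "Jordan_Normal_Form.DL_Submatrix"
begin

section \<open>Polynomial rings\<close>

text \<open>A monomial is a finitely supported exponent function, a polynomial a finitely
  supported function from monomials to coefficients.\<close>

type_synonym ('v, 'k) mpoly = "('v \<Rightarrow>\<^sub>0 nat) \<Rightarrow>\<^sub>0 'k"

definition var :: "'v \<Rightarrow> ('v, 'k::field) mpoly" where
  "var v = Poly_Mapping.single (Poly_Mapping.single v 1) 1"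

definition const_poly :: "'k \<Rightarrow> ('v, 'k::field) mpoly" where
  "const_poly c = Poly_Mapping.single 0 c"

definition mpoly_ring :: "'v set \<Rightarrow> ('v, 'k::field) mpoly ring" where
  "mpoly_ring V =
     ring_of_type_algebra\<lparr>carrier := {p. \<forall>e\<in>Poly_Mapping.keys p. Poly_Mapping.keys e \<subseteq> V}\<rparr>"

definition homogeneous_poly :: "nat \<Rightarrow> ('v, 'k::field) mpoly \<Rightarrow> bool" where
  "homogeneous_poly d p \<longleftrightarrow>
     (\<forall>e\<in>Poly_Mapping.keys p. (\<Sum>v\<in>Poly_Mapping.keys e. Poly_Mapping.lookup e v) = d)"

definition homogeneous_elements :: "'v set \<Rightarrow> ('v, 'k::field) mpoly set" where
  "homogeneous_elements V = {p \<in> carrier (mpoly_ring V). \<exists>d. homogeneous_poly d p}"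

definition homogeneous_ideal :: "'v set \<Rightarrow> ('v, 'k::field) mpoly set \<Rightarrow> bool" where
  "homogeneous_ideal V J \<longleftrightarrow> (\<exists>S \<subseteq> homogeneous_elements V. J = Idl\<^bsub>mpoly_ring V\<^esub> S)"


section \<open>DG-algebras and trivial Massey operations\<close>

record 'a dga = "'a ring" +
  component :: "nat \<Rightarrow> 'a set"
  differential :: "'a \<Rightarrow> 'a"

definition cycles :: "'a dga \<Rightarrow> 'a set" where
  "cycles A = {z \<in> carrier A. differential A z = \<zero>\<^bsub>A\<^esub>}"

definition boundaries :: "'a dga \<Rightarrow> 'a set" where
  "boundaries A = differential A ` carrier A"

definition homology :: "'a dga \<Rightarrow> 'a set ring" where
  "homology A = (A\<lparr>carrier := cycles A\<rparr>) Quot (boundaries A)"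

definition homology_class :: "'a dga \<Rightarrow> 'a \<Rightarrow> 'a set" where
  "homology_class A z = boundaries A +>\<^bsub>A\<^esub> z"

definition homology_component :: "'a dga \<Rightarrow> nat \<Rightarrow> 'a set set" where
  "homology_component A p = homology_class A ` (cycles A \<inter> component A p)"

text \<open>The sum of the homology in all positive degrees, as an additive subgroup of the homology.\<close>

definition positive_homology :: "'a dga \<Rightarrow> 'a set set" where
  "positive_homology A =
     \<Inter>{H. additive_subgroup H (homology A) \<and> (\<forall>p\<ge>1. homology_component A p \<subseteq> H)}"

text \<open>Here \<open>F\<close> is the copy of the ground field in the algebra. Bases are lists, hence finite:
  this is no restriction for Koszul homology over a finitely generated graded algebra, which is
  finite-dimensional. The library predicate \<open>independent\<close> is linear independence.\<close>

definition homogeneous_homology_basis :: "'a set \<Rightarrow> 'a dga \<Rightarrow> 'a set list \<Rightarrow> bool" where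
  "homogeneous_homology_basis F A hs \<longleftrightarrow>
     (\<forall>h\<in>set hs. \<exists>p\<ge>1. h \<in> homology_component A p) \<and>
     ring.independent (homology A) (homology_class A ` F) hs \<and>
     ring.Span (homology A) (homology_class A ` F) hs = positive_homology A"

text \<open>The function \<open>deg\<close> records the homological degrees of the values of \<open>\<mu>\<close>, which enter
  through the sign in \<open>\<mu>\<close> overlined. A value that is zero has every degree, and then the sign
  is irrelevant.\<close>

definition trivial_Massey_operation ::
  "'a dga \<Rightarrow> 'a set list \<Rightarrow> ('a set list \<Rightarrow> 'a) \<Rightarrow> bool" where
  "trivial_Massey_operation A hs \<mu> \<longleftrightarrow>
     (\<exists>deg :: 'a set list \<Rightarrow> nat.
        (\<forall>h\<in>set hs. \<mu> [h] \<in> cycles A \<and> homology_class A (\<mu> [h]) = h) \<and>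
        (\<forall>w. w \<noteq> [] \<and> set w \<subseteq> set hs \<longrightarrow>
           \<mu> w \<in> component A (deg w) \<and>
           differential A (\<mu> w) =
             (\<Oplus>\<^bsub>A\<^esub> j\<in>{1..<length w}.
                (((\<ominus>\<^bsub>A\<^esub> \<one>\<^bsub>A\<^esub>) [^]\<^bsub>A\<^esub> (deg (take j w) + 1)) \<otimes>\<^bsub>A\<^esub> \<mu> (take j w))
                  \<otimes>\<^bsub>A\<^esub> \<mu> (drop j w))))"

definition admits_trivial_Massey_operation :: "'a set \<Rightarrow> 'a dga \<Rightarrow> bool" where
  "admits_trivial_Massey_operation F A \<longleftrightarrow>
     (\<exists>hs \<mu>. homogeneous_homology_basis F A hs \<and> trivial_Massey_operation A hs \<mu>)"


section \<open>The Koszul complex\<close>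

text \<open>The exterior algebra over \<open>S\<close> on \<open>e\<^sub>0, \<dots>, e\<^sub>r\<^sub>-\<^sub>1\<close>: an element is the function that sends
  \<open>U \<subseteq> {0, \<dots>, r - 1}\<close> to its coefficient at \<open>e\<^sub>U\<close>, the wedge product of the \<open>e\<^sub>u\<close>, \<open>u \<in> U\<close>, in
  increasing order. For disjoint \<open>T\<close> and \<open>U\<close>, the product of \<open>e\<^sub>T\<close> and \<open>e\<^sub>U\<close> is \<open>e\<close> at
  \<open>T \<union> U\<close> up to the sign that counts the pairs \<open>(t, u)\<close> with \<open>u < t\<close>. The differential sends \<open>e\<^sub>U\<close>
  to the sum over \<open>i \<in> U\<close> of the terms \<open>f\<^sub>i\<close> times \<open>e\<close> at \<open>U - {i}\<close>, with the sign that counts the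
  elements of \<open>U\<close> below \<open>i\<close>.\<close>

definition sign_in :: "('a, 'b) ring_scheme \<Rightarrow> nat \<Rightarrow> 'a" where
  "sign_in S k = (\<ominus>\<^bsub>S\<^esub> \<one>\<^bsub>S\<^esub>) [^]\<^bsub>S\<^esub> k"

definition koszul_carrier :: "('a, 'b) ring_scheme \<Rightarrow> nat \<Rightarrow> (nat set \<Rightarrow> 'a) set" where
  "koszul_carrier S r = Pow {..<r} \<rightarrow>\<^sub>E carrier S"

definition koszul_mult ::
  "('a, 'b) ring_scheme \<Rightarrow> nat \<Rightarrow> (nat set \<Rightarrow> 'a) \<Rightarrow> (nat set \<Rightarrow> 'a) \<Rightarrow> nat set \<Rightarrow> 'a" where
  "koszul_mult S r a b =
     (\<lambda>W\<in>Pow {..<r}. \<Oplus>\<^bsub>S\<^esub> T\<in>Pow W.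
        sign_in S (card {(t, u). t \<in> T \<and> u \<in> W - T \<and> u < t}) \<otimes>\<^bsub>S\<^esub> (a T \<otimes>\<^bsub>S\<^esub> b (W - T)))"

definition koszul_differential ::
  "('a, 'b) ring_scheme \<Rightarrow> 'a list \<Rightarrow> (nat set \<Rightarrow> 'a) \<Rightarrow> nat set \<Rightarrow> 'a" where
  "koszul_differential S fs a =
     (\<lambda>W\<in>Pow {..<length fs}. \<Oplus>\<^bsub>S\<^esub> i\<in>{..<length fs} - W.
        sign_in S (card {v\<in>W. v < i}) \<otimes>\<^bsub>S\<^esub> (fs ! i \<otimes>\<^bsub>S\<^esub> a (insert i W)))"

definition koszul_scalar :: "('a, 'b) ring_scheme \<Rightarrow> nat \<Rightarrow> 'a \<Rightarrow> nat set \<Rightarrow> 'a" where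
  "koszul_scalar S r c = (\<lambda>U\<in>Pow {..<r}. if U = {} then c else \<zero>\<^bsub>S\<^esub>)"

definition koszul :: "('a, 'b) ring_scheme \<Rightarrow> 'a list \<Rightarrow> (nat set \<Rightarrow> 'a) dga" where
  "koszul S fs =
     \<lparr>carrier = koszul_carrier S (length fs),
      monoid.mult = koszul_mult S (length fs),
      one = koszul_scalar S (length fs) \<one>\<^bsub>S\<^esub>,
      ring.zero = koszul_scalar S (length fs) \<zero>\<^bsub>S\<^esub>,
      add = (\<lambda>a b. \<lambda>U\<in>Pow {..<length fs}. a U \<oplus>\<^bsub>S\<^esub> b U),
      component = (\<lambda>p. {a \<in> koszul_carrier S (length fs).
                          \<forall>U\<in>Pow {..<length fs}. card U \<noteq> p \<longrightarrow> a U = \<zero>\<^bsub>S\<^esub>}),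
      differential = koszul_differential S fs\<rparr>"


section \<open>Golod ideals\<close>

definition graded_maximal_ideal ::
  "'v set \<Rightarrow> ('v, 'k::field) mpoly set \<Rightarrow> ('v, 'k) mpoly set set" where
  "graded_maximal_ideal V J =
     Idl\<^bsub>mpoly_ring V Quot J\<^esub> ((\<lambda>v. J +>\<^bsub>mpoly_ring V\<^esub> var v) ` V)"

text \<open>The minimal generators are homogeneous (a homogeneous element of the quotient is the class of
  a homogeneous polynomial). They need not be the classes of the variables, as the ideal may
  contain linear forms.\<close>

definition minimal_homogeneous_generators ::
  "'v set \<Rightarrow> ('v, 'k::field) mpoly set \<Rightarrow> ('v, 'k) mpoly set list \<Rightarrow> bool" where
  "minimal_homogeneous_generators V J fs \<longleftrightarrow>
     distinct fs \<and>
     set fs \<subseteq> (\<lambda>p. J +>\<^bsub>mpoly_ring V\<^esub> p) ` homogeneous_elements V \<and>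
     Idl\<^bsub>mpoly_ring V Quot J\<^esub> (set fs) = graded_maximal_ideal V J \<and>
     (\<forall>G. G \<subset> set fs \<longrightarrow> Idl\<^bsub>mpoly_ring V Quot J\<^esub> G \<noteq> graded_maximal_ideal V J)"

text \<open>Up to isomorphism of DG-algebras the Koszul complex does not depend on the minimal generators.\<close>

definition golod :: "'v set \<Rightarrow> ('v, 'k::field) mpoly set \<Rightarrow> bool" where
  "golod V J \<longleftrightarrow>
     ideal J (mpoly_ring V) \<and> J \<noteq> carrier (mpoly_ring V) \<and> homogeneous_ideal V J \<and>
     (\<exists>fs. minimal_homogeneous_generators V J fs \<and>
        admits_trivial_Massey_operation
          (range (\<lambda>c. koszul_scalar (mpoly_ring V Quot J) (length fs)
                        (J +>\<^bsub>mpoly_ring V\<^esub> const_poly c)))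
          (koszul (mpoly_ring V Quot J) fs))"


section \<open>Minors and ladders\<close>

text \<open>Rows and columns are indexed from 0.\<close>

definition generic_matrix :: "nat \<Rightarrow> nat \<Rightarrow> (nat \<times> nat, 'k::field) mpoly mat" where
  "generic_matrix n m = mat n m var"

definition minors :: "nat \<Rightarrow> 'a::comm_ring_1 mat \<Rightarrow> 'a set" where
  "minors k A = {det (submatrix A I J) | I J.
     I \<subseteq> {..<dim_row A} \<and> J \<subseteq> {..<dim_col A} \<and> card I = k \<and> card J = k}"

definition nonzero_positions :: "'a::zero mat \<Rightarrow> (nat \<times> nat) set" where
  "nonzero_positions A = {(i, j). i < dim_row A \<and> j < dim_col A \<and> A $$ (i, j) \<noteq> 0}"

text \<open>The bounds are integers, so that every row is allowed to be empty.\<close>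

definition two_sided_ladder :: "nat \<Rightarrow> nat \<Rightarrow> (nat \<times> nat) set \<Rightarrow> bool" where
  "two_sided_ladder n m L \<longleftrightarrow>
     (\<exists>\<alpha> \<beta> :: nat \<Rightarrow> int.
        (mono_on {..<n} \<alpha> \<and> mono_on {..<n} \<beta> \<or>
         antimono_on {..<n} \<alpha> \<and> antimono_on {..<n} \<beta>) \<and>
        L = {(i, j). i < n \<and> j < m \<and> \<alpha> i \<le> int j \<and> int j \<le> \<beta> i})"

end

theory Submission
  imports Defs "HOL-Library.Function_Algebras"
begin

text \<open>
Let \<open>J\<close> be the \<open>t\<close>-th power of the ideal of maximal minors of the ladder. It is generated by the products of
\<open>t\<close> maximal minors, which have degree \<open>d = n t\<close>. If \<open>d = 1\<close>, then \<open>J\<close> is generated by variables and the Koszul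
complex of the quotient is that of a polynomial ring (\<open>golod_ideal_of_variables\<close>). Let \<open>d \<ge> 2\<close>. The reason for
Golodness is that \<open>J\<close> has a linear resolution.

In terms of Koszul homology a linear resolution means that every cycle of positive homological degree with
coefficients of degree other than \<open>d - 1\<close> is a boundary (\<open>linear_koszul_quotient\<close>). A trivial Massey operation is
then built by recursion on the length \<open>l\<close> of words: the right-hand side of its defining equation is a cycle
with coefficients of degree \<open>l (d - 2) + 2\<close>, which is not \<open>d - 1\<close> as \<open>l \<ge> 2\<close>, so it is a boundary
(\<open>exists_massey_lift\<close>, \<open>admits_massey\<close>).

The linear resolution comes from the initial ideal of \<open>J\<close>. The entry in row \<open>i\<close> and column \<open>j\<close> gets the weight
\<open>i j\<close>, where the rows are numbered such that the bounds of the ladder increase. The term of highest weight of a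
minor is then the one of its diagonal, when that diagonal lies in the ladder (\<open>det_has_lead\<close>). Call a product of
the diagonals of \<open>t\<close> minors in the ladder a tableau. Each tableau is the leading monomial of an element of \<open>J\<close>
(\<open>tableau_generator\<close>). Conversely, all monomials of highest weight of a homogeneous element of \<open>J\<close> are divisible by a
tableau (\<open>initial_tableau\<close>). This rests on two facts.

\<^item> Given a set of \<open>n - 1\<close> columns, choose in every other column the entry in the row whose index is the number of chosen
  columns before it. Such a cut meets every diagonal, and the degree of the monomial in the entries of the cut is at
  least \<open>t\<close> (\<open>cut_inequality\<close>). For the proof one substitutes for the entries of the cut such that the matrix
  drops rank where they vanish.

\<^item> A monomial whose degree is at least \<open>t\<close> on every cut is divisible by a tableau. This is a duality of the type of
  maximal flows and minimal cuts: a greedy choice of \<open>t\<close> chains, row by row and as far to the left as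
  possible, fails only if some cut has degree below \<open>t\<close> (\<open>greedy_cut\<close>, \<open>cut_condition_imp_tableau\<close>).

The first fact is proved for a generic matrix. A ladder is completed to a generic matrix by new variables of very low
weight, decreasing with the distance from the ladder; the shape of the ladder is what makes this choice compatible with the
preference for diagonals (\<open>\<omega>'_monge\<close>).

Finally, the tableaux generate a monomial ideal with linear quotients when they are ordered by how far to the left they run
(\<open>tableau_linear_quotients\<close>): where an earlier tableau gets ahead, its cell can replace the next cell of the later
one. Linear quotients give the exactness of the Koszul complex of the monomial ideal outside of the linear strand
(\<open>multigraded_strand_exact\<close>), and an induction on the weight carries it over to \<open>J\<close> (\<open>weight_strand_exact\<close>) and then
to the quotient by \<open>J\<close> (\<open>strand_modulo\<close>).
\<close>


section \<open>Coefficients and degrees of polynomials\<close>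

abbreviation coef :: "('a \<Rightarrow>\<^sub>0 'b::zero) \<Rightarrow> 'a \<Rightarrow> 'b" where
  "coef \<equiv> Poly_Mapping.lookup"

abbreviation supp :: "('a \<Rightarrow>\<^sub>0 'b::zero) \<Rightarrow> 'a set" where
  "supp \<equiv> Poly_Mapping.keys"

abbreviation mterm :: "'a \<Rightarrow> 'b \<Rightarrow> 'a \<Rightarrow>\<^sub>0 'b::zero" where
  "mterm \<equiv> Poly_Mapping.single"

lemma coef_sum: "coef (sum f A) e = (\<Sum>x\<in>A. coef (f x) e)"
  by (rule Poly_Mapping.lookup_sum)

lemma coef_term: "coef (mterm a c) e = (if e = a then c else 0)"
  by (simp add: Poly_Mapping.lookup_single when_def)

lemma poly_as_sum: "p = (\<Sum>e\<in>supp p. mterm e (coef p e))"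
proof (rule Poly_Mapping.poly_mapping_eqI)
  fix k
  show "coef p k = coef (\<Sum>e\<in>supp p. mterm e (coef p e)) k"
    by (simp add: coef_sum coef_term in_keys_iff)
qed

lemma poly_induct [case_names zero mterm add]:
  assumes "P 0" "\<And>e c. P (mterm e c)" "\<And>p q. P p \<Longrightarrow> P q \<Longrightarrow> P (p + q)"
  shows "P (p :: 'a \<Rightarrow>\<^sub>0 'b::comm_monoid_add)"
proof -
  have "P (\<Sum>e\<in>A. mterm e (coef p e))" if "finite A" for A
    using that by induction (auto intro: assms)
  from this[of "supp p"] show ?thesis using poly_as_sum[of p] by simp
qed

lemma supp_poly_add_cases: "e \<in> supp (p + q) \<Longrightarrow> e \<in> supp p \<or> e \<in> supp q"
  using Poly_Mapping.keys_add[of p q] by blast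

lemma supp_poly_mult_cases:
  assumes "e \<in> supp (p * q)"
  shows "\<exists>a\<in>supp p. \<exists>b\<in>supp q. e = a + b"
proof -
  have "e \<in> {a + b | a b. a \<in> supp p \<and> b \<in> supp q}"
    using assms by (rule subsetD[OF Poly_Mapping.keys_mult])
  then show ?thesis by blast
qed

lemma supp_poly_diff_cases: "e \<in> supp (p - q) \<Longrightarrow> e \<in> supp p \<or> e \<in> supp (q :: 'a \<Rightarrow>\<^sub>0 'b::ab_group_add)"
  by (auto simp: in_keys_iff lookup_minus)

lemma supp_sum_cases: "e \<in> supp (sum f A) \<Longrightarrow> \<exists>x\<in>A. e \<in> supp (f x)"
proof (rule ccontr)
  assume "e \<in> supp (sum f A)" "\<not> (\<exists>x\<in>A. e \<in> supp (f x))"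
  then show False by (simp add: in_keys_iff coef_sum)
qed

lemma supp_mono_add: "supp (a + b) = supp a \<union> supp (b :: 'v \<Rightarrow>\<^sub>0 nat)"
  by (auto simp: in_keys_iff lookup_add)

lemma supp_mono_sum: "finite A \<Longrightarrow> supp (sum f A) = (\<Union>x\<in>A. supp (f x :: 'v \<Rightarrow>\<^sub>0 nat))"
  by (induction rule: finite_induct) (auto simp: supp_mono_add)

definition mdvd :: "('v \<Rightarrow>\<^sub>0 nat) \<Rightarrow> ('v \<Rightarrow>\<^sub>0 nat) \<Rightarrow> bool" where
  "mdvd a e \<longleftrightarrow> (\<forall>v. coef a v \<le> coef e v)"

lemma mdvd_refl [simp]: "mdvd a a"
  by (simp add: mdvd_def)

lemma mdvd_add [simp]: "mdvd a (a + b)" "mdvd a (b + a)"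
  by (simp_all add: mdvd_def lookup_add)

lemma mdvd_trans: "mdvd a b \<Longrightarrow> mdvd b c \<Longrightarrow> mdvd a c"
  unfolding mdvd_def using order_trans by blast

lemma mdvd_diff_add: "mdvd a e \<Longrightarrow> a + (e - a) = e"
  by (rule Poly_Mapping.poly_mapping_eqI) (simp add: mdvd_def lookup_add lookup_minus)

lemma coef_term_mult:
  "coef (mterm a c * p) e = (if mdvd a e then c * coef p (e - a) else (0 :: 'k::comm_ring_1))"
proof (induction p rule: poly_induct)
  case zero then show ?case by simp
next
  case (mterm b d)
  have *: "e = a + b \<longleftrightarrow> mdvd a e \<and> e - a = b"
    using mdvd_diff_add by (metis add_diff_cancel_left' mdvd_add(1))
  show ?case unfolding mult_single coef_term * by simp
next
  case (add p q) then show ?case by (simp add: lookup_add distrib_left)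
qed

lemma coef_mult:
  fixes p q :: "('v \<Rightarrow>\<^sub>0 nat) \<Rightarrow>\<^sub>0 'k::comm_ring_1"
  shows "coef (p * q) e = (\<Sum>a\<in>supp p. if mdvd a e then coef p a * coef q (e - a) else 0)"
proof -
  have "p * q = (\<Sum>a\<in>supp p. mterm a (coef p a) * q)"
    by (subst poly_as_sum[of p]) (rule sum_distrib_right)
  then show ?thesis by (simp add: coef_sum coef_term_mult)
qed

definition weight :: "('v \<Rightarrow> 'c::comm_semiring_1) \<Rightarrow> ('v \<Rightarrow>\<^sub>0 nat) \<Rightarrow> 'c" where
  "weight w e = (\<Sum>v\<in>supp e. w v * of_nat (coef e v))"

lemma weight_zero [simp]: "weight w 0 = 0"
  by (simp add: weight_def)

lemma weight_add [simp]: "weight w (a + b) = weight w a + weight w b"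
  unfolding weight_def
  by (rule setsum_keys_plus_distrib) (simp_all add: distrib_left)

lemma weight_term [simp]: "weight w (mterm v k) = w v * of_nat k"
  by (cases "k = 0") (simp_all add: weight_def)

lemma weight_sum: "weight w (sum f A) = (\<Sum>x\<in>A. weight w (f x))"
  by (induction A rule: infinite_finite_induct) simp_all

lemma weight_superset:
  "finite A \<Longrightarrow> supp e \<subseteq> A \<Longrightarrow> weight w e = (\<Sum>v\<in>A. w v * of_nat (coef e v))"
  unfolding weight_def by (rule sum.mono_neutral_left) (auto simp: in_keys_iff)

definition mdeg :: "('v \<Rightarrow>\<^sub>0 nat) \<Rightarrow> nat" where
  "mdeg = weight (\<lambda>_. 1)"

lemma mdeg_simps [simp]:
  "mdeg 0 = 0" "mdeg (a + b) = mdeg a + mdeg b" "mdeg (Poly_Mapping.single v k) = k"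
  by (simp_all add: mdeg_def)

lemma mdeg_sum: "mdeg (sum f A) = (\<Sum>x\<in>A. mdeg (f x))"
  by (simp add: mdeg_def weight_sum)

lemma homogeneous_poly_iff: "homogeneous_poly d p \<longleftrightarrow> (\<forall>e\<in>supp p. mdeg e = d)"
  by (simp add: homogeneous_poly_def mdeg_def weight_def)

lemma homogeneous_zero [simp]: "homogeneous_poly d 0"
  by (simp add: homogeneous_poly_iff)

lemma homogeneous_add: "homogeneous_poly d p \<Longrightarrow> homogeneous_poly d q \<Longrightarrow> homogeneous_poly d (p + q)"
  unfolding homogeneous_poly_iff by (meson supp_poly_add_cases)

lemma homogeneous_diff: "homogeneous_poly d p \<Longrightarrow> homogeneous_poly d q \<Longrightarrow> homogeneous_poly d (p - q)"
  unfolding homogeneous_poly_iff by (meson supp_poly_diff_cases)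

lemma homogeneous_uminus: "homogeneous_poly d p \<Longrightarrow> homogeneous_poly d (- p)"
  using homogeneous_diff[of d 0 p] by simp

lemma homogeneous_sum: "(\<And>x. x \<in> A \<Longrightarrow> homogeneous_poly d (f x)) \<Longrightarrow> homogeneous_poly d (sum f A)"
  unfolding homogeneous_poly_iff by (meson supp_sum_cases)

lemma homogeneous_mult:
  "homogeneous_poly d p \<Longrightarrow> homogeneous_poly e q \<Longrightarrow> homogeneous_poly (d + e) (p * q)"
  unfolding homogeneous_poly_iff using supp_poly_mult_cases[of _ p q] by fastforce

lemma homogeneous_term: "homogeneous_poly (mdeg e) (mterm e c)"
  by (auto simp: homogeneous_poly_iff)

lemma homogeneous_var [simp]: "homogeneous_poly 1 (var v)"
  by (simp add: homogeneous_poly_iff var_def)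

lemma homogeneous_one [simp]: "homogeneous_poly 0 1"
  by (simp add: homogeneous_poly_iff)

lemma homogeneous_const [simp]: "homogeneous_poly 0 (const_poly c)"
  by (auto simp: homogeneous_poly_iff const_poly_def)

lemma neg_one_power_mult_homogeneous:
  "homogeneous_poly d p \<Longrightarrow> homogeneous_poly d ((- 1) ^ k * p)"
  by (cases "even k") (auto simp: homogeneous_uminus)

definition hcomp :: "nat \<Rightarrow> ('v, 'k::field) mpoly \<Rightarrow> ('v, 'k) mpoly" where
  "hcomp k p = (\<Sum>e | e \<in> supp p \<and> mdeg e = k. mterm e (coef p e))"

lemma coef_hcomp: "coef (hcomp k p) e = (if mdeg e = k then coef p e else 0)"
  by (auto simp: hcomp_def coef_sum coef_term in_keys_iff)

lemma hcomp_add: "hcomp k (p + q) = hcomp k p + hcomp k q"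
  by (rule Poly_Mapping.poly_mapping_eqI) (simp add: coef_hcomp lookup_add)

lemma hcomp_diff: "hcomp k (p - q) = hcomp k p - hcomp k q"
  by (rule Poly_Mapping.poly_mapping_eqI) (simp add: coef_hcomp lookup_minus)

lemma hcomp_zero [simp]: "hcomp k 0 = 0"
  by (simp add: hcomp_def)

lemma hcomp_sum: "hcomp k (sum f A) = (\<Sum>x\<in>A. hcomp k (f x))"
  by (induction A rule: infinite_finite_induct) (simp_all add: hcomp_add)

lemma homogeneous_hcomp [simp]: "homogeneous_poly k (hcomp k p)"
  by (auto simp: homogeneous_poly_iff in_keys_iff coef_hcomp split: if_splits)

lemma hcomp_homogeneous: "homogeneous_poly d p \<Longrightarrow> hcomp k p = (if k = d then p else 0)"
  by (rule Poly_Mapping.poly_mapping_eqI)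
     (auto simp: coef_hcomp homogeneous_poly_iff in_keys_iff)

lemma hcomp_mult_homogeneous:
  assumes "homogeneous_poly d q"
  shows "hcomp k (p * q) = (if d \<le> k then hcomp (k - d) p * q else 0)"
proof (induction p rule: poly_induct)
  case zero then show ?case by simp
next
  case (mterm e c)
  have *: "homogeneous_poly (mdeg e + d) (mterm e c * q)"
    by (intro homogeneous_mult homogeneous_term assms)
  have eq: "k = mdeg e + d \<longleftrightarrow> d \<le> k \<and> k - d = mdeg e" by linarith
  show ?case
    unfolding hcomp_homogeneous[OF *] hcomp_homogeneous[OF homogeneous_term] eq by simp
next
  case (add p p') then show ?case by (simp add: hcomp_add distrib_right)
qed

lemma sum_hcomp:
  assumes "\<And>e. e \<in> supp p \<Longrightarrow> mdeg e < N"
  shows "p = (\<Sum>k<N. hcomp k p)"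
proof (rule Poly_Mapping.poly_mapping_eqI)
  fix e
  show "coef p e = coef (\<Sum>k<N. hcomp k p) e"
  proof (cases "e \<in> supp p")
    case True
    then show ?thesis using assms[of e] by (simp add: coef_sum coef_hcomp)
  next
    case False
    then have "coef p e = 0" by (simp add: in_keys_iff)
    then show ?thesis by (simp add: coef_sum coef_hcomp if_distrib cong: if_cong)
  qed
qed

abbreviation polys :: "'v set \<Rightarrow> ('v, 'k::field) mpoly set" where
  "polys V \<equiv> carrier (mpoly_ring V)"

lemma mem_polys: "p \<in> polys V \<longleftrightarrow> (\<forall>e\<in>supp p. supp e \<subseteq> V)"
  by (simp add: mpoly_ring_def ring_of_type_algebra_def)

lemma mpoly_ring_simps [simp]:
  "\<one>\<^bsub>mpoly_ring V\<^esub> = 1" "\<zero>\<^bsub>mpoly_ring V\<^esub> = 0"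
  "p \<oplus>\<^bsub>mpoly_ring V\<^esub> q = p + q" "p \<otimes>\<^bsub>mpoly_ring V\<^esub> q = p * q"
  by (simp_all add: mpoly_ring_def ring_of_type_algebra_def)

lemma polys_zero [simp]: "0 \<in> polys V"
  by (simp add: mem_polys)

lemma polys_one [simp]: "1 \<in> polys V"
  by (simp add: mem_polys)

lemma polys_var: "v \<in> V \<Longrightarrow> var v \<in> polys V"
  by (simp add: mem_polys var_def)

lemma polys_const [simp]: "const_poly c \<in> polys V"
  by (simp add: mem_polys const_poly_def)

lemma polys_term: "supp e \<subseteq> V \<Longrightarrow> mterm e c \<in> polys V"
  by (simp add: mem_polys)

lemma polys_add: "p \<in> polys V \<Longrightarrow> q \<in> polys V \<Longrightarrow> p + q \<in> polys V"
  unfolding mem_polys by (meson supp_poly_add_cases)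

lemma polys_diff: "p \<in> polys V \<Longrightarrow> q \<in> polys V \<Longrightarrow> p - q \<in> polys V"
  unfolding mem_polys by (meson supp_poly_diff_cases)

lemma polys_uminus: "p \<in> polys V \<Longrightarrow> - p \<in> polys V"
  using polys_diff[of 0 V p] by simp

lemma polys_mult: "p \<in> polys V \<Longrightarrow> q \<in> polys V \<Longrightarrow> p * q \<in> polys V"
proof -
  assume p: "p \<in> polys V" and q: "q \<in> polys V"
  have "supp e \<subseteq> V" if e: "e \<in> supp (p * q)" for e
  proof -
    obtain a b where "a \<in> supp p" "b \<in> supp q" "e = a + b"
      using supp_poly_mult_cases[OF e] by blast
    then show ?thesis using p q by (simp add: mem_polys supp_mono_add)
  qed
  then show ?thesis by (simp add: mem_polys)
qed

lemma polys_sum: "(\<And>x. x \<in> A \<Longrightarrow> f x \<in> polys V) \<Longrightarrow> sum f A \<in> polys V"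
  unfolding mem_polys by (meson supp_sum_cases)

lemma polys_prod: "(\<And>x. x \<in> A \<Longrightarrow> f x \<in> polys V) \<Longrightarrow> prod f A \<in> polys V"
  by (induction A rule: infinite_finite_induct) (auto intro: polys_mult)

lemma polys_sign: "p \<in> polys V \<Longrightarrow> (- 1) ^ k * p \<in> polys V"
  by (cases "even k") (auto simp: polys_uminus)

lemma polys_hcomp: "p \<in> polys V \<Longrightarrow> hcomp k p \<in> polys V"
  by (auto simp: mem_polys in_keys_iff coef_hcomp split: if_splits)

lemma mpoly_ring_cring: "cring (mpoly_ring V)"
proof (rule cringI)
  show "abelian_group (mpoly_ring V)"
  proof (rule abelian_groupI)
    fix p assume "p \<in> polys V"
    then show "\<exists>q\<in>polys V. q \<oplus>\<^bsub>mpoly_ring V\<^esub> p = \<zero>\<^bsub>mpoly_ring V\<^esub>"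
      by (intro bexI[of _ "- p"]) (auto intro: polys_uminus)
  qed (auto simp: polys_add algebra_simps)
  show "comm_monoid (mpoly_ring V)"
    by (rule comm_monoidI) (auto simp: polys_mult algebra_simps)
qed (auto simp: algebra_simps)

lemma mpoly_ring_ring: "ring (mpoly_ring V)"
  using mpoly_ring_cring cring.axioms(1) by blast

lemma mpoly_ring_a_inv:
  assumes "p \<in> polys V"
  shows "\<ominus>\<^bsub>mpoly_ring V\<^esub> p = - p"
proof -
  interpret cring "mpoly_ring V :: ('a, 'b) mpoly ring" by (rule mpoly_ring_cring)
  show ?thesis
    using minus_equality[of "- p" p] assms polys_uminus[OF assms] by simp
qed

lemma ideal_closed:
  assumes "ideal J (mpoly_ring V)"
  shows "0 \<in> J" "p \<in> J \<Longrightarrow> q \<in> J \<Longrightarrow> p + q \<in> J" "p \<in> J \<Longrightarrow> - p \<in> J"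
    "p \<in> J \<Longrightarrow> q \<in> J \<Longrightarrow> p - q \<in> J" "p \<in> J \<Longrightarrow> q \<in> polys V \<Longrightarrow> q * p \<in> J"
    "p \<in> J \<Longrightarrow> p \<in> polys V"
proof -
  interpret ideal J "mpoly_ring V" by (rule assms)
  show 0: "0 \<in> J" using additive_subgroup.zero_closed[OF ideal.axioms(1)[OF assms]] by simp
  show add: "p + q \<in> J" if "p \<in> J" "q \<in> J" for p q using additive_subgroup.a_closed[OF ideal.axioms(1)[OF assms] that] by simp
  show car: "p \<in> polys V" if "p \<in> J" for p using that by (rule Icarr)
  show neg: "- p \<in> J" if "p \<in> J" for p
    using additive_subgroup.a_inv_closed[OF ideal.axioms(1)[OF assms] that] by (simp add: mpoly_ring_a_inv[OF car[OF that]])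
  show "p - q \<in> J" if "p \<in> J" "q \<in> J" for p q
    using add[OF that(1) neg[OF that(2)]] by simp
  show "q * p \<in> J" if "p \<in> J" "q \<in> polys V" for p q
    using I_l_closed[OF that] by simp
qed

lemma ideal_sum_closed:
  assumes "ideal J (mpoly_ring V)" "\<And>x. x \<in> A \<Longrightarrow> f x \<in> J"
  shows "sum f A \<in> J"
  using assms(2) by (induction A rule: infinite_finite_induct) (auto intro: ideal_closed[OF assms(1)])


section \<open>The Koszul algebra over a commutative ring\<close>

text \<open>The operations of the Koszul algebra on total functions. An element is a function on all sets of
  indices, with value \<open>0\<close> at the sets that are not contained in \<open>{..<r}\<close>; no restriction of the
  argument gets in the way of calculations. The sign involution \<open>khat\<close> is the one that occurs in the Leibniz rule.\<close>

definition inversions :: "nat set \<Rightarrow> nat set \<Rightarrow> nat" where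
  "inversions T U = card {(t, u). t \<in> T \<and> u \<in> U \<and> u < t}"

definition kmul :: "nat \<Rightarrow> (nat set \<Rightarrow> 'a::comm_ring_1) \<Rightarrow> (nat set \<Rightarrow> 'a) \<Rightarrow> nat set \<Rightarrow> 'a" where
  "kmul r a b W = (if W \<subseteq> {..<r} then
     \<Sum>T\<in>Pow W. (- 1) ^ inversions T (W - T) * (a T * b (W - T)) else 0)"

definition kd :: "'a::comm_ring_1 list \<Rightarrow> (nat set \<Rightarrow> 'a) \<Rightarrow> nat set \<Rightarrow> 'a" where
  "kd fs a W = (if W \<subseteq> {..<length fs} then
     \<Sum>i\<in>{..<length fs} - W. (- 1) ^ card {v\<in>W. v < i} * (fs ! i * a (insert i W)) else 0)"

definition khat :: "(nat set \<Rightarrow> 'a::comm_ring_1) \<Rightarrow> nat set \<Rightarrow> 'a" where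
  "khat a T = (- 1) ^ card T * a T"

lemma neg_one_power_eqI: "even (m + n) \<Longrightarrow> (- 1 :: 'a::ring_1) ^ m = (- 1) ^ n"
  by (metis even_add minus_one_power_iff)

lemma neg_one_power_oppI: "odd (m + n) \<Longrightarrow> (- 1 :: 'a::ring_1) ^ m = - ((- 1) ^ n)"
  by (metis even_add minus_one_power_iff minus_minus)

lemma sign_collect:
  "(- 1) ^ p * (f * ((- 1) ^ q * (x * y))) = (- 1) ^ (p + q) * (f * x * (y :: 'a::comm_ring_1))"
  by (simp add: power_add mult_ac)

lemma finite_inversion_set: "finite T \<Longrightarrow> finite U \<Longrightarrow> finite {(t, u). t \<in> T \<and> u \<in> U \<and> u < (t::nat)}"
  by (rule finite_subset[of _ "T \<times> U"]) auto

lemma inversions_Un_left: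
  assumes "finite T" "finite T'" "finite U" "T \<inter> T' = {}"
  shows "inversions (T \<union> T') U = inversions T U + inversions T' U"
proof -
  have "{(t, u). t \<in> T \<union> T' \<and> u \<in> U \<and> u < t} =
     {(t, u). t \<in> T \<and> u \<in> U \<and> u < t} \<union> {(t, u). t \<in> T' \<and> u \<in> U \<and> u < t}" by auto
  then show ?thesis unfolding inversions_def
    using assms by (auto intro!: card_Un_disjoint finite_inversion_set)
qed

lemma inversions_Un_right:
  assumes "finite T" "finite U" "finite U'" "U \<inter> U' = {}"
  shows "inversions T (U \<union> U') = inversions T U + inversions T U'"
proof -
  have "{(t, u). t \<in> T \<and> u \<in> U \<union> U' \<and> u < t} =
     {(t, u). t \<in> T \<and> u \<in> U \<and> u < t} \<union> {(t, u). t \<in> T \<and> u \<in> U' \<and> u < t}" by auto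
  then show ?thesis unfolding inversions_def
    using assms by (auto intro!: card_Un_disjoint finite_inversion_set)
qed

lemma inversions_singleton_left: "inversions {i} U = card {u\<in>U. u < i}"
proof -
  have "{(t, u). t \<in> {i} \<and> u \<in> U \<and> u < t} = Pair i ` {u\<in>U. u < i}" by auto
  then show ?thesis by (simp add: inversions_def card_image inj_on_def)
qed

lemma inversions_singleton_right: "inversions T {i} = card {t\<in>T. i < t}"
proof -
  have "{(t, u). t \<in> T \<and> u \<in> {i} \<and> u < t} = (\<lambda>t. (t, i)) ` {t\<in>T. i < t}" by auto
  then show ?thesis by (simp add: inversions_def card_image inj_on_def)
qed

lemma inversions_insert_left:
  assumes "finite T" "finite U" "i \<notin> T"
  shows "inversions (insert i T) U = card {u\<in>U. u < i} + inversions T U"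
  using inversions_Un_left[of "{i}" T U] assms by (simp add: inversions_singleton_left)

lemma inversions_insert_right:
  assumes "finite T" "finite U" "i \<notin> U"
  shows "inversions T (insert i U) = card {t\<in>T. i < t} + inversions T U"
  using inversions_Un_right[of T "{i}" U] assms by (simp add: inversions_singleton_right)

lemma card_below_above:
  assumes "finite T" "i \<notin> T"
  shows "card {t\<in>T. t < i} + card {t\<in>T. i < t} = card (T :: nat set)"
proof -
  have "T = {t\<in>T. t < i} \<union> {t\<in>T. i < t}" using assms(2) by (auto, metis neqE)
  moreover have "card ({t\<in>T. t < i} \<union> {t\<in>T. i < t}) = card {t\<in>T. t < i} + card {t\<in>T. i < t}"
    by (rule card_Un_disjoint) (use assms(1) in auto)
  ultimately show ?thesis by simp
qed

lemma card_below_union: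
  assumes "finite T" "finite U" "T \<inter> U = {}"
  shows "card {v \<in> T \<union> U. v < (i::nat)} = card {v\<in>T. v < i} + card {v\<in>U. v < i}"
proof -
  have "{v \<in> T \<union> U. v < i} = {v\<in>T. v < i} \<union> {v\<in>U. v < i}" by auto
  then show ?thesis using assms by (auto intro!: card_Un_disjoint)
qed

text \<open>Both ways of associating are the sum over all ordered partitions of \<open>W\<close> into three parts,
  with the sign that counts the inversions between each two of the parts.\<close>

lemma kmul_assoc: "kmul r (kmul r a b) c = kmul r a (kmul r b c)"
proof
  fix W
  show "kmul r (kmul r a b) c W = kmul r a (kmul r b c) W"
  proof (cases "W \<subseteq> {..<r}")
    case W: True
    then have fin: "finite W" using finite_subset by blast
    define F where "F T Q = (- 1) ^ (inversions T Q + inversions (T \<union> Q) (W - (T \<union> Q))) *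
      (a T * b Q * c (W - (T \<union> Q)))" for T Q
    have "kmul r (kmul r a b) c W = (\<Sum>S\<in>Pow W. \<Sum>T\<in>Pow S. F T (S - T))"
    proof -
      have "(- 1) ^ inversions S (W - S) * (kmul r a b S * c (W - S)) = (\<Sum>T\<in>Pow S. F T (S - T))"
        if "S \<in> Pow W" for S
      proof -
        have "T \<union> (S - T) = S" if "T \<in> Pow S" for T using that by auto
        then show ?thesis using that W
          by (auto simp: kmul_def F_def sum_distrib_left sum_distrib_right power_add Un_absorb1
              mult_ac intro!: sum.cong)
      qed
      then show ?thesis using W by (simp add: kmul_def[of r "kmul r a b"])
    qed
    also have "\<dots> = (\<Sum>(S, T)\<in>Sigma (Pow W) Pow. F T (S - T))"
      by (subst sum.Sigma) (auto simp: fin intro: finite_subset[OF _ fin])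
    also have "\<dots> = (\<Sum>(T, Q)\<in>Sigma (Pow W) (\<lambda>T. Pow (W - T)). F T Q)"
      by (rule sum.reindex_bij_witness[of _ "\<lambda>(T, Q). (T \<union> Q, T)" "\<lambda>(S, T). (T, S - T)"]) auto
    also have "\<dots> = (\<Sum>T\<in>Pow W. \<Sum>Q\<in>Pow (W - T). F T Q)"
      by (subst sum.Sigma) (auto simp: fin intro: finite_subset[OF _ fin])
    also have "\<dots> = kmul r a (kmul r b c) W"
    proof -
      have "(- 1) ^ inversions T (W - T) * (a T * kmul r b c (W - T)) = (\<Sum>Q\<in>Pow (W - T). F T Q)"
        if T: "T \<in> Pow W" for T
      proof -
        have "W - T \<subseteq> {..<r}" using W by auto
        moreover have "F T Q = (- 1) ^ inversions T (W - T) *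
            (a T * ((- 1) ^ inversions Q (W - T - Q) * (b Q * c (W - T - Q))))"
          if Q: "Q \<in> Pow (W - T)" for Q
        proof -
          have f: "finite T" "finite Q" "finite (W - T - Q)"
            using T Q by (auto intro: finite_subset[OF _ fin])
          have eq: "W - (T \<union> Q) = W - T - Q" "W - T = Q \<union> (W - T - Q)" using Q by auto
          have "inversions T (W - T) = inversions T Q + inversions T (W - T - Q)"
            by (subst eq(2), rule inversions_Un_right) (use f in auto)
          moreover have "inversions (T \<union> Q) (W - T - Q) = inversions T (W - T - Q) + inversions Q (W - T - Q)"
            by (rule inversions_Un_left) (use f Q in auto)
          ultimately show ?thesis by (simp add: F_def eq(1) power_add mult_ac)
        qed
        ultimately show ?thesis by (simp add: kmul_def sum_distrib_left)
      qed
      then show ?thesis using W by (simp add: kmul_def[of r a])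
    qed
    finally show ?thesis .
  qed (simp add: kmul_def)
qed

lemma kmul_add_left: "kmul r (\<lambda>U. a U + b U) c = (\<lambda>W. kmul r a c W + kmul r b c W)"
  by (rule ext) (simp add: kmul_def distrib_left distrib_right sum.distrib)

lemma kmul_add_right: "kmul r c (\<lambda>U. a U + b U) = (\<lambda>W. kmul r c a W + kmul r c b W)"
  by (rule ext) (simp add: kmul_def distrib_left distrib_right sum.distrib)

definition kscalar :: "'a::comm_ring_1 \<Rightarrow> nat set \<Rightarrow> 'a" where
  "kscalar c U = (if U = {} then c else 0)"

lemma kmul_scalar_left:
  "W \<subseteq> {..<r} \<Longrightarrow> kmul r (kscalar c) a W = c * a W"
proof -
  assume W: "W \<subseteq> {..<r}"
  then have "finite W" using finite_subset by blast
  then have "(\<Sum>T\<in>Pow W. (- 1) ^ inversions T (W - T) * (kscalar c T * a (W - T))) =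
    (\<Sum>T\<in>{{}}. (- 1) ^ inversions T (W - T) * (kscalar c T * a (W - T)))"
    by (intro sum.mono_neutral_right) (auto simp: kscalar_def)
  then show ?thesis using W by (simp add: kmul_def kscalar_def inversions_def)
qed

lemma kmul_scalar_right:
  "W \<subseteq> {..<r} \<Longrightarrow> kmul r a (kscalar c) W = a W * c"
proof -
  assume W: "W \<subseteq> {..<r}"
  then have "finite W" using finite_subset by blast
  then have "(\<Sum>T\<in>Pow W. (- 1) ^ inversions T (W - T) * (a T * kscalar c (W - T))) =
    (\<Sum>T\<in>{W}. (- 1) ^ inversions T (W - T) * (a T * kscalar c (W - T)))"
    by (intro sum.mono_neutral_right) (auto simp: kscalar_def)
  then show ?thesis using W by (simp add: kmul_def kscalar_def inversions_def)
qed

lemma sum_Pow_insert: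
  assumes "finite W" "i \<notin> W"
  shows "(\<Sum>T\<in>Pow (insert i W). g T) = (\<Sum>T\<in>Pow W. g (insert i T) + (g T :: 'a::comm_monoid_add))"
proof -
  have "(\<Sum>T\<in>Pow (insert i W). g T) = (\<Sum>T\<in>Pow W. g T) + (\<Sum>T\<in>insert i ` Pow W. g T)"
    unfolding Pow_insert using assms by (intro sum.union_disjoint) auto
  also have "(\<Sum>T\<in>insert i ` Pow W. g T) = (\<Sum>T\<in>Pow W. g (insert i T))"
    by (rule sum.reindex_cong[of "insert i"]) (use assms in \<open>auto simp: inj_on_def\<close>)
  finally show ?thesis by (simp add: sum.distrib add.commute)
qed

text \<open>The Leibniz rule. The terms of the right-hand side in which the removed index lies in \<open>W\<close>
  cancel in pairs; the others are the terms of the left-hand side.\<close>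

lemma kd_kmul:
  "kd fs (kmul (length fs) a b) W =
     kmul (length fs) (kd fs a) b W + kmul (length fs) (khat a) (kd fs b) W"
proof (cases "W \<subseteq> {..<length fs}")
  case W: True
  let ?r = "length fs"
  have fin: "finite W" using W finite_subset by blast
  define C where "C = {..<?r} - W"
  define s where "s i T = card {v\<in>T. v < (i::nat)}" for i T
  define E1 where "E1 T i = (- 1) ^ (inversions T (W - T) + s i T) *
    (fs ! i * a (insert i T) * b (W - T))" for T i
  define E2 where "E2 T i = (- 1) ^ (inversions T (W - T) + card T + s i (W - T)) *
    (fs ! i * a T * b (insert i (W - T)))" for T i
  have lhs: "kd fs (kmul ?r a b) W = (\<Sum>T\<in>Pow W. \<Sum>i\<in>C. E1 T i + E2 T i)"
  proof -
    have "kd fs (kmul ?r a b) W = (\<Sum>i\<in>C. \<Sum>T\<in>Pow W. E1 T i + E2 T i)"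
    proof -
      have "(- 1) ^ card {v\<in>W. v < i} * (fs ! i * kmul ?r a b (insert i W)) = (\<Sum>T\<in>Pow W. E1 T i + E2 T i)"
        if i: "i \<in> C" for i
      proof -
        have iW: "i \<notin> W" "insert i W \<subseteq> {..<?r}" using i W by (auto simp: C_def)
        have "(- 1) ^ s i W * (fs ! i * ((- 1) ^ inversions (insert i T) (insert i W - insert i T) *
             (a (insert i T) * b (insert i W - insert i T)))) = E1 T i"
          "(- 1) ^ s i W * (fs ! i * ((- 1) ^ inversions T (insert i W - T) * (a T * b (insert i W - T)))) = E2 T i"
          if T: "T \<in> Pow W" for T
        proof -
          have f: "finite T" "finite (W - T)" "i \<notin> T" "i \<notin> W - T"
            using T iW by (auto intro: finite_subset[OF _ fin])
          have e: "insert i W - insert i T = W - T" "insert i W - T = insert i (W - T)"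
            using T iW by auto
          have sW: "s i W = s i T + s i (W - T)"
          proof -
            have "T \<union> (W - T) = W" using T by auto
            then show ?thesis unfolding s_def using card_below_union[of T "W - T" i] f by auto
          qed
          have 1: "inversions (insert i T) (W - T) = s i (W - T) + inversions T (W - T)"
            unfolding s_def by (rule inversions_insert_left) (use f in auto)
          have 2: "inversions T (insert i (W - T)) = card {t\<in>T. i < t} + inversions T (W - T)"
            by (rule inversions_insert_right) (use f in auto)
          have 3: "card T = s i T + card {t\<in>T. i < t}"
            unfolding s_def using card_below_above[of T i] f by simp
          have "(- 1 :: 'a) ^ (s i W + inversions (insert i T) (W - T)) = (- 1) ^ (inversions T (W - T) + s i T)"
            by (rule neg_one_power_eqI) (simp add: sW 1, blast)
          then show "(- 1) ^ s i W * (fs ! i * ((- 1) ^ inversions (insert i T) (insert i W - insert i T) *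
             (a (insert i T) * b (insert i W - insert i T)))) = E1 T i"
            unfolding E1_def e by (simp only: sign_collect)
          have "(- 1 :: 'a) ^ (s i W + inversions T (insert i (W - T))) =
             (- 1) ^ (inversions T (W - T) + card T + s i (W - T))"
            by (rule neg_one_power_eqI) (simp add: sW 2 3, blast?)
          then show "(- 1) ^ s i W * (fs ! i * ((- 1) ^ inversions T (insert i W - T) * (a T * b (insert i W - T)))) = E2 T i"
            unfolding E2_def e by (simp only: sign_collect)
        qed
        then show ?thesis using iW
          by (simp add: kmul_def sum_Pow_insert[OF fin iW(1)] sum_distrib_left distrib_left s_def)
      qed
      then show ?thesis using W by (simp add: kd_def C_def)
    qed
    then show ?thesis by (simp add: sum.swap[of _ "Pow W"])
  qed
  have r1: "kmul ?r (kd fs a) b W = (\<Sum>T\<in>Pow W. (\<Sum>i\<in>C. E1 T i) + (\<Sum>i\<in>W - T. E1 T i))"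
  proof -
    have "(- 1) ^ inversions T (W - T) * (kd fs a T * b (W - T)) = (\<Sum>i\<in>C. E1 T i) + (\<Sum>i\<in>W - T. E1 T i)"
      if T: "T \<in> Pow W" for T
    proof -
      have "{..<?r} - T = C \<union> (W - T)" "C \<inter> (W - T) = {}" using T W by (auto simp: C_def)
      moreover have "T \<subseteq> {..<?r}" using T W by auto
      ultimately have "(- 1) ^ inversions T (W - T) * (kd fs a T * b (W - T)) = (\<Sum>i\<in>C \<union> (W - T). E1 T i)"
        by (simp add: kd_def E1_def s_def sum_distrib_left sum_distrib_right power_add mult_ac)
      also have "\<dots> = (\<Sum>i\<in>C. E1 T i) + (\<Sum>i\<in>W - T. E1 T i)"
        by (rule sum.union_disjoint) (use fin in \<open>auto simp: C_def\<close>)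
      finally show ?thesis .
    qed
    then show ?thesis using W by (simp add: kmul_def)
  qed
  have r2: "kmul ?r (khat a) (kd fs b) W = (\<Sum>T\<in>Pow W. (\<Sum>i\<in>C. E2 T i) + (\<Sum>i\<in>T. E2 T i))"
  proof -
    have "(- 1) ^ inversions T (W - T) * (khat a T * kd fs b (W - T)) = (\<Sum>i\<in>C. E2 T i) + (\<Sum>i\<in>T. E2 T i)"
      if T: "T \<in> Pow W" for T
    proof -
      have "{..<?r} - (W - T) = C \<union> T" "C \<inter> T = {}" using T W by (auto simp: C_def)
      moreover have "W - T \<subseteq> {..<?r}" using T W by auto
      ultimately have "(- 1) ^ inversions T (W - T) * (khat a T * kd fs b (W - T)) = (\<Sum>i\<in>C \<union> T. E2 T i)"
        by (simp add: kd_def khat_def E2_def s_def sum_distrib_left sum_distrib_right power_add mult_ac)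
      also have "\<dots> = (\<Sum>i\<in>C. E2 T i) + (\<Sum>i\<in>T. E2 T i)"
        by (rule sum.union_disjoint) (use T in \<open>auto simp: C_def intro: finite_subset[OF _ fin]\<close>)
      finally show ?thesis .
    qed
    then show ?thesis using W by (simp add: kmul_def)
  qed
  have "(\<Sum>T\<in>Pow W. \<Sum>i\<in>T. E2 T i) = (\<Sum>(T, i)\<in>Sigma (Pow W) (\<lambda>T. T). E2 T i)"
    by (subst sum.Sigma) (auto simp: fin intro: finite_subset[OF _ fin])
  also have "\<dots> = (\<Sum>(T, i)\<in>Sigma (Pow W) (\<lambda>T. W - T). E2 (insert i T) i)"
    by (rule sum.reindex_bij_witness[of _ "\<lambda>(T, i). (insert i T, i)" "\<lambda>(T, i). (T - {i}, i)"])
       (auto simp: insert_absorb)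
  also have "\<dots> = (\<Sum>(T, i)\<in>Sigma (Pow W) (\<lambda>T. W - T). - E1 T i)"
  proof (rule sum.cong[OF refl], clarify)
    fix T i assume T: "T \<subseteq> W" and i: "i \<in> W" "i \<notin> T"
    define U where "U = W - insert i T"
    have f: "finite T" "finite U" "i \<notin> U" "i \<notin> T" using T i by (auto simp: U_def intro: finite_subset[OF _ fin])
    have WT: "W - T = insert i U" using i by (auto simp: U_def)
    have 1: "inversions (insert i T) U = s i U + inversions T U"
      unfolding s_def by (rule inversions_insert_left) (use f in auto)
    have 2: "inversions T (insert i U) = card {t\<in>T. i < t} + inversions T U"
      by (rule inversions_insert_right) (use f in auto)
    have 3: "card T = s i T + card {t\<in>T. i < t}"
      unfolding s_def using card_below_above[of T i] f by simp
    have 4: "card (insert i T) = Suc (card T)" using f by simp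
    have "(- 1 :: 'a) ^ (inversions (insert i T) U + card (insert i T) + s i U) =
        - ((- 1) ^ (inversions T (insert i U) + s i T))"
      by (rule neg_one_power_oppI) (simp add: 1 2 4, simp add: 3, blast)
    then show "E2 (insert i T) i = - E1 T i"
      unfolding E1_def E2_def WT U_def[symmetric] by (simp add: mult_ac)
  qed
  also have "\<dots> = (\<Sum>T\<in>Pow W. \<Sum>i\<in>W - T. - E1 T i)"
    by (subst sum.Sigma) (auto simp: fin intro: finite_subset[OF _ fin])
  finally have "(\<Sum>T\<in>Pow W. \<Sum>i\<in>W - T. E1 T i) + (\<Sum>T\<in>Pow W. \<Sum>i\<in>T. E2 T i) = 0"
    by (simp add: sum_negf)
  then show ?thesis unfolding lhs r1 r2 by (simp add: sum.distrib algebra_simps)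
qed (simp add: kd_def kmul_def)

text \<open>In the double sum each pair of distinct indices outside \<open>W\<close> occurs twice, with opposite
  signs.\<close>

lemma kd_kd: "kd fs (kd fs a) W = 0"
proof (cases "W \<subseteq> {..<length fs}")
  case W: True
  let ?r = "length fs"
  have fin: "finite W" using W finite_subset by blast
  define C where "C = {..<?r} - W"
  define s where "s i T = card {v\<in>T. v < (i::nat)}" for i T
  define F where "F i j = (- 1) ^ (s i W + s j (insert i W)) * (fs ! i * fs ! j * a (insert j (insert i W)))" for i j
  define A where "A = {(i, j). i \<in> C \<and> j \<in> C \<and> i < j}"
  define B where "B = {(i, j). i \<in> C \<and> j \<in> C \<and> j < i}"
  have finC: "finite C" by (simp add: C_def)
  have fAB: "finite A" "finite B"
    unfolding A_def B_def by (rule finite_subset[of _ "C \<times> C"]; use finC in auto)+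
  have "kd fs (kd fs a) W = (\<Sum>i\<in>C. \<Sum>j\<in>C - {i}. F i j)"
  proof -
    have "(- 1) ^ s i W * (fs ! i * kd fs a (insert i W)) = (\<Sum>j\<in>C - {i}. F i j)" if "i \<in> C" for i
    proof -
      have "insert i W \<subseteq> {..<?r}" "{..<?r} - insert i W = C - {i}" using that W by (auto simp: C_def)
      then show ?thesis by (simp add: kd_def F_def s_def sum_distrib_left power_add mult_ac)
    qed
    then show ?thesis using W by (simp add: kd_def[of fs "kd fs a"] C_def s_def)
  qed
  also have "\<dots> = (\<Sum>(i, j)\<in>Sigma C (\<lambda>i. C - {i}). F i j)"
    by (subst sum.Sigma) (use finC in auto)
  also have "Sigma C (\<lambda>i. C - {i}) = A \<union> B" by (auto simp: A_def B_def)
  also have "(\<Sum>(i, j)\<in>A \<union> B. F i j) = (\<Sum>(i, j)\<in>A. F i j) + (\<Sum>(i, j)\<in>B. F i j)"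
    by (rule sum.union_disjoint) (use fAB in \<open>auto simp: A_def B_def\<close>)
  also have "(\<Sum>(i, j)\<in>B. F i j) = (\<Sum>(i, j)\<in>A. F j i)"
    by (rule sum.reindex_bij_witness[of _ "\<lambda>(i, j). (j, i)" "\<lambda>(i, j). (j, i)"]) (auto simp: A_def B_def)
  also have "\<dots> = (\<Sum>(i, j)\<in>A. - F i j)"
  proof (rule sum.cong[OF refl], clarify)
    fix i j assume "(i, j) \<in> A"
    then have ij: "i < j" "i \<notin> W" "j \<notin> W" by (auto simp: A_def C_def)
    have e: "{v \<in> insert i W. v < j} = insert i {v\<in>W. v < j}" "{v \<in> insert j W. v < i} = {v\<in>W. v < i}"
      using ij by auto
    then have "s j (insert i W) = Suc (s j W)" "s i (insert j W) = s i W"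
      unfolding s_def e using fin ij by simp_all
    then have "(- 1 :: 'a) ^ (s j W + s i (insert j W)) = - ((- 1) ^ (s i W + s j (insert i W)))"
      by (intro neg_one_power_oppI) (simp, blast)
    then show "F j i = - F i j" unfolding F_def by (simp add: insert_commute mult_ac)
  qed
  finally show ?thesis by (simp add: sum_negf case_prod_beta)
qed (simp add: kd_def)


section \<open>The Koszul algebra of a quotient of a polynomial ring\<close>

lemma kd_add: "kd fs (\<lambda>U. a U + b U) W = kd fs a W + kd fs b W"
  by (simp add: kd_def distrib_left sum.distrib)

lemma kd_scale: "kd fs (\<lambda>U. c * a U) W = c * kd fs a W"
  by (simp add: kd_def sum_distrib_left mult_ac)

lemma kd_diff: "kd fs (\<lambda>U. a U - b U) W = kd fs a W - kd fs b W"
  using kd_add[of fs a "\<lambda>U. - 1 * b U" W] kd_scale[of fs "- 1" b W] by simp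

lemma kd_zero [simp]: "kd fs (\<lambda>U. 0) W = 0"
  by (simp add: kd_def)

lemma kd_sum: "kd fs (\<lambda>U. \<Sum>x\<in>A. f x U) W = (\<Sum>x\<in>A. kd fs (f x) W)"
  by (induction A rule: infinite_finite_induct) (simp_all add: kd_add)

lemma kmul_scale_left: "kmul r (\<lambda>U. c * a U) b W = c * kmul r a b W"
  by (simp add: kmul_def sum_distrib_left mult_ac)

lemma kmul_scale_right: "kmul r a (\<lambda>U. c * b U) W = c * kmul r a b W"
  by (simp add: kmul_def sum_distrib_left mult_ac)

lemma kmul_zero_left [simp]: "kmul r (\<lambda>U. 0) b W = 0"
  by (simp add: kmul_def)

lemma kmul_zero_right [simp]: "kmul r a (\<lambda>U. 0) W = 0"
  by (simp add: kmul_def)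

lemma kmul_sum_left: "kmul r (\<lambda>U. \<Sum>x\<in>A. f x U) b W = (\<Sum>x\<in>A. kmul r (f x) b W)"
  by (induction A rule: infinite_finite_induct) (simp_all add: kmul_add_left)

lemma kmul_sum_right: "kmul r a (\<lambda>U. \<Sum>x\<in>A. f x U) W = (\<Sum>x\<in>A. kmul r a (f x) W)"
  by (induction A rule: infinite_finite_induct) (simp_all add: kmul_add_right)

lemma kmul_diff_left: "kmul r (\<lambda>U. a U - b U) c W = kmul r a c W - kmul r b c W"
  using fun_cong[OF kmul_add_left[of r a "\<lambda>U. - 1 * b U" c]] kmul_scale_left[of r "- 1" b c W] by simp

lemma kmul_diff_right: "kmul r c (\<lambda>U. a U - b U) W = kmul r c a W - kmul r c b W"
  using fun_cong[OF kmul_add_right[of r c a "\<lambda>U. - 1 * b U"]] kmul_scale_right[of r c "- 1" b W] by simp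

definition in_comp :: "nat \<Rightarrow> (nat set \<Rightarrow> 'a::zero) \<Rightarrow> bool" where
  "in_comp i a \<longleftrightarrow> (\<forall>U. card U \<noteq> i \<longrightarrow> a U = 0)"

lemma kmul_in_comp:
  assumes "in_comp i a" "in_comp j b"
  shows "in_comp (i + j) (kmul r a b)"
  unfolding in_comp_def
proof (intro allI impI)
  fix W :: "nat set" assume W: "card W \<noteq> i + j"
  have "a T * b (W - T) = 0" if "T \<subseteq> W" "W \<subseteq> {..<r}" for T
  proof -
    have "finite W" using that finite_subset by blast
    then have "card T + card (W - T) = card W"
      using that card_Un_disjoint[of T "W - T"] finite_subset[of T W] by (simp add: Un_absorb1)
    then have "card T \<noteq> i \<or> card (W - T) \<noteq> j" using W by auto
    then show ?thesis using assms by (auto simp: in_comp_def)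
  qed
  then show "kmul r a b W = 0" by (simp add: kmul_def)
qed

lemma kd_in_comp:
  assumes "in_comp (Suc i) a"
  shows "in_comp i (kd fs a)"
  unfolding in_comp_def
proof (intro allI impI)
  fix W :: "nat set" assume W: "card W \<noteq> i"
  have "a (insert j W) = 0" if "j \<notin> W" "W \<subseteq> {..<length fs}" for j
  proof -
    have "finite W" using that finite_subset by blast
    then show ?thesis using that W assms by (simp add: in_comp_def)
  qed
  then show "kd fs a W = 0" by (simp add: kd_def)
qed

lemma khat_in_comp: "in_comp i a \<Longrightarrow> khat a = (\<lambda>U. (- 1) ^ i * a U)"
  by (rule ext) (auto simp: khat_def in_comp_def)

locale koszul_quotient =
  fixes V :: "'v set" and J :: "('v, 'k::field) mpoly set" and vs :: "'v list"
  assumes J: "ideal J (mpoly_ring V)"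
    and vs: "set vs \<subseteq> V"
    and J_const: "\<And>p. p \<in> J \<Longrightarrow> coef p 0 = 0"
    and J_hcomp: "\<And>p k. p \<in> J \<Longrightarrow> hcomp k p \<in> J"
begin

definition "fs = (map var vs :: ('v, 'k) mpoly list)"

abbreviation "r \<equiv> length vs"

definition "cl p = J +>\<^bsub>mpoly_ring V\<^esub> p"

abbreviation "S \<equiv> mpoly_ring V Quot J"

definition "A = koszul S (map (\<lambda>v. J +>\<^bsub>mpoly_ring V\<^esub> var v) vs)"

lemma length_fs [simp]: "length fs = r"
  by (simp add: fs_def)

sublocale S: cring S
  by (rule ideal.quotient_is_cring[OF J mpoly_ring_cring])

lemma cl_hom: "cl \<in> Ring.ring_hom (mpoly_ring V) S"
  using ideal.rcos_ring_hom[OF J] unfolding cl_def[abs_def] .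

lemma cl_simps:
  assumes "p \<in> polys V" "q \<in> polys V"
  shows "cl (p + q) = cl p \<oplus>\<^bsub>S\<^esub> cl q" "cl (p * q) = cl p \<otimes>\<^bsub>S\<^esub> cl q"
  using ring_hom_add[OF cl_hom assms] ring_hom_mult[OF cl_hom assms] by simp_all

lemma cl_one: "cl 1 = \<one>\<^bsub>S\<^esub>"
  using ring_hom_one[OF cl_hom] by simp

lemma cl_closed: "p \<in> polys V \<Longrightarrow> cl p \<in> carrier S"
  using ring_hom_closed[OF cl_hom] by simp

lemma cl_zero: "cl 0 = \<zero>\<^bsub>S\<^esub>"
proof -
  interpret ring_hom_ring "mpoly_ring V" S cl
    using cl_hom mpoly_ring_ring S.ring_axioms by (intro ring_hom_ringI2)
  show ?thesis using hom_zero by simp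
qed

lemma cl_uminus: "p \<in> polys V \<Longrightarrow> cl (- p) = \<ominus>\<^bsub>S\<^esub> cl p"
  using cl_simps(1)[of "- p" p] S.minus_equality[of "cl (- p)" "cl p"] polys_uminus[of p V] cl_closed[of p]
    cl_closed[of "- p"] by (simp add: cl_zero)

lemma carrier_S: "carrier S = cl ` polys V"
  by (auto simp: FactRing_def A_RCOSETS_def RCOSETS_def cl_def a_r_coset_def)

lemma cl_eq_iff:
  assumes "p \<in> polys V" "q \<in> polys V"
  shows "cl p = cl q \<longleftrightarrow> p - q \<in> J"
proof -
  interpret R: ring "mpoly_ring V" by (rule mpoly_ring_ring)
  interpret ideal J "mpoly_ring V" by (rule J)
  have "p \<ominus>\<^bsub>mpoly_ring V\<^esub> q = p - q"
    using mpoly_ring_a_inv[OF assms(2)] by (simp add: a_minus_def)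
  then show ?thesis
    using R.quotient_eq_iff_same_a_r_cos[OF J assms] by (simp add: cl_def)
qed

lemma cl_finsum:
  assumes "\<And>x. x \<in> B \<Longrightarrow> f x \<in> polys V"
  shows "finsum S (\<lambda>x. cl (f x)) B = cl (sum f B)"
proof (cases "finite B")
  case True
  then show ?thesis using assms
  proof (induction B rule: finite_induct)
    case (insert x B)
    have "(\<lambda>x. cl (f x)) \<in> B \<rightarrow> carrier S" using insert by (auto intro: cl_closed)
    then show ?case using insert
      by (simp add: S.finsum_insert cl_closed cl_simps polys_sum)
  qed (simp add: cl_zero)
qed (simp add: cl_zero finsum_def finprod_def)

lemma cl_sign: "sign_in S k = cl ((- 1) ^ k)"
proof (induction k)
  case (Suc k)
  have "(- 1) ^ k \<in> polys V" "(- 1 :: ('v, 'k) mpoly) \<in> polys V"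
    using polys_sign[OF polys_one, of k V] polys_uminus[OF polys_one, of V] by simp_all
  then have "cl ((- 1) ^ k * - 1) = cl ((- 1) ^ k) \<otimes>\<^bsub>S\<^esub> cl (- 1)" by (rule cl_simps(2))
  then show ?case using Suc cl_uminus[OF polys_one]
    by (simp add: sign_in_def cl_one mult.commute)
qed (simp add: sign_in_def cl_one)

text \<open>Lifts to polynomials of the elements of the Koszul algebra.\<close>

definition chains :: "(nat set \<Rightarrow> ('v, 'k) mpoly) set" where
  "chains = {a. (\<forall>U. a U \<in> polys V) \<and> (\<forall>U. \<not> U \<subseteq> {..<r} \<longrightarrow> a U = 0)}"

definition proj :: "(nat set \<Rightarrow> ('v, 'k) mpoly) \<Rightarrow> nat set \<Rightarrow> ('v, 'k) mpoly set" where
  "proj a = (\<lambda>U\<in>Pow {..<r}. cl (a U))"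

lemma chainsD: "a \<in> chains \<Longrightarrow> a U \<in> polys V"
  by (simp add: chains_def)

lemma proj_apply: "U \<subseteq> {..<r} \<Longrightarrow> proj a U = cl (a U)"
  by (simp add: proj_def)

lemma fs_nth: "i < r \<Longrightarrow> fs ! i \<in> polys V"
  using vs by (auto simp: fs_def intro!: polys_var)

lemma chains_zero [simp]: "(\<lambda>U. 0) \<in> chains"
  by (simp add: chains_def)

lemma chains_add: "a \<in> chains \<Longrightarrow> b \<in> chains \<Longrightarrow> (\<lambda>U. a U + b U) \<in> chains"
  by (simp add: chains_def polys_add)

lemma chains_diff: "a \<in> chains \<Longrightarrow> b \<in> chains \<Longrightarrow> (\<lambda>U. a U - b U) \<in> chains"
  by (simp add: chains_def polys_diff)

lemma chains_sign: "a \<in> chains \<Longrightarrow> (\<lambda>U. (- 1) ^ k * a U) \<in> chains"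
  by (simp add: chains_def polys_sign)

lemma chains_sum: "(\<And>x. x \<in> B \<Longrightarrow> f x \<in> chains) \<Longrightarrow> (\<lambda>U. \<Sum>x\<in>B. f x U) \<in> chains"
  by (auto simp: chains_def intro!: polys_sum)

lemma chains_khat: "a \<in> chains \<Longrightarrow> khat a \<in> chains"
  by (simp add: chains_def khat_def polys_sign)

lemma chains_kscalar: "p \<in> polys V \<Longrightarrow> kscalar p \<in> chains"
  by (simp add: chains_def kscalar_def)

lemma chains_kmul: "a \<in> chains \<Longrightarrow> b \<in> chains \<Longrightarrow> kmul r a b \<in> chains"
  by (auto simp: chains_def kmul_def intro!: polys_sum polys_sign polys_mult)

lemma chains_kd: "a \<in> chains \<Longrightarrow> kd fs a \<in> chains"
  by (auto simp: chains_def kd_def intro!: polys_sum polys_sign polys_mult fs_nth)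

lemma proj_eq_iff:
  assumes "a \<in> chains" "b \<in> chains"
  shows "proj a = proj b \<longleftrightarrow> (\<forall>U. a U - b U \<in> J)"
proof -
  have "proj a = proj b \<longleftrightarrow> (\<forall>U\<in>Pow {..<r}. cl (a U) = cl (b U))"
  proof
    assume eq: "proj a = proj b"
    show "\<forall>U\<in>Pow {..<r}. cl (a U) = cl (b U)"
    proof
      fix U assume "U \<in> Pow {..<r}"
      then show "cl (a U) = cl (b U)" using fun_cong[OF eq, of U] by (simp add: proj_def)
    qed
  qed (auto simp: proj_def intro!: restrict_ext)
  also have "\<dots> \<longleftrightarrow> (\<forall>U\<in>Pow {..<r}. a U - b U \<in> J)"
    using assms by (simp add: cl_eq_iff chainsD)
  also have "\<dots> \<longleftrightarrow> (\<forall>U. a U - b U \<in> J)"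
  proof (intro iffI allI)
    fix U assume "\<forall>U\<in>Pow {..<r}. a U - b U \<in> J"
    then show "a U - b U \<in> J"
      using assms ideal_closed(1)[OF J] by (cases "U \<subseteq> {..<r}") (simp_all add: chains_def)
  qed simp
  finally show ?thesis .
qed

lemma A_simps:
  "carrier A = koszul_carrier S r" "monoid.mult A = koszul_mult S r"
  "one A = koszul_scalar S r \<one>\<^bsub>S\<^esub>" "ring.zero A = koszul_scalar S r \<zero>\<^bsub>S\<^esub>"
  "add A = (\<lambda>a b. \<lambda>U\<in>Pow {..<r}. a U \<oplus>\<^bsub>S\<^esub> b U)"
  "component A = (\<lambda>p. {a \<in> koszul_carrier S r. \<forall>U\<in>Pow {..<r}. card U \<noteq> p \<longrightarrow> a U = \<zero>\<^bsub>S\<^esub>})"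
  "differential A = koszul_differential S (map (\<lambda>v. J +>\<^bsub>mpoly_ring V\<^esub> var v) vs)"
  by (simp_all add: A_def koszul_def)

lemma proj_closed: "a \<in> chains \<Longrightarrow> proj a \<in> carrier A"
  by (auto simp: A_simps koszul_carrier_def proj_def chainsD intro!: cl_closed)

lemma carrier_A: "carrier A = proj ` chains"
proof
  show "carrier A \<subseteq> proj ` chains"
  proof
    fix b assume b: "b \<in> carrier A"
    then have "\<forall>U\<in>Pow {..<r}. \<exists>p\<in>polys V. b U = cl p"
      unfolding A_simps koszul_carrier_def carrier_S PiE_iff by blast
    then obtain g where g: "\<And>U. U \<in> Pow {..<r} \<Longrightarrow> g U \<in> polys V \<and> b U = cl (g U)" by metis
    define a where "a U = (if U \<in> Pow {..<r} then g U else 0)" for U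
    have "a \<in> chains" using g by (auto simp: chains_def a_def)
    moreover have "b = proj a"
    proof
      fix U
      show "b U = proj a U"
        using b g[of U] by (cases "U \<in> Pow {..<r}")
          (simp_all add: A_simps koszul_carrier_def proj_def a_def PiE_iff extensional_def)
    qed
    ultimately show "b \<in> proj ` chains" by blast
  qed
qed (auto intro: proj_closed)

lemma proj_add: "a \<in> chains \<Longrightarrow> b \<in> chains \<Longrightarrow> proj (\<lambda>U. a U + b U) = proj a \<oplus>\<^bsub>A\<^esub> proj b"
  unfolding A_simps proj_def by (rule restrict_ext) (simp add: cl_simps chainsD)

lemma proj_scalar: "proj (kscalar p) = koszul_scalar S r (cl p)"
  unfolding proj_def kscalar_def koszul_scalar_def by (rule restrict_ext) (simp add: cl_zero)

lemma proj_one: "proj (kscalar 1) = \<one>\<^bsub>A\<^esub>"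
  by (simp add: proj_scalar A_simps cl_one)

lemma proj_zero: "proj (\<lambda>U. 0) = \<zero>\<^bsub>A\<^esub>"
  unfolding proj_def A_simps koszul_scalar_def by (rule restrict_ext) (simp add: cl_zero)

lemma proj_mult:
  assumes "a \<in> chains" "b \<in> chains"
  shows "proj (kmul r a b) = proj a \<otimes>\<^bsub>A\<^esub> proj b"
proof -
  have "cl (kmul r a b W) = (\<Oplus>\<^bsub>S\<^esub> T\<in>Pow W. sign_in S (card {(t, u). t \<in> T \<and> u \<in> W - T \<and> u < t})
      \<otimes>\<^bsub>S\<^esub> (proj a T \<otimes>\<^bsub>S\<^esub> proj b (W - T)))" if W: "W \<in> Pow {..<r}" for W
  proof -
    have sgn: "(- 1) ^ k \<in> polys V" for k using polys_sign[OF polys_one, of k V] by simp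
    have "(\<Oplus>\<^bsub>S\<^esub> T\<in>Pow W. sign_in S (card {(t, u). t \<in> T \<and> u \<in> W - T \<and> u < t})
        \<otimes>\<^bsub>S\<^esub> (proj a T \<otimes>\<^bsub>S\<^esub> proj b (W - T))) =
      (\<Oplus>\<^bsub>S\<^esub> T\<in>Pow W. cl ((- 1) ^ inversions T (W - T) * (a T * b (W - T))))"
    proof (rule S.finsum_cong')
      fix T assume T: "T \<in> Pow W"
      have sub: "T \<subseteq> {..<r}" "W - T \<subseteq> {..<r}" using T W by auto
      show "sign_in S (card {(t, u). t \<in> T \<and> u \<in> W - T \<and> u < t}) \<otimes>\<^bsub>S\<^esub> (proj a T \<otimes>\<^bsub>S\<^esub> proj b (W - T))
        = cl ((- 1) ^ inversions T (W - T) * (a T * b (W - T)))"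
        unfolding proj_apply[OF sub(1)] proj_apply[OF sub(2)] cl_sign
        using assms by (simp add: cl_simps chainsD polys_mult sgn inversions_def)
    qed (auto intro!: cl_closed polys_sign polys_mult chainsD[OF assms(1)] chainsD[OF assms(2)])
    also have "\<dots> = cl (kmul r a b W)"
      using W by (subst cl_finsum)
        (auto simp: kmul_def intro!: polys_sign polys_mult chainsD[OF assms(1)] chainsD[OF assms(2)])
    finally show ?thesis by simp
  qed
  then show ?thesis
    unfolding A_simps koszul_mult_def proj_def[of "kmul r a b"] by (rule restrict_ext)
qed

lemma proj_differential:
  assumes "a \<in> chains"
  shows "differential A (proj a) = proj (kd fs a)"
proof -
  have "cl (kd fs a W) = (\<Oplus>\<^bsub>S\<^esub> i\<in>{..<r} - W. sign_in S (card {v\<in>W. v < i}) \<otimes>\<^bsub>S\<^esub>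
      (map (\<lambda>v. J +>\<^bsub>mpoly_ring V\<^esub> var v) vs ! i \<otimes>\<^bsub>S\<^esub> proj a (insert i W)))"
    if W: "W \<in> Pow {..<r}" for W
  proof -
    have sgn: "(- 1) ^ k \<in> polys V" for k using polys_sign[OF polys_one, of k V] by simp
    have "(\<Oplus>\<^bsub>S\<^esub> i\<in>{..<r} - W. sign_in S (card {v\<in>W. v < i}) \<otimes>\<^bsub>S\<^esub>
      (map (\<lambda>v. J +>\<^bsub>mpoly_ring V\<^esub> var v) vs ! i \<otimes>\<^bsub>S\<^esub> proj a (insert i W))) =
      (\<Oplus>\<^bsub>S\<^esub> i\<in>{..<r} - W. cl ((- 1) ^ card {v\<in>W. v < i} * (fs ! i * a (insert i W))))"
    proof (rule S.finsum_cong')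
      fix i assume i: "i \<in> {..<r} - W"
      have sub: "insert i W \<subseteq> {..<r}" using i W by auto
      have "map (\<lambda>v. J +>\<^bsub>mpoly_ring V\<^esub> var v) vs ! i = cl (fs ! i)"
        using i by (simp add: cl_def fs_def)
      then show "sign_in S (card {v\<in>W. v < i}) \<otimes>\<^bsub>S\<^esub>
        (map (\<lambda>v. J +>\<^bsub>mpoly_ring V\<^esub> var v) vs ! i \<otimes>\<^bsub>S\<^esub> proj a (insert i W))
        = cl ((- 1) ^ card {v\<in>W. v < i} * (fs ! i * a (insert i W)))"
        unfolding proj_apply[OF sub] cl_sign
        using assms i by (simp add: cl_simps chainsD polys_mult sgn fs_nth)
    qed (auto intro!: cl_closed polys_sign polys_mult chainsD[OF assms] fs_nth)
    also have "\<dots> = cl (kd fs a W)"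
      using W by (subst cl_finsum)
        (auto simp: kd_def intro!: polys_sign polys_mult chainsD[OF assms] fs_nth)
    finally show ?thesis by simp
  qed
  then show ?thesis
    unfolding A_simps koszul_differential_def proj_def[of "kd fs a"] length_map
    by - (rule sym, rule restrict_ext, blast)
qed

definition "chain_ring = \<lparr>carrier = chains, monoid.mult = kmul r, one = kscalar 1,
  ring.zero = (\<lambda>U. 0), add = (\<lambda>a b U. a U + b U)\<rparr>"

lemma chain_ring_simps [simp]:
  "carrier chain_ring = chains" "monoid.mult chain_ring = kmul r" "one chain_ring = kscalar 1"
  "ring.zero chain_ring = (\<lambda>U. 0)" "add chain_ring = (\<lambda>a b U. a U + b U)"
  by (simp_all add: chain_ring_def)

lemma kmul_one:
  assumes "a \<in> chains"
  shows "kmul r (kscalar 1) a = a" "kmul r a (kscalar 1) = a"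
proof -
  have "kmul r (kscalar 1) a W = a W \<and> kmul r a (kscalar 1) W = a W" for W
    using assms by (cases "W \<subseteq> {..<r}")
      (simp_all add: kmul_scalar_left kmul_scalar_right, simp_all add: kmul_def chains_def)
  then show "kmul r (kscalar 1) a = a" "kmul r a (kscalar 1) = a" by auto
qed

lemma chain_ring_ring: "ring chain_ring"
proof (rule ringI)
  show "abelian_group chain_ring"
  proof (rule abelian_groupI)
    fix a assume "a \<in> carrier chain_ring"
    then show "\<exists>b\<in>carrier chain_ring. b \<oplus>\<^bsub>chain_ring\<^esub> a = \<zero>\<^bsub>chain_ring\<^esub>"
      using chains_sign[of a 1] by (intro bexI[of _ "\<lambda>U. - a U"]) auto
  qed (auto simp: chains_add algebra_simps)
  show "monoid chain_ring"
    by (rule monoidI) (auto simp: chains_kmul chains_kscalar kmul_assoc kmul_one)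
qed (auto simp: kmul_add_left kmul_add_right)

lemma proj_hom: "proj \<in> Ring.ring_hom chain_ring A"
  by (rule ring_hom_memI) (auto simp: proj_closed proj_mult proj_add proj_one)

lemma A_ring: "ring A"
  using ring.ring_hom_imp_img_ring[OF chain_ring_ring proj_hom]
  unfolding chain_ring_simps carrier_A[symmetric] proj_zero by simp

sublocale A: ring A by (rule A_ring)

lemma proj_uminus: "a \<in> chains \<Longrightarrow> proj (\<lambda>U. - a U) = \<ominus>\<^bsub>A\<^esub> proj a"
  using A.minus_equality[of "proj (\<lambda>U. - a U)" "proj a"] proj_add[of "\<lambda>U. - a U" a]
    chains_sign[of a 1] proj_closed[of a] proj_closed[of "\<lambda>U. - a U"] by (simp add: proj_zero)

lemma proj_signed:
  assumes "a \<in> chains"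
  shows "((\<ominus>\<^bsub>A\<^esub> \<one>\<^bsub>A\<^esub>) [^]\<^bsub>A\<^esub> k) \<otimes>\<^bsub>A\<^esub> proj a = proj (\<lambda>U. (- 1) ^ k * a U)"
  using assms
proof (induction k arbitrary: a)
  case 0
  then show ?case using proj_closed[of a] by simp
next
  case (Suc k)
  have "((\<ominus>\<^bsub>A\<^esub> \<one>\<^bsub>A\<^esub>) [^]\<^bsub>A\<^esub> Suc k) \<otimes>\<^bsub>A\<^esub> proj a =
      ((\<ominus>\<^bsub>A\<^esub> \<one>\<^bsub>A\<^esub>) [^]\<^bsub>A\<^esub> k) \<otimes>\<^bsub>A\<^esub> ((\<ominus>\<^bsub>A\<^esub> \<one>\<^bsub>A\<^esub>) \<otimes>\<^bsub>A\<^esub> proj a)"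
    using proj_closed[OF Suc.prems] by (simp add: A.m_assoc)
  also have "(\<ominus>\<^bsub>A\<^esub> \<one>\<^bsub>A\<^esub>) \<otimes>\<^bsub>A\<^esub> proj a = proj (\<lambda>U. - a U)"
    using proj_closed[OF Suc.prems] proj_uminus[OF Suc.prems] by (simp add: A.l_minus)
  finally show ?case using Suc.IH[of "\<lambda>U. - a U"] chains_sign[OF Suc.prems, of 1] by simp
qed

lemma proj_finsum:
  assumes "\<And>x. x \<in> B \<Longrightarrow> f x \<in> chains" "finite B"
  shows "finsum A (\<lambda>x. proj (f x)) B = proj (\<lambda>U. \<Sum>x\<in>B. f x U)"
  using assms(2,1)
proof (induction B rule: finite_induct)
  case empty
  then show ?case by (simp add: proj_zero)
next
  case (insert x B)
  have "(\<lambda>x. proj (f x)) \<in> B \<rightarrow> carrier A" using insert by (auto intro: proj_closed)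
  then show ?case using insert by (simp add: A.finsum_insert proj_closed proj_add chains_sum)
qed

lemma proj_component:
  assumes "a \<in> chains" "in_comp i a"
  shows "proj a \<in> component A i"
  using proj_closed[OF assms(1)] assms(2)
  by (auto simp: A_simps proj_def in_comp_def cl_zero)

end


section \<open>Koszul homology and trivial Massey operations\<close>

text \<open>A vector is kept only if it is not in the span of the vectors kept so far.\<close>

lemma (in ring) exists_independent_sublist:
  assumes "subfield K R" "set Us \<subseteq> carrier R"
  shows "\<exists>Vs. set Vs \<subseteq> set Us \<and> independent K Vs \<and> Span K Vs = Span K Us"
  using assms(2)
proof (induction Us)
  case Nil
  show ?case by (intro exI[of _ "[]"]) auto
next
  case (Cons u Us)
  then obtain Vs where Vs: "set Vs \<subseteq> set Us" "independent K Vs" "Span K Vs = Span K Us" by auto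
  have car: "set Vs \<subseteq> carrier R" "set Us \<subseteq> carrier R" "u \<in> carrier R" using Vs Cons by auto
  show ?case
  proof (cases "u \<in> Span K Vs")
    case True
    have "set (u # Us) \<subseteq> Span K Vs"
      using True Span_base_incl[OF assms(1) car(2)] Vs by simp
    then have "Span K (u # Us) \<subseteq> Span K Vs" by (rule mono_Span_subset[OF assms(1) _ car(1)])
    moreover have "Span K Us \<subseteq> Span K (u # Us)" by (rule mono_Span[OF assms(1) car(2,3)])
    ultimately have "Span K Vs = Span K (u # Us)" using Vs by blast
    then show ?thesis using Vs by (intro exI[of _ Vs]) (auto simp del: Span.simps)
  next
    case False
    have "independent K (u # Vs)" using li_Cons[OF car(3) False Vs(2)] .
    moreover have "Span K (u # Vs) = Span K (u # Us)" using Vs(3) by simp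
    ultimately show ?thesis using Vs(1) by (intro exI[of _ "u # Vs"]) (auto simp del: Span.simps)
  qed
qed

lemma coef_const_mult: "coef (const_poly c * p) e = c * coef p e"
  by (simp add: const_poly_def coef_term_mult mdvd_def)

lemma const_poly_simps:
  "const_poly (a + b) = const_poly a + const_poly b" "const_poly (a * b) = const_poly a * const_poly b"
  "const_poly 1 = 1" "const_poly 0 = 0"
  by (simp_all add: const_poly_def single_add mult_single)

lemma homogeneous_const_mult: "homogeneous_poly e p \<Longrightarrow> homogeneous_poly e (const_poly c * p)"
  using homogeneous_mult[OF homogeneous_const] by fastforce

lemma coef_le_mdeg: "coef e v \<le> mdeg e"
proof (cases "v \<in> supp e")
  case True
  then show ?thesis
    using member_le_sum[of v "supp e" "\<lambda>v. 1 * of_nat (coef e v) :: nat"] by (simp add: mdeg_def weight_def)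
qed (simp add: in_keys_iff)

text \<open>This is why a graded piece of the Koszul algebra has finite dimension.\<close>

lemma finite_monomials:
  assumes "finite V"
  shows "finite {e :: 'v \<Rightarrow>\<^sub>0 nat. supp e \<subseteq> V \<and> mdeg e = k}"
proof (rule finite_imageD)
  let ?M = "{e :: 'v \<Rightarrow>\<^sub>0 nat. supp e \<subseteq> V \<and> mdeg e = k}"
  have "(\<lambda>e. restrict (coef e) V) ` ?M \<subseteq> V \<rightarrow>\<^sub>E {..k}"
    using coef_le_mdeg by fastforce
  then show "finite ((\<lambda>e. restrict (coef e) V) ` ?M)"
    by (rule finite_subset) (simp add: assms finite_PiE)
  show "inj_on (\<lambda>e. restrict (coef e) V) ?M"
  proof (rule inj_onI)
    fix a b assume a: "a \<in> ?M" and b: "b \<in> ?M" and eq: "restrict (coef a) V = restrict (coef b) V"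
    show "a = b"
    proof (rule Poly_Mapping.poly_mapping_eqI)
      fix v
      show "coef a v = coef b v"
      proof (cases "v \<in> V")
        case True
        then show ?thesis using fun_cong[OF eq, of v] by simp
      next
        case False
        then have "v \<notin> supp a" "v \<notin> supp b" using a b by auto
        then show ?thesis by (simp add: in_keys_iff)
      qed
    qed
  qed
qed

context koszul_quotient
begin

definition "cyc = {a \<in> chains. \<forall>W. kd fs a W \<in> J}"

lemma cycD: "a \<in> cyc \<Longrightarrow> a \<in> chains" "a \<in> cyc \<Longrightarrow> kd fs a W \<in> J"
  by (simp_all add: cyc_def)

lemma proj_eq_zero_iff: "a \<in> chains \<Longrightarrow> proj a = \<zero>\<^bsub>A\<^esub> \<longleftrightarrow> (\<forall>U. a U \<in> J)"
  using proj_eq_iff[of a "\<lambda>U. 0"] by (simp add: proj_zero)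

lemma proj_cycle_iff: "a \<in> chains \<Longrightarrow> proj a \<in> cycles A \<longleftrightarrow> a \<in> cyc"
  by (simp add: cycles_def proj_closed proj_differential proj_eq_zero_iff chains_kd cyc_def)

lemma cycles_A: "cycles A = proj ` cyc"
proof
  show "cycles A \<subseteq> proj ` cyc"
  proof
    fix b assume b: "b \<in> cycles A"
    then obtain a where "a \<in> chains" "b = proj a" using carrier_A by (auto simp: cycles_def)
    then show "b \<in> proj ` cyc" using b proj_cycle_iff by auto
  qed
  show "proj ` cyc \<subseteq> cycles A" using cycD(1) proj_cycle_iff by blast
qed

lemma boundaries_A: "boundaries A = (\<lambda>y. proj (kd fs y)) ` chains"
  unfolding boundaries_def carrier_A image_image by (rule image_cong) (simp_all add: proj_differential)

lemma kmul_ideal_left: "(\<And>U. a U \<in> J) \<Longrightarrow> b \<in> chains \<Longrightarrow> kmul r a b W \<in> J"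
  unfolding kmul_def using ideal_closed(1)[OF J]
  by (auto intro!: ideal_sum_closed[OF J] ideal_closed(5)[OF J] polys_sign[OF polys_one, simplified]
      chainsD simp: mult.commute[of "a _"])

lemma kmul_ideal_right: "(\<And>U. b U \<in> J) \<Longrightarrow> a \<in> chains \<Longrightarrow> kmul r a b W \<in> J"
  unfolding kmul_def using ideal_closed(1)[OF J]
  by (auto intro!: ideal_sum_closed[OF J] ideal_closed(5)[OF J] polys_sign[OF polys_one, simplified]
      chainsD)

lemma khat_ideal: "(\<And>U. a U \<in> J) \<Longrightarrow> khat a U \<in> J"
  unfolding khat_def by (rule ideal_closed(5)[OF J]) (auto intro: polys_sign[OF polys_one, simplified])

lemma khat_khat: "khat (khat a) = a"
  by (rule ext) (simp add: khat_def mult.assoc[symmetric] power_add[symmetric])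

lemma kd_khat: "kd fs (khat a) W = - khat (kd fs a) W"
proof (cases "W \<subseteq> {..<r}")
  case True
  then have "finite W" using finite_subset by blast
  then show ?thesis using True
    by (auto simp: kd_def khat_def sum_distrib_left sum_negf[symmetric] mult_ac intro!: sum.cong)
qed (simp add: kd_def khat_def)

lemma kd_kmul': "kd fs (kmul r a b) W = kmul r (kd fs a) b W + kmul r (khat a) (kd fs b) W"
  using kd_kmul[of fs a b W] by simp

lemma cyc_closed:
  "p \<in> polys V \<Longrightarrow> kscalar p \<in> cyc"
  "a \<in> cyc \<Longrightarrow> b \<in> cyc \<Longrightarrow> (\<lambda>U. a U + b U) \<in> cyc"
  "a \<in> cyc \<Longrightarrow> b \<in> cyc \<Longrightarrow> (\<lambda>U. a U - b U) \<in> cyc"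
  "a \<in> cyc \<Longrightarrow> (\<lambda>U. - a U) \<in> cyc"
  "a \<in> cyc \<Longrightarrow> b \<in> cyc \<Longrightarrow> kmul r a b \<in> cyc"
  "y \<in> chains \<Longrightarrow> kd fs y \<in> cyc"
  "(\<lambda>U. 0) \<in> cyc"
proof -
  show "kscalar p \<in> cyc" if "p \<in> polys V" for p
    using that ideal_closed(1)[OF J] by (simp add: cyc_def chains_kscalar kd_def kscalar_def)
  show "(\<lambda>U. a U + b U) \<in> cyc" if "a \<in> cyc" "b \<in> cyc" for a b
    using that ideal_closed(2)[OF J] by (simp add: cyc_def chains_add kd_add)
  show "(\<lambda>U. a U - b U) \<in> cyc" if "a \<in> cyc" "b \<in> cyc" for a b
    using that ideal_closed(4)[OF J] by (simp add: cyc_def chains_diff kd_diff)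
  show "(\<lambda>U. - a U) \<in> cyc" if "a \<in> cyc" for a
    using that ideal_closed(3)[OF J] chains_sign[of a 1] kd_scale[of fs "-1" a] by (simp add: cyc_def)
  show "kmul r a b \<in> cyc" if "a \<in> cyc" "b \<in> cyc" for a b
  proof -
    have "kmul r (kd fs a) b W \<in> J" for W
      by (rule kmul_ideal_left[OF cycD(2)[OF that(1)] cycD(1)[OF that(2)]])
    moreover have "kmul r (khat a) (kd fs b) W \<in> J" for W
      by (rule kmul_ideal_right[OF cycD(2)[OF that(2)] chains_khat[OF cycD(1)[OF that(1)]]])
    ultimately show ?thesis
      using that by (simp add: cyc_def kd_kmul' chains_kmul ideal_closed(2)[OF J])
  qed
  show "kd fs y \<in> cyc" if "y \<in> chains" for y
    using that ideal_closed(1)[OF J] by (simp add: cyc_def chains_kd kd_kd)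
  show "(\<lambda>U. 0) \<in> cyc" using ideal_closed(1)[OF J] by (simp add: cyc_def)
qed

abbreviation "C \<equiv> A\<lparr>carrier := cycles A\<rparr>"

lemma C_ring: "ring C"
proof -
  have "subring (cycles A) A"
  proof (rule A.subringI)
    show "cycles A \<subseteq> carrier A" by (auto simp: cycles_def)
    show "\<one>\<^bsub>A\<^esub> \<in> cycles A"
      unfolding cycles_A proj_one[symmetric] by (intro imageI cyc_closed(1) polys_one)
    show "\<ominus>\<^bsub>A\<^esub> h \<in> cycles A" if h: "h \<in> cycles A" for h
    proof -
      obtain a where a: "a \<in> cyc" "h = proj a" using h cycles_A by auto
      show ?thesis
        unfolding a(2) proj_uminus[OF cycD(1)[OF a(1)], symmetric] cycles_A
        by (intro imageI cyc_closed(4) a(1))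
    qed
    fix h1 h2 assume "h1 \<in> cycles A" "h2 \<in> cycles A"
    then obtain a b where a: "a \<in> cyc" "h1 = proj a" and b: "b \<in> cyc" "h2 = proj b"
      using cycles_A by auto
    show "h1 \<otimes>\<^bsub>A\<^esub> h2 \<in> cycles A"
      unfolding a(2) b(2) proj_mult[OF cycD(1)[OF a(1)] cycD(1)[OF b(1)], symmetric] cycles_A
      by (intro imageI cyc_closed(5) a(1) b(1))
    show "h1 \<oplus>\<^bsub>A\<^esub> h2 \<in> cycles A"
      unfolding a(2) b(2) proj_add[OF cycD(1)[OF a(1)] cycD(1)[OF b(1)], symmetric] cycles_A
      by (intro imageI cyc_closed(2) a(1) b(1))
  qed
  then show ?thesis by (rule A.subring_is_ring)
qed

lemma proj_cycle: "a \<in> cyc \<Longrightarrow> proj a \<in> cycles A"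
  by (simp add: cycles_A)

lemma C_uminus:
  assumes "a \<in> cyc"
  shows "\<ominus>\<^bsub>C\<^esub> proj a = proj (\<lambda>U. - a U)"
proof -
  interpret C: ring C by (rule C_ring)
  have "proj (\<lambda>U. - a U) \<oplus>\<^bsub>C\<^esub> proj a = \<zero>\<^bsub>C\<^esub>"
    using proj_add[of "\<lambda>U. - a U" a] cycD(1)[OF assms] cycD(1)[OF cyc_closed(4)[OF assms]]
    by (simp add: proj_zero)
  then show ?thesis
    by (rule C.minus_equality) (simp_all add: proj_cycle assms cyc_closed(4))
qed

lemma boundaries_ideal: "ideal (boundaries A) C"
proof (rule idealI)
  interpret C: ring C by (rule C_ring)
  show "ring C" by (rule C_ring)
  have sub: "boundaries A \<subseteq> cycles A"
    by (auto simp: boundaries_A intro!: proj_cycle cyc_closed(6))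
  show "subgroup (boundaries A) (add_monoid C)"
  proof (rule C.add.subgroupI)
    show "boundaries A \<subseteq> carrier C" using sub by simp
    show "boundaries A \<noteq> {}" unfolding boundaries_A using chains_zero by blast
    show "\<ominus>\<^bsub>C\<^esub> b \<in> boundaries A" if b: "b \<in> boundaries A" for b
    proof -
      obtain y where y: "y \<in> chains" "b = proj (kd fs y)" using b by (auto simp: boundaries_A)
      have "(\<lambda>U. - kd fs y U) = kd fs (\<lambda>U. - 1 * y U)" by (rule ext) (simp only: kd_scale, simp)
      then have "\<ominus>\<^bsub>C\<^esub> b = proj (kd fs (\<lambda>U. - 1 * y U))"
        using C_uminus[OF cyc_closed(6)[OF y(1)]] y(2) by simp
      then show ?thesis using chains_sign[OF y(1), of 1] by (auto simp: boundaries_A)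
    qed
    show "a \<oplus>\<^bsub>C\<^esub> b \<in> boundaries A" if ab: "a \<in> boundaries A" "b \<in> boundaries A" for a b
    proof -
      obtain y z where y: "y \<in> chains" "a = proj (kd fs y)" and z: "z \<in> chains" "b = proj (kd fs z)"
        using ab by (auto simp: boundaries_A)
      have "a \<oplus>\<^bsub>C\<^esub> b = proj (kd fs (\<lambda>U. y U + z U))"
        using proj_add[OF chains_kd[OF y(1)] chains_kd[OF z(1)]] y(2) z(2)
        by (simp add: kd_add[abs_def])
      then show ?thesis using chains_add[OF y(1) z(1)] by (auto simp: boundaries_A)
    qed
  qed
  fix b x assume b: "b \<in> boundaries A" and x: "x \<in> carrier C"
  obtain y where y: "y \<in> chains" "b = proj (kd fs y)" using b by (auto simp: boundaries_A)
  obtain z where z: "z \<in> cyc" "x = proj z" using x by (auto simp: cycles_A)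
  have ch: "z \<in> chains" "kd fs y \<in> chains" "khat z \<in> chains" "kmul r (khat z) y \<in> chains" "kmul r y z \<in> chains"
    using y z cycD(1) by (auto intro: chains_kd chains_khat chains_kmul)
  have "proj (kmul r z (kd fs y)) = proj (kd fs (kmul r (khat z) y))"
  proof (subst proj_eq_iff)
    have "khat (kd fs z) U \<in> J" for U using z cycD(2) khat_ideal by blast
    then have "kmul r (kd fs (khat z)) y W \<in> J" for W
      using ideal_closed(3)[OF J] by (intro kmul_ideal_left[OF _ y(1)]) (simp add: kd_khat)
    then show "\<forall>U. kmul r z (kd fs y) U - kd fs (kmul r (khat z) y) U \<in> J"
      using ideal_closed(3)[OF J] by (simp add: kd_kmul' khat_khat)
  qed (use ch in \<open>auto intro: chains_kmul chains_kd\<close>)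
  then have "x \<otimes>\<^bsub>C\<^esub> b = proj (kd fs (kmul r (khat z) y))"
    using proj_mult[OF ch(1,2)] y z by simp
  then show "x \<otimes>\<^bsub>C\<^esub> b \<in> boundaries A" using ch(4) by (auto simp: boundaries_A)
  have "proj (kmul r (kd fs y) z) = proj (kd fs (kmul r y z))"
  proof (subst proj_eq_iff)
    have "kmul r (khat y) (kd fs z) W \<in> J" for W
      using z cycD(2) by (intro kmul_ideal_right chains_khat y(1)) auto
    then show "\<forall>U. kmul r (kd fs y) z U - kd fs (kmul r y z) U \<in> J"
      using ideal_closed(3)[OF J] by (simp add: kd_kmul')
  qed (use ch in \<open>auto intro: chains_kmul chains_kd\<close>)
  then have "b \<otimes>\<^bsub>C\<^esub> x = proj (kd fs (kmul r y z))"
    using proj_mult[OF ch(2,1)] y z by simp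
  then show "b \<otimes>\<^bsub>C\<^esub> x \<in> boundaries A" using ch(5) by (auto simp: boundaries_A)
qed

sublocale H: ring "homology A"
  unfolding homology_def by (rule ideal.quotient_is_ring[OF boundaries_ideal])

definition hcl :: "(nat set \<Rightarrow> ('v, 'k) mpoly) \<Rightarrow> (nat set \<Rightarrow> ('v, 'k) mpoly set) set" where
  "hcl a = homology_class A (proj a)"

lemma homology_class_C: "homology_class A z = boundaries A +>\<^bsub>C\<^esub> z"
  by (simp add: homology_class_def a_r_coset_def r_coset_def)

lemma homology_class_hom: "homology_class A \<in> Ring.ring_hom C (homology A)"
  using ideal.rcos_ring_hom[OF boundaries_ideal] unfolding homology_def homology_class_C[abs_def] .

lemma hcl_closed: "a \<in> cyc \<Longrightarrow> hcl a \<in> carrier (homology A)"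
  unfolding hcl_def using ring_hom_memE(1)[OF homology_class_hom] proj_cycle by simp

lemma hcl_add: "a \<in> cyc \<Longrightarrow> b \<in> cyc \<Longrightarrow> hcl (\<lambda>U. a U + b U) = hcl a \<oplus>\<^bsub>homology A\<^esub> hcl b"
  unfolding hcl_def using ring_hom_memE(3)[OF homology_class_hom, of "proj a" "proj b"]
  by (simp add: proj_cycle proj_add cycD)

lemma hcl_mult: "a \<in> cyc \<Longrightarrow> b \<in> cyc \<Longrightarrow> hcl (kmul r a b) = hcl a \<otimes>\<^bsub>homology A\<^esub> hcl b"
  unfolding hcl_def using ring_hom_memE(2)[OF homology_class_hom, of "proj a" "proj b"]
  by (simp add: proj_cycle proj_mult cycD)

lemma hcl_one: "hcl (kscalar 1) = \<one>\<^bsub>homology A\<^esub>"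
  unfolding hcl_def using ring_hom_memE(4)[OF homology_class_hom] by (simp add: proj_one)

lemma hcl_eq_iff:
  assumes "a \<in> cyc" "b \<in> cyc"
  shows "hcl a = hcl b \<longleftrightarrow> (\<exists>y\<in>chains. \<forall>W. a W - b W - kd fs y W \<in> J)"
proof -
  interpret C: ring C by (rule C_ring)
  have ab: "(\<lambda>U. a U - b U) \<in> chains" "(\<lambda>U. - b U) \<in> chains"
    using cycD(1)[OF cyc_closed(3)[OF assms]] cycD(1)[OF cyc_closed(4)[OF assms(2)]] by auto
  have "proj a \<ominus>\<^bsub>C\<^esub> proj b = proj (\<lambda>U. a U - b U)"
    using C_uminus[OF assms(2)] proj_add[OF cycD(1)[OF assms(1)] ab(2)] by (simp add: a_minus_def)
  then have "hcl a = hcl b \<longleftrightarrow> proj (\<lambda>U. a U - b U) \<in> boundaries A"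
    using C.quotient_eq_iff_same_a_r_cos[OF boundaries_ideal, of "proj a" "proj b"] assms
    by (simp add: hcl_def homology_class_C proj_cycle)
  also have "\<dots> \<longleftrightarrow> (\<exists>y\<in>chains. \<forall>W. a W - b W - kd fs y W \<in> J)"
    using ab(1) by (auto simp: boundaries_A image_iff proj_eq_iff chains_kd)
  finally show ?thesis .
qed

lemma hcl_zero: "hcl (\<lambda>U. 0) = \<zero>\<^bsub>homology A\<^esub>"
proof -
  have "hcl (\<lambda>U. 0) \<oplus>\<^bsub>homology A\<^esub> hcl (\<lambda>U. 0) = hcl (\<lambda>U. 0)"
    using hcl_add[OF cyc_closed(7) cyc_closed(7)] by simp
  then show ?thesis using hcl_closed[OF cyc_closed(7)] H.add.l_cancel_one by simp
qed

lemma coef_kd_const: "coef (kd fs y W) 0 = 0"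
proof -
  have "coef ((- 1) ^ n * (fs ! i * p)) 0 = 0" if "i < r" for i n p
  proof -
    have "(- 1) ^ n * (fs ! i * p) = var (vs ! i) * ((- 1) ^ n * p)"
      using that by (simp add: fs_def mult_ac)
    moreover have "\<not> mdvd (mterm (vs ! i) 1) 0"
      by (auto simp: mdvd_def intro!: exI[of _ "vs ! i"])
    ultimately show ?thesis by (simp add: var_def coef_term_mult)
  qed
  then show ?thesis by (simp add: kd_def coef_sum)
qed

text \<open>Neither boundaries nor elements of \<open>J\<close> have constant terms, so that \<open>1\<close> is not a boundary. Hence the
  ground field embeds into the homology.\<close>

lemma H_one_not_zero: "\<one>\<^bsub>homology A\<^esub> \<noteq> \<zero>\<^bsub>homology A\<^esub>"
proof
  assume "\<one>\<^bsub>homology A\<^esub> = \<zero>\<^bsub>homology A\<^esub>"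
  then have "hcl (kscalar 1) = hcl (\<lambda>U. 0)" by (simp add: hcl_one hcl_zero)
  then obtain y where "kscalar 1 {} - 0 - kd fs y {} \<in> J"
    using hcl_eq_iff[OF cyc_closed(1)[OF polys_one] cyc_closed(7)] by blast
  then have "coef (kscalar 1 {} - 0 - kd fs y {}) 0 = 0" by (rule J_const)
  then show False by (simp add: kscalar_def lookup_minus coef_kd_const)
qed

definition "K = range (\<lambda>c. hcl (kscalar (const_poly c)))"

lemma K_eq:
  "homology_class A ` range (\<lambda>c. koszul_scalar S r (J +>\<^bsub>mpoly_ring V\<^esub> const_poly c)) = K"
  by (simp add: K_def hcl_def image_image proj_scalar cl_def)

lemma kmul_kscalar: "a \<in> chains \<Longrightarrow> kmul r (kscalar p) a = (\<lambda>U. p * a U)"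
proof
  fix W assume "a \<in> chains"
  then show "kmul r (kscalar p) a W = p * a W"
    by (cases "W \<subseteq> {..<r}") (simp_all add: kmul_scalar_left, simp_all add: kmul_def chains_def)
qed

lemma cyc_const: "a \<in> cyc \<Longrightarrow> (\<lambda>U. const_poly c * a U) \<in> cyc"
  using cyc_closed(5)[OF cyc_closed(1)[OF polys_const], of a c] kmul_kscalar[OF cycD(1)] by simp

lemma hcl_const_mult:
  "a \<in> cyc \<Longrightarrow> hcl (kscalar (const_poly c)) \<otimes>\<^bsub>homology A\<^esub> hcl a = hcl (\<lambda>U. const_poly c * a U)"
  using hcl_mult[OF cyc_closed(1)[OF polys_const], of a c] kmul_kscalar[OF cycD(1)] by simp

lemma K_subfield: "subfield K (homology A)"
proof -
  let ?k = "ring_of_type_algebra :: 'k ring"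
  let ?g = "\<lambda>c. hcl (kscalar (const_poly c))"
  interpret k: field ?k by (rule field_from_type_algebra)
  have ks: "(\<lambda>U. kscalar p U + kscalar q U) = kscalar (p + q)" for p q :: "('v, 'k) mpoly"
    by (rule ext) (simp add: kscalar_def)
  have kp: "kmul r (kscalar p) (kscalar q) = kscalar (p * q)"
    if "q \<in> polys V" for p q :: "('v, 'k) mpoly"
    using kmul_kscalar[OF chains_kscalar[OF that]] by (auto simp: kscalar_def)
  have "?g \<in> Ring.ring_hom ?k (homology A)"
  proof (rule ring_hom_memI)
    fix x y
    show "?g x \<in> carrier (homology A)" by (intro hcl_closed cyc_closed(1) polys_const)
    show "?g (x \<otimes>\<^bsub>?k\<^esub> y) = ?g x \<otimes>\<^bsub>homology A\<^esub> ?g y"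
      using hcl_mult[OF cyc_closed(1)[OF polys_const] cyc_closed(1)[OF polys_const], of x y]
      by (simp add: ring_of_type_algebra_def kp const_poly_simps)
    show "?g (x \<oplus>\<^bsub>?k\<^esub> y) = ?g x \<oplus>\<^bsub>homology A\<^esub> ?g y"
      using hcl_add[OF cyc_closed(1)[OF polys_const] cyc_closed(1)[OF polys_const], of x y]
      by (simp add: ring_of_type_algebra_def ks const_poly_simps)
    show "?g \<one>\<^bsub>?k\<^esub> = \<one>\<^bsub>homology A\<^esub>"
      by (simp add: ring_of_type_algebra_def const_poly_simps hcl_one)
  qed
  then interpret g: ring_hom_ring ?k "homology A" ?g
    by (intro ring_hom_ringI2 k.ring_axioms H.ring_axioms)
  have "subfield (?g ` carrier ?k) (homology A)"
    by (rule g.img_is_subfield(2)[OF k.carrier_is_subfield H_one_not_zero])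
  then show ?thesis by (simp add: K_def ring_of_type_algebra_def)
qed

lemma homology_component_A:
  "homology_component A p = hcl ` {a \<in> cyc. in_comp p a}"
proof
  show "homology_component A p \<subseteq> hcl ` {a \<in> cyc. in_comp p a}"
  proof
    fix h assume "h \<in> homology_component A p"
    then obtain z where z: "z \<in> cycles A" "z \<in> component A p" "h = homology_class A z"
      by (auto simp: homology_component_def)
    then obtain b where b: "b \<in> cyc" "z = proj b" by (auto simp: cycles_A)
    define a where "a U = (if card U = p then b U else 0)" for U
    have a: "a \<in> chains" using cycD(1)[OF b(1)] by (auto simp: a_def chains_def)
    have "b U - a U \<in> J" for U
    proof (cases "card U = p \<or> \<not> U \<subseteq> {..<r}")
      case True
      then show ?thesis using cycD(1)[OF b(1)] ideal_closed(1)[OF J] by (auto simp: a_def chains_def)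
    next
      case False
      then have "z U = \<zero>\<^bsub>S\<^esub>" using z(2) by (simp add: A_simps)
      then have "cl (b U) = cl 0" using b(2) False by (simp add: proj_apply cl_zero)
      then show ?thesis using False cl_eq_iff[of "b U" 0] chainsD[OF cycD(1)[OF b(1)]] by (simp add: a_def)
    qed
    then have eq: "proj b = proj a" using proj_eq_iff[OF cycD(1)[OF b(1)] a] by simp
    then have "a \<in> cyc" using proj_cycle_iff[OF a] z(1) b(2) by simp
    moreover have "in_comp p a" by (simp add: in_comp_def a_def)
    ultimately show "h \<in> hcl ` {a \<in> cyc. in_comp p a}" using z(3) b(2) eq by (auto simp: hcl_def)
  qed
  show "hcl ` {a \<in> cyc. in_comp p a} \<subseteq> homology_component A p"
    using proj_component cycD(1) proj_cycle by (auto simp: homology_component_def hcl_def)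
qed

end


text \<open>The recursion scheme of a Massey operation: \<open>s\<close> forms the sum of the products of the values at the
  two parts of a word, and \<open>b\<close> chooses an element whose boundary is that sum. The guards on \<open>j\<close> make every
  recursive call one on a shorter word.\<close>

function massey ::
  "('w \<Rightarrow> 'c) \<Rightarrow> ('w list \<Rightarrow> 'c \<Rightarrow> 'c) \<Rightarrow> ((nat \<Rightarrow> 'w list \<Rightarrow> 'c) \<Rightarrow> (nat \<Rightarrow> 'w list \<Rightarrow> 'c) \<Rightarrow> 'w list \<Rightarrow> 'c) \<Rightarrow> 'w list \<Rightarrow> 'c" where
  "massey z b s w = (if length w \<le> 1 then z (hd w)
     else b w (s (\<lambda>j u. if j \<in> {1..<length w} then massey z b s (take j w) else undefined)
                 (\<lambda>j u. if j \<in> {1..<length w} then massey z b s (drop j w) else undefined) w))"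
  by pat_completeness auto
termination by (relation "measure (\<lambda>(z, b, s, w). length w)") auto

declare massey.simps [simp del]

lemma homogeneous_degrees_bounded:
  fixes a :: "nat set \<Rightarrow> ('v, 'k::field) mpoly"
  assumes "\<And>U. \<not> U \<subseteq> {..<r} \<Longrightarrow> a U = 0"
  shows "\<exists>N. \<forall>U. \<forall>e\<in>supp (a U). mdeg e < N"
proof -
  have "finite (\<Union>U\<in>Pow {..<r}. mdeg ` supp (a U))" by auto
  then obtain N where N: "\<forall>x\<in>(\<Union>U\<in>Pow {..<r}. mdeg ` supp (a U)). x < N"
    using finite_nat_set_iff_bounded by metis
  have "mdeg e < N" if e: "e \<in> supp (a U)" for U e
  proof -
    have "a U \<noteq> 0" using e by force
    then have "U \<in> Pow {..<r}" using assms[of U] by blast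
    then have "mdeg e \<in> (\<Union>U\<in>Pow {..<r}. mdeg ` supp (a U))" using e by blast
    then show ?thesis using N by blast
  qed
  then show ?thesis by blast
qed

lemma kmul_homogeneous:
  assumes "\<And>U. homogeneous_poly k (a U)" "\<And>U. homogeneous_poly l (b U)"
  shows "homogeneous_poly (k + l) (kmul r a b W)"
  unfolding kmul_def
  by (auto intro!: homogeneous_sum neg_one_power_mult_homogeneous homogeneous_mult assms)

context koszul_quotient
begin

abbreviation hpart :: "nat \<Rightarrow> (nat set \<Rightarrow> ('v, 'k) mpoly) \<Rightarrow> nat set \<Rightarrow> ('v, 'k) mpoly" where
  "hpart e a \<equiv> (\<lambda>U. hcomp e (a U))"

lemma hcomp_signed_var_mult:
  assumes "i < r"
  shows "hcomp k ((- 1) ^ n * (fs ! i * p)) =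
    (if 1 \<le> k then (- 1) ^ n * (fs ! i * hcomp (k - 1) p) else 0)"
proof -
  have "homogeneous_poly 1 ((- 1) ^ n * fs ! i)"
    using assms by (intro neg_one_power_mult_homogeneous) (simp add: fs_def del: One_nat_def)
  from hcomp_mult_homogeneous[OF this, of k p] show ?thesis by (simp add: mult_ac)
qed

lemma hcomp_kd: "hcomp (Suc e) (kd fs a W) = kd fs (hpart e a) W" "hcomp 0 (kd fs a W) = 0"
  by (auto simp: kd_def hcomp_sum hcomp_signed_var_mult intro!: sum.cong sum.neutral)

lemma chains_hpart: "a \<in> chains \<Longrightarrow> hpart e a \<in> chains"
  by (simp add: chains_def polys_hcomp)

lemma cyc_hpart: "a \<in> cyc \<Longrightarrow> hpart e a \<in> cyc"
  using J_hcomp hcomp_kd(1) unfolding cyc_def by (auto simp: chains_hpart hcomp_kd(1)[symmetric])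

lemma kd_comp_part:
  "card W = i \<Longrightarrow> kd fs (\<lambda>U. if card U = Suc i then a U else 0) W = kd fs a W"
proof (cases "W \<subseteq> {..<r}")
  case True
  assume "card W = i"
  moreover have "finite W" using True finite_subset by blast
  ultimately show ?thesis by (auto simp: kd_def intro!: sum.cong)
qed (simp add: kd_def)

end

section \<open>A criterion for Golodness\<close>

text \<open>Every cycle of positive homological degree whose coefficients have degree other than \<open>d - 1\<close> is a
  boundary modulo \<open>J\<close>. When \<open>J\<close> is generated in degree \<open>d\<close> and \<open>vs\<close> lists all
  variables, this says that \<open>J\<close> has a linear resolution.\<close>

locale linear_koszul_quotient = koszul_quotient V J vs
  for V :: "'v set" and J :: "('v, 'k::field) mpoly set" and vs :: "'v list" +
  fixes d :: nat
  assumes finite_V: "finite V"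
    and d: "2 \<le> d"
    and strand: "\<And>i e z. 1 \<le> i \<Longrightarrow> e \<noteq> d - 1 \<Longrightarrow> z \<in> chains \<Longrightarrow> in_comp i z \<Longrightarrow>
      (\<And>U. homogeneous_poly e (z U)) \<Longrightarrow> (\<And>W. kd fs z W \<in> J) \<Longrightarrow>
      \<exists>y\<in>chains. \<forall>W. z W - kd fs y W \<in> J"
begin

declare H.Span.simps [simp del]

text \<open>The differential raises the degree of the coefficients by one and lowers the homological degree by
  one, so the matching bihomogeneous part of any bounding chain bounds as well.\<close>

lemma strand_homogeneous:
  assumes "1 \<le> i" "1 \<le> e" "e \<noteq> d - 1" "z \<in> chains" "in_comp i z"
    and hom: "\<And>U. homogeneous_poly e (z U)" and "\<And>W. kd fs z W \<in> J"
  shows "\<exists>y\<in>chains. in_comp (Suc i) y \<and> (\<forall>U. homogeneous_poly (e - 1) (y U)) \<and>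
    (\<forall>W. z W - kd fs y W \<in> J)"
proof -
  obtain y where y: "y \<in> chains" "\<And>W. z W - kd fs y W \<in> J"
    using strand[OF assms(1,3,4,5) hom assms(7)] by blast
  define x where "x = hpart (e - 1) y"
  define x' where "x' = (\<lambda>U. if card U = Suc i then x U else 0)"
  have x: "x \<in> chains" unfolding x_def by (rule chains_hpart[OF y(1)])
  then have x'ch: "x' \<in> chains" by (auto simp: chains_def x'_def)
  have x'comp: "in_comp (Suc i) x'" by (simp add: x'_def in_comp_def)
  have "z W - kd fs x' W \<in> J" for W
  proof (cases "card W = i")
    case True
    have "hcomp e (z W - kd fs y W) = z W - kd fs x W"
      using hcomp_homogeneous[OF hom[of W], of e] hcomp_kd(1)[of "e - 1" y W] assms(2)
      by (simp add: hcomp_diff x_def)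
    then have "z W - kd fs x W \<in> J" using J_hcomp[OF y(2)[of W], of e] by simp
    then show ?thesis using kd_comp_part[OF True, of x] by (simp add: x'_def)
  next
    case False
    then show ?thesis using assms(5) kd_in_comp[OF x'comp, of fs] ideal_closed(1)[OF J]
      by (simp add: in_comp_def)
  qed
  moreover have "homogeneous_poly (e - 1) (x' U)" for U by (simp add: x'_def x_def)
  ultimately show ?thesis using x'ch x'comp by blast
qed

text \<open>The cycles that represent the homology in degree \<open>p \<ge> 1\<close>.\<close>

definition "lin_cyc p = {a \<in> cyc. in_comp p a \<and> (\<forall>U. homogeneous_poly (d - 1) (a U))}"

text \<open>The homogeneous parts of a cycle in the other internal degrees are boundaries.\<close>

lemma homology_component_lin:
  assumes "1 \<le> p"
  shows "homology_component A p = hcl ` lin_cyc p"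
proof
  show "homology_component A p \<subseteq> hcl ` lin_cyc p"
  proof
    fix h assume "h \<in> homology_component A p"
    then obtain a where a: "a \<in> cyc" "in_comp p a" "h = hcl a" by (auto simp: homology_component_A)
    have ach: "a \<in> chains" by (rule cycD(1)[OF a(1)])
    obtain N0 where N0: "\<And>U e. e \<in> supp (a U) \<Longrightarrow> mdeg e < N0"
      using homogeneous_degrees_bounded[of r a] ach unfolding chains_def by blast
    define N where "N = N0 + d"
    have N: "\<And>U e. e \<in> supp (a U) \<Longrightarrow> mdeg e < N" using N0 by (fastforce simp: N_def)
    define b where "b = hpart (d - 1) a"
    have b: "b \<in> lin_cyc p"
      using cyc_hpart[OF a(1)] a(2) by (auto simp: lin_cyc_def b_def in_comp_def)
    have "\<exists>y\<in>chains. \<forall>W. hpart e a W - kd fs y W \<in> J" if "e \<noteq> d - 1" for e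
      using strand[OF assms that, of "hpart e a"] cycD[OF cyc_hpart[OF a(1), of e]] a(2)
      by (auto simp: in_comp_def)
    then obtain y where y: "\<And>e. e \<noteq> d - 1 \<Longrightarrow> y e \<in> chains"
      "\<And>e W. e \<noteq> d - 1 \<Longrightarrow> hpart e a W - kd fs (y e) W \<in> J" by metis
    let ?E = "{..<N} - {d - 1}"
    have "a W - b W - kd fs (\<lambda>U. \<Sum>e\<in>?E. y e U) W \<in> J" for W
    proof -
      have "a W = (\<Sum>e<N. hcomp e (a W))" by (rule sum_hcomp) (rule N)
      also have "\<dots> = b W + (\<Sum>e\<in>?E. hcomp e (a W))"
        unfolding b_def using d by (subst sum.remove[of _ "d - 1"]) (auto simp: N_def)
      finally have "a W - b W - kd fs (\<lambda>U. \<Sum>e\<in>?E. y e U) W = (\<Sum>e\<in>?E. hpart e a W - kd fs (y e) W)"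
        by (simp add: kd_sum sum_subtractf algebra_simps)
      also have "\<dots> \<in> J" by (rule ideal_sum_closed[OF J]) (use y(2) in auto)
      finally show ?thesis .
    qed
    moreover have "(\<lambda>U. \<Sum>e\<in>?E. y e U) \<in> chains" by (rule chains_sum) (use y(1) in auto)
    ultimately have "hcl a = hcl b"
      using b by (subst hcl_eq_iff[OF a(1)]) (auto simp: lin_cyc_def)
    then show "h \<in> hcl ` lin_cyc p" using a(3) b by blast
  qed
  show "hcl ` lin_cyc p \<subseteq> homology_component A p"
    by (auto simp: homology_component_A lin_cyc_def)
qed

lemma lin_cyc_closed:
  "(\<lambda>U. 0) \<in> lin_cyc p"
  "a \<in> lin_cyc p \<Longrightarrow> b \<in> lin_cyc p \<Longrightarrow> (\<lambda>U. a U + b U) \<in> lin_cyc p"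
  "a \<in> lin_cyc p \<Longrightarrow> (\<lambda>U. const_poly c * a U) \<in> lin_cyc p"
proof -
  show "(\<lambda>U. 0) \<in> lin_cyc p" using cyc_closed(7) by (simp add: lin_cyc_def in_comp_def)
  show "(\<lambda>U. a U + b U) \<in> lin_cyc p" if "a \<in> lin_cyc p" "b \<in> lin_cyc p"
    using that cyc_closed(2)[of a b] by (auto simp: lin_cyc_def in_comp_def homogeneous_add)
  show "(\<lambda>U. const_poly c * a U) \<in> lin_cyc p" if "a \<in> lin_cyc p"
    using that cyc_const[of a c] by (auto simp: lin_cyc_def in_comp_def homogeneous_const_mult)
qed

text \<open>Closure under the operations of a vector space over the ground field. The predicate is stated for sets of
  representatives, so that the finite dimension of \<open>lin_cyc p\<close> can be used without a vector space type.\<close>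

definition subsp :: "(nat set \<Rightarrow> ('v, 'k) mpoly) set \<Rightarrow> bool" where
  "subsp T \<longleftrightarrow> (\<lambda>U. 0) \<in> T \<and> (\<forall>a\<in>T. \<forall>b\<in>T. (\<lambda>U. a U + b U) \<in> T) \<and>
    (\<forall>a\<in>T. \<forall>c. (\<lambda>U. const_poly c * a U) \<in> T)"

lemma lin_cyc_finite_basis:
  "\<exists>B. finite B \<and> B \<subseteq> lin_cyc p \<and> (\<forall>T. B \<subseteq> T \<longrightarrow> T \<subseteq> lin_cyc p \<longrightarrow> subsp T \<longrightarrow> T = lin_cyc p)"
proof -
  define scale where "scale = (\<lambda>(c :: 'k) (a :: nat set \<Rightarrow> ('v, 'k) mpoly) U. const_poly c * a U)"
  interpret L: vector_space scale
    by unfold_locales (auto simp: scale_def const_poly_simps distrib_left distrib_right mult.assoc fun_eq_iff)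
  define E where "E = (\<lambda>(U, e). (\<lambda>U'. if U' = U then mterm e (1 :: 'k) else 0)) `
    (Pow {..<r} \<times> {e. supp e \<subseteq> V \<and> mdeg e = d - 1})"
  have finE: "finite E" 
    unfolding E_def by (intro finite_imageI finite_cartesian_product finite_monomials finite_V) simp
  have "a \<in> L.span E" if a: "a \<in> lin_cyc p" for a
  proof -
    have ach: "a \<in> chains" using a cycD(1) by (auto simp: lin_cyc_def)
    have "a = (\<Sum>U\<in>Pow {..<r}. \<Sum>e\<in>supp (a U). scale (coef (a U) e) (\<lambda>U'. if U' = U then mterm e 1 else 0))"
    proof
      fix W
      have sf: "(\<Sum>x\<in>X1. f x) W = (\<Sum>x\<in>X1. f x W)" for X1 and f :: "'x \<Rightarrow> nat set \<Rightarrow> ('v, 'k) mpoly"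
        by (induction X1 rule: infinite_finite_induct) auto
      have "(\<Sum>U\<in>Pow {..<r}. \<Sum>e\<in>supp (a U). scale (coef (a U) e) (\<lambda>U'. if U' = U then mterm e 1 else 0)) W
        = (\<Sum>U\<in>Pow {..<r}. if W = U then a U else 0)"
      proof -
        have "(\<Sum>e\<in>supp (a U). scale (coef (a U) e) (\<lambda>U'. if U' = U then mterm e 1 else 0)) W =
            (if W = U then a U else 0)" for U
        proof -
          have "const_poly c * mterm e 1 = mterm e c" for c :: 'k and e :: "'v \<Rightarrow>\<^sub>0 nat"
            by (simp add: const_poly_def mult_single)
          then show ?thesis by (simp add: sf scale_def poly_as_sum[symmetric])
        qed
        then show ?thesis by (simp add: sf)
      qed
      also have "\<dots> = a W" using ach by (auto simp: chains_def)
      finally show "a W = (\<Sum>U\<in>Pow {..<r}. \<Sum>e\<in>supp (a U). scale (coef (a U) e) (\<lambda>U'. if U' = U then mterm e 1 else 0)) W"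
        by simp
    qed
    also have "\<dots> \<in> L.span E"
    proof (intro L.span_sum L.span_scale L.span_base)
      fix U e assume U: "U \<in> Pow {..<r}" and e: "e \<in> supp (a U)"
      have "supp e \<subseteq> V" using e chainsD[OF ach, of U] by (simp add: mem_polys)
      moreover have "mdeg e = d - 1" using e a by (simp add: lin_cyc_def homogeneous_poly_iff)
      ultimately show "(\<lambda>U'. if U' = U then mterm e 1 else 0) \<in> E" using U by (auto simp: E_def)
    qed
    finally show ?thesis .
  qed
  then have sub: "lin_cyc p \<subseteq> L.span E" by blast
  obtain B where B: "B \<subseteq> lin_cyc p" "L.independent B" "lin_cyc p \<subseteq> L.span B"
    using L.maximal_independent_subset by blast
  have fin: "finite B" using L.independent_span_bound[OF finE B(2)] B(1) sub by blast
  have "T = lin_cyc p" if T: "B \<subseteq> T" "T \<subseteq> lin_cyc p" "subsp T" for T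
  proof -
    have "L.subspace T"
      unfolding L.subspace_def zero_fun_def plus_fun_def using T(3) by (simp add: scale_def subsp_def)
    from L.span_minimal[OF T(1) this] show ?thesis using T(2) B(3) by (meson subset_antisym subset_trans)
  qed
  then show ?thesis using fin B(1) by blast
qed

text \<open>The classes of the finitely many generators of the spaces \<open>lin_cyc p\<close> with \<open>1 \<le> p \<le> r\<close> span the
  positive homology; an independent sublist of them is a basis.\<close>

lemma exists_homology_basis:
  "\<exists>hs. homogeneous_homology_basis (range (\<lambda>c. koszul_scalar S r (J +>\<^bsub>mpoly_ring V\<^esub> const_poly c))) A hs \<and>
    (\<forall>h\<in>set hs. \<exists>p\<ge>1. \<exists>a\<in>lin_cyc p. h = hcl a)"
proof -
  obtain B where B: "\<And>p. finite (B p)" "\<And>p. B p \<subseteq> lin_cyc p"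
    "\<And>p T. B p \<subseteq> T \<Longrightarrow> T \<subseteq> lin_cyc p \<Longrightarrow> subsp T \<Longrightarrow> T = lin_cyc p"
    using lin_cyc_finite_basis by metis
  obtain Us where Us: "set Us = (\<Union>p\<in>{1..r}. hcl ` B p)"
    using finite_list[of "\<Union>p\<in>{1..r}. hcl ` B p"] B(1) by auto
  have car: "set Us \<subseteq> carrier (homology A)"
  proof -
    have "hcl a \<in> carrier (homology A)" if "a \<in> B p" for a p
    proof -
      have "a \<in> cyc" using that B(2)[of p] by (auto simp: lin_cyc_def)
      then show ?thesis by (rule hcl_closed)
    qed
    then show ?thesis unfolding Us by blast
  qed
  obtain hs where hs: "set hs \<subseteq> set Us" "H.independent K hs" "H.Span K hs = H.Span K Us"
    using H.exists_independent_sublist[OF K_subfield car] by blast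
  note hcar = subset_trans[OF hs(1) car]
  have in_span: "hcl a \<in> H.Span K hs" if a: "a \<in> lin_cyc p" "1 \<le> p" for a p
  proof (cases "p \<le> r")
    case True
    define T where "T = {a \<in> lin_cyc p. hcl a \<in> H.Span K hs}"
    have "T = lin_cyc p"
    proof (rule B(3))
      have "hcl b \<in> H.Span K Us" if "b \<in> B p" for b
      proof -
        have "p \<in> {1..r}" using True a(2) by simp
        then have "hcl b \<in> set Us" using that unfolding Us by blast
        then show ?thesis using H.Span_base_incl[OF K_subfield car] by blast
      qed
      then show "B p \<subseteq> T" using B(2)[of p] hs(3) by (auto simp: T_def)
      show "T \<subseteq> lin_cyc p" by (auto simp: T_def)
      show "subsp T" unfolding subsp_def
      proof (intro conjI)
      show "(\<lambda>U. 0) \<in> T"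
        using lin_cyc_closed(1) hcl_zero H.Span_subgroup_props(2)[OF K_subfield hcar]
        by (simp add: T_def)
      show "\<forall>a\<in>T. \<forall>b\<in>T. (\<lambda>U. a U + b U) \<in> T"
      proof (intro ballI)
        fix a b assume "a \<in> T" "b \<in> T"
        then have ab: "a \<in> lin_cyc p" "b \<in> lin_cyc p" "hcl a \<in> H.Span K hs" "hcl b \<in> H.Span K hs"
          by (simp_all add: T_def)
        then have "hcl (\<lambda>U. a U + b U) = hcl a \<oplus>\<^bsub>homology A\<^esub> hcl b"
          by (intro hcl_add) (simp_all add: lin_cyc_def)
        then show "(\<lambda>U. a U + b U) \<in> T"
          using lin_cyc_closed(2)[OF ab(1,2)] H.Span_subgroup_props(3)[OF K_subfield hcar ab(3,4)]
          by (simp add: T_def)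
      qed
      show "\<forall>a\<in>T. \<forall>c. (\<lambda>U. const_poly c * a U) \<in> T"
      proof (intro ballI allI)
        fix a c assume "a \<in> T"
        then have a: "a \<in> lin_cyc p" "hcl a \<in> H.Span K hs" by (simp_all add: T_def)
        have "hcl (kscalar (const_poly c)) \<in> K" by (simp add: K_def)
        then have "hcl (kscalar (const_poly c)) \<otimes>\<^bsub>homology A\<^esub> hcl a \<in> H.Span K hs"
          by (rule H.Span_smult_closed[OF K_subfield hcar _ a(2)])
        then show "(\<lambda>U. const_poly c * a U) \<in> T"
          using lin_cyc_closed(3)[OF a(1)] hcl_const_mult[of a c] a(1)
          by (simp add: T_def lin_cyc_def)
      qed
      qed
    qed
    then show ?thesis using a(1) by (auto simp: T_def)
  next
    case False
    have "a U = 0" for U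
    proof (cases "U \<subseteq> {..<r}")
      case True
      then have "card U \<le> r" using card_mono[of "{..<r}" U] by simp
      then show ?thesis using a(1) False by (simp add: lin_cyc_def in_comp_def)
    next
      case False
      then show ?thesis using a(1) cycD(1) by (auto simp: lin_cyc_def chains_def)
    qed
    then have "a = (\<lambda>U. 0)" by auto
    then show ?thesis using hcl_zero H.Span_subgroup_props(2)[OF K_subfield hcar] by (simp)
  qed
  have reps: "\<exists>p\<ge>1. \<exists>a\<in>lin_cyc p. h = hcl a" if "h \<in> set hs" for h
  proof -
    have "h \<in> (\<Union>p\<in>{1..r}. hcl ` B p)" using that hs(1) Us by blast
    then obtain p a where "p \<in> {1..r}" "a \<in> B p" "h = hcl a" by blast
    moreover have "a \<in> lin_cyc p" using calculation(2) B(2)[of p] by blast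
    ultimately show ?thesis by auto
  qed
  have "H.Span K hs = positive_homology A"
  proof
    have sub: "additive_subgroup (H.Span K hs) (homology A)"
      by (rule additive_subgroup.intro) (rule H.Span_is_add_subgroup[OF K_subfield hcar])
    moreover have "homology_component A p \<subseteq> H.Span K hs" if "1 \<le> p" for p
      unfolding homology_component_lin[OF that] using in_span that by blast
    ultimately show "positive_homology A \<subseteq> H.Span K hs"
      unfolding positive_homology_def by blast
    show "H.Span K hs \<subseteq> positive_homology A"
      unfolding positive_homology_def
    proof (rule Inter_greatest)
      fix T assume "T \<in> {T. additive_subgroup T (homology A) \<and> (\<forall>p\<ge>1. homology_component A p \<subseteq> T)}"
      then have T: "additive_subgroup T (homology A)" "\<And>p. 1 \<le> p \<Longrightarrow> homology_component A p \<subseteq> T" by auto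
      show "H.Span K hs \<subseteq> T"
      proof (rule H.Span_min[OF K_subfield hcar additive_subgroup.a_subgroup[OF T(1)]])
        show "K <#>\<^bsub>homology A\<^esub> set hs \<subseteq> T"
        proof
          fix x assume "x \<in> K <#>\<^bsub>homology A\<^esub> set hs"
          then obtain c h where x: "x = hcl (kscalar (const_poly c)) \<otimes>\<^bsub>homology A\<^esub> h" "h \<in> set hs"
            by (auto simp: set_mult_def K_def)
          obtain p a where a: "1 \<le> p" "a \<in> lin_cyc p" "h = hcl a" using reps[OF x(2)] by blast
          have "x = hcl (\<lambda>U. const_poly c * a U)"
            using x(1) a hcl_const_mult[of a c] by (simp add: lin_cyc_def)
          then show "x \<in> T" using T(2)[OF a(1)] homology_component_lin[OF a(1)] lin_cyc_closed(3)[OF a(2)]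
            by blast
        qed
      qed
    qed
  qed
  moreover have "\<forall>h\<in>set hs. \<exists>p\<ge>1. h \<in> homology_component A p"
    using reps homology_component_lin by blast
  ultimately show ?thesis
    unfolding homogeneous_homology_basis_def K_eq using hs(2) reps by (intro exI[of _ hs]) simp
qed

text \<open>A Massey operation on representatives: its defining equation holds modulo \<open>J\<close>. The value at a word has
  homological degree the sum of the degrees of the letters plus the length minus one, which determines the sign.\<close>

definition massey_lift :: "'w set \<Rightarrow> ('w \<Rightarrow> nat) \<Rightarrow> ('w \<Rightarrow> nat set \<Rightarrow> ('v, 'k) mpoly) \<Rightarrow>
    ('w list \<Rightarrow> nat set \<Rightarrow> ('v, 'k) mpoly) \<Rightarrow> bool" where
  "massey_lift Hs p z \<mu> \<longleftrightarrow> (\<forall>h. \<mu> [h] = z h) \<and>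
    (\<forall>w. w \<noteq> [] \<and> set w \<subseteq> Hs \<longrightarrow> \<mu> w \<in> chains \<and> in_comp (sum_list (map p w) + length w - 1) (\<mu> w) \<and>
      (\<forall>W. kd fs (\<mu> w) W - (\<Sum>j\<in>{1..<length w}.
        (- 1) ^ (sum_list (map p (take j w)) + length (take j w) - 1 + 1) * kmul r (\<mu> (take j w)) (\<mu> (drop j w)) W) \<in> J))"

text \<open>The value at a word of length \<open>l\<close> has coefficients of degree \<open>l (d - 2) + 1\<close>, so the
  cycle to be bounded has coefficients of degree \<open>l (d - 2) + 2\<close>. For \<open>l \<ge> 2\<close> this is not \<open>d - 1\<close>,
  so the cycle is a boundary.\<close>

lemma exists_massey_lift:
  fixes p :: "'w \<Rightarrow> nat" and Hs :: "'w set"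
  assumes "\<And>h. h \<in> Hs \<Longrightarrow> 1 \<le> p h \<and> z h \<in> lin_cyc (p h)"
  shows "\<exists>\<mu>. massey_lift Hs p z \<mu>"
proof -
  define dg where "dg w = sum_list (map p w) + length w - 1" for w :: "'w list"
  define ok where "ok w y x \<longleftrightarrow> y \<in> chains \<and> in_comp (dg w) y \<and>
    (\<forall>U. homogeneous_poly (length w * (d - 2) + 1) (y U)) \<and> (\<forall>W. x W - kd fs y W \<in> J)" for w y x
  define b where "b w x = (SOME y. ok w y x)" for w x
  define s where "s f g w = (\<lambda>W. \<Sum>j\<in>{1..<length w}. (- 1) ^ (dg (take j w) + 1) * kmul r (f j w) (g j w) W)"
    for f g :: "nat \<Rightarrow> 'w list \<Rightarrow> nat set \<Rightarrow> ('v, 'k) mpoly" and w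
  define \<mu> where "\<mu> = massey z b s"
  define rhs where "rhs w = (\<lambda>W. \<Sum>j\<in>{1..<length w}. (- 1) ^ (dg (take j w) + 1) * kmul r (\<mu> (take j w)) (\<mu> (drop j w)) W)" for w
  have \<mu>1: "\<mu> [h] = z h" for h by (simp add: \<mu>_def massey.simps[of _ _ _ "[h]"])
  have \<mu>2: "\<mu> w = b w (rhs w)" if "length w \<ge> 2" for w
  proof -
    have "\<mu> w = b w (s (\<lambda>j u. if j \<in> {1..<length w} then \<mu> (take j w) else undefined)
                 (\<lambda>j u. if j \<in> {1..<length w} then \<mu> (drop j w) else undefined) w)"
      unfolding \<mu>_def using that by (subst massey.simps) simp
    also have "s (\<lambda>j u. if j \<in> {1..<length w} then \<mu> (take j w) else undefined)
                 (\<lambda>j u. if j \<in> {1..<length w} then \<mu> (drop j w) else undefined) w = rhs w"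
      unfolding s_def rhs_def by (intro ext sum.cong) auto
    finally show ?thesis .
  qed
  have dg_split: "dg w = Suc (dg (take j w) + dg (drop j w))"
    if "set w \<subseteq> Hs" "j \<in> {1..<length w}" for w j
  proof -
    have "sum_list (map p w) = sum_list (map p (take j w)) + sum_list (map p (drop j w))"
      by (metis append_take_drop_id map_append sum_list_append)
    then show ?thesis using that(2) by (auto simp: dg_def min_def)
  qed
  define good where "good w \<longleftrightarrow> \<mu> w \<in> chains \<and> in_comp (dg w) (\<mu> w) \<and>
    (\<forall>U. homogeneous_poly (length w * (d - 2) + 1) (\<mu> w U)) \<and> (\<forall>W. kd fs (\<mu> w) W - rhs w W \<in> J)" for w
  have "good w" if "w \<noteq> []" "set w \<subseteq> Hs" for w
    using that
  proof (induction w rule: length_induct)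
    case (1 w)
    show ?case
    proof (cases "length w = 1")
      case True
      then obtain h where w: "w = [h]" by (auto simp: length_Suc_conv)
      then have "z h \<in> lin_cyc (p h)" "1 \<le> p h" using assms 1 by auto
      moreover have "rhs w = (\<lambda>W. 0)" by (simp add: rhs_def w)
      moreover have "d - 1 = length w * (d - 2) + 1" using d w by simp
      ultimately show ?thesis using cycD by (simp add: good_def w \<mu>1 dg_def lin_cyc_def)
    next
      case False
      then have len: "length w \<ge> 2" using 1(2) by (cases w) (auto simp: Suc_le_eq)
      let ?n = "length w"
      have IH: "good u" if "u \<noteq> []" "set u \<subseteq> set w" "length u < ?n" for u
        using 1 that by blast
      have tk: "good (take j w)" "good (drop j w)" if "j \<in> {1..<?n}" for j
        using that by (auto intro!: IH dest: in_set_takeD in_set_dropD)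
      have ch: "\<mu> (take j w) \<in> chains" "\<mu> (drop j w) \<in> chains" if "j \<in> {1..<?n}" for j
        using tk[OF that] by (simp_all add: good_def)
      have rhs_ch: "rhs w \<in> chains"
        unfolding rhs_def by (intro chains_sum chains_sign chains_kmul ch)
      have rhs_comp: "in_comp (dg w - 1) (rhs w)"
      proof -
        have "in_comp (dg w - 1) (kmul r (\<mu> (take j w)) (\<mu> (drop j w)))" if "j \<in> {1..<?n}" for j
          using kmul_in_comp[of "dg (take j w)" "\<mu> (take j w)" "dg (drop j w)" "\<mu> (drop j w)" r]
            tk[OF that] dg_split[OF 1(3) that] by (simp add: good_def)
        then show ?thesis by (simp add: in_comp_def rhs_def)
      qed
      have rhs_hom: "homogeneous_poly (?n * (d - 2) + 2) (rhs w U)" for U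
      proof -
        have "homogeneous_poly (?n * (d - 2) + 2) (kmul r (\<mu> (take j w)) (\<mu> (drop j w)) U)"
          if j: "j \<in> {1..<?n}" for j
        proof -
          have "?n * (d - 2) + 2 = (length (take j w) * (d - 2) + 1) + (length (drop j w) * (d - 2) + 1)"
            using j by (simp add: min_def add_mult_distrib[symmetric])
          moreover have "homogeneous_poly ((length (take j w) * (d - 2) + 1) + (length (drop j w) * (d - 2) + 1))
              (kmul r (\<mu> (take j w)) (\<mu> (drop j w)) U)"
            using tk[OF j] unfolding good_def by (intro kmul_homogeneous) blast+
          ultimately show ?thesis by simp
        qed
        then show ?thesis unfolding rhs_def by (intro homogeneous_sum neg_one_power_mult_homogeneous)
      qed
      \<comment> \<open>The Leibniz rule turns the boundary into two sums over the ways to cut the word into three parts, which cancel.\<close>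
      have rhs_cyc: "kd fs (rhs w) W \<in> J" for W
      proof -
        define \<epsilon> where "\<epsilon> u = (- 1 :: ('v, 'k) mpoly) ^ (dg u + 1)" for u
        define T where "T j l = kmul r (\<mu> (take j w)) (kmul r (\<mu> (take (l - j) (drop j w))) (\<mu> (drop l w))) W" for j l
        define \<sigma> where "\<sigma> j l = (- 1 :: ('v, 'k) mpoly) ^ (dg (take (l - j) (drop j w)) + 1)" for j l
        have kd_term: "kd fs (\<lambda>U. \<epsilon> (take j w) * kmul r (\<mu> (take j w)) (\<mu> (drop j w)) U) W =
            \<epsilon> (take j w) * kmul r (kd fs (\<mu> (take j w))) (\<mu> (drop j w)) W
            - kmul r (\<mu> (take j w)) (kd fs (\<mu> (drop j w))) W" if j: "j \<in> {1..<?n}" for j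
        proof -
          have "khat (\<mu> (take j w)) = (\<lambda>U. (- 1) ^ dg (take j w) * \<mu> (take j w) U)"
            using tk(1)[OF j] by (intro khat_in_comp) (simp add: good_def)
          moreover have "\<epsilon> (take j w) * (- 1) ^ dg (take j w) = - 1"
            by (simp add: \<epsilon>_def mult.commute power_add[symmetric])
          ultimately show ?thesis
            by (simp add: kd_scale kd_kmul' kmul_scale_left distrib_left mult.assoc[symmetric])
        qed
        have mod1: "\<epsilon> (take l w) * kmul r (kd fs (\<mu> (take l w))) (\<mu> (drop l w)) W - (\<Sum>j\<in>{1..<l}. \<sigma> j l * T j l) \<in> J"
          if l: "l \<in> {1..<?n}" for l
        proof -
          have "kmul r (\<lambda>U. kd fs (\<mu> (take l w)) U - rhs (take l w) U) (\<mu> (drop l w)) W \<in> J"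
            using tk(1)[OF l] by (intro kmul_ideal_left ch(2)[OF l]) (simp add: good_def)
          then have "\<epsilon> (take l w) * kmul r (\<lambda>U. kd fs (\<mu> (take l w)) U - rhs (take l w) U) (\<mu> (drop l w)) W \<in> J"
            unfolding \<epsilon>_def by (intro ideal_closed(5)[OF J] polys_sign[OF polys_one, simplified])
          moreover have "\<epsilon> (take l w) * kmul r (rhs (take l w)) (\<mu> (drop l w)) W = (\<Sum>j\<in>{1..<l}. \<sigma> j l * T j l)"
          proof -
            have len_l: "length (take l w) = l" using l by simp
            have "kmul r (rhs (take l w)) (\<mu> (drop l w)) W = (\<Sum>j\<in>{1..<l}. \<epsilon> (take j (take l w)) *
                kmul r (kmul r (\<mu> (take j (take l w))) (\<mu> (drop j (take l w)))) (\<mu> (drop l w)) W)"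
              unfolding rhs_def \<epsilon>_def by (simp only: kmul_sum_left kmul_scale_left len_l)
            moreover have "\<epsilon> (take l w) * (\<epsilon> (take j (take l w)) *
                kmul r (kmul r (\<mu> (take j (take l w))) (\<mu> (drop j (take l w)))) (\<mu> (drop l w)) W) = \<sigma> j l * T j l"
              if j: "j \<in> {1..<l}" for j
            proof -
              have "dg (take l w) = Suc (dg (take j (take l w)) + dg (drop j (take l w)))"
                using 1(3) l j by (intro dg_split) (auto dest: in_set_takeD)
              moreover have tj: "take j (take l w) = take j w" "drop j (take l w) = take (l - j) (drop j w)"
                using j by (simp_all add: min_def drop_take)
              ultimately have "\<epsilon> (take l w) * \<epsilon> (take j w) = \<sigma> j l"
                unfolding \<epsilon>_def \<sigma>_def power_add[symmetric] tj by (intro neg_one_power_eqI) (simp, blast)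
              then show ?thesis unfolding tj T_def kmul_assoc by (simp add: mult.assoc[symmetric])
            qed
            ultimately show ?thesis by (simp add: sum_distrib_left)
          qed
          ultimately show ?thesis by (simp add: kmul_diff_left right_diff_distrib)
        qed
        have mod2: "kmul r (\<mu> (take j w)) (kd fs (\<mu> (drop j w))) W - (\<Sum>l\<in>{Suc j..<?n}. \<sigma> j l * T j l) \<in> J"
          if j: "j \<in> {1..<?n}" for j
        proof -
          have "kmul r (\<mu> (take j w)) (\<lambda>U. kd fs (\<mu> (drop j w)) U - rhs (drop j w) U) W \<in> J"
            using tk(2)[OF j] by (intro kmul_ideal_right ch(1)[OF j]) (simp add: good_def)
          moreover have "kmul r (\<mu> (take j w)) (rhs (drop j w)) W = (\<Sum>l\<in>{Suc j..<?n}. \<sigma> j l * T j l)"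
          proof -
            have "kmul r (\<mu> (take j w)) (rhs (drop j w)) W = (\<Sum>l\<in>{1..<?n - j}.
              (- 1) ^ (dg (take l (drop j w)) + 1) *
                kmul r (\<mu> (take j w)) (kmul r (\<mu> (take l (drop j w))) (\<mu> (drop (l + j) w))) W)"
              unfolding rhs_def by (simp only: kmul_sum_right kmul_scale_right drop_drop length_drop)
            also have "\<dots> = (\<Sum>l\<in>{Suc j..<?n}. \<sigma> j l * T j l)"
              by (rule sum.reindex_bij_witness[of _ "\<lambda>l. l - j" "\<lambda>l. l + j"]) (auto simp: \<sigma>_def T_def)
            finally show ?thesis .
          qed
          ultimately show ?thesis by (simp add: kmul_diff_right)
        qed
        have swap: "(\<Sum>l\<in>{1..<?n}. \<Sum>j\<in>{1..<l}. \<sigma> j l * T j l) = (\<Sum>j\<in>{1..<?n}. \<Sum>l\<in>{Suc j..<?n}. \<sigma> j l * T j l)"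
        proof -
          have "(\<Sum>l\<in>{1..<?n}. \<Sum>j\<in>{1..<l}. \<sigma> j l * T j l) = (\<Sum>(l, j)\<in>Sigma {1..<?n} (\<lambda>l. {1..<l}). \<sigma> j l * T j l)"
            by (subst sum.Sigma) auto
          also have "\<dots> = (\<Sum>(j, l)\<in>Sigma {1..<?n} (\<lambda>j. {Suc j..<?n}). \<sigma> j l * T j l)"
            by (rule sum.reindex_bij_witness[of _ "\<lambda>(j, l). (l, j)" "\<lambda>(l, j). (j, l)"]) auto
          finally show ?thesis by (subst (asm) sum.Sigma[symmetric]) auto
        qed
        have "kd fs (rhs w) W = (\<Sum>j\<in>{1..<?n}. \<epsilon> (take j w) * kmul r (kd fs (\<mu> (take j w))) (\<mu> (drop j w)) W
            - kmul r (\<mu> (take j w)) (kd fs (\<mu> (drop j w))) W)"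
          unfolding rhs_def \<epsilon>_def[symmetric] kd_sum by (rule sum.cong) (simp_all add: kd_term)
        also have "\<dots> = (\<Sum>j\<in>{1..<?n}. (\<epsilon> (take j w) * kmul r (kd fs (\<mu> (take j w))) (\<mu> (drop j w)) W - (\<Sum>i\<in>{1..<j}. \<sigma> i j * T i j))
            - (kmul r (\<mu> (take j w)) (kd fs (\<mu> (drop j w))) W - (\<Sum>l\<in>{Suc j..<?n}. \<sigma> j l * T j l)))"
          using swap by (simp add: sum_subtractf)
        also have "\<dots> \<in> J"
          by (intro ideal_sum_closed[OF J] ideal_closed(4)[OF J] mod1 mod2)
        finally show ?thesis .
      qed
      have "1 \<le> dg w - 1"
      proof -
        have "1 \<le> sum_list (map p w)"
        proof -
          have "hd w \<in> set w" using 1(2) by simp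
          then have "p (hd w) \<le> sum_list (map p w)" using member_le_sum_list[of "p (hd w)" "map p w"] by auto
          moreover have "1 \<le> p (hd w)" using assms \<open>hd w \<in> set w\<close> 1(3) by blast
          ultimately show ?thesis by linarith
        qed
        then show ?thesis using len by (simp add: dg_def)
      qed
      moreover have "?n * (d - 2) + 2 \<noteq> d - 1"
      proof -
        have "2 * (d - 2) \<le> ?n * (d - 2)" using len by (rule mult_le_mono1)
        then show ?thesis using d by linarith
      qed
      moreover have "dg w = Suc (dg w - 1)" using calculation(1) by simp
      ultimately have "\<exists>y. ok w y (rhs w)"
        using strand_homogeneous[of "dg w - 1" "?n * (d - 2) + 2" "rhs w"] rhs_ch rhs_comp rhs_hom rhs_cyc
        unfolding ok_def by auto
      then have "ok w (\<mu> w) (rhs w)" unfolding \<mu>2[OF len] b_def by (rule someI_ex)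
      then have "good w" unfolding ok_def good_def
        using ideal_closed(3)[OF J] by (metis minus_diff_eq)
      then show ?thesis .
    qed
  qed
  then have "massey_lift Hs p z \<mu>"
    unfolding massey_lift_def good_def rhs_def dg_def using \<mu>1 by simp
  then show ?thesis by blast
qed

theorem admits_massey:
  "admits_trivial_Massey_operation
     (range (\<lambda>c. koszul_scalar S r (J +>\<^bsub>mpoly_ring V\<^esub> const_poly c))) A"
proof -
  obtain hs where hs: "homogeneous_homology_basis (range (\<lambda>c. koszul_scalar S r (J +>\<^bsub>mpoly_ring V\<^esub> const_poly c))) A hs"
    "\<forall>h\<in>set hs. \<exists>p\<ge>1. \<exists>a\<in>lin_cyc p. h = hcl a"
    using exists_homology_basis by blast
  have "\<exists>pz. \<forall>h\<in>set hs. 1 \<le> fst (pz h) \<and> snd (pz h) \<in> lin_cyc (fst (pz h)) \<and> h = hcl (snd (pz h))"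
    by (rule bchoice) (use hs(2) in force)
  then obtain pz where pz0: "\<And>h. h \<in> set hs \<Longrightarrow> 1 \<le> fst (pz h) \<and> snd (pz h) \<in> lin_cyc (fst (pz h)) \<and> h = hcl (snd (pz h))"
    by blast
  define p z where "p = fst \<circ> pz" and "z = snd \<circ> pz"
  have pz: "\<And>h. h \<in> set hs \<Longrightarrow> 1 \<le> p h \<and> z h \<in> lin_cyc (p h)" "\<And>h. h \<in> set hs \<Longrightarrow> h = hcl (z h)"
    using pz0 by (auto simp: p_def z_def)
  obtain \<mu> where lift: "massey_lift (set hs) p z \<mu>"
    using exists_massey_lift[of "set hs" p z] pz(1) by blast
  have \<mu>1: "\<And>h. \<mu> [h] = z h" using lift by (simp add: massey_lift_def)
  have \<mu>: "\<mu> w \<in> chains" "in_comp (sum_list (map p w) + length w - 1) (\<mu> w)"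
     "kd fs (\<mu> w) W - (\<Sum>j\<in>{1..<length w}.
        (- 1) ^ (sum_list (map p (take j w)) + length (take j w) - 1 + 1) * kmul r (\<mu> (take j w)) (\<mu> (drop j w)) W) \<in> J"
    if "w \<noteq> []" "set w \<subseteq> set hs" for w W
    using lift that unfolding massey_lift_def by simp_all
  define dg where "dg w = sum_list (map p w) + length w - 1" for w
  define M where "M w = proj (\<mu> w)" for w
  have "trivial_Massey_operation A hs M"
    unfolding trivial_Massey_operation_def
  proof (intro exI[of _ dg] conjI ballI allI impI)
    fix h assume h: "h \<in> set hs"
    then have "z h \<in> cyc" using pz(1) by (simp add: lin_cyc_def)
    then show "M [h] \<in> cycles A" by (simp add: M_def \<mu>1 proj_cycle)
    show "homology_class A (M [h]) = h" using pz(2)[OF h] by (simp add: M_def \<mu>1 hcl_def)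
  next
    fix w :: "(nat set \<Rightarrow> ('v, 'k) mpoly set) set list"
    assume w: "w \<noteq> [] \<and> set w \<subseteq> set hs"
    show "M w \<in> component A (dg w)" unfolding M_def dg_def using w by (intro proj_component \<mu>) auto
    let ?f = "\<lambda>j U. (- 1) ^ (dg (take j w) + 1) * kmul r (\<mu> (take j w)) (\<mu> (drop j w)) U"
    have ch: "\<mu> (take j w) \<in> chains" "\<mu> (drop j w) \<in> chains" if "j \<in> {1..<length w}" for j
    proof -
      have "take j w \<noteq> []" "drop j w \<noteq> []" "set (take j w) \<subseteq> set hs" "set (drop j w) \<subseteq> set hs"
        using that w set_take_subset[of j w] set_drop_subset[of j w] by auto
      then show "\<mu> (take j w) \<in> chains" "\<mu> (drop j w) \<in> chains" by (auto intro: \<mu>(1))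
    qed
    have fch: "?f j \<in> chains" if "j \<in> {1..<length w}" for j
      using ch[OF that] by (intro chains_sign chains_kmul)
    have eq: "((\<ominus>\<^bsub>A\<^esub> \<one>\<^bsub>A\<^esub>) [^]\<^bsub>A\<^esub> (dg (take j w) + 1) \<otimes>\<^bsub>A\<^esub> M (take j w)) \<otimes>\<^bsub>A\<^esub> M (drop j w) = proj (?f j)"
      if j: "j \<in> {1..<length w}" for j
    proof -
      have "((\<ominus>\<^bsub>A\<^esub> \<one>\<^bsub>A\<^esub>) [^]\<^bsub>A\<^esub> (dg (take j w) + 1) \<otimes>\<^bsub>A\<^esub> M (take j w)) \<otimes>\<^bsub>A\<^esub> M (drop j w) =
        proj (\<lambda>U. (- 1) ^ (dg (take j w) + 1) * \<mu> (take j w) U) \<otimes>\<^bsub>A\<^esub> proj (\<mu> (drop j w))"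
        unfolding M_def proj_signed[OF ch(1)[OF j]] ..
      also have "\<dots> = proj (kmul r (\<lambda>U. (- 1) ^ (dg (take j w) + 1) * \<mu> (take j w) U) (\<mu> (drop j w)))"
        using ch[OF j] by (intro proj_mult[symmetric] chains_sign)
      also have "kmul r (\<lambda>U. (- 1) ^ (dg (take j w) + 1) * \<mu> (take j w) U) (\<mu> (drop j w)) = ?f j"
        by (rule ext) (rule kmul_scale_left)
      finally show ?thesis .
    qed
    have "(\<Oplus>\<^bsub>A\<^esub> j\<in>{1..<length w}. (((\<ominus>\<^bsub>A\<^esub> \<one>\<^bsub>A\<^esub>) [^]\<^bsub>A\<^esub> (dg (take j w) + 1)) \<otimes>\<^bsub>A\<^esub> M (take j w)) \<otimes>\<^bsub>A\<^esub> M (drop j w))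
        = (\<Oplus>\<^bsub>A\<^esub> j\<in>{1..<length w}. proj (?f j))"
    proof (rule A.finsum_cong')
      show "(\<lambda>j. proj (?f j)) \<in> {1..<length w} \<rightarrow> carrier A" by (intro Pi_I proj_closed fch)
    qed (use eq in blast)+
    also have "\<dots> = proj (\<lambda>U. \<Sum>j\<in>{1..<length w}. ?f j U)"
      by (rule proj_finsum) (rule fch, assumption, simp)
    also have "\<dots> = proj (kd fs (\<mu> w))"
    proof (rule sym, subst proj_eq_iff)
      show "(\<lambda>U. \<Sum>j\<in>{1..<length w}. ?f j U) \<in> chains" by (intro chains_sum fch)
      show "kd fs (\<mu> w) \<in> chains" using \<mu>(1) w by (auto intro: chains_kd)
      show "\<forall>U. kd fs (\<mu> w) U - (\<Sum>j\<in>{1..<length w}. ?f j U) \<in> J"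
        using \<mu>(3) w unfolding dg_def by blast
    qed
    also have "\<dots> = differential A (M w)"
      unfolding M_def using \<mu>(1) w by (subst proj_differential) auto
    finally show "differential A (M w) = (\<Oplus>\<^bsub>A\<^esub> j\<in>{1..<length w}.
      (((\<ominus>\<^bsub>A\<^esub> \<one>\<^bsub>A\<^esub>) [^]\<^bsub>A\<^esub> (dg (take j w) + 1)) \<otimes>\<^bsub>A\<^esub> M (take j w)) \<otimes>\<^bsub>A\<^esub> M (drop j w))" by simp
  qed
  with hs(1) show ?thesis unfolding admits_trivial_Massey_operation_def by (intro exI conjI)
qed

end


section \<open>Monomial ideals with linear quotients\<close>

definition vmono :: "'v \<Rightarrow> 'v \<Rightarrow>\<^sub>0 nat" where
  "vmono v = Poly_Mapping.single v 1"

lemma coef_vmono: "coef (vmono v) x = (if x = v then 1 else 0)"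
  by (simp add: vmono_def Poly_Mapping.lookup_single when_def)

lemma supp_vmono [simp]: "supp (vmono v) = {v}"
  by (simp add: vmono_def)

lemma weight_vmono [simp]: "weight w (vmono v) = w v"
  by (simp add: vmono_def)

lemma mdeg_vmono [simp]: "mdeg (vmono v) = 1"
  by (simp add: vmono_def)

lemma var_eq: "var v = mterm (vmono v) 1"
  by (simp add: var_def vmono_def)

lemma mdvd_vmono: "mdvd (vmono v) e \<longleftrightarrow> v \<in> supp e"
proof
  assume "mdvd (vmono v) e"
  then have "coef (vmono v) v \<le> coef e v" by (simp only: mdvd_def)
  then show "v \<in> supp e" by (simp add: coef_vmono in_keys_iff)
qed (auto simp: mdvd_def coef_vmono in_keys_iff)

lemma mdvd_diff_add2: "mdvd a e \<Longrightarrow> e - a + a = e"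
  using mdvd_diff_add[of a e] by (simp add: add.commute)

lemma mdvd_add_cases: "mdvd (a + b) e \<longleftrightarrow> mdvd b e \<and> mdvd a (e - b)"
proof
  assume "mdvd (a + b) e"
  then have *: "coef a v + coef b v \<le> coef e v" for v by (simp add: mdvd_def lookup_add)
  show "mdvd b e \<and> mdvd a (e - b)"
    unfolding mdvd_def lookup_minus using * add_leE le_diff_conv2 add.commute by (metis add_le_imp_le_diff)
next
  assume "mdvd b e \<and> mdvd a (e - b)"
  then have "coef b v \<le> coef e v" "coef a v \<le> coef e v - coef b v" for v
    by (auto simp: mdvd_def lookup_minus)
  then show "mdvd (a + b) e" by (auto simp: mdvd_def lookup_add intro: le_diff_conv2[THEN iffD1])
qed

lemma kd_single_term:
  assumes "W \<subseteq> {..<length fs}" "y < length fs" "y \<notin> W" "\<And>j. j \<notin> W \<Longrightarrow> j \<noteq> y \<Longrightarrow> a (insert j W) = 0"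
  shows "kd fs a W = (- 1) ^ card {v\<in>W. v < y} * (fs ! y * a (insert y W))"
proof -
  have "kd fs a W = (\<Sum>i\<in>{..<length fs} - W. (- 1) ^ card {v\<in>W. v < i} * (fs ! i * a (insert i W)))"
    using assms(1) by (simp add: kd_def)
  also have "\<dots> = (\<Sum>i\<in>{y}. (- 1) ^ card {v\<in>W. v < i} * (fs ! i * a (insert i W)))"
    by (rule sum.mono_neutral_right) (use assms in auto)
  finally show ?thesis by simp
qed

text \<open>The monomials \<open>G\<close>, ordered by \<open>rk\<close>, have linear quotients: the colon ideal of the generators of
  lower rank with respect to \<open>\<tau>\<close> is generated by variables. Ties of the rank are allowed, except between
  generators of lowest rank that divide the same monomial.\<close>

locale linear_quotients =
  fixes vs :: "'v list" and G :: "('v \<Rightarrow>\<^sub>0 nat) set" and rk :: "('v \<Rightarrow>\<^sub>0 nat) \<Rightarrow> nat" and d :: nat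
  assumes distinct_vs: "distinct vs"
    and G_vars: "\<tau> \<in> G \<Longrightarrow> supp \<tau> \<subseteq> set vs"
    and G_deg: "\<tau> \<in> G \<Longrightarrow> mdeg \<tau> = d"
    and G_unique: "\<tau> \<in> G \<Longrightarrow> \<tau>' \<in> G \<Longrightarrow> mdvd \<tau> u \<Longrightarrow> mdvd \<tau>' u \<Longrightarrow>
      (\<And>\<tau>''. \<tau>'' \<in> G \<Longrightarrow> mdvd \<tau>'' u \<Longrightarrow> rk \<tau> \<le> rk \<tau>'') \<Longrightarrow> rk \<tau>' = rk \<tau> \<Longrightarrow> \<tau>' = \<tau>"
    and G_linear: "\<tau> \<in> G \<Longrightarrow> \<tau>' \<in> G \<Longrightarrow> mdvd \<tau>' (\<tau> + \<rho>) \<Longrightarrow> rk \<tau>' < rk \<tau> \<Longrightarrow> supp \<rho> \<subseteq> set vs \<Longrightarrow>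
      \<exists>y\<in>supp \<rho>. \<exists>\<tau>''\<in>G. mdvd \<tau>'' (\<tau> + vmono y) \<and> rk \<tau>'' < rk \<tau>"
begin

abbreviation "r \<equiv> length vs"

definition "in_ideal u \<longleftrightarrow> (\<exists>\<tau>\<in>G. mdvd \<tau> u)"

text \<open>The generator of lowest rank among those that divide \<open>u\<close>.\<close>

definition "first u = (SOME \<tau>. \<tau> \<in> G \<and> mdvd \<tau> u \<and> (\<forall>\<tau>'\<in>G. mdvd \<tau>' u \<longrightarrow> rk \<tau> \<le> rk \<tau>'))"

lemma first:
  assumes "in_ideal u"
  shows "first u \<in> G" "mdvd (first u) u" "\<And>\<tau>. \<tau> \<in> G \<Longrightarrow> mdvd \<tau> u \<Longrightarrow> rk (first u) \<le> rk \<tau>"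
proof -
  obtain \<tau> where \<tau>: "\<tau> \<in> G \<and> mdvd \<tau> u" using assms by (auto simp: in_ideal_def)
  have "\<exists>\<tau>. \<tau> \<in> G \<and> mdvd \<tau> u \<and> (\<forall>\<tau>'\<in>G. mdvd \<tau>' u \<longrightarrow> rk \<tau> \<le> rk \<tau>')"
    using ex_has_least_nat[of "\<lambda>\<tau>. \<tau> \<in> G \<and> mdvd \<tau> u" \<tau> rk] \<tau> by blast
  from someI_ex[OF this] show "first u \<in> G" "mdvd (first u) u"
    "\<And>\<tau>. \<tau> \<in> G \<Longrightarrow> mdvd \<tau> u \<Longrightarrow> rk (first u) \<le> rk \<tau>" by (auto simp: first_def)
qed

lemma first_eqI:
  assumes "in_ideal u" "\<tau> \<in> G" "mdvd \<tau> u" "rk \<tau> \<le> rk (first u)"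
  shows "first u = \<tau>"
proof -
  have "rk \<tau> = rk (first u)" using first(3)[OF assms(1-3)] assms(4) by simp
  then show ?thesis using G_unique[OF first(1)[OF assms(1)] assms(2) first(2)[OF assms(1)] assms(3) first(3)[OF assms(1)]]
    by simp
qed

lemma in_ideal_mono: "in_ideal u \<Longrightarrow> mdvd u v \<Longrightarrow> in_ideal v"
  unfolding in_ideal_def using mdvd_trans by blast

lemma first_mono: "in_ideal u \<Longrightarrow> mdvd u v \<Longrightarrow> rk (first v) \<le> rk (first u)"
  using first[of u] first(3)[of v "first u"] in_ideal_mono[of u v] mdvd_trans[of "first u" u v] by blast

lemma first_divisor:
  assumes "in_ideal v" "mdvd (first v) u" "mdvd u v"
  shows "in_ideal u" "first u = first v"
proof -
  show iu: "in_ideal u" using first(1)[OF assms(1)] assms(2) by (auto simp: in_ideal_def)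
  have "rk (first v) \<le> rk (first u)" using first_mono[OF iu assms(3)] .
  then show "first u = first v" by (rule first_eqI[OF iu first(1)[OF assms(1)] assms(2)])
qed

text \<open>Linear quotients: the variables that keep a generator first can be multiplied together.\<close>

lemma first_mult_var:
  assumes v: "in_ideal v" "first v = \<tau>" "supp v \<subseteq> set vs"
    and y: "y \<in> set vs" "first (\<tau> + vmono y) = \<tau>"
  shows "first (v + vmono y) = \<tau>"
proof -
  have \<tau>: "\<tau> \<in> G" "mdvd \<tau> v" using first[OF v(1)] v(2) by auto
  have iu: "in_ideal (v + vmono y)" by (rule in_ideal_mono[OF v(1)]) simp
  have div: "mdvd \<tau> (v + vmono y)" using mdvd_trans[OF \<tau>(2)] by simp
  have "\<not> rk (first (v + vmono y)) < rk \<tau>"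
  proof
    assume lt: "rk (first (v + vmono y)) < rk \<tau>"
    define \<rho> where "\<rho> = (v - \<tau>) + vmono y"
    have vy: "v + vmono y = \<tau> + \<rho>" using mdvd_diff_add[OF \<tau>(2)] by (simp add: \<rho>_def add.assoc[symmetric])
    have "supp \<rho> \<subseteq> set vs"
      using v(3) y(1) by (auto simp: \<rho>_def supp_mono_add in_keys_iff lookup_minus)
    moreover have "mdvd (first (v + vmono y)) (\<tau> + \<rho>)" using first(2)[OF iu] by (simp only: vy)
    ultimately obtain x \<tau>'' where x: "x \<in> supp \<rho>" "\<tau>'' \<in> G" "mdvd \<tau>'' (\<tau> + vmono x)" "rk \<tau>'' < rk \<tau>"
      using G_linear[OF \<tau>(1) first(1)[OF iu] _ lt] by blast
    have i\<tau>: "in_ideal (\<tau> + vmono y)" unfolding in_ideal_def by (rule bexI[OF _ \<tau>(1)]) simp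
    show False
    proof (cases "x = y")
      case True
      then show False using first(3)[OF i\<tau> x(2)] x y(2) by auto
    next
      case False
      then have "x \<in> supp (v - \<tau>)" using x(1) by (auto simp: \<rho>_def supp_mono_add)
      then have "mdvd (vmono x) (v - \<tau>)" by (simp add: mdvd_vmono)
      then have "mdvd (\<tau> + vmono x) v" using \<tau>(2) mdvd_add_cases[of "vmono x" \<tau> v] by (simp add: add.commute)
      then have "mdvd \<tau>'' v" by (rule mdvd_trans[OF x(3)])
      then show False using first(3)[OF v(1) x(2)] x(4) v(2) by simp
    qed
  qed
  then show ?thesis by (intro first_eqI[OF iu \<tau>(1) div]) simp
qed

text \<open>The multidegree of the basis element at \<open>U\<close>.\<close>

definition "dU U = (\<Sum>i\<in>U. vmono (vs ! i))"

lemma dU_insert: "finite U \<Longrightarrow> i \<notin> U \<Longrightarrow> dU (insert i U) = vmono (vs ! i) + dU U"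
  by (simp add: dU_def)

lemma mdeg_dU: "mdeg (dU U) = card U"
  by (simp add: dU_def mdeg_sum)

lemma coef_dU:
  assumes "U \<subseteq> {..<r}" "i < r"
  shows "coef (dU U) (vs ! i) = (if i \<in> U then 1 else 0)"
proof -
  have fin: "finite U" using assms(1) finite_subset by blast
  have "coef (dU U) (vs ! i) = (\<Sum>j\<in>U. if j = i then 1 else 0)"
    unfolding dU_def coef_sum coef_vmono
    by (rule sum.cong) (use assms nth_eq_iff_index_eq[OF distinct_vs] in auto)
  then show ?thesis using fin by simp
qed

abbreviation "ones \<equiv> replicate r 1"

text \<open>In multidegree \<open>\<mu>\<close> the coefficient at \<open>U\<close> of an element of the Koszul complex is a scalar multiple of
  the monomial \<open>\<mu> - dU U\<close>; the sets at which this is a monomial of the ideal are the admissible ones. On the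
  scalars, the Koszul differential is the one with all entries equal to \<open>1\<close>.\<close>

definition adm :: "('v \<Rightarrow>\<^sub>0 nat) \<Rightarrow> nat set \<Rightarrow> bool" where
  "adm \<mu> U \<longleftrightarrow> U \<subseteq> {..<r} \<and> mdvd (dU U) \<mu> \<and> in_ideal (\<mu> - dU U)"

lemma adm_insert_diff:
  assumes "adm \<mu> (insert i U)" "i \<notin> U"
  shows "mdvd (dU U) \<mu>" "\<mu> - dU U = (\<mu> - dU (insert i U)) + vmono (vs ! i)" "adm \<mu> U"
proof -
  have fin: "finite U" using assms finite_subset by (auto simp: adm_def)
  have dv: "mdvd (vmono (vs ! i) + dU U) \<mu>" using assms dU_insert[OF fin assms(2)] by (simp add: adm_def)
  then show dvU: "mdvd (dU U) \<mu>" using mdvd_add_cases by blast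
  have "\<mu> = (\<mu> - dU (insert i U)) + (vmono (vs ! i) + dU U)"
    using mdvd_diff_add2[OF dv] dU_insert[OF fin assms(2)] by simp
  then show eq: "\<mu> - dU U = (\<mu> - dU (insert i U)) + vmono (vs ! i)"
    using add_diff_cancel_right'[of "(\<mu> - dU (insert i U)) + vmono (vs ! i)" "dU U"] by (simp only: add.assoc)
  show "adm \<mu> U" unfolding adm_def using assms dvU eq in_ideal_mono[of "\<mu> - dU (insert i U)"]
    by (auto simp: adm_def)
qed

text \<open>Exactness of one multigraded strand of the Koszul complex of the monomial ideal. If \<open>\<tau>\<close> is
  the first generator at an index set \<open>U\<close>, then some variable \<open>y\<close> in the quotient of \<open>\<mu>\<close> by \<open>\<tau>\<close>
  keeps \<open>\<tau>\<close> first; adding or removing the index of \<open>y\<close> cancels the part of highest rank of a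
  cycle.\<close>

lemma multigraded_strand_exact:
  fixes c :: "nat set \<Rightarrow> 'k::field"
  assumes \<mu>: "supp \<mu> \<subseteq> set vs" "mdeg \<mu> \<noteq> d + i"
    and "\<And>U. c U \<noteq> 0 \<Longrightarrow> adm \<mu> U \<and> card U = i \<and> rk (first (\<mu> - dU U)) < N"
    and "\<And>W. kd ones c W = 0"
  shows "\<exists>b. (\<forall>U. b U \<noteq> 0 \<longrightarrow> adm \<mu> U \<and> card U = Suc i) \<and> (\<forall>W. kd ones b W = c W)"
  using assms(3,4)
proof (induction N arbitrary: c)
  case 0
  then have "c = (\<lambda>U. 0)" by (intro ext) blast
  then show ?case by (intro exI[of _ "\<lambda>U. 0"]) simp
next
  case (Suc N)
  define gen where "gen U = first (\<mu> - dU U)" for U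
  define good where "good \<tau> y \<longleftrightarrow> y < r \<and> mdvd (\<tau> + vmono (vs ! y)) \<mu> \<and> first (\<tau> + vmono (vs ! y)) = \<tau>" for \<tau> y
  define pick where "pick \<tau> = (SOME y. good \<tau> y)" for \<tau>
  have pick: "good (gen U) (pick (gen U))" if U: "adm \<mu> U" "card U = i" for U
  proof -
    let ?v = "\<mu> - dU U"
    have iv: "in_ideal ?v" and dv: "mdvd (dU U) \<mu>" using U by (auto simp: adm_def)
    have \<tau>: "gen U \<in> G" "mdvd (gen U) ?v" using first[OF iv] by (auto simp: gen_def)
    have "mdeg \<mu> = mdeg ?v + i" using arg_cong[OF mdvd_diff_add2[OF dv], of mdeg] by (simp add: mdeg_dU U)
    then have "mdeg ?v \<noteq> d" using \<mu>(2) by auto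
    then have "?v \<noteq> gen U" using G_deg[OF \<tau>(1)] by auto
    then have "?v - gen U \<noteq> 0" using mdvd_diff_add[OF \<tau>(2)] by auto
    then have "supp (?v - gen U) \<noteq> {}" by simp
    then obtain x where x: "x \<in> supp (?v - gen U)" by blast
    then have dx: "mdvd (vmono x + gen U) ?v" unfolding mdvd_add_cases mdvd_vmono using \<tau>(2) by blast
    have "mdvd ?v \<mu>" using mdvd_add(1)[of ?v "dU U"] unfolding mdvd_diff_add2[OF dv] .
    then have dx\<mu>: "mdvd (gen U + vmono x) \<mu>" using mdvd_trans[OF dx] by (simp add: add.commute)
    have "x \<in> supp \<mu>" using mdvd_trans[OF mdvd_add(2) dx\<mu>] by (simp add: mdvd_vmono)
    then have "x \<in> set vs" using \<mu>(1) by blast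
    then obtain y where y: "y < r" "x = vs ! y" by (auto simp: in_set_conv_nth)
    have "first (gen U + vmono x) = gen U"
      using first_divisor(2)[OF iv, of "gen U + vmono x"] dx by (simp add: gen_def add.commute)
    then have "good (gen U) y" using y dx\<mu> by (simp add: good_def)
    then show ?thesis unfolding pick_def by (rule someI)
  qed
  define b0 where "b0 U = (if adm \<mu> U \<and> rk (gen U) = N \<and> pick (gen U) \<in> U \<and>
      gen (U - {pick (gen U)}) = gen U \<and> card U = Suc i
    then (- 1) ^ card {v \<in> U - {pick (gen U)}. v < pick (gen U)} * c (U - {pick (gen U)}) else 0)" for U
  define c' where "c' U = c U - kd ones b0 U" for U
  have gen_eqI: "gen U = gen (insert j U)"
    if "adm \<mu> (insert j U)" "j \<notin> U" "rk (gen (insert j U)) \<le> rk (gen U)" for j U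
  proof -
    note ai = adm_insert_diff[OF that(1,2)]
    have iv: "in_ideal (\<mu> - dU (insert j U))" "in_ideal (\<mu> - dU U)" using that(1) ai(3) by (auto simp: adm_def)
    have "mdvd (gen (insert j U)) (\<mu> - dU U)"
      unfolding gen_def ai(2) by (rule mdvd_trans[OF first(2)[OF iv(1)]]) simp
    then show ?thesis using first_eqI[OF iv(2) _ _ that(3)[unfolded gen_def]] first(1)[OF iv(1)]
      by (simp add: gen_def)
  qed
  have gen_mono: "rk (gen U) \<le> rk (gen (insert j U))" if "adm \<mu> (insert j U)" "j \<notin> U" for j U
    using first_mono[of "\<mu> - dU (insert j U)" "\<mu> - dU U"] that adm_insert_diff(2)[OF that]
    by (simp add: gen_def adm_def)
  have cyc': "kd ones c' W = 0" for W
    unfolding c'_def kd_diff using Suc.prems(2) kd_kd[of ones b0 W] by simp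
  have c'_supp: "adm \<mu> U \<and> card U = i \<and> rk (gen U) \<le> N" if "c' U \<noteq> 0" for U
  proof (cases "c U = 0")
    case False
    then show ?thesis using Suc.prems(1)[OF False] by (auto simp: gen_def)
  next
    case True
    then have "kd ones b0 U \<noteq> 0" using that by (simp add: c'_def)
    then obtain j where j: "j < r" "j \<notin> U" "b0 (insert j U) \<noteq> 0" "U \<subseteq> {..<r}"
      unfolding kd_def by (auto split: if_splits elim!: sum.not_neutral_contains_not_neutral)
    then have b: "adm \<mu> (insert j U)" "rk (gen (insert j U)) = N" "card (insert j U) = Suc i"
      by (auto simp: b0_def split: if_splits)
    have "finite U" using j(4) finite_subset by blast
    then have "card U = i" using b(3) j(2) by simp
    then show ?thesis using adm_insert_diff(3)[OF b(1) j(2)] gen_mono[OF b(1) j(2)] b(2) by simp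
  qed
  have top: "c' U = 0" if U: "adm \<mu> U" "card U = i" "rk (gen U) = N" "pick (gen U) \<notin> U" for U
  proof -
    let ?y = "pick (gen U)"
    have y: "?y < r" "mdvd (gen U + vmono (vs ! ?y)) \<mu>" using pick[OF U(1,2)] by (auto simp: good_def)
    have Ur: "U \<subseteq> {..<r}" and fin: "finite U" using U(1) finite_subset by (auto simp: adm_def)
    have iv: "in_ideal (\<mu> - dU U)" and dv: "mdvd (dU U) \<mu>" using U(1) by (auto simp: adm_def)
    have dgen: "mdvd (gen U) (\<mu> - dU U)" using first(2)[OF iv] by (simp add: gen_def)
    have dvy: "mdvd (vmono (vs ! ?y) + gen U) (\<mu> - dU U)"
      unfolding mdvd_def lookup_add
    proof
      fix v
      show "coef (vmono (vs ! ?y)) v + coef (gen U) v \<le> coef (\<mu> - dU U) v"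
      proof (cases "v = vs ! ?y")
        case True
        then have "coef (dU U) v = 0" using coef_dU[OF Ur y(1)] U(4) by simp
        moreover have "coef (gen U) v + coef (vmono (vs ! ?y)) v \<le> coef \<mu> v"
          using y(2) by (simp add: mdvd_def lookup_add)
        ultimately show ?thesis by (simp add: lookup_minus)
      next
        case False
        then show ?thesis using dgen by (simp add: coef_vmono mdvd_def)
      qed
    qed
    then have vy: "mdvd (vmono (vs ! ?y)) (\<mu> - dU U)" "mdvd (gen U) ((\<mu> - dU U) - vmono (vs ! ?y))"
      using mdvd_add_cases[of "gen U" "vmono (vs ! ?y)"] by (simp_all add: add.commute)
    have dU': "dU (insert ?y U) = vmono (vs ! ?y) + dU U" by (rule dU_insert[OF fin U(4)])
    have eq: "(\<mu> - dU U) - vmono (vs ! ?y) = \<mu> - dU (insert ?y U)"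
      by (simp add: dU' diff_diff_eq add.commute)
    have dle: "mdvd ((\<mu> - dU U) - vmono (vs ! ?y)) (\<mu> - dU U)"
      using mdvd_add(1)[of "(\<mu> - dU U) - vmono (vs ! ?y)" "vmono (vs ! ?y)"] unfolding mdvd_diff_add2[OF vy(1)] .
    have fd: "in_ideal (\<mu> - dU (insert ?y U))" "gen (insert ?y U) = gen U"
      using first_divisor[OF iv _ dle] vy(2) eq by (auto simp: gen_def)
    have "adm \<mu> (insert ?y U)"
      using Ur y(1) fd(1) vy(1) dv mdvd_add_cases[of "vmono (vs ! ?y)" "dU U" \<mu>] by (auto simp: adm_def dU')
    then have b0y: "b0 (insert ?y U) = (- 1) ^ card {v \<in> U. v < ?y} * c U"
      using U fd(2) fin by (simp add: b0_def)
    have other: "b0 (insert j U) = 0" if j: "j \<notin> U" "j \<noteq> ?y" for j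
    proof (rule ccontr)
      assume "b0 (insert j U) \<noteq> 0"
      then have b: "adm \<mu> (insert j U)" "rk (gen (insert j U)) = N" "pick (gen (insert j U)) \<in> insert j U"
        by (auto simp: b0_def split: if_splits)
      have "gen U = gen (insert j U)" using gen_eqI[OF b(1) j(1)] b(2) U(3) by simp
      then show False using b(3) U(4) j by auto
    qed
    have "kd ones b0 U = (- 1) ^ card {v\<in>U. v < ?y} * (ones ! ?y * b0 (insert ?y U))"
      by (rule kd_single_term) (use Ur y(1) U(4) other in auto)
    also have "\<dots> = c U"
      using y(1) by (simp add: b0y mult.assoc[symmetric] power_add[symmetric])
    finally show ?thesis by (simp add: c'_def)
  qed
  have low: "rk (gen U) < N" if U: "c' U \<noteq> 0" for U
  proof (rule ccontr)
    assume "\<not> rk (gen U) < N"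
    with c'_supp[OF U] have aU: "adm \<mu> U" "card U = i" "rk (gen U) = N" by auto
    let ?y = "pick (gen U)"
    have yU: "?y \<in> U" using top[OF aU] U by blast
    have g: "?y < r" "first (gen U + vmono (vs ! ?y)) = gen U" using pick[OF aU(1,2)] by (auto simp: good_def)
    define W where "W = U - {?y}"
    have UW: "U = insert ?y W" "?y \<notin> W" using yU by (auto simp: W_def)
    have Wr: "W \<subseteq> {..<r}" using aU(1) by (auto simp: adm_def W_def)
    have iv: "in_ideal (\<mu> - dU U)" using aU(1) by (simp add: adm_def)
    have "supp (\<mu> - dU U) \<subseteq> set vs" using \<mu>(1) by (auto simp: in_keys_iff lookup_minus)
    then have "first ((\<mu> - dU U) + vmono (vs ! ?y)) = gen U"
      by (intro first_mult_var[OF iv]) (use g in \<open>auto simp: gen_def\<close>)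
    then have genW: "gen W = gen U"
      using adm_insert_diff(2)[of \<mu> ?y W] aU(1) UW by (simp add: gen_def)
    have other: "c' (insert j W) = 0" if j: "j \<notin> W" "j \<noteq> ?y" for j
    proof (rule ccontr)
      assume nz: "c' (insert j W) \<noteq> 0"
      note cs = c'_supp[OF nz]
      have "rk (gen (insert j W)) \<le> rk (gen W)" using cs genW aU(3) by simp
      then have "gen W = gen (insert j W)" using gen_eqI[OF _ j(1)] cs by blast
      then have "gen (insert j W) = gen U" using genW by simp
      moreover have "pick (gen (insert j W)) \<in> insert j W"
        using top[of "insert j W"] cs nz calculation aU(3) by auto
      ultimately show False using j UW(2) by auto
    qed
    have "0 = kd ones c' W" by (simp add: cyc')
    also have "\<dots> = (- 1) ^ card {v\<in>W. v < ?y} * (ones ! ?y * c' (insert ?y W))"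
      by (rule kd_single_term) (use Wr g(1) UW(2) other in auto)
    also have "\<dots> = (- 1) ^ card {v\<in>W. v < ?y} * c' U" using g(1) UW(1) by simp
    finally show False using U by simp
  qed
  have "\<exists>b. (\<forall>U. b U \<noteq> 0 \<longrightarrow> adm \<mu> U \<and> card U = Suc i) \<and> (\<forall>W. kd ones b W = c' W)"
    by (rule Suc.IH) (use c'_supp low cyc' in \<open>auto simp: gen_def\<close>)
  then obtain b where b: "\<And>U. b U \<noteq> 0 \<Longrightarrow> adm \<mu> U \<and> card U = Suc i" "\<And>W. kd ones b W = c' W" by blast
  show ?case
  proof (intro exI[of _ "\<lambda>U. b U + b0 U"] conjI allI impI)
    fix U assume "b U + b0 U \<noteq> 0"
    then have "b U \<noteq> 0 \<or> b0 U \<noteq> 0" by auto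
    then show "adm \<mu> U" "card U = Suc i" using b(1)[of U] by (auto simp: b0_def split: if_splits)
  next
    fix W show "kd ones (\<lambda>U. b U + b0 U) W = c W" by (simp add: kd_add b(2) c'_def)
  qed
qed

end

section \<open>Ideals whose initial ideal has linear quotients\<close>

text \<open>Only the terms of highest weight matter: all of them lie in the monomial ideal, and each
  generator of the monomial ideal is the unique term of highest weight of an element of \<open>J\<close>.\<close>

locale groebner_linear_quotients = linear_quotients vs G rk d
  for vs :: "'v list" and G rk d +
  fixes J :: "('v, 'k::field) mpoly set" and w :: "'v \<Rightarrow> nat"
  assumes ideal_J: "ideal J (mpoly_ring (set vs))"
    and initial: "\<And>f e u. f \<in> J \<Longrightarrow> homogeneous_poly e f \<Longrightarrow> u \<in> supp f \<Longrightarrow>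
      (\<And>u'. u' \<in> supp f \<Longrightarrow> weight w u' \<le> weight w u) \<Longrightarrow> \<exists>\<tau>\<in>G. mdvd \<tau> u"
    and generator: "\<And>\<tau>. \<tau> \<in> G \<Longrightarrow> \<exists>g\<in>J. homogeneous_poly d g \<and> coef g \<tau> = 1 \<and>
      (\<forall>u\<in>supp g. u = \<tau> \<or> weight w u < weight w \<tau>)"
begin

definition "fs = (map var vs :: ('v, 'k) mpoly list)"

lemma length_fs [simp]: "length fs = r"
  by (simp add: fs_def)

lemma generator_multiple:
  assumes "in_ideal u" "supp u \<subseteq> set vs"
  shows "\<exists>g\<in>J. homogeneous_poly (mdeg u) g \<and> coef g u = 1 \<and> (\<forall>v\<in>supp g. v = u \<or> weight w v < weight w u)"
proof -
  obtain \<tau> where \<tau>: "\<tau> \<in> G" "mdvd \<tau> u" using assms(1) by (auto simp: in_ideal_def)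
  obtain g where g: "g \<in> J" "homogeneous_poly d g" "coef g \<tau> = 1" "\<And>v. v \<in> supp g \<Longrightarrow> v = \<tau> \<or> weight w v < weight w \<tau>"
    using generator[OF \<tau>(1)] by blast
  define \<nu> where "\<nu> = u - \<tau>"
  have u: "u = \<nu> + \<tau>" using mdvd_diff_add2[OF \<tau>(2)] by (simp add: \<nu>_def)
  have "mterm \<nu> 1 * g \<in> J"
    using assms(2) u by (intro ideal_closed(5)[OF ideal_J g(1)] polys_term) (simp add: supp_mono_add)
  moreover have "homogeneous_poly (mdeg u) (mterm \<nu> 1 * g)"
    using homogeneous_mult[OF homogeneous_term g(2), of \<nu> 1] G_deg[OF \<tau>(1)] by (simp add: u)
  moreover have "coef (mterm \<nu> 1 * g) u = 1" using g(3) by (simp add: coef_term_mult u)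
  moreover have "v = u \<or> weight w v < weight w u" if v: "v \<in> supp (mterm \<nu> 1 * g)" for v
  proof -
    obtain a b where "v = a + b" "a \<in> supp (mterm \<nu> (1 :: 'k))" "b \<in> supp g"
      using supp_poly_mult_cases[OF v] by blast
    then have "v = \<nu> + b" "b \<in> supp g" by (simp_all split: if_splits)
    then show ?thesis using g(4)[of b] u by auto
  qed
  ultimately show ?thesis by blast
qed

lemma coef_var_mult: "coef (var v * p) e = (if v \<in> supp e then coef p (e - vmono v) else 0)"
  by (simp add: var_eq coef_term_mult mdvd_vmono)

lemma coef_kd:
  assumes "W \<subseteq> {..<r}" "\<mu> = e + dU W"
  shows "coef (kd fs z W) e = kd ones (\<lambda>U. if mdvd (dU U) \<mu> then coef (z U) (\<mu> - dU U) else 0) W"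
proof -
  have fin: "finite W" using assms(1) finite_subset by blast
  have one: "coef ((- 1) ^ k * (fs ! i * z (insert i W))) e = (- 1) ^ k *
      (ones ! i * (if mdvd (dU (insert i W)) \<mu> then coef (z (insert i W)) (\<mu> - dU (insert i W)) else 0))"
    if i: "i \<in> {..<r} - W" for i k
  proof -
    have dU': "dU (insert i W) = vmono (vs ! i) + dU W" using i by (intro dU_insert fin) auto
    have "mdvd (dU (insert i W)) \<mu> \<longleftrightarrow> vs ! i \<in> supp e"
      unfolding dU' mdvd_add_cases mdvd_vmono assms(2) by simp
    moreover have "\<mu> - dU (insert i W) = e - vmono (vs ! i)"
      unfolding dU' assms(2) by (simp add: add.commute diff_diff_eq[symmetric])
    ultimately have "coef (fs ! i * z (insert i W)) e =
      (if mdvd (dU (insert i W)) \<mu> then coef (z (insert i W)) (\<mu> - dU (insert i W)) else 0)"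
      using i by (simp add: fs_def coef_var_mult)
    moreover have "ones ! i = (1 :: 'k)" using i by simp
    ultimately show ?thesis by (cases "even k") simp_all
  qed
  have "coef (kd fs z W) e = (\<Sum>i\<in>{..<r} - W. coef ((- 1) ^ card {v\<in>W. v < i} * (fs ! i * z (insert i W))) e)"
    unfolding kd_def using assms(1) by (simp only: length_fs if_True coef_sum)
  also have "\<dots> = (\<Sum>i\<in>{..<r} - W. (- 1) ^ card {v\<in>W. v < i} *
      (ones ! i * (if mdvd (dU (insert i W)) \<mu> then coef (z (insert i W)) (\<mu> - dU (insert i W)) else 0)))"
    by (rule sum.cong[OF refl]) (rule one)
  also have "\<dots> = kd ones (\<lambda>U. if mdvd (dU U) \<mu> then coef (z U) (\<mu> - dU U) else 0) W"
    unfolding kd_def using assms(1) by (simp only: length_replicate if_True)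
  finally show ?thesis .
qed

text \<open>Induction on a bound for the weights. The terms of highest weight of a cycle form cycles of the Koszul
  complex of the monomial ideal, one in each multidegree, and these are boundaries there. Replacing the
  monomials of a bounding chain by elements of \<open>J\<close> with these leading monomials lifts it to \<open>J\<close>, and
  subtracting its boundary lowers the weight.\<close>

lemma weight_strand_exact:
  fixes z :: "nat set \<Rightarrow> ('v, 'k) mpoly"
  assumes "e \<noteq> d"
    and "\<And>U. z U \<in> J" "\<And>U. \<not> U \<subseteq> {..<r} \<Longrightarrow> z U = 0" "in_comp i z" "\<And>U. homogeneous_poly e (z U)"
    and "\<And>W. kd fs z W = 0"
    and "\<And>U u. u \<in> supp (z U) \<Longrightarrow> weight w (u + dU U) < N"
  shows "\<exists>y. (\<forall>U. y U \<in> J) \<and> (\<forall>U. \<not> U \<subseteq> {..<r} \<longrightarrow> y U = 0) \<and> (\<forall>W. kd fs y W = z W)"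
  using assms(2-)
proof (induction N arbitrary: z)
  case 0
  then have "supp (z U) = {}" for U by (metis equals0I less_zeroE)
  then have "z U = 0" for U by simp
  then show ?case using ideal_closed(1)[OF ideal_J] by (intro exI[of _ "\<lambda>U. 0"]) auto
next
  case (Suc N)
  define Ms where "Ms = (\<Union>U\<in>Pow {..<r}. (\<lambda>u. u + dU U) ` {u \<in> supp (z U). weight w (u + dU U) = N})"
  have finMs: "finite Ms" unfolding Ms_def by auto
  have zpoly: "z U \<in> polys (set vs)" for U using ideal_closed(6)[OF ideal_J Suc.prems(1)] .
  have dU_supp: "supp (dU U) \<subseteq> set vs" if "U \<subseteq> {..<r}" for U
  proof -
    have "finite U" using that finite_subset by blast
    then show ?thesis using that unfolding dU_def by (subst supp_mono_sum) auto
  qed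
  have Ms: "supp \<mu> \<subseteq> set vs" "mdeg \<mu> = e + i" "weight w \<mu> = N" if "\<mu> \<in> Ms" for \<mu>
  proof -
    obtain U u where U: "U \<subseteq> {..<r}" "u \<in> supp (z U)" "weight w (u + dU U) = N" "\<mu> = u + dU U"
      using \<open>\<mu> \<in> Ms\<close> by (auto simp: Ms_def)
    have "z U \<noteq> 0" using U(2) by force
    then have "card U = i" using Suc.prems(3) unfolding in_comp_def by blast
    then show "mdeg \<mu> = e + i" using Suc.prems(4)[of U] U(2,4) by (simp add: homogeneous_poly_iff mdeg_dU)
    show "supp \<mu> \<subseteq> set vs" using U zpoly[of U] dU_supp[OF U(1)] by (auto simp: supp_mono_add mem_polys)
    show "weight w \<mu> = N" using U by simp
  qed
  define c where "c \<mu> U = (if mdvd (dU U) \<mu> then coef (z U) (\<mu> - dU U) else 0)" for \<mu> U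
  have c_adm: "adm \<mu> U \<and> card U = i" if \<mu>: "\<mu> \<in> Ms" and nz: "c \<mu> U \<noteq> 0" for \<mu> U
  proof -
    have dv: "mdvd (dU U) \<mu>" and u: "\<mu> - dU U \<in> supp (z U)" using nz by (auto simp: c_def in_keys_iff split: if_splits)
    have zU: "z U \<noteq> 0" using u by force
    then have Ur: "U \<subseteq> {..<r}" and card: "card U = i" using Suc.prems(2,3) by (auto simp: in_comp_def)
    have eq: "\<mu> - dU U + dU U = \<mu>" by (rule mdvd_diff_add2[OF dv])
    have wt: "weight w (\<mu> - dU U) + weight w (dU U) = N" using Ms(3)[OF \<mu>] arg_cong[OF eq, of "weight w"] by simp
    have "\<exists>\<tau>\<in>G. mdvd \<tau> (\<mu> - dU U)"
    proof (rule initial[OF Suc.prems(1) Suc.prems(4) u])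
      fix u' assume "u' \<in> supp (z U)"
      then have "weight w (u' + dU U) < Suc N" by (rule Suc.prems(6))
      then show "weight w u' \<le> weight w (\<mu> - dU U)" using wt by simp
    qed
    then show ?thesis using Ur dv card by (simp add: adm_def in_ideal_def)
  qed
  have c_cyc: "kd ones (c \<mu>) W = 0" if \<mu>: "\<mu> \<in> Ms" for \<mu> W
  proof (cases "W \<subseteq> {..<r}")
    case W: True
    show ?thesis
    proof (cases "mdvd (dU W) \<mu>")
      case True
      then have "kd ones (c \<mu>) W = coef (kd fs z W) (\<mu> - dU W)"
        unfolding c_def[abs_def] by (intro coef_kd[OF W, symmetric]) (simp add: mdvd_diff_add2)
      then show ?thesis using Suc.prems(5) by simp
    next
      case False
      have "c \<mu> (insert j W) = 0" if "j \<notin> W" for j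
        using adm_insert_diff(1)[of \<mu> j W] c_adm[OF \<mu>, of "insert j W"] that False by blast
      then show ?thesis by (simp add: kd_def)
    qed
  qed (simp add: kd_def)
  have "\<exists>b. (\<forall>U. b U \<noteq> 0 \<longrightarrow> adm \<mu> U \<and> card U = Suc i) \<and> (\<forall>W. kd ones b W = c \<mu> W)" if \<mu>: "\<mu> \<in> Ms" for \<mu>
  proof (rule multigraded_strand_exact)
    show "supp \<mu> \<subseteq> set vs" "mdeg \<mu> \<noteq> d + i" using Ms[OF \<mu>] assms(1) by auto
    have fin: "finite ((\<lambda>U. rk (first (\<mu> - dU U))) ` Pow {..<r})" by simp
    show "adm \<mu> U \<and> card U = i \<and> rk (first (\<mu> - dU U)) < Suc (Max ((\<lambda>U. rk (first (\<mu> - dU U))) ` Pow {..<r}))"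
      if "c \<mu> U \<noteq> 0" for U
      using c_adm[OF \<mu> that] Max_ge[OF fin, of "rk (first (\<mu> - dU U))"] by (auto simp: adm_def less_Suc_eq_le)
    show "kd ones (c \<mu>) W = 0" for W by (rule c_cyc[OF \<mu>])
  qed
  then obtain b where b: "\<And>\<mu> U. \<mu> \<in> Ms \<Longrightarrow> b \<mu> U \<noteq> 0 \<Longrightarrow> adm \<mu> U \<and> card U = Suc i"
    "\<And>\<mu> W. \<mu> \<in> Ms \<Longrightarrow> kd ones (b \<mu>) W = c \<mu> W" by metis
  define isg where "isg u h \<longleftrightarrow> h \<in> J \<and> homogeneous_poly (mdeg u) h \<and> coef h u = 1 \<and>
    (\<forall>v\<in>supp h. v = u \<or> weight w v < weight w u)" for u h
  define g where "g u = (SOME h. isg u h)" for u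
  have isg: "isg u (g u)" if iu: "in_ideal u" "supp u \<subseteq> set vs" for u
  proof -
    have "\<exists>h. isg u h" using generator_multiple[OF iu] unfolding isg_def by blast
    then show ?thesis unfolding g_def by (rule someI_ex)
  qed
  have g: "g u \<in> J" "homogeneous_poly (mdeg u) (g u)" "coef (g u) u = 1"
    "\<And>v. v \<in> supp (g u) \<Longrightarrow> v = u \<or> weight w v < weight w u"
    if "in_ideal u" "supp u \<subseteq> set vs" for u
    using isg[OF that] unfolding isg_def by blast+
  define s where "s \<mu> U = (if b \<mu> U = 0 then 0 else const_poly (b \<mu> U) * g (\<mu> - dU U))" for \<mu> U
  define y where "y U = (\<Sum>\<mu>\<in>Ms. s \<mu> U)" for U
  have s_facts: "in_ideal (\<mu> - dU U)" "supp (\<mu> - dU U) \<subseteq> set vs" "mdvd (dU U) \<mu>" "U \<subseteq> {..<r}" "card U = Suc i"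
    if "\<mu> \<in> Ms" "b \<mu> U \<noteq> 0" for \<mu> U
    using b(1)[OF that] Ms(1)[OF that(1)] by (auto simp: adm_def in_keys_iff lookup_minus)
  have sJ: "s \<mu> U \<in> J" if "\<mu> \<in> Ms" for \<mu> U
    using g(1)[OF s_facts(1,2)[OF that]] ideal_closed(1,5)[OF ideal_J] by (auto simp: s_def)
  have s_supp: "v = \<mu> - dU U \<or> weight w (v + dU U) < N" "mdeg v = mdeg \<mu> - Suc i"
    if \<mu>: "\<mu> \<in> Ms" and v: "v \<in> supp (s \<mu> U)" for \<mu> U v
  proof -
    have nz: "b \<mu> U \<noteq> 0" using v by (auto simp: s_def)
    note sf = s_facts[OF \<mu> nz]
    have vg: "v \<in> supp (g (\<mu> - dU U))" using v nz by (auto simp: s_def in_keys_iff coef_const_mult)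
    have eq: "\<mu> - dU U + dU U = \<mu>" by (rule mdvd_diff_add2[OF sf(3)])
    have "weight w (\<mu> - dU U) + weight w (dU U) = N" using Ms(3)[OF \<mu>] arg_cong[OF eq, of "weight w"] by simp
    then show "v = \<mu> - dU U \<or> weight w (v + dU U) < N" using g(4)[OF sf(1,2) vg] by auto
    have "mdeg (\<mu> - dU U) + Suc i = mdeg \<mu>" using arg_cong[OF eq, of mdeg] sf(5) by (simp add: mdeg_dU)
    moreover have "mdeg v = mdeg (\<mu> - dU U)" using g(2)[OF sf(1,2)] vg by (simp add: homogeneous_poly_iff)
    ultimately show "mdeg v = mdeg \<mu> - Suc i" by simp
  qed
  have s_coef: "coef (s \<mu> U) (\<mu> - dU U) = b \<mu> U" if "\<mu> \<in> Ms" for \<mu> U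
    using g(3)[OF s_facts(1,2)[OF that]] by (auto simp: s_def coef_const_mult)
  have yJ: "y U \<in> J" for U unfolding y_def by (rule ideal_sum_closed[OF ideal_J]) (rule sJ)
  have y0: "y U = 0" if "\<not> U \<subseteq> {..<r}" for U
    unfolding y_def
  proof (intro sum.neutral ballI)
    fix \<mu> assume "\<mu> \<in> Ms"
    then have "b \<mu> U = 0" using s_facts(4)[of \<mu> U] that by blast
    then show "s \<mu> U = 0" by (simp add: s_def)
  qed
  have y_comp: "in_comp (Suc i) y"
    unfolding in_comp_def y_def
  proof (intro allI impI sum.neutral ballI)
    fix U :: "nat set" and \<mu> assume "card U \<noteq> Suc i" "\<mu> \<in> Ms"
    then have "b \<mu> U = 0" using s_facts(5)[of \<mu> U] by blast
    then show "s \<mu> U = 0" by (simp add: s_def)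
  qed
  have y_hom: "homogeneous_poly (e - 1) (y U)" for U
    unfolding y_def using s_supp(2) Ms(2) by (intro homogeneous_sum) (auto simp: homogeneous_poly_iff)
  have e_pos: "1 \<le> e" if "Ms \<noteq> {}" "b \<mu> U \<noteq> 0" "\<mu> \<in> Ms" for \<mu> U
  proof -
    have "mdeg \<mu> = mdeg (\<mu> - dU U) + Suc i"
      using arg_cong[OF mdvd_diff_add2[OF s_facts(3)[OF that(3,2)]], of mdeg] s_facts(5)[OF that(3,2)]
      by (simp add: mdeg_dU)
    then show ?thesis using Ms(2)[OF that(3)] by simp
  qed
  define z' where "z' U = z U - kd fs y U" for U
  have kdyJ: "kd fs y W \<in> J" for W
    unfolding kd_def using ideal_closed(1)[OF ideal_J]
    by (auto simp: fs_def intro!: ideal_sum_closed[OF ideal_J] ideal_closed(5)[OF ideal_J]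
        polys_sign[OF polys_one, simplified] polys_var yJ)
  have kdy_hom: "homogeneous_poly e (kd fs y W)" for W
  proof (cases "\<forall>U. y U = 0")
    case True
    then show ?thesis by (simp add: kd_def)
  next
    case False
    then obtain U where "y U \<noteq> 0" by blast
    then obtain \<mu> where "\<mu> \<in> Ms" "s \<mu> U \<noteq> 0" unfolding y_def by (meson sum.not_neutral_contains_not_neutral)
    then have "1 \<le> e" using e_pos by (auto simp: s_def split: if_splits)
    then have "homogeneous_poly e (fs ! j * y U')" if "j < r" for j U'
      using homogeneous_mult[OF homogeneous_var y_hom, of "vs ! j" U'] that by (simp add: fs_def del: One_nat_def)
    then show ?thesis unfolding kd_def
      by (auto intro!: homogeneous_sum neg_one_power_mult_homogeneous)
  qed
  have top: "coef (kd fs y W) u = coef (z W) u" if W: "W \<subseteq> {..<r}" and u: "weight w (u + dU W) = N" for u W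
  proof -
    define \<mu> where "\<mu> = u + dU W"
    have "coef (kd fs y W) u = kd ones (\<lambda>U. if mdvd (dU U) \<mu> then coef (y U) (\<mu> - dU U) else 0) W"
      by (rule coef_kd[OF W \<mu>_def])
    moreover have "(if mdvd (dU U) \<mu> then coef (y U) (\<mu> - dU U) else 0) = (if \<mu> \<in> Ms then b \<mu> U else 0)" for U
    proof (cases "mdvd (dU U) \<mu>")
      case dv: True
      have eq: "\<mu> - dU U + dU U = \<mu>" by (rule mdvd_diff_add2[OF dv])
      have "coef (s \<mu>' U) (\<mu> - dU U) = (if \<mu>' = \<mu> then b \<mu> U else 0)" if "\<mu>' \<in> Ms" for \<mu>'
      proof (cases "\<mu>' = \<mu>")
        case True
        then show ?thesis using s_coef that by simp
      next
        case False
        have "\<mu> - dU U \<notin> supp (s \<mu>' U)"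
        proof
          assume a: "\<mu> - dU U \<in> supp (s \<mu>' U)"
          have "weight w \<mu> = N" using u by (simp only: \<mu>_def)
          then have "weight w (\<mu> - dU U + dU U) = N" by (simp only: eq)
          then have same: "\<mu> - dU U = \<mu>' - dU U" using s_supp(1)[OF that a] by (metis less_irrefl)
          have "b \<mu>' U \<noteq> 0" using a by (auto simp: s_def)
          then have "mdvd (dU U) \<mu>'" using s_facts(3)[OF that] by blast
          then have "\<mu>' - dU U + dU U = \<mu>'" by (rule mdvd_diff_add2)
          then show False using False eq unfolding same by simp
        qed
        then show ?thesis using False by (simp add: in_keys_iff)
      qed
      then show ?thesis using dv finMs by (simp add: y_def coef_sum)
    next
      case False
      then show ?thesis using s_facts(3)[of \<mu> U] by auto
    qed
    ultimately have *: "coef (kd fs y W) u = kd ones (\<lambda>U. if \<mu> \<in> Ms then b \<mu> U else 0) W" by simp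
    show ?thesis
    proof (cases "\<mu> \<in> Ms")
      case True
      then have "coef (kd fs y W) u = c \<mu> W" using * b(2) by simp
      also have "\<dots> = coef (z W) u" by (simp add: c_def \<mu>_def)
      finally show ?thesis .
    next
      case False
      then have "u \<notin> supp (z W)" using W u by (auto simp: Ms_def \<mu>_def)
      then show ?thesis using * False by (simp add: in_keys_iff)
    qed
  qed
  have kdy_low: "weight w (u + dU W) \<le> N" if u: "u \<in> supp (kd fs y W)" for u W
  proof -
    have W: "W \<subseteq> {..<r}" using u by (auto simp: kd_def split: if_splits)
    then have finW: "finite W" using finite_subset by blast
    obtain j where j: "j \<in> {..<r} - W" "u \<in> supp ((- 1) ^ card {v\<in>W. v < j} * (fs ! j * y (insert j W)))"
      using u W unfolding kd_def by (auto dest!: supp_sum_cases)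
    then have "u \<in> supp (fs ! j * y (insert j W))" by (cases "even (card {v\<in>W. v < j})") auto
    then have uj: "vs ! j \<in> supp u" "u - vmono (vs ! j) \<in> supp (y (insert j W))"
      using j(1) by (auto simp: fs_def in_keys_iff coef_var_mult split: if_splits)
    have u': "u = (u - vmono (vs ! j)) + vmono (vs ! j)" using uj(1) mdvd_vmono mdvd_diff_add2 by metis
    obtain \<mu> where \<mu>: "\<mu> \<in> Ms" "u - vmono (vs ! j) \<in> supp (s \<mu> (insert j W))"
      using uj(2) unfolding y_def by (auto dest!: supp_sum_cases)
    have "mdvd (dU (insert j W)) \<mu>" using s_facts(3)[OF \<mu>(1)] \<mu>(2) by (auto simp: s_def split: if_splits)
    then have eq: "\<mu> - dU (insert j W) + dU (insert j W) = \<mu>" by (rule mdvd_diff_add2)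
    have "weight w (\<mu> - dU (insert j W) + dU (insert j W)) = N" unfolding eq by (rule Ms(3)[OF \<mu>(1)])
    then have "weight w (u - vmono (vs ! j) + dU (insert j W)) \<le> N"
      using s_supp(1)[OF \<mu>] by (metis le_eq_less_or_eq)
    also have "u - vmono (vs ! j) + dU (insert j W) = u + dU W"
      using j(1) finW by (subst (2) u') (simp add: dU_insert add.assoc)
    finally show ?thesis .
  qed
  have "\<exists>y'. (\<forall>U. y' U \<in> J) \<and> (\<forall>U. \<not> U \<subseteq> {..<r} \<longrightarrow> y' U = 0) \<and> (\<forall>W. kd fs y' W = z' W)"
  proof (rule Suc.IH)
    show "z' U \<in> J" for U unfolding z'_def by (intro ideal_closed(4)[OF ideal_J] Suc.prems(1) kdyJ)
    show "z' U = 0" if "\<not> U \<subseteq> {..<r}" for U using Suc.prems(2)[OF that] that by (simp add: z'_def kd_def)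
    show "in_comp i z'" using Suc.prems(3) kd_in_comp[OF y_comp, of fs] by (simp add: in_comp_def z'_def)
    show "homogeneous_poly e (z' U)" for U unfolding z'_def by (intro homogeneous_diff Suc.prems(4) kdy_hom)
    show "kd fs z' W = 0" for W unfolding z'_def kd_diff using Suc.prems(5) kd_kd[of fs y W] by simp
    show "weight w (u + dU U) < N" if u: "u \<in> supp (z' U)" for U u
    proof -
      have "z' U \<noteq> 0" using u by force
      then have Ur: "U \<subseteq> {..<r}"
        using Suc.prems(2)[of U] unfolding z'_def kd_def by (cases "U \<subseteq> {..<r}") auto
      have "u \<in> supp (z U) \<or> u \<in> supp (kd fs y U)" using u unfolding z'_def by (rule supp_poly_diff_cases)
      then have "weight w (u + dU U) \<le> N" using Suc.prems(6) kdy_low by (auto simp: less_Suc_eq_le)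
      moreover have "weight w (u + dU U) \<noteq> N"
        using top[OF Ur, of u] u by (auto simp: z'_def in_keys_iff lookup_minus)
      ultimately show ?thesis by simp
    qed
  qed
  then obtain y' where y': "\<forall>U. y' U \<in> J" "\<forall>U. \<not> U \<subseteq> {..<r} \<longrightarrow> y' U = 0" "\<forall>W. kd fs y' W = z' W"
    by blast
  have "y' U + y U \<in> J" for U by (rule ideal_closed(2)[OF ideal_J spec[OF y'(1)] yJ])
  moreover have "y' U + y U = 0" if "\<not> U \<subseteq> {..<r}" for U using y'(2) y0[OF that] that by simp
  moreover have "kd fs (\<lambda>U. y' U + y U) W = z W" for W
    using spec[OF y'(3), of W] by (simp add: kd_add z'_def)
  ultimately show ?case by (intro exI[of _ "\<lambda>U. y' U + y U"]) blast
qed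

lemma strand_exact:
  fixes z :: "nat set \<Rightarrow> ('v, 'k) mpoly"
  assumes "e \<noteq> d"
    and "\<And>U. z U \<in> J" "\<And>U. \<not> U \<subseteq> {..<r} \<Longrightarrow> z U = 0" "in_comp i z" "\<And>U. homogeneous_poly e (z U)"
    and "\<And>W. kd fs z W = 0"
  shows "\<exists>y. (\<forall>U. y U \<in> J) \<and> (\<forall>U. \<not> U \<subseteq> {..<r} \<longrightarrow> y U = 0) \<and> (\<forall>W. kd fs y W = z W)"
proof -
  define T where "T = (\<Union>U\<in>Pow {..<r}. (\<lambda>u. weight w (u + dU U)) ` supp (z U))"
  have "finite T" unfolding T_def by auto
  then obtain N where N: "\<forall>x\<in>T. x < N" using finite_nat_set_iff_bounded[of T] by blast
  have "weight w (u + dU U) < N" if u: "u \<in> supp (z U)" for U u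
  proof -
    have "z U \<noteq> 0" using u by force
    then have "U \<in> Pow {..<r}" using assms(3)[of U] by blast
    then have "weight w (u + dU U) \<in> T" unfolding T_def using u by blast
    then show ?thesis using N by blast
  qed
  from weight_strand_exact[OF assms this] show ?thesis .
qed

end


section \<open>Exactness of the Koszul complex of a polynomial ring\<close>

lemma ideal_polys: "ideal (polys V) (mpoly_ring V)"
  by (rule ring.oneideal[OF mpoly_ring_ring])

text \<open>The unit ideal has linear quotients: its only generator is \<open>1\<close>, of degree \<open>0\<close>. In coefficient
  degree \<open>0\<close>, which this leaves open, there are no nonzero cycles of positive homological degree.\<close>

lemma koszul_polynomial_ring_exact:
  fixes z :: "nat set \<Rightarrow> ('v, 'k::field) mpoly"
  assumes "distinct vs" "1 \<le> i" "\<And>U. z U \<in> polys (set vs)" "\<And>U. \<not> U \<subseteq> {..<length vs} \<Longrightarrow> z U = 0"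
    "in_comp i z" "\<And>U. homogeneous_poly e (z U)" "\<And>W. kd (map var vs) z W = 0"
  shows "\<exists>y. (\<forall>U. y U \<in> polys (set vs)) \<and> (\<forall>U. \<not> U \<subseteq> {..<length vs} \<longrightarrow> y U = 0) \<and>
    (\<forall>W. kd (map var vs) y W = z W)"
proof -
  interpret groebner_linear_quotients vs "{0}" "\<lambda>_. 0" 0 "polys (set vs) :: ('v, 'k) mpoly set" "\<lambda>_. 0"
  proof (intro groebner_linear_quotients.intro linear_quotients.intro groebner_linear_quotients_axioms.intro)
    show "distinct vs" by fact
    show "ideal (polys (set vs)) (mpoly_ring (set vs))" by (rule ideal_polys)
    show "\<exists>g\<in>polys (set vs). homogeneous_poly 0 g \<and> coef g \<tau> = 1 \<and>
        (\<forall>u\<in>supp g. u = \<tau> \<or> weight (\<lambda>_. 0 :: nat) u < weight (\<lambda>_. 0) \<tau>)" if "\<tau> \<in> {0}" for \<tau> :: "'v \<Rightarrow>\<^sub>0 nat"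
      using that by (intro bexI[of _ 1]) auto
  qed (auto simp: mdvd_def)
  show ?thesis
  proof (cases "e = 0")
    case False
    show ?thesis using strand_exact[OF False assms(3) _ assms(5,6)] assms(4,7) by (simp add: fs_def)
  next
    case True
    have zero: "z U = 0" for U
    proof (rule ccontr)
      assume nz: "z U \<noteq> 0"
      then have U: "U \<subseteq> {..<length vs}" "card U = i" using assms(4,5) by (auto simp: in_comp_def)
      then have "U \<noteq> {}" using assms(2) by auto
      then obtain j where j: "j \<in> U" by blast
      define W where "W = U - {j}"
      have UW: "U = insert j W" "j \<notin> W" using j by (auto simp: W_def)
      have const: "coef (z U') e' = 0" if "e' \<noteq> 0" for U' e'
      proof (rule ccontr)
        assume "coef (z U') e' \<noteq> 0"
        then have "mdeg e' = 0" using assms(6)[of U'] True by (simp add: homogeneous_poly_iff in_keys_iff)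
        then have "coef e' v = 0" for v using coef_le_mdeg[of e' v] by simp
        then have "e' = 0" by (intro Poly_Mapping.poly_mapping_eqI) simp
        then show False using that by simp
      qed
      have "0 = coef (kd (map var vs) z W) (vmono (vs ! j))" by (simp add: assms(7))
      also have "\<dots> = (\<Sum>l\<in>{..<length vs} - W. (if l = j then (- 1) ^ card {v\<in>W. v < l} * coef (z U) 0 else 0))"
      proof -
        have one: "coef ((- 1) ^ k * (map var vs ! l * z (insert l W))) (vmono (vs ! j)) =
            (if l = j then (- 1) ^ k * coef (z U) 0 else 0)" if l: "l \<in> {..<length vs} - W" for l k
        proof -
          have "coef (map var vs ! l * z (insert l W)) (vmono (vs ! j)) = (if l = j then coef (z U) 0 else 0)"
            using l j U(1) nth_eq_iff_index_eq[OF assms(1), of l j] by (auto simp: coef_var_mult UW)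
          then show ?thesis by (cases "even k") simp_all
        qed
        have W: "W \<subseteq> {..<length (map var vs :: ('v, 'k) mpoly list)}" using U(1) by (auto simp: W_def)
        have "coef (kd (map var vs) z W) (vmono (vs ! j)) = (\<Sum>l\<in>{..<length vs} - W.
            coef ((- 1) ^ card {v\<in>W. v < l} * (map var vs ! l * z (insert l W))) (vmono (vs ! j)))"
          unfolding kd_def if_P[OF W] coef_sum by (simp only: length_map)
        also have "\<dots> = (\<Sum>l\<in>{..<length vs} - W. (if l = j then (- 1) ^ card {v\<in>W. v < l} * coef (z U) 0 else 0))"
          by (rule sum.cong[OF refl]) (rule one)
        finally show ?thesis .
      qed
      also have "\<dots> = (- 1) ^ card {v\<in>W. v < j} * coef (z U) 0"
        using j U(1) UW(2) by auto
      finally have "coef (z U) 0 = 0" by simp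
      then have "coef (z U) e' = coef 0 e'" for e' using const by (cases "e' = 0") auto
      then show False using nz Poly_Mapping.poly_mapping_eqI by blast
    qed
    show ?thesis by (intro exI[of _ "\<lambda>U. 0"]) (simp add: zero)
  qed
qed

text \<open>A cycle modulo \<open>J\<close> has a boundary in \<open>J\<close>. Outside of the linear strand that boundary is the
  boundary of a chain in \<open>J\<close>; subtracting it leaves a cycle over the polynomial ring.\<close>

lemma (in groebner_linear_quotients) strand_modulo:
  fixes z :: "nat set \<Rightarrow> ('v, 'k) mpoly"
  assumes const: "\<And>p. p \<in> J \<Longrightarrow> coef p 0 = 0" and hcomp: "\<And>p k. p \<in> J \<Longrightarrow> hcomp k p \<in> J"
    and "1 \<le> i" "Suc e \<noteq> d" and z: "\<And>U. z U \<in> polys (set vs)" "\<And>U. \<not> U \<subseteq> {..<r} \<Longrightarrow> z U = 0"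
      "in_comp i z" "\<And>U. homogeneous_poly e (z U)" "\<And>W. kd fs z W \<in> J"
  shows "\<exists>y. (\<forall>U. y U \<in> polys (set vs)) \<and> (\<forall>U. \<not> U \<subseteq> {..<r} \<longrightarrow> y U = 0) \<and> (\<forall>W. z W - kd fs y W \<in> J)"
proof -
  have var_hom: "homogeneous_poly 1 ((- 1) ^ n * fs ! l)" if "l < r" for l n
    using that by (intro neg_one_power_mult_homogeneous) (simp add: fs_def del: One_nat_def)
  have hk: "hcomp (Suc k) (kd fs a W) = kd fs (\<lambda>U. hcomp k (a U)) W" for k a W
  proof -
    have one: "hcomp (Suc k) ((- 1) ^ n * (fs ! l * p)) = (- 1) ^ n * (fs ! l * hcomp k p)" if "l < r" for l n p
      using hcomp_mult_homogeneous[OF var_hom[OF that], of "Suc k" p n] by (simp add: mult_ac)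
    show ?thesis by (auto simp: kd_def hcomp_sum one intro!: sum.cong)
  qed
  have kz_hom: "homogeneous_poly (Suc e) (kd fs z W)" for W
  proof -
    have "kd fs z W = hcomp (Suc e) (kd fs z W)" by (simp add: hk hcomp_homogeneous[OF z(4)])
    then show ?thesis by (metis homogeneous_hcomp)
  qed
  obtain i' where i': "i = Suc i'" using assms(3) by (cases i) auto
  have "\<exists>x. (\<forall>U. x U \<in> J) \<and> (\<forall>U. \<not> U \<subseteq> {..<r} \<longrightarrow> x U = 0) \<and> (\<forall>W. kd fs x W = kd fs z W)"
  proof (rule strand_exact[OF assms(4)])
    show "in_comp i' (kd fs z)" using z(3) unfolding i' by (rule kd_in_comp)
    show "kd fs z U \<in> J" for U by (rule z(5))
    show "kd fs z U = 0" if "\<not> U \<subseteq> {..<r}" for U using that by (simp add: kd_def)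
    show "homogeneous_poly (Suc e) (kd fs z U)" for U by (rule kz_hom)
    show "kd fs (kd fs z) W = 0" for W by (rule kd_kd)
  qed
  then obtain x where x: "\<And>U. x U \<in> J" "\<And>U. \<not> U \<subseteq> {..<r} \<Longrightarrow> x U = 0" "\<And>W. kd fs x W = kd fs z W" by blast
  define x' where "x' U = (if card U = i then hcomp e (x U) else 0)" for U
  have x'J: "x' U \<in> J" for U using hcomp[OF x(1)] ideal_closed(1)[OF ideal_J] by (simp add: x'_def)
  have kx': "kd fs x' W = kd fs z W" for W
  proof (cases "card W = i' \<and> W \<subseteq> {..<r}")
    case True
    then have fin: "finite W" using finite_subset by blast
    have "kd fs x' W = kd fs (\<lambda>U. hcomp e (x U)) W"
      using True fin by (auto simp: kd_def x'_def i' intro!: sum.cong)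
    also have "\<dots> = kd fs z W" using kz_hom[of W] by (simp add: hk[symmetric] x(3) hcomp_homogeneous)
    finally show ?thesis .
  next
    case False
    have "in_comp i x'" by (simp add: in_comp_def x'_def)
    then have "in_comp i' (kd fs x')" "in_comp i' (kd fs z)" using z(3) unfolding i' by (auto intro: kd_in_comp)
    then have "card W \<noteq> i' \<Longrightarrow> kd fs x' W = kd fs z W" unfolding in_comp_def by metis
    moreover have "kd fs x' W = kd fs z W" if "\<not> W \<subseteq> {..<r}" using that by (simp add: kd_def)
    ultimately show ?thesis using False by blast
  qed
  have "\<exists>y. (\<forall>U. y U \<in> polys (set vs)) \<and> (\<forall>U. \<not> U \<subseteq> {..<length vs} \<longrightarrow> y U = 0) \<and>
    (\<forall>W. kd (map var vs) y W = z W - x' W)"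
  proof (rule koszul_polynomial_ring_exact[OF distinct_vs assms(3)])
    show "z U - x' U \<in> polys (set vs)" for U using z(1) ideal_closed(6)[OF ideal_J x'J] by (rule polys_diff)
    show "z U - x' U = 0" if "\<not> U \<subseteq> {..<length vs}" for U using that z(2) x(2) by (simp add: x'_def)
    show "in_comp i (\<lambda>U. z U - x' U)" using z(3) by (simp add: in_comp_def x'_def)
    show "homogeneous_poly e (z U - x' U)" for U by (rule homogeneous_diff[OF z(4)]) (simp add: x'_def)
    show "kd (map var vs) (\<lambda>U. z U - x' U) W = 0" for W
      using kx'[of W] by (simp add: kd_diff fs_def)
  qed
  then obtain y where y: "\<And>U. y U \<in> polys (set vs)" "\<And>U. \<not> U \<subseteq> {..<r} \<Longrightarrow> y U = 0"
    "\<And>W. kd fs y W = z W - x' W" by (auto simp: fs_def)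
  have "z W - kd fs y W \<in> J" for W using x'J by (simp add: y(3))
  then show ?thesis using y by blast
qed

section \<open>From the criterion to Golodness\<close>

text \<open>The variables of \<open>vs\<close> are minimal generators of the graded maximal ideal of the quotient, since no
  element of \<open>J\<close> has a linear term in them.\<close>

lemma (in linear_koszul_quotient) golod_J:
  assumes hom: "homogeneous_ideal V J" and dist: "distinct vs"
    and rest: "\<And>v. v \<in> V \<Longrightarrow> v \<notin> set vs \<Longrightarrow> var v \<in> J"
    and lin: "\<And>p v. p \<in> J \<Longrightarrow> v \<in> set vs \<Longrightarrow> coef p (vmono v) = 0"
  shows "golod V J"
proof -
  let ?R = "mpoly_ring V :: ('v, 'k) mpoly ring"
  let ?gs = "map (\<lambda>v. J +>\<^bsub>?R\<^esub> var v) vs"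
  have coef_var: "coef (var u :: ('v, 'k) mpoly) (vmono v) = (if u = v then 1 else 0)" for u v :: 'v
  proof -
    have "vmono v = vmono u \<longleftrightarrow> v = u" by (metis singleton_inject supp_vmono)
    then show ?thesis by (auto simp: var_eq coef_term)
  qed
  have var_V: "var v \<in> polys V" if "v \<in> set vs" for v using that vs by (auto intro: polys_var)
  have not_car: "J \<noteq> carrier ?R"
  proof
    assume "J = carrier ?R"
    then have "coef (1 :: ('v, 'k) mpoly) 0 = 0" using J_const[of 1] by simp
    then show False by simp
  qed
  have inj: "cl (var u) \<noteq> cl (var v)" if "u \<in> set vs" "v \<in> set vs" "u \<noteq> v" for u v
  proof
    assume "cl (var u) = cl (var v)"
    then have "var u - var v \<in> J" using cl_eq_iff var_V that by blast
    then have "coef (var u - var v :: ('v, 'k) mpoly) (vmono u) = 0" using lin that by blast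
    then show False using that by (simp add: lookup_minus coef_var)
  qed
  have set_gs: "set ?gs = (\<lambda>v. cl (var v)) ` set vs" by (auto simp: cl_def)
  have "distinct ?gs" using dist inj by (auto simp: distinct_map inj_on_def cl_def)
  moreover have "set ?gs \<subseteq> (\<lambda>p. J +>\<^bsub>?R\<^esub> p) ` homogeneous_elements V"
  proof -
    have "var v \<in> homogeneous_elements V" if "v \<in> set vs" for v
      unfolding homogeneous_elements_def
      by (intro CollectI conjI exI[of _ 1] var_V[OF that] homogeneous_var)
    then show ?thesis by auto
  qed
  moreover have gmax: "Idl\<^bsub>S\<^esub> (set ?gs) = graded_maximal_ideal V J"
  proof -
    have same: "set ?gs \<subseteq> I \<longleftrightarrow> (\<lambda>v. J +>\<^bsub>?R\<^esub> var v) ` V \<subseteq> I" if I: "ideal I S" for I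
    proof
      assume gsI: "set ?gs \<subseteq> I"
      show "(\<lambda>v. J +>\<^bsub>?R\<^esub> var v) ` V \<subseteq> I"
      proof
        fix x assume "x \<in> (\<lambda>v. J +>\<^bsub>?R\<^esub> var v) ` V"
        then obtain v where v: "v \<in> V" "x = cl (var v)" by (auto simp: cl_def)
        show "x \<in> I"
        proof (cases "v \<in> set vs")
          case True
          then show ?thesis using gsI v by (auto simp: cl_def)
        next
          case False
          then have "cl (var v) = cl 0" using cl_eq_iff[of "var v" 0] rest v(1) polys_var[OF v(1)] by simp
          then show ?thesis using v additive_subgroup.zero_closed[OF ideal.axioms(1)[OF I]] by (simp add: cl_zero)
        qed
      qed
    qed (use vs in auto)
    have "{I. ideal I S \<and> set ?gs \<subseteq> I} = {I. ideal I S \<and> (\<lambda>v. J +>\<^bsub>?R\<^esub> var v) ` V \<subseteq> I}"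
      by (rule Collect_cong) (rule conj_cong[OF refl same])
    then show ?thesis unfolding graded_maximal_ideal_def genideal_def by (rule arg_cong[of _ _ Inter])
  qed
  moreover have "Idl\<^bsub>S\<^esub> H \<noteq> graded_maximal_ideal V J" if H: "H \<subset> set ?gs" for H
  proof
    assume eq: "Idl\<^bsub>S\<^esub> H = graded_maximal_ideal V J"
    have "\<exists>x\<in>set ?gs. x \<notin> H" using H by blast
    then obtain v where v: "v \<in> set vs" "cl (var v) \<notin> H" unfolding set_gs by blast
    define P where "P = {p \<in> polys V. coef p 0 = (0 :: 'k) \<and> coef p (vmono v) = 0}"
    have coef0: "coef (p * q) 0 = 0" if "coef q 0 = 0" for p q :: "('v, 'k) mpoly"
    proof -
      have "coef q (0 - e) = 0" if "mdvd e 0" for e :: "'v \<Rightarrow>\<^sub>0 nat"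
      proof -
        have "e = 0" using that by (intro Poly_Mapping.poly_mapping_eqI) (simp add: mdvd_def)
        then show ?thesis using \<open>coef q 0 = 0\<close> by simp
      qed
      then show ?thesis by (auto simp: coef_mult intro!: sum.neutral)
    qed
    have coef1: "coef (p * q) (vmono v) = 0" if "coef q 0 = 0" "coef q (vmono v) = 0" for p q :: "('v, 'k) mpoly"
    proof -
      have "coef q (vmono v - e) = 0" if e: "mdvd e (vmono v)" for e
      proof -
        have le: "coef e x \<le> (if x = v then 1 else 0)" for x using e by (simp only: mdvd_def coef_vmono)
        show ?thesis
        proof (cases "coef e v = 0")
          case True
          have "coef e x = 0" for x using le[of x] True by (cases "x = v") auto
          then have "e = 0" by (intro Poly_Mapping.poly_mapping_eqI) simp
          then show ?thesis using that by (simp add: \<open>coef q (vmono v) = 0\<close>)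
        next
          case False
          then have "coef e x = coef (vmono v) x" for x using le[of x] by (auto simp: coef_vmono split: if_splits)
          then have "e = vmono v" by (intro Poly_Mapping.poly_mapping_eqI)
          then show ?thesis using \<open>coef q 0 = 0\<close> by simp
        qed
      qed
      then show ?thesis by (auto simp: coef_mult intro!: sum.neutral)
    qed
    have PV: "P \<subseteq> polys V" by (auto simp: P_def)
    have id: "ideal (cl ` P) S"
    proof (rule idealI)
      show "ring S" by (rule S.ring_axioms)
      show "subgroup (cl ` P) (add_monoid S)"
      proof (rule S.add.subgroupI)
        show "cl ` P \<subseteq> carrier S" using PV cl_closed by auto
        show "cl ` P \<noteq> {}" by (auto simp: P_def intro!: exI[of _ 0])
        show "\<ominus>\<^bsub>S\<^esub> a \<in> cl ` P" if a: "a \<in> cl ` P" for a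
        proof -
          obtain p where p: "p \<in> P" "a = cl p" using a by blast
          have "- p \<in> P" using p(1) polys_uminus by (auto simp: P_def)
          moreover have "p \<in> polys V" using PV p(1) by blast
          ultimately show ?thesis unfolding p(2) cl_uminus[OF \<open>p \<in> polys V\<close>, symmetric] by (intro imageI)
        qed
        show "a \<oplus>\<^bsub>S\<^esub> b \<in> cl ` P" if ab: "a \<in> cl ` P" "b \<in> cl ` P" for a b
        proof -
          obtain p q where p: "p \<in> P" "a = cl p" and q: "q \<in> P" "b = cl q" using ab by blast
          have "p + q \<in> P" using p(1) q(1) polys_add by (auto simp: P_def lookup_add)
          moreover have pq: "p \<in> polys V" "q \<in> polys V" using PV p(1) q(1) by blast+
          ultimately show ?thesis unfolding p(2) q(2) cl_simps(1)[OF pq, symmetric] by (intro imageI)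
        qed
      qed
      fix a x assume "a \<in> cl ` P" and "x \<in> carrier S"
      then obtain p q where p: "p \<in> P" "a = cl p" and q: "q \<in> polys V" "x = cl q" using carrier_S by auto
      have "q * p \<in> P" using p(1) q(1) coef0 coef1 polys_mult by (auto simp: P_def)
      moreover have pV: "p \<in> polys V" using PV p(1) by blast
      ultimately show xa: "x \<otimes>\<^bsub>S\<^esub> a \<in> cl ` P"
        unfolding p(2) q(2) cl_simps(2)[OF q(1) pV, symmetric] by (intro imageI)
      have "a \<otimes>\<^bsub>S\<^esub> x = x \<otimes>\<^bsub>S\<^esub> a"
        unfolding p(2) q(2) by (rule S.m_comm[OF cl_closed[OF pV] cl_closed[OF q(1)]])
      then show "a \<otimes>\<^bsub>S\<^esub> x \<in> cl ` P" using xa by simp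
    qed
    have "H \<subseteq> cl ` P"
    proof
      fix x assume x: "x \<in> H"
      then have "x \<in> set ?gs" using H by blast
      then obtain u where u: "u \<in> set vs" "x = cl (var u)" unfolding set_gs by blast
      then have "u \<noteq> v" using x v(2) by blast
      have "vmono u \<noteq> 0" using supp_vmono[of u] by (metis keys_zero insert_not_empty)
      then have "var u \<in> P" using u var_V \<open>u \<noteq> v\<close> by (simp add: P_def coef_var) (simp add: var_eq coef_term)
      then show "x \<in> cl ` P" using u by blast
    qed
    then have "Idl\<^bsub>S\<^esub> H \<subseteq> cl ` P" by (rule S.genideal_minimal[OF id])
    moreover have "cl (var v) \<in> graded_maximal_ideal V J"
    proof -
      have "set ?gs \<subseteq> carrier S" using cl_closed var_V unfolding set_gs by blast
      then have "set ?gs \<subseteq> Idl\<^bsub>S\<^esub> (set ?gs)" by (rule S.genideal_self)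
      then show ?thesis using v(1) unfolding gmax[symmetric] set_gs by blast
    qed
    ultimately obtain p where p: "p \<in> P" "cl (var v) = cl p" using eq by blast
    then have "var v - p \<in> J" using cl_eq_iff[of "var v" p] var_V[OF v(1)] PV by blast
    then have "coef (var v - p) (vmono v) = 0" using lin v(1) by blast
    then show False using p(1) by (simp add: P_def lookup_minus coef_var)
  qed
  ultimately have "minimal_homogeneous_generators V J ?gs"
    unfolding minimal_homogeneous_generators_def by blast
  moreover have "admits_trivial_Massey_operation
     (range (\<lambda>c. koszul_scalar S (length ?gs) (J +>\<^bsub>?R\<^esub> const_poly c))) (koszul S ?gs)"
    using admits_massey by (simp add: A_def)
  ultimately show ?thesis
    unfolding golod_def using J not_car hom by blast
qed


section \<open>Substitution\<close>

definition subst :: "('v \<Rightarrow> ('u, 'k::field) mpoly) \<Rightarrow> ('v, 'k) mpoly \<Rightarrow> ('u, 'k) mpoly" where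
  "subst \<psi> p = (\<Sum>e\<in>supp p. const_poly (coef p e) * (\<Prod>v\<in>supp e. \<psi> v ^ coef e v))"

definition subst_mono :: "('v \<Rightarrow> ('u, 'k::field) mpoly) \<Rightarrow> ('v \<Rightarrow>\<^sub>0 nat) \<Rightarrow> ('u, 'k) mpoly" where
  "subst_mono \<psi> e = (\<Prod>v\<in>supp e. \<psi> v ^ coef e v)"

lemma subst_mono_add: "subst_mono \<psi> (a + b) = subst_mono \<psi> a * subst_mono \<psi> b"
proof -
  let ?A = "supp a \<union> supp b"
  have "subst_mono \<psi> e = (\<Prod>v\<in>?A. \<psi> v ^ coef e v)" if "supp e \<subseteq> ?A" for e
    unfolding subst_mono_def by (rule prod.mono_neutral_left) (use that in \<open>auto simp: in_keys_iff\<close>)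
  then show ?thesis by (simp add: supp_mono_add lookup_add power_add prod.distrib)
qed

lemma subst_mono_vmono [simp]: "subst_mono \<psi> (vmono v) = \<psi> v"
  by (simp add: subst_mono_def coef_vmono)

lemma subst_mono_zero [simp]: "subst_mono \<psi> 0 = 1"
  by (simp add: subst_mono_def)

lemma subst_eq: "subst \<psi> p = (\<Sum>e\<in>supp p. const_poly (coef p e) * subst_mono \<psi> e)"
  by (simp add: subst_def subst_mono_def)

lemma subst_add: "subst \<psi> (p + q) = subst \<psi> p + subst \<psi> q"
proof -
  let ?A = "supp p \<union> supp q"
  have "subst \<psi> f = (\<Sum>e\<in>?A. const_poly (coef f e) * subst_mono \<psi> e)" if "supp f \<subseteq> ?A" for f
    unfolding subst_eq
    by (rule sum.mono_neutral_left) (use that in \<open>auto simp: in_keys_iff const_poly_simps\<close>)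
  moreover have "supp (p + q) \<subseteq> ?A" by (rule Poly_Mapping.keys_add)
  ultimately show ?thesis by (simp add: lookup_add const_poly_simps distrib_right sum.distrib)
qed

lemma subst_zero [simp]: "subst \<psi> 0 = 0"
  by (simp add: subst_def)

lemma subst_term: "subst \<psi> (mterm e c) = const_poly c * subst_mono \<psi> e"
  by (simp add: subst_eq const_poly_simps)

lemma subst_mult: "subst \<psi> (p * q) = subst \<psi> p * subst \<psi> q"
proof (induction p rule: poly_induct)
  case zero then show ?case by simp
next
  case (mterm a c)
  show ?case
  proof (induction q rule: poly_induct)
    case zero then show ?case by simp
  next
    case (mterm b d)
    then show ?case by (simp add: mult_single subst_term subst_mono_add const_poly_simps mult_ac)
  next
    case (add p q) then show ?case by (simp add: subst_add distrib_left)
  qed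
next
  case (add p p') then show ?case by (simp add: subst_add distrib_right)
qed

lemma subst_one [simp]: "subst \<psi> 1 = 1"
  using subst_term[of \<psi> 0 1] by (simp add: const_poly_simps)

lemma subst_var [simp]: "subst \<psi> (var v) = \<psi> v"
  by (simp add: var_eq subst_term const_poly_simps)

lemma subst_hom: "comm_ring_hom (subst \<psi>)"
  by unfold_locales (simp_all add: subst_add subst_mult)

lemma subst_sum: "subst \<psi> (sum f A) = (\<Sum>x\<in>A. subst \<psi> (f x))"
  by (induction A rule: infinite_finite_induct) (simp_all add: subst_add)

lemma subst_det: "subst \<psi> (det M) = det (map_mat (subst \<psi>) M)"
  by (rule comm_ring_hom.hom_det[OF subst_hom, symmetric])


section \<open>Terms of highest weight\<close>

definition nmul :: "nat \<Rightarrow> ('v \<Rightarrow>\<^sub>0 nat) \<Rightarrow> 'v \<Rightarrow>\<^sub>0 nat" where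
  "nmul k e = (\<Sum>i<k. e)"

lemma nmul_simps [simp]: "nmul 0 e = 0" "nmul (Suc k) e = nmul k e + e"
  by (simp_all add: nmul_def)

lemma coef_nmul: "coef (nmul k e) x = k * coef e x"
  by (induction k) (simp_all add: lookup_add)

lemma weight_nmul [simp]: "weight w (nmul k e) = of_nat k * weight w e"
  by (induction k) (simp_all add: distrib_right add.commute)

definition bounded_by :: "('v \<Rightarrow> int) \<Rightarrow> ('v, 'k::field) mpoly \<Rightarrow> int \<Rightarrow> bool" where
  "bounded_by w p N \<longleftrightarrow> (\<forall>u\<in>supp p. weight w u \<le> N)"

definition has_lead :: "('v \<Rightarrow> int) \<Rightarrow> ('v, 'k::field) mpoly \<Rightarrow> ('v \<Rightarrow>\<^sub>0 nat) \<Rightarrow> bool" where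
  "has_lead w p u \<longleftrightarrow> coef p u \<noteq> 0 \<and> (\<forall>v\<in>supp p. v = u \<or> weight w v < weight w u)"

lemma has_lead_bounded: "has_lead w p u \<Longrightarrow> bounded_by w p (weight w u)"
  by (auto simp: has_lead_def bounded_by_def le_less)

lemma bounded_sum: "(\<And>x. x \<in> A \<Longrightarrow> bounded_by w (f x) N) \<Longrightarrow> bounded_by w (sum f A) N"
  unfolding bounded_by_def by (meson supp_sum_cases)

lemma bounded_mult:
  assumes "bounded_by w p N" "bounded_by w q M"
  shows "bounded_by w (p * q) (N + M)"
  unfolding bounded_by_def
proof
  fix u assume "u \<in> supp (p * q)"
  then obtain a b where "a \<in> supp p" "b \<in> supp q" "u = a + b" using supp_poly_mult_cases by blast
  then show "weight w u \<le> N + M" using assms by (auto simp: bounded_by_def intro: add_mono)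
qed

lemma bounded_weaken: "bounded_by w p N \<Longrightarrow> N \<le> M \<Longrightarrow> bounded_by w p M"
  by (auto simp: bounded_by_def intro: order_trans)

lemma bounded_uminus: "bounded_by w p N \<Longrightarrow> bounded_by w (- p) N"
  by (auto simp: bounded_by_def)

lemma coef_mult_lead:
  assumes "has_lead w p a" "bounded_by w q (weight w b)"
  shows "coef (p * q) (a + b) = coef p a * coef q b"
proof -
  have "(if mdvd x (a + b) then coef p x * coef q (a + b - x) else 0) = (if x = a then coef p a * coef q b else 0)"
    if x: "x \<in> supp p" for x
  proof (cases "x = a")
    case True
    then show ?thesis by simp
  next
    case False
    then have lt: "weight w x < weight w a" using assms(1) x by (auto simp: has_lead_def)
    have "coef q (a + b - x) = 0" if "mdvd x (a + b)"
    proof (rule ccontr)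
      assume "coef q (a + b - x) \<noteq> 0"
      then have "weight w (a + b - x) \<le> weight w b" using assms(2) by (auto simp: bounded_by_def in_keys_iff)
      moreover have "weight w x + weight w (a + b - x) = weight w (a + b)"
        using arg_cong[OF mdvd_diff_add[OF that], of "weight w"] by simp
      ultimately show False using lt by simp
    qed
    then show ?thesis using False by simp
  qed
  then have "coef (p * q) (a + b) = (\<Sum>x\<in>supp p. if x = a then coef p a * coef q b else 0)"
    unfolding coef_mult by (intro sum.cong) auto
  also have "\<dots> = coef p a * coef q b" using assms(1) by (simp add: has_lead_def in_keys_iff)
  finally show ?thesis .
qed

lemma has_lead_mult:
  assumes "has_lead w p a" "has_lead w q b"
  shows "has_lead w (p * q) (a + b)"
  unfolding has_lead_def
proof (intro conjI ballI)
  show "coef (p * q) (a + b) \<noteq> 0"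
    using coef_mult_lead[OF assms(1) has_lead_bounded[OF assms(2)]] assms by (simp add: has_lead_def)
  fix u assume "u \<in> supp (p * q)"
  then obtain x y where "x \<in> supp p" "y \<in> supp q" "u = x + y" using supp_poly_mult_cases by blast
  then show "u = a + b \<or> weight w u < weight w (a + b)"
    using assms by (fastforce simp: has_lead_def)
qed

lemma has_lead_one [simp]: "has_lead w 1 0"
  by (simp add: has_lead_def)

lemma has_lead_prod:
  assumes "finite A" "\<And>x. x \<in> A \<Longrightarrow> has_lead w (f x) (u x)"
  shows "has_lead w (prod f A) (sum u A)"
  using assms by (induction A rule: finite_induct) (auto intro: has_lead_mult)

lemma has_lead_power: "has_lead w p u \<Longrightarrow> has_lead w (p ^ k) (nmul k u)"
  
proof (induction k)
  case (Suc k)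
  from has_lead_mult[OF Suc.prems Suc.IH[OF Suc.prems]] show ?case by (simp add: add.commute)
qed simp

lemma has_lead_var [simp]: "has_lead w (var v) (vmono v)"
  by (simp add: has_lead_def var_eq)

lemma has_lead_signed: "has_lead w p u \<Longrightarrow> has_lead w ((- 1) ^ k * p) u"
  by (cases "even k") (auto simp: has_lead_def)

lemma has_lead_add_lower:
  assumes "has_lead w p u" "bounded_by w q N" "N < weight w u"
  shows "has_lead w (p + q) u"
  unfolding has_lead_def
proof (intro conjI ballI)
  have "u \<notin> supp q" using assms(2,3) by (auto simp: bounded_by_def)
  then show "coef (p + q) u \<noteq> 0" using assms(1) by (simp add: has_lead_def lookup_add in_keys_iff)
  fix v assume "v \<in> supp (p + q)"
  then have "v \<in> supp p \<or> v \<in> supp q" by (rule supp_poly_add_cases)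
  then show "v = u \<or> weight w v < weight w u" using assms by (fastforce simp: has_lead_def bounded_by_def)
qed

text \<open>A substitution that multiplies the leading monomial by \<open>\<delta>\<close> for each variable preserves the
  monomials of highest weight of a homogeneous polynomial.\<close>

lemma has_lead_subst_mono:
  fixes e :: "'v \<Rightarrow>\<^sub>0 nat"
  assumes "\<And>v. has_lead w (\<psi> v) (\<delta> + vmono v)"
  shows "has_lead w (subst_mono \<psi> e) (nmul (mdeg e) \<delta> + e)"
proof -
  have "has_lead w (subst_mono \<psi> e) (\<Sum>v\<in>supp e. nmul (coef e v) (\<delta> + vmono v))"
    unfolding subst_mono_def by (intro has_lead_prod has_lead_power assms) simp
  also have "(\<Sum>v\<in>supp e. nmul (coef e v) (\<delta> + vmono v)) = nmul (mdeg e) \<delta> + e"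
  proof -
    have "coef (\<Sum>v\<in>supp e. nmul (coef e v) (\<delta> + vmono v)) x = coef (nmul (mdeg e) \<delta> + e) x" for x
    proof -
      have "coef (\<Sum>v\<in>supp e. nmul (coef e v) (\<delta> + vmono v)) x =
          (\<Sum>v\<in>supp e. coef e v * coef \<delta> x + (if x = v then coef e v else 0))"
        unfolding coef_sum by (rule sum.cong) (simp_all add: coef_nmul lookup_add coef_vmono distrib_left)
      also have "\<dots> = (\<Sum>v\<in>supp e. coef e v) * coef \<delta> x + coef e x"
        by (simp add: sum.distrib sum_distrib_right in_keys_iff)
      finally show ?thesis by (simp add: coef_nmul lookup_add mdeg_def weight_def)
    qed
    then show ?thesis by (intro Poly_Mapping.poly_mapping_eqI)
  qed
  finally show ?thesis .
qed

lemma coef_subst_lead: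
  assumes lead: "\<And>v. has_lead w (\<psi> v) (\<delta> + vmono v)"
    and f: "homogeneous_poly e f" "u \<in> supp f" "\<And>u'. u' \<in> supp f \<Longrightarrow> weight w u' \<le> weight w u"
  shows "coef (subst \<psi> f) (nmul e \<delta> + u) \<noteq> 0"
    and "bounded_by w (subst \<psi> f) (weight w (nmul e \<delta> + u))"
proof -
  have l: "has_lead w (subst_mono \<psi> u') (nmul e \<delta> + u')" if "u' \<in> supp f" for u'
    using has_lead_subst_mono[OF lead, of u'] f(1) that by (simp add: homogeneous_poly_iff)
  have "coef (subst_mono \<psi> u') (nmul e \<delta> + u) = 0" if u': "u' \<in> supp f" "u' \<noteq> u" for u'
  proof (rule ccontr)
    assume "coef (subst_mono \<psi> u') (nmul e \<delta> + u) \<noteq> 0"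
    then have "nmul e \<delta> + u \<in> supp (subst_mono \<psi> u')" by (simp add: in_keys_iff)
    then have "nmul e \<delta> + u = nmul e \<delta> + u' \<or> weight w (nmul e \<delta> + u) < weight w (nmul e \<delta> + u')"
      using l[OF u'(1)] unfolding has_lead_def by blast
    then show False using f(3)[OF u'(1)] u'(2) by auto
  qed
  then have "coef (subst \<psi> f) (nmul e \<delta> + u) =
      (\<Sum>u'\<in>supp f. if u' = u then coef f u * coef (subst_mono \<psi> u) (nmul e \<delta> + u) else 0)"
    unfolding subst_eq coef_sum coef_const_mult by (intro sum.cong) auto
  also have "\<dots> = coef f u * coef (subst_mono \<psi> u) (nmul e \<delta> + u)" using f(2) by simp
  finally show "coef (subst \<psi> f) (nmul e \<delta> + u) \<noteq> 0"
    using l[OF f(2)] f(2) by (simp add: has_lead_def in_keys_iff)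
  show "bounded_by w (subst \<psi> f) (weight w (nmul e \<delta> + u))"
    unfolding subst_eq
  proof (rule bounded_sum)
    fix u' assume u': "u' \<in> supp f"
    have "bounded_by w (subst_mono \<psi> u') (weight w (nmul e \<delta> + u))"
      by (rule bounded_weaken[OF has_lead_bounded[OF l[OF u']]]) (use f(3)[OF u'] in simp)
    then show "bounded_by w (const_poly (coef f u') * subst_mono \<psi> u') (weight w (nmul e \<delta> + u))"
      by (auto simp: bounded_by_def in_keys_iff coef_const_mult)
  qed
qed


section \<open>The leading monomial of a minor\<close>

definition strictly_monge :: "nat \<Rightarrow> (nat \<Rightarrow> nat \<Rightarrow> int) \<Rightarrow> bool" where
  "strictly_monge n \<omega> \<longleftrightarrow> (\<forall>a a' b b'. a < a' \<longrightarrow> a' < n \<longrightarrow> b < b' \<longrightarrow> b' < n \<longrightarrow>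
     \<omega> a b' + \<omega> a' b < \<omega> a b + \<omega> a' b')"

text \<open>Potentials \<open>p\<close> with \<open>\<omega> a b \<le> \<omega> b b + p a - p b\<close>, strictly for \<open>a < b\<close>, bound the weight of every
  permutation by that of the identity.\<close>

lemma strictly_monge_permutation:
  assumes "strictly_monge n \<omega>" "\<pi> permutes {..<n}" "\<pi> \<noteq> id"
  shows "(\<Sum>a<n. \<omega> a (\<pi> a)) < (\<Sum>a<n. \<omega> a a)"
proof -
  define q where "q l = \<omega> (Suc l) l - \<omega> l l" for l
  define p where "p a = (\<Sum>l<a. q l)" for a
  have M: "\<omega> a b' + \<omega> a' b < \<omega> a b + \<omega> a' b'" if "a < a'" "a' < n" "b < b'" "b' < n" for a a' b b'
    using assms(1) that unfolding strictly_monge_def by blast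
  have up: "\<omega> (b + k) b - \<omega> b b \<le> p (b + k) - p b" if "b + k < n" for b k
    using that
  proof (induction k)
    case (Suc k)
    have "\<omega> (Suc (b + k)) b - \<omega> (b + k) b \<le> q (b + k)"
      using M[of "b + k" "Suc (b + k)" b "b + k"] Suc.prems by (cases "k = 0") (auto simp: q_def)
    then show ?case using Suc by (simp add: p_def)
  qed simp
  have down: "\<omega> a (a + Suc k) - \<omega> (a + Suc k) (a + Suc k) < p a - p (a + Suc k)" if "a + Suc k < n" for a k
  proof -
    define b where "b = a + Suc k"
    have "\<omega> (b - Suc j) b - \<omega> b b < p (b - Suc j) - p b" if "Suc j \<le> b" "b < n" for j
      using that
    proof (induction j)
      case 0
      then obtain c where c: "b = Suc c" by (cases b) auto
      then show ?case using M[of c "Suc c" c "Suc c"] 0 by (simp add: p_def q_def)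
    next
      case (Suc j)
      define c where "c = b - Suc (Suc j)"
      have c: "b - Suc j = Suc c" "c < b" using Suc.prems by (auto simp: c_def)
      have "\<omega> c b + \<omega> (Suc c) c < \<omega> c c + \<omega> (Suc c) b" using M[of c "Suc c" c b] Suc.prems c by auto
      then show ?case using Suc c unfolding c_def[symmetric] by (simp add: p_def q_def)
    qed
    from this[of k] show ?thesis using that by (simp add: b_def)
  qed
  have le: "\<omega> a b \<le> \<omega> b b + p a - p b" if "a < n" "b < n" for a b
  proof (cases "b \<le> a")
    case True
    then show ?thesis using up[of b "a - b"] that by simp
  next
    case False
    then obtain k where "b = a + Suc k" using less_imp_Suc_add[of a b] by auto
    then show ?thesis using down[of a k] that by simp
  qed
  have lt: "\<omega> a b < \<omega> b b + p a - p b" if "a < b" "b < n" for a b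
  proof -
    obtain k where "b = a + Suc k" using \<open>a < b\<close> less_imp_Suc_add[of a b] by auto
    then show ?thesis using down[of a k] that by simp
  qed
  have bij: "bij_betw \<pi> {..<n} {..<n}" using assms(2) by (rule permutes_imp_bij)
  have in_range: "\<pi> a < n" if "a < n" for a using permutes_in_image[OF assms(2), of a] that by simp
  have "\<exists>a<n. a < \<pi> a"
  proof (rule ccontr)
    assume no: "\<not> (\<exists>a<n. a < \<pi> a)"
    have "\<pi> a = a" if "a < n" for a
      using that
    proof (induction a rule: less_induct)
      case (less a)
      have "\<pi> a \<le> a" using no less.prems by (meson not_le_imp_less)
      moreover have "\<not> \<pi> a < a"
      proof
        assume lt': "\<pi> a < a"
        then have "\<pi> (\<pi> a) = \<pi> a" using less by simp
        then show False using permutes_inj[OF assms(2)] lt' by (metis injD less_irrefl)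
      qed
      ultimately show ?case by simp
    qed
    then have "\<pi> = id" using assms(2) by (auto simp: permutes_def fun_eq_iff)
    then show False using assms(3) by simp
  qed
  then obtain a0 where a0: "a0 < n" "a0 < \<pi> a0" by blast
  have "(\<Sum>a<n. \<omega> a (\<pi> a)) < (\<Sum>a<n. \<omega> (\<pi> a) (\<pi> a) + p a - p (\<pi> a))"
    by (rule sum_strict_mono_ex1) (use le in_range lt a0 in \<open>auto intro!: bexI[of _ a0]\<close>)
  also have "\<dots> = (\<Sum>a<n. \<omega> (\<pi> a) (\<pi> a)) + (\<Sum>a<n. p a) - (\<Sum>a<n. p (\<pi> a))"
    by (simp add: sum.distrib sum_subtractf)
  also have "\<dots> = (\<Sum>a<n. \<omega> a a)"
    using sum.reindex_bij_betw[OF bij, of "\<lambda>b. \<omega> b b"] sum.reindex_bij_betw[OF bij, of p] by simp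
  finally show ?thesis .
qed

lemma det_has_lead:
  fixes M :: "('v, 'k::field) mpoly mat"
  assumes M: "M \<in> carrier_mat n n"
    and ent: "\<And>a b. a < n \<Longrightarrow> b < n \<Longrightarrow> M $$ (a, b) = var (\<eta> a b) \<or> M $$ (a, b) = 0"
    and diag: "\<And>a. a < n \<Longrightarrow> M $$ (a, a) = var (\<eta> a a)"
    and monge: "strictly_monge n (\<lambda>a b. w (\<eta> a b))"
  shows "has_lead w (det M) (\<Sum>a<n. vmono (\<eta> a a))"
proof -
  define f where "f \<pi> = signof \<pi> * (\<Prod>i = 0..<n. M $$ (i, \<pi> i))" for \<pi>
  have det: "det M = (\<Sum>\<pi>\<in>{\<pi>. \<pi> permutes {0..<n}}. f \<pi>)" using det_def'[OF M] by (simp add: f_def)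
  have fin: "finite {\<pi>. \<pi> permutes {0..<n}}" by (simp add: finite_permutations)
  have idp: "id \<in> {\<pi>. \<pi> permutes {0..<n}}" by (simp add: permutes_id)
  let ?D = "\<Sum>a<n. vmono (\<eta> a a)"
  have wD: "weight w ?D = (\<Sum>a<n. w (\<eta> a a))" by (simp add: weight_sum)
  have "has_lead w (\<Prod>i = 0..<n. M $$ (i, i)) (\<Sum>a = 0..<n. vmono (\<eta> a a))"
    by (rule has_lead_prod) (use diag in auto)
  then have fid: "has_lead w (f id) ?D" by (simp add: f_def atLeast0LessThan)
  have "bounded_by w (f \<pi>) (weight w ?D - 1)" if \<pi>: "\<pi> permutes {0..<n}" "\<pi> \<noteq> id" for \<pi>
  proof -
    have \<pi>': "\<pi> permutes {..<n}" using \<pi>(1) by (simp add: atLeast0LessThan)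
    have "bounded_by w (\<Prod>i = 0..<n. M $$ (i, \<pi> i)) (weight w ?D - 1)"
    proof (cases "\<exists>i\<in>{0..<n}. M $$ (i, \<pi> i) = 0")
      case True
      then have "(\<Prod>i = 0..<n. M $$ (i, \<pi> i)) = 0" by (intro prod_zero) auto
      then show ?thesis by (simp add: bounded_by_def)
    next
      case False
      have "M $$ (i, \<pi> i) = var (\<eta> i (\<pi> i))" if "i \<in> {0..<n}" for i
        using ent[of i "\<pi> i"] False that permutes_in_image[OF \<pi>(1), of i] by auto
      then have "has_lead w (\<Prod>i = 0..<n. M $$ (i, \<pi> i)) (\<Sum>i = 0..<n. vmono (\<eta> i (\<pi> i)))"
        by (intro has_lead_prod) auto
      then have "bounded_by w (\<Prod>i = 0..<n. M $$ (i, \<pi> i)) (\<Sum>i<n. w (\<eta> i (\<pi> i)))"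
        using has_lead_bounded by (fastforce simp: weight_sum atLeast0LessThan)
      then show ?thesis
        by (rule bounded_weaken) (use strictly_monge_permutation[OF monge \<pi>' \<pi>(2)] wD in simp)
    qed
    then show ?thesis by (cases "signof \<pi> = (1 :: ('v, 'k) mpoly)") (auto simp: f_def sign_def bounded_uminus)
  qed
  then have "bounded_by w (\<Sum>\<pi>\<in>{\<pi>. \<pi> permutes {0..<n}} - {id}. f \<pi>) (weight w ?D - 1)"
    by (intro bounded_sum) auto
  then have "has_lead w (f id + (\<Sum>\<pi>\<in>{\<pi>. \<pi> permutes {0..<n}} - {id}. f \<pi>)) ?D"
    by (rule has_lead_add_lower[OF fid]) simp
  then show ?thesis unfolding det by (simp add: sum.remove[OF fin idp])
qed


section \<open>Cut inequalities for the initial monomials of powers of ideals of maximal minors\<close>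

text \<open>The increasing enumeration of the row indices other than \<open>i\<close>.\<close>

definition skip :: "nat \<Rightarrow> nat \<Rightarrow> nat" where
  "skip i a = (if a < i then a else Suc a)"

text \<open>A generic matrix whose weights favour the diagonal of each minor, and a set \<open>D\<close> of \<open>n - 1\<close> columns.
  The set \<open>D\<close> determines the cut, which has one entry in each of the other columns, in row \<open>cut_row j\<close>.\<close>

locale generic_matrix_cut =
  fixes n m :: nat and \<xi> :: "nat \<Rightarrow> nat \<Rightarrow> 'v" and w :: "'v \<Rightarrow> int" and D :: "nat set"
    and ty :: "'k::field itself"
  assumes n: "1 \<le> n"
    and inj: "\<And>i j i' j'. i < n \<Longrightarrow> j < m \<Longrightarrow> i' < n \<Longrightarrow> j' < m \<Longrightarrow> \<xi> i j = \<xi> i' j' \<Longrightarrow> i = i' \<and> j = j'"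
    and monge: "\<And>i j i' j'. i < i' \<Longrightarrow> i' < n \<Longrightarrow> j < j' \<Longrightarrow> j' < m \<Longrightarrow>
      w (\<xi> i j') + w (\<xi> i' j) < w (\<xi> i j) + w (\<xi> i' j')"
    and D: "D \<subseteq> {..<m}" "card D = n - 1"
begin

definition "ds = sorted_list_of_set D"

definition "cut_row j = card {x \<in> D. x < j}"

lemma finite_D: "finite D"
  using D(1) finite_subset by blast

lemma ds: "length ds = n - 1" "set ds = D" "sorted_wrt (<) ds"
  using finite_D D(2) by (simp_all add: ds_def)

lemma ds_mono: "a < b \<Longrightarrow> b < n - 1 \<Longrightarrow> ds ! a < ds ! b"
  using ds sorted_wrt_nth_less by metis

lemma ds_in: "a < n - 1 \<Longrightarrow> ds ! a \<in> D \<and> ds ! a < m"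
  using ds D(1) nth_mem by (metis lessThan_iff subsetD)

lemma ds_less_iff:
  assumes "l < n - 1"
  shows "ds ! l < j \<longleftrightarrow> l < cut_row j"
proof
  have inj_ds: "inj_on ((!) ds) {..<n - 1}"
    by (rule inj_onI) (metis ds_mono less_irrefl lessThan_iff linorder_neqE_nat)
  show "l < cut_row j" if lt: "ds ! l < j"
  proof -
    have "ds ! x < j" if "x \<le> l" for x
      using ds_mono[of x l] that lt assms by (cases "x = l") auto
    then have "(!) ds ` {..l} \<subseteq> {x \<in> D. x < j}" using ds_in assms by auto
    then have "card ((!) ds ` {..l}) \<le> cut_row j" unfolding cut_row_def
      by (rule card_mono[rotated]) (use finite_D in simp)
    moreover have "card ((!) ds ` {..l}) = Suc l"
      by (subst card_image) (use inj_ds assms in \<open>auto intro: inj_on_subset\<close>)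
    ultimately show ?thesis by simp
  qed
  show "ds ! l < j" if "l < cut_row j"
  proof (rule ccontr)
    assume "\<not> ds ! l < j"
    then have ge: "j \<le> ds ! l" by simp
    have "{x \<in> D. x < j} \<subseteq> (!) ds ` {..<l}"
    proof
      fix x assume x: "x \<in> {x \<in> D. x < j}"
      then obtain a where a: "a < n - 1" "x = ds ! a" using ds by (metis in_set_conv_nth mem_Collect_eq)
      have "a < l"
      proof (rule ccontr)
        assume "\<not> a < l"
        then have "ds ! l \<le> ds ! a" using ds_mono[of l a] a(1) by (cases "a = l") auto
        then show False using x a(2) ge by auto
      qed
      then show "x \<in> (!) ds ` {..<l}" using a(2) by blast
    qed
    then have "cut_row j \<le> card ((!) ds ` {..<l})" unfolding cut_row_def by (rule card_mono[rotated]) simp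
    also have "\<dots> \<le> l" using card_image_le[of "{..<l}" "(!) ds"] by simp
    finally show False using that by simp
  qed
qed

lemma cut_row_less: "cut_row j < n"
proof -
  have "cut_row j \<le> card D" unfolding cut_row_def by (rule card_mono[OF finite_D]) auto
  then show ?thesis using D(2) n by simp
qed

definition column_matrix :: "(nat \<Rightarrow> ('v, 'k) mpoly) \<Rightarrow> ('v, 'k) mpoly mat" where
  "column_matrix c = mat n n (\<lambda>(i, l). if l < n - 1 then var (\<xi> i (ds ! l)) else c i)"

text \<open>The cofactors \<open>\<gamma>\<close> span the left kernel of the columns of \<open>D\<close>.\<close>

definition \<gamma> :: "nat \<Rightarrow> ('v, 'k) mpoly" where
  "\<gamma> i = cofactor (column_matrix (\<lambda>_. 0)) i (n - 1)"

lemma mat_delete_column_matrix: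
  assumes "i < n"
  shows "mat_delete (column_matrix c) i (n - 1) = mat (n - 1) (n - 1) (\<lambda>(a, b). var (\<xi> (skip i a) (ds ! b)))"
  unfolding mat_delete_def column_matrix_def skip_def
  by (rule eq_matI) (use assms in auto)

lemma det_column_matrix: "det (column_matrix c) = (\<Sum>i<n. \<gamma> i * c i)"
proof -
  have car: "column_matrix c \<in> carrier_mat n n" by (simp add: column_matrix_def)
  have "det (column_matrix c) = (\<Sum>i<n. column_matrix c $$ (i, n - 1) * cofactor (column_matrix c) i (n - 1))"
    by (rule laplace_expansion_column[OF car]) (use n in simp)
  also have "\<dots> = (\<Sum>i<n. \<gamma> i * c i)"
  proof (rule sum.cong[OF refl])
    fix i assume "i \<in> {..<n}"
    then have i: "i < n" by simp
    have "cofactor (column_matrix c) i (n - 1) = \<gamma> i"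
      unfolding \<gamma>_def cofactor_def mat_delete_column_matrix[OF i] ..
    moreover have "column_matrix c $$ (i, n - 1) = c i" using i by (simp add: column_matrix_def)
    ultimately show "column_matrix c $$ (i, n - 1) * cofactor (column_matrix c) i (n - 1) = \<gamma> i * c i"
      by (simp add: mult.commute)
  qed
  finally show ?thesis .
qed

lemma \<gamma>_kernel:
  assumes "j \<in> D"
  shows "(\<Sum>i<n. \<gamma> i * var (\<xi> i j)) = 0"
proof -
  obtain l where l: "l < n - 1" "j = ds ! l" using assms ds by (metis in_set_conv_nth)
  have "det (column_matrix (\<lambda>i. var (\<xi> i j))) = 0"
  proof (rule det_identical_columns)
    show "column_matrix (\<lambda>i. var (\<xi> i j)) \<in> carrier_mat n n" by (simp add: column_matrix_def)
    show "col (column_matrix (\<lambda>i. var (\<xi> i j))) l = col (column_matrix (\<lambda>i. var (\<xi> i j))) (n - 1)"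
      using l by (intro eq_vecI) (auto simp: column_matrix_def)
  qed (use l in auto)
  then show ?thesis by (simp add: det_column_matrix)
qed

definition \<gamma>_lead :: "nat \<Rightarrow> 'v \<Rightarrow>\<^sub>0 nat" where
  "\<gamma>_lead i = (\<Sum>a<n - 1. vmono (\<xi> (skip i a) (ds ! a)))"

lemma has_lead_\<gamma>:
  assumes "i < n"
  shows "has_lead w (\<gamma> i) (\<gamma>_lead i)"
proof -
  have "has_lead w (det (mat (n - 1) (n - 1) (\<lambda>(a, b). var (\<xi> (skip i a) (ds ! b)) :: ('v, 'k) mpoly)))
      (\<Sum>a<n - 1. vmono (\<xi> (skip i a) (ds ! a)))"
  proof (rule det_has_lead[where \<eta> = "\<lambda>a b. \<xi> (skip i a) (ds ! b)"])
    show "strictly_monge (n - 1) (\<lambda>a b. w (\<xi> (skip i a) (ds ! b)))"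
      unfolding strictly_monge_def
    proof (intro allI impI)
      fix a a' b b' assume *: "a < a'" "a' < n - 1" "b < b'" "b' < n - 1"
      show "w (\<xi> (skip i a) (ds ! b')) + w (\<xi> (skip i a') (ds ! b)) < w (\<xi> (skip i a) (ds ! b)) + w (\<xi> (skip i a') (ds ! b'))"
        by (rule monge) (use * ds_mono ds_in in \<open>auto simp: skip_def\<close>)
    qed
  qed auto
  then show ?thesis
    unfolding \<gamma>_def cofactor_def mat_delete_column_matrix[OF assms] \<gamma>_lead_def by (rule has_lead_signed)
qed

lemma \<gamma>_lead_step:
  assumes "Suc i < n"
  shows "weight w (\<gamma>_lead (Suc i)) - weight w (\<gamma>_lead i) = w (\<xi> i (ds ! i)) - w (\<xi> (Suc i) (ds ! i))"
proof -
  have "weight w (\<gamma>_lead (Suc i)) - weight w (\<gamma>_lead i) =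
      (\<Sum>a<n - 1. w (\<xi> (skip (Suc i) a) (ds ! a)) - w (\<xi> (skip i a) (ds ! a)))"
    by (simp add: \<gamma>_lead_def weight_sum sum_subtractf)
  also have "\<dots> = (\<Sum>a<n - 1. if a = i then w (\<xi> i (ds ! i)) - w (\<xi> (Suc i) (ds ! i)) else 0)"
    by (rule sum.cong) (auto simp: skip_def)
  also have "\<dots> = w (\<xi> i (ds ! i)) - w (\<xi> (Suc i) (ds ! i))" using assms by auto
  finally show ?thesis .
qed

text \<open>In the expansion of the minor of the columns \<open>D \<union> {j}\<close> along column \<open>j\<close> the highest weight occurs in
  row \<open>cut_row j\<close>: going down the rows the weight increases until that row and then decreases.\<close>

lemma \<gamma>_lead_max:
  assumes j: "j < m" "j \<notin> D" and i: "i < n" "i \<noteq> cut_row j"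
  shows "weight w (\<gamma>_lead i) + w (\<xi> i j) < weight w (\<gamma>_lead (cut_row j)) + w (\<xi> (cut_row j) j)"
proof -
  define h where "h i = weight w (\<gamma>_lead i) + w (\<xi> i j)" for i
  have up: "h i < h (Suc i)" if "Suc i \<le> cut_row j" for i
  proof -
    have i: "Suc i < n" using that cut_row_less[of j] by simp
    have "ds ! i < j" using ds_less_iff[of i j] that i by simp
    then show ?thesis using \<gamma>_lead_step[OF i] monge[of i "Suc i" "ds ! i" j] i j(1) by (simp add: h_def)
  qed
  have down: "h (Suc i) < h i" if "cut_row j \<le> i" "Suc i < n" for i
  proof -
    have i': "i < n - 1" using that by simp
    have "\<not> ds ! i < j" using ds_less_iff[OF i', of j] that by simp
    moreover have "ds ! i \<noteq> j" using ds_in[OF i'] j(2) by blast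
    ultimately have "j < ds ! i" by simp
    then show ?thesis
      using \<gamma>_lead_step[OF that(2)] monge[of i "Suc i" j "ds ! i"] that ds_in[OF i'] by (simp add: h_def)
  qed
  show ?thesis
  proof (cases "i < cut_row j")
    case True
    have "h i < h (i + Suc k)" if "i + Suc k \<le> cut_row j" for k
      using that
    proof (induction k)
      case (Suc k)
      then show ?case using up[of "i + Suc k"] by fastforce
    qed (use up in auto)
    from this[of "cut_row j - i - 1"] True show ?thesis by (simp add: h_def)
  next
    case False
    have "h (cut_row j + Suc k) < h (cut_row j)" if "cut_row j + Suc k < n" for k
      using that
    proof (induction k)
      case (Suc k)
      then show ?case using down[of "cut_row j + Suc k"] by fastforce
    qed (use down in auto)
    from this[of "i - cut_row j - 1"] False i show ?thesis by (simp add: h_def)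
  qed
qed

definition "\<delta> = (\<Prod>i<n. \<gamma> i)"
definition "\<delta>' r = (\<Prod>i\<in>{..<n} - {r}. \<gamma> i)"
definition "\<delta>_lead = (\<Sum>i<n. \<gamma>_lead i)"

text \<open>Up to the common factor \<open>\<delta>\<close>, the substitution adds to the variable at row \<open>cut_row j\<close> of a column
  \<open>j \<notin> D\<close> the element that makes the column lie in the span of the columns of \<open>D\<close> as soon as that
  variable is set to zero.\<close>

definition \<psi> :: "'v \<Rightarrow> ('v, 'k) mpoly" where
  "\<psi> v = \<delta> * var v - (\<Sum>j\<in>{..<m} - D. if v = \<xi> (cut_row j) j
     then \<delta>' (cut_row j) * (\<Sum>i\<in>{..<n} - {cut_row j}. \<gamma> i * var (\<xi> i j)) else 0)"

lemma \<delta>_split: "r < n \<Longrightarrow> \<delta> = \<gamma> r * \<delta>' r"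
  unfolding \<delta>_def \<delta>'_def by (rule prod.remove) auto

lemma has_lead_\<psi>: "has_lead w (\<psi> v) (\<delta>_lead + vmono v)"
proof -
  have \<delta>l: "has_lead w \<delta> \<delta>_lead"
    unfolding \<delta>_def \<delta>_lead_def by (rule has_lead_prod) (use has_lead_\<gamma> in auto)
  have "bounded_by w (- (\<Sum>j\<in>{..<m} - D. if v = \<xi> (cut_row j) j
     then \<delta>' (cut_row j) * (\<Sum>i\<in>{..<n} - {cut_row j}. \<gamma> i * var (\<xi> i j)) else 0)) (weight w (\<delta>_lead + vmono v) - 1)"
  proof (intro bounded_uminus bounded_sum)
    fix j assume j: "j \<in> {..<m} - D"
    let ?r = "cut_row j"
    have r: "?r < n" by (rule cut_row_less)
    have dl': "has_lead w (\<delta>' ?r) (\<Sum>i\<in>{..<n} - {?r}. \<gamma>_lead i)"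
      unfolding \<delta>'_def by (rule has_lead_prod) (use has_lead_\<gamma> in auto)
    have split: "\<delta>_lead = \<gamma>_lead ?r + (\<Sum>i\<in>{..<n} - {?r}. \<gamma>_lead i)"
      unfolding \<delta>_lead_def by (rule sum.remove) (use r in auto)
    show "bounded_by w (if v = \<xi> ?r j then \<delta>' ?r * (\<Sum>i\<in>{..<n} - {?r}. \<gamma> i * var (\<xi> i j)) else 0)
        (weight w (\<delta>_lead + vmono v) - 1)"
    proof (cases "v = \<xi> ?r j")
      case True
      have "bounded_by w (\<Sum>i\<in>{..<n} - {?r}. \<gamma> i * var (\<xi> i j)) (weight w (\<gamma>_lead ?r) + w v - 1)"
      proof (rule bounded_sum)
        fix i assume i: "i \<in> {..<n} - {?r}"
        have "has_lead w (\<gamma> i * var (\<xi> i j)) (\<gamma>_lead i + vmono (\<xi> i j))"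
          by (rule has_lead_mult) (use has_lead_\<gamma> i in auto)
        then have "bounded_by w (\<gamma> i * var (\<xi> i j)) (weight w (\<gamma>_lead i + vmono (\<xi> i j)))" by (rule has_lead_bounded)
        then show "bounded_by w (\<gamma> i * var (\<xi> i j)) (weight w (\<gamma>_lead ?r) + w v - 1)"
          by (rule bounded_weaken) (use \<gamma>_lead_max[of j i] i j True in auto)
      qed
      from bounded_mult[OF has_lead_bounded[OF dl'] this] True show ?thesis
        by (simp add: split algebra_simps)
    qed (simp add: bounded_by_def)
  qed
  from has_lead_add_lower[OF has_lead_mult[OF \<delta>l has_lead_var] this] show ?thesis
    by (simp add: \<psi>_def)
qed

definition "cut_deg u = (\<Sum>j\<in>{..<m} - D. coef u (\<xi> (cut_row j) j))"

lemma cut_deg_simps [simp]: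
  "cut_deg 0 = 0" "cut_deg (a + b) = cut_deg a + cut_deg b"
  by (simp_all add: cut_deg_def lookup_add sum.distrib)

lemma cut_deg_sum: "cut_deg (sum f A) = (\<Sum>x\<in>A. cut_deg (f x))"
  by (induction A rule: infinite_finite_induct) simp_all

lemma cut_deg_nmul: "cut_deg (nmul k a) = k * cut_deg a"
  by (induction k) simp_all

lemma cut_deg_vmono_D: "i < n \<Longrightarrow> d \<in> D \<Longrightarrow> cut_deg (vmono (\<xi> i d)) = 0"
  unfolding cut_deg_def
proof (rule sum.neutral, rule ballI)
  fix j assume *: "i < n" "d \<in> D" "j \<in> {..<m} - D"
  then have "\<xi> i d \<noteq> \<xi> (cut_row j) j" using inj[of i d "cut_row j" j] cut_row_less D(1) by auto
  then show "coef (vmono (\<xi> i d)) (\<xi> (cut_row j) j) = 0" by (auto simp: coef_vmono)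
qed

lemma cut_deg_\<gamma>_lead:
  assumes "i < n"
  shows "cut_deg (\<gamma>_lead i) = 0"
  unfolding \<gamma>_lead_def cut_deg_sum
proof (rule sum.neutral, rule ballI)
  fix a assume a: "a \<in> {..<n - 1}"
  then have "skip i a < n" "ds ! a \<in> D" using ds_in[of a] by (auto simp: skip_def)
  then show "cut_deg (vmono (\<xi> (skip i a) (ds ! a))) = 0" by (rule cut_deg_vmono_D)
qed

text \<open>Vanishing to order at least \<open>t\<close> along the entries of the cut.\<close>

definition cut_ge :: "nat \<Rightarrow> ('v, 'k) mpoly \<Rightarrow> bool" where
  "cut_ge t p \<longleftrightarrow> (\<forall>u\<in>supp p. t \<le> cut_deg u)"

lemma cut_ge_zero_poly [simp]: "cut_ge t 0"
  by (simp add: cut_ge_def)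

lemma cut_ge_0 [simp]: "cut_ge 0 p"
  by (simp add: cut_ge_def)

lemma cut_ge_sum: "(\<And>x. x \<in> A \<Longrightarrow> cut_ge t (f x)) \<Longrightarrow> cut_ge t (sum f A)"
  unfolding cut_ge_def by (meson supp_sum_cases)

lemma cut_ge_mult:
  assumes "cut_ge s p" "cut_ge t q"
  shows "cut_ge (s + t) (p * q)"
  unfolding cut_ge_def
proof
  fix u assume "u \<in> supp (p * q)"
  then obtain a b where "a \<in> supp p" "b \<in> supp q" "u = a + b" using supp_poly_mult_cases by blast
  then show "s + t \<le> cut_deg u" using assms by (auto simp: cut_ge_def intro: add_mono)
qed

lemma cut_ge_prod: "(\<And>s. s < t \<Longrightarrow> cut_ge 1 (f s)) \<Longrightarrow> cut_ge t (\<Prod>s<t. f s)"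
proof (induction t)
  case (Suc t)
  have "cut_ge (t + 1) ((\<Prod>s<t. f s) * f t)" by (rule cut_ge_mult) (use Suc in auto)
  then show ?case by simp
qed simp

text \<open>After the substitution the row vector \<open>\<gamma>\<close> annihilates all columns up to multiples of the entries of
  the cut.\<close>

lemma \<psi>_kernel:
  assumes j: "j < m"
  shows "cut_ge 1 (\<Sum>i<n. \<gamma> i * \<psi> (\<xi> i j))"
proof (cases "j \<in> D")
  case True
  have "\<psi> (\<xi> i j) = \<delta> * var (\<xi> i j)" if "i < n" for i
  proof -
    have "\<xi> i j \<noteq> \<xi> (cut_row j') j'" if j': "j' \<in> {..<m} - D" for j'
      using inj[of i j "cut_row j'" j'] \<open>i < n\<close> j cut_row_less j' True by auto
    then show ?thesis by (auto simp: \<psi>_def intro!: sum.neutral)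
  qed
  then have "(\<Sum>i<n. \<gamma> i * \<psi> (\<xi> i j)) = \<delta> * (\<Sum>i<n. \<gamma> i * var (\<xi> i j))"
    by (simp add: sum_distrib_left mult_ac)
  then show ?thesis by (simp add: \<gamma>_kernel[OF True])
next
  case False
  let ?r = "cut_row j"
  have r: "?r < n" by (rule cut_row_less)
  let ?rest = "\<Sum>i\<in>{..<n} - {?r}. \<gamma> i * var (\<xi> i j)"
  have eq: "\<psi> (\<xi> i j) = \<delta> * var (\<xi> i j) - (if i = ?r then \<delta>' ?r * ?rest else 0)" if "i < n" for i
  proof -
    have "(\<Sum>j'\<in>{..<m} - D. if \<xi> i j = \<xi> (cut_row j') j'
        then \<delta>' (cut_row j') * (\<Sum>i\<in>{..<n} - {cut_row j'}. \<gamma> i * var (\<xi> i j')) else 0) =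
      (\<Sum>j'\<in>{..<m} - D. if j' = j then (if i = ?r then \<delta>' ?r * ?rest else 0) else 0)"
    proof (rule sum.cong[OF refl])
      fix j' assume j': "j' \<in> {..<m} - D"
      have "\<xi> i j = \<xi> (cut_row j') j' \<longleftrightarrow> j' = j \<and> i = ?r"
        using inj[of i j "cut_row j'" j'] that j cut_row_less j' by auto
      then show "(if \<xi> i j = \<xi> (cut_row j') j'
        then \<delta>' (cut_row j') * (\<Sum>i\<in>{..<n} - {cut_row j'}. \<gamma> i * var (\<xi> i j')) else 0) =
        (if j' = j then (if i = ?r then \<delta>' ?r * ?rest else 0) else 0)" by auto
    qed
    then show ?thesis using j False by (simp add: \<psi>_def)
  qed
  have "(\<Sum>i<n. \<gamma> i * \<psi> (\<xi> i j)) = \<gamma> ?r * \<psi> (\<xi> ?r j) + (\<Sum>i\<in>{..<n} - {?r}. \<gamma> i * \<psi> (\<xi> i j))"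
    by (rule sum.remove) (use r in auto)
  also have "(\<Sum>i\<in>{..<n} - {?r}. \<gamma> i * \<psi> (\<xi> i j)) = \<delta> * ?rest"
    unfolding sum_distrib_left by (rule sum.cong) (auto simp: eq)
  also have "\<gamma> ?r * \<psi> (\<xi> ?r j) + \<delta> * ?rest = \<gamma> ?r * \<delta> * var (\<xi> ?r j)"
    using \<delta>_split[OF r] by (simp add: eq[OF r] algebra_simps)
  finally have *: "(\<Sum>i<n. \<gamma> i * \<psi> (\<xi> i j)) = \<gamma> ?r * \<delta> * var (\<xi> ?r j)" .
  have "cut_deg (vmono (\<xi> ?r j)) \<ge> 1"
  proof -
    have "coef (vmono (\<xi> ?r j)) (\<xi> (cut_row j) j) \<le> cut_deg (vmono (\<xi> ?r j))"
      unfolding cut_deg_def by (rule member_le_sum) (use j False in auto)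
    then show ?thesis by (simp add: coef_vmono)
  qed
  then have "cut_ge 1 (var (\<xi> ?r j))" by (simp add: cut_ge_def var_eq)
  then have "cut_ge (0 + 1) (\<gamma> ?r * \<delta> * var (\<xi> ?r j))" by (intro cut_ge_mult cut_ge_0)
  then show ?thesis unfolding * by simp
qed

definition gminor :: "(nat \<Rightarrow> nat) \<Rightarrow> ('v, 'k) mpoly" where
  "gminor a = det (mat n n (\<lambda>(i, l). var (\<xi> i (a l))))"

text \<open>Modulo the entries of the cut the rows of the substituted matrix are linearly dependent with
  coefficients \<open>\<gamma>\<close>, so that \<open>\<gamma> 0\<close> times a maximal minor vanishes.\<close>

lemma cut_ge_minor:
  assumes "\<And>l. l < n \<Longrightarrow> a l < m"
  shows "cut_ge 1 (\<gamma> 0 * subst \<psi> (gminor a))"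
proof -
  define B where "B = mat n n (\<lambda>(i, l). \<psi> (\<xi> i (a l)))"
  have B: "B \<in> carrier_mat n n" by (simp add: B_def)
  have "map_mat (subst \<psi>) (mat n n (\<lambda>(i, l). var (\<xi> i (a l)))) = B"
    by (rule eq_matI) (auto simp: B_def)
  then have sd: "subst \<psi> (gminor a) = det B" by (simp add: gminor_def subst_det)
  have adj: "adj_mat B \<in> carrier_mat n n" "B * adj_mat B = det B \<cdot>\<^sub>m 1\<^sub>m n" using adj_mat[OF B] by auto
  have row: "(\<Sum>l<n. B $$ (i, l) * adj_mat B $$ (l, 0)) = (if i = 0 then det B else 0)" if "i < n" for i
  proof -
    have "(B * adj_mat B) $$ (i, 0) = (\<Sum>l = 0..<n. B $$ (i, l) * adj_mat B $$ (l, 0))"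
      using B adj(1) that n by (auto simp: scalar_prod_def intro!: sum.cong)
    moreover have "(B * adj_mat B) $$ (i, 0) = (if i = 0 then det B else 0)" using adj(2) that n by simp
    ultimately show ?thesis by (simp add: atLeast0LessThan)
  qed
  have "\<gamma> 0 * det B = (\<Sum>i<n. \<gamma> i * (if i = 0 then det B else 0))"
    using n by (simp add: if_distrib cong: if_cong)
  also have "\<dots> = (\<Sum>i<n. \<gamma> i * (\<Sum>l<n. B $$ (i, l) * adj_mat B $$ (l, 0)))"
    by (rule sum.cong) (simp_all add: row)
  also have "\<dots> = (\<Sum>i<n. \<Sum>l<n. \<gamma> i * B $$ (i, l) * adj_mat B $$ (l, 0))"
    by (simp add: sum_distrib_left mult.assoc)
  also have "\<dots> = (\<Sum>l<n. (\<Sum>i<n. \<gamma> i * B $$ (i, l)) * adj_mat B $$ (l, 0))"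
    unfolding sum_distrib_right by (rule sum.swap)
  also have "\<dots> = (\<Sum>l<n. (\<Sum>i<n. \<gamma> i * \<psi> (\<xi> i (a l))) * adj_mat B $$ (l, 0))"
    by (rule sum.cong) (simp_all add: B_def)
  finally have eq: "\<gamma> 0 * det B = (\<Sum>l<n. (\<Sum>i<n. \<gamma> i * \<psi> (\<xi> i (a l))) * adj_mat B $$ (l, 0))" .
  have "cut_ge (1 + 0) ((\<Sum>i<n. \<gamma> i * \<psi> (\<xi> i (a l))) * adj_mat B $$ (l, 0))" if "l < n" for l
    by (intro cut_ge_mult \<psi>_kernel assms that cut_ge_0)
  then show ?thesis unfolding sd eq by (intro cut_ge_sum) auto
qed

text \<open>The substitution \<open>\<psi>\<close> sends every maximal minor, up to the factor \<open>\<gamma> 0\<close>, into the ideal of the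
  entries of the cut, so the image of an element of the \<open>t\<close>-th power of the ideal of maximal minors vanishes to
  order \<open>t\<close> along the cut. As \<open>\<psi>\<close> multiplies each variable by the same leading monomial up to lower terms,
  and the factors involve only the columns of \<open>D\<close>, the initial monomial itself has degree at least \<open>t\<close> in the
  entries of the cut.\<close>

theorem cut_inequality:
  assumes f: "f = (\<Sum>k<K. p k * (\<Prod>s<t. gminor (a k s)))"
    and a: "\<And>k s l. k < K \<Longrightarrow> s < t \<Longrightarrow> l < n \<Longrightarrow> a k s l < m"
    and hom: "homogeneous_poly e f" and u: "u \<in> supp f" "\<And>u'. u' \<in> supp f \<Longrightarrow> weight w u' \<le> weight w u"
  shows "t \<le> cut_deg u"
proof -
  have prod: "subst \<psi> (\<Prod>s<t'. gminor (b s)) = (\<Prod>s<t'. subst \<psi> (gminor (b s)))" for b and t' :: nat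
    by (induction t') (simp_all add: subst_mult)
  have "\<gamma> 0 ^ t * subst \<psi> f = (\<Sum>k<K. subst \<psi> (p k) * (\<Prod>s<t. \<gamma> 0 * subst \<psi> (gminor (a k s))))"
    by (simp add: f subst_sum subst_mult prod sum_distrib_left prod.distrib mult_ac)
  moreover have "cut_ge (0 + t) (subst \<psi> (p k) * (\<Prod>s<t. \<gamma> 0 * subst \<psi> (gminor (a k s))))" if "k < K" for k
    by (intro cut_ge_mult cut_ge_prod cut_ge_minor cut_ge_0) (use a that in auto)
  ultimately have ge: "cut_ge t (\<gamma> 0 ^ t * subst \<psi> f)" by (auto intro!: cut_ge_sum)
  have "has_lead w (\<gamma> 0 ^ t) (nmul t (\<gamma>_lead 0))" by (intro has_lead_power has_lead_\<gamma>) (use n in simp)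
  moreover have "bounded_by w (subst \<psi> f) (weight w (nmul e \<delta>_lead + u))"
    by (rule coef_subst_lead(2)[OF has_lead_\<psi> hom u])
  ultimately have "coef (\<gamma> 0 ^ t * subst \<psi> f) (nmul t (\<gamma>_lead 0) + (nmul e \<delta>_lead + u)) =
      coef (\<gamma> 0 ^ t) (nmul t (\<gamma>_lead 0)) * coef (subst \<psi> f) (nmul e \<delta>_lead + u)"
    by (rule coef_mult_lead)
  also have "\<dots> \<noteq> 0"
    using \<open>has_lead w (\<gamma> 0 ^ t) (nmul t (\<gamma>_lead 0))\<close> coef_subst_lead(1)[OF has_lead_\<psi> hom u]
    by (simp add: has_lead_def)
  finally have "t \<le> cut_deg (nmul t (\<gamma>_lead 0) + (nmul e \<delta>_lead + u))"
    using ge unfolding cut_ge_def in_keys_iff[symmetric] by (rule bspec[rotated])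
  also have "\<dots> = cut_deg u"
    using cut_deg_\<gamma>_lead n by (simp add: cut_deg_nmul \<delta>_lead_def cut_deg_sum)
  finally show ?thesis .
qed

end


section \<open>Tableaux and chains\<close>

text \<open>The number of cells in row \<open>i - 1\<close> and the columns before \<open>j\<close> that can be filled when \<open>t\<close> chains are
  built row by row, as far to the left as possible, with at most \<open>u i j\<close> of them through the cell \<open>(i, j)\<close>. The
  chains start in a virtual row \<open>0\<close> above the matrix; a chain moves on to a column further right in the next row.\<close>

fun greedy :: "(nat \<Rightarrow> nat \<Rightarrow> nat) \<Rightarrow> nat \<Rightarrow> nat \<Rightarrow> nat \<Rightarrow> nat" where
  "greedy u t 0 j = t"
| "greedy u t (Suc i) 0 = 0"
| "greedy u t (Suc i) (Suc j) = min (greedy u t (Suc i) j + u i j) (greedy u t i j)"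

lemma greedy_mono: "greedy u t i j \<le> greedy u t i (Suc j) \<and> greedy u t (Suc i) j \<le> greedy u t i j"
proof (induction i arbitrary: j)
  case 0
  have b: "greedy u t (Suc 0) j \<le> t" for j by (cases j) auto
  then show ?case by simp
next
  case (Suc i)
  have a: "greedy u t (Suc i) j \<le> greedy u t (Suc i) (Suc j)" for j using Suc[of j] by simp
  have "greedy u t (Suc (Suc i)) j \<le> greedy u t (Suc i) j"
  proof (cases j)
    case (Suc j')
    then show ?thesis using a[of j'] by (metis greedy.simps(3) min.coboundedI2)
  qed simp
  then show ?case using a by blast
qed

lemma greedy_le: "greedy u t i j \<le> t"
proof (induction i)
  case (Suc i)
  then show ?case using greedy_mono[of u t i j] by linarith
qed simp

text \<open>If the greedy choice of \<open>t\<close> chains fails, then the columns in which it is bounded by the previous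
  row form a cut of too low degree.\<close>

lemma greedy_cut:
  assumes "greedy u t (Suc i) j < t" "i \<le> j"
  shows "\<exists>D\<subseteq>{..<j}. card D = i \<and> (\<Sum>l\<in>{..<j} - D. u (card {x\<in>D. x < l}) l) \<le> greedy u t (Suc i) j"
  using assms
proof (induction j arbitrary: i)
  case 0
  then show ?case by auto
next
  case (Suc j)
  show ?case
  proof (cases "i = Suc j")
    case True
    then show ?thesis by (intro exI[of _ "{..<Suc j}"]) auto
  next
    case False
    then have ij: "i \<le> j" using Suc.prems by simp
    show ?thesis
    proof (cases "greedy u t (Suc i) j + u i j \<le> greedy u t i j")
      case True
      then have eq: "greedy u t (Suc i) (Suc j) = greedy u t (Suc i) j + u i j" by simp
      then obtain D where D: "D \<subseteq> {..<j}" "card D = i"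
        "(\<Sum>l\<in>{..<j} - D. u (card {x\<in>D. x < l}) l) \<le> greedy u t (Suc i) j"
        using Suc.IH[OF _ ij] Suc.prems by auto
      have parts: "{..<Suc j} - D = insert j ({..<j} - D)" "{x\<in>D. x < j} = D" using D(1) by auto
      have "(\<Sum>l\<in>{..<Suc j} - D. u (card {x\<in>D. x < l}) l) = u i j + (\<Sum>l\<in>{..<j} - D. u (card {x\<in>D. x < l}) l)"
        unfolding parts(1) by (subst sum.insert) (simp_all only: finite_Diff finite_lessThan parts(2) D(2), simp)
      then have "(\<Sum>l\<in>{..<Suc j} - D. u (card {x\<in>D. x < l}) l) \<le> greedy u t (Suc i) (Suc j)"
        unfolding eq using D(3) by linarith
      moreover have "D \<subseteq> {..<Suc j}" using D(1) by auto
      ultimately show ?thesis using D(2) by blast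
    next
      case False
      then have eq: "greedy u t (Suc i) (Suc j) = greedy u t i j" by simp
      then have "i \<noteq> 0" using Suc.prems by (cases i) auto
      then obtain i' where i': "i = Suc i'" by (cases i) auto
      then obtain D where D: "D \<subseteq> {..<j}" "card D = i'"
        "(\<Sum>l\<in>{..<j} - D. u (card {x\<in>D. x < l}) l) \<le> greedy u t (Suc i') j"
        using Suc.IH[of i'] Suc.prems ij eq by auto
      have fin: "finite D" using D(1) finite_subset by blast
      have parts: "{..<Suc j} - insert j D = {..<j} - D" using D(1) by auto
      have below: "{x \<in> insert j D. x < l} = {x\<in>D. x < l}" if "l < j" for l using that by auto
      have "(\<Sum>l\<in>{..<Suc j} - insert j D. u (card {x\<in>insert j D. x < l}) l) =
          (\<Sum>l\<in>{..<j} - D. u (card {x\<in>D. x < l}) l)"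
        unfolding parts
      proof (rule sum.cong[OF refl])
        fix l assume "l \<in> {..<j} - D"
        then have "l < j" by simp
        then show "u (card {x\<in>insert j D. x < l}) l = u (card {x\<in>D. x < l}) l" by (simp only: below)
      qed
      then have "(\<Sum>l\<in>{..<Suc j} - insert j D. u (card {x\<in>insert j D. x < l}) l) \<le> greedy u t (Suc i) (Suc j)"
        using D(3) unfolding eq unfolding i' by linarith
      moreover have "j \<notin> D" using D(1) by auto
      then have "card (insert j D) = i" unfolding card_insert_disjoint[OF fin \<open>j \<notin> D\<close>] using D(2) i' by simp
      moreover have "insert j D \<subseteq> {..<Suc j}" using D(1) by auto
      ultimately show ?thesis by blast
    qed
  qed
qed

text \<open>The variable at the cell \<open>(i, j)\<close> is \<open>\<xi> i j\<close>.\<close>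

locale ladder_tableaux =
  fixes n m t :: nat and \<xi> :: "nat \<Rightarrow> nat \<Rightarrow> 'v" and L :: "(nat \<times> nat) set"
  assumes n: "1 \<le> n" "n \<le> m"
    and inj: "\<And>i j i' j'. i < n \<Longrightarrow> j < m \<Longrightarrow> i' < n \<Longrightarrow> j' < m \<Longrightarrow> \<xi> i j = \<xi> i' j' \<Longrightarrow> i = i' \<and> j = j'"
    and L: "L \<subseteq> {..<n} \<times> {..<m}"
begin

text \<open>The number of cells of \<open>\<tau>\<close> in row \<open>i\<close> and in the columns before \<open>j\<close>, with multiplicity.\<close>

definition F :: "('v \<Rightarrow>\<^sub>0 nat) \<Rightarrow> nat \<Rightarrow> nat \<Rightarrow> nat" where
  "F \<tau> i j = (\<Sum>l<j. coef \<tau> (\<xi> i l))"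

lemma F_simps [simp]: "F \<tau> i 0 = 0" "F \<tau> i (Suc j) = F \<tau> i j + coef \<tau> (\<xi> i j)"
  by (simp_all add: F_def)

lemma F_mono: "j \<le> j' \<Longrightarrow> F \<tau> i j \<le> F \<tau> i j'"
  by (induction j' rule: dec_induct) auto

text \<open>With the cells of each row listed by increasing column, the \<open>s\<close>-th cells of the rows form a chain:
  this is what the comparison of consecutive rows says.\<close>

definition tableaux :: "('v \<Rightarrow>\<^sub>0 nat) set" where
  "tableaux = {\<tau>. supp \<tau> \<subseteq> (\<lambda>(i, j). \<xi> i j) ` L \<and> (\<forall>i<n. F \<tau> i m = t) \<and>
     (\<forall>i j. Suc i < n \<longrightarrow> j < m \<longrightarrow> F \<tau> (Suc i) (Suc j) \<le> F \<tau> i j)}"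

text \<open>The rank is low when the chains run far to the left.\<close>

definition rank :: "('v \<Rightarrow>\<^sub>0 nat) \<Rightarrow> nat" where
  "rank \<tau> = (\<Sum>(i, j)\<in>{..<n} \<times> {..<m}. t - F \<tau> i j)"

definition cell_coef :: "('v \<Rightarrow>\<^sub>0 nat) \<Rightarrow> nat \<Rightarrow> nat \<Rightarrow> nat" where
  "cell_coef u i j = (if (i, j) \<in> L then coef u (\<xi> i j) else 0)"

lemma tableau_off_ladder:
  assumes "\<tau> \<in> tableaux" "i < n" "j < m" "(i, j) \<notin> L"
  shows "coef \<tau> (\<xi> i j) = 0"
proof (rule ccontr)
  assume "coef \<tau> (\<xi> i j) \<noteq> 0"
  then have "\<xi> i j \<in> (\<lambda>(i, j). \<xi> i j) ` L" using assms(1) by (auto simp: tableaux_def in_keys_iff)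
  then obtain i' j' where "(i', j') \<in> L" "\<xi> i j = \<xi> i' j'" by auto
  then show False using inj[OF assms(2,3), of i' j'] L assms(4) by auto
qed

lemma F_le_t: "\<tau> \<in> tableaux \<Longrightarrow> i < n \<Longrightarrow> j \<le> m \<Longrightarrow> F \<tau> i j \<le> t"
  using F_mono[of j m \<tau> i] by (auto simp: tableaux_def)

lemma tableau_eqI:
  assumes "\<tau> \<in> tableaux" "\<tau>' \<in> tableaux" "\<And>i j. i < n \<Longrightarrow> j < m \<Longrightarrow> F \<tau> i j = F \<tau>' i j"
  shows "\<tau> = \<tau>'"
proof (rule Poly_Mapping.poly_mapping_eqI)
  fix v
  have F: "F \<tau> i j = F \<tau>' i j" if "i < n" "j \<le> m" for i j
    using assms that by (cases "j = m") (auto simp: tableaux_def)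
  show "coef \<tau> v = coef \<tau>' v"
  proof (cases "v \<in> (\<lambda>(i, j). \<xi> i j) ` L")
    case True
    then obtain i j where ij: "i < n" "j < m" "v = \<xi> i j" using L by auto
    then show ?thesis using F[of i j] F[of i "Suc j"] by simp
  next
    case False
    then have "v \<notin> supp \<tau>" "v \<notin> supp \<tau>'" using assms(1,2) by (auto simp: tableaux_def)
    then show ?thesis by (simp add: in_keys_iff)
  qed
qed

lemma rank_mono:
  assumes "\<And>i j. i < n \<Longrightarrow> j < m \<Longrightarrow> F \<tau> i j \<le> F \<tau>' i j"
  shows "rank \<tau>' \<le> rank \<tau>"
  unfolding rank_def by (rule sum_mono) (use assms in \<open>auto intro: diff_le_mono2\<close>)

lemma rank_strict:
  assumes "\<tau>' \<in> tableaux" "\<And>i j. i < n \<Longrightarrow> j < m \<Longrightarrow> F \<tau> i j \<le> F \<tau>' i j" "i < n" "j < m" "F \<tau> i j < F \<tau>' i j"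
  shows "rank \<tau>' < rank \<tau>"
  unfolding rank_def
proof (rule sum_strict_mono_ex1)
  show "\<forall>x\<in>{..<n} \<times> {..<m}. (case x of (i, j) \<Rightarrow> t - F \<tau>' i j) \<le> (case x of (i, j) \<Rightarrow> t - F \<tau> i j)"
    using assms(2) by (auto intro: diff_le_mono2)
  show "\<exists>x\<in>{..<n} \<times> {..<m}. (case x of (i, j) \<Rightarrow> t - F \<tau>' i j) < (case x of (i, j) \<Rightarrow> t - F \<tau> i j)"
    using assms(3-5) F_le_t[OF assms(1), of i j] by (intro bexI[of _ "(i, j)"]) auto
qed simp

lemma F_le_greedy:
  assumes "\<tau> \<in> tableaux" "mdvd \<tau> u" "i < n" "j \<le> m"
  shows "F \<tau> i j \<le> greedy (cell_coef u) t (Suc i) j"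
  using assms(3,4)
proof (induction i arbitrary: j)
  case 0
  then show ?case
  proof (induction j)
    case (Suc j)
    have "coef \<tau> (\<xi> 0 j) \<le> cell_coef u 0 j"
      using tableau_off_ladder[OF assms(1), of 0 j] assms(2) Suc.prems by (auto simp: cell_coef_def mdvd_def)
    moreover have "F \<tau> 0 (Suc j) \<le> t" using F_le_t[OF assms(1)] Suc.prems by blast
    ultimately show ?case using Suc by simp
  qed simp
next
  case (Suc i)
  note IH = Suc.IH
  from Suc.prems(2) show ?case
  proof (induction j)
    case (Suc j)
    have "coef \<tau> (\<xi> (Suc i) j) \<le> cell_coef u (Suc i) j"
      using tableau_off_ladder[OF assms(1), of "Suc i" j] assms(2) Suc.prems \<open>Suc i < n\<close>
      by (auto simp: cell_coef_def mdvd_def)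
    moreover have "F \<tau> (Suc i) (Suc j) \<le> F \<tau> i j"
      using assms(1) \<open>Suc i < n\<close> Suc.prems by (auto simp: tableaux_def simp del: F_simps)
    moreover have "F \<tau> i j \<le> greedy (cell_coef u) t (Suc i) j" using IH[of j] \<open>Suc i < n\<close> Suc.prems by simp
    ultimately show ?case using Suc by simp
  qed simp
qed

definition greedy_mono_tab :: "('v \<Rightarrow>\<^sub>0 nat) \<Rightarrow> 'v \<Rightarrow>\<^sub>0 nat" where
  "greedy_mono_tab u = (\<Sum>(i, j)\<in>{..<n} \<times> {..<m}. Poly_Mapping.single (\<xi> i j)
     (greedy (cell_coef u) t (Suc i) (Suc j) - greedy (cell_coef u) t (Suc i) j))"

lemma coef_greedy_tab:
  assumes "i < n" "j < m"
  shows "coef (greedy_mono_tab u) (\<xi> i j) = greedy (cell_coef u) t (Suc i) (Suc j) - greedy (cell_coef u) t (Suc i) j"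
proof -
  have "coef (greedy_mono_tab u) (\<xi> i j) = (\<Sum>x\<in>{..<n} \<times> {..<m}. if x = (i, j) then
      greedy (cell_coef u) t (Suc i) (Suc j) - greedy (cell_coef u) t (Suc i) j else 0)"
    unfolding greedy_mono_tab_def coef_sum
  proof (rule sum.cong[OF refl])
    fix x assume "x \<in> {..<n} \<times> {..<m}"
    then obtain i' j' where x: "x = (i', j')" "i' < n" "j' < m" by auto
    have "\<xi> i j = \<xi> i' j' \<longleftrightarrow> (i', j') = (i, j)" using inj[OF assms x(2,3)] by auto
    then show "coef (case x of (i, j) \<Rightarrow> Poly_Mapping.single (\<xi> i j)
          (greedy (cell_coef u) t (Suc i) (Suc j) - greedy (cell_coef u) t (Suc i) j)) (\<xi> i j) =
        (if x = (i, j) then greedy (cell_coef u) t (Suc i) (Suc j) - greedy (cell_coef u) t (Suc i) j else 0)"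
      unfolding x(1) prod.case coef_term by (auto simp del: greedy.simps)
  qed
  then show ?thesis using assms by (simp del: greedy.simps)
qed

lemma F_greedy_tab: "i < n \<Longrightarrow> j \<le> m \<Longrightarrow> F (greedy_mono_tab u) i j = greedy (cell_coef u) t (Suc i) j"
proof (induction j)
  case (Suc j)
  then show ?case using coef_greedy_tab[of i j u] greedy_mono[of "cell_coef u" t "Suc i" j]
    by (simp del: greedy.simps)
qed simp

lemma greedy_tab:
  assumes full: "greedy (cell_coef u) t n m = t"
  shows "greedy_mono_tab u \<in> tableaux" "mdvd (greedy_mono_tab u) u"
proof -
  let ?K = "greedy (cell_coef u) t"
  have step: "?K (Suc i) (Suc j) - ?K (Suc i) j \<le> cell_coef u i j" for i j by simp
  have supp: "supp (greedy_mono_tab u) \<subseteq> (\<lambda>(i, j). \<xi> i j) ` ({..<n} \<times> {..<m})"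
    unfolding greedy_mono_tab_def by (subst supp_mono_sum) (auto split: if_splits)
  have le: "coef (greedy_mono_tab u) v \<le> coef u v \<and> (coef (greedy_mono_tab u) v \<noteq> 0 \<longrightarrow> v \<in> (\<lambda>(i, j). \<xi> i j) ` L)" for v
  proof (cases "v \<in> supp (greedy_mono_tab u)")
    case True
    then obtain i j where ij: "i < n" "j < m" "v = \<xi> i j" using supp by auto
    have "coef (greedy_mono_tab u) v \<le> cell_coef u i j" using coef_greedy_tab[OF ij(1,2)] step ij(3) by simp
    then show ?thesis using ij(3) by (cases "(i, j) \<in> L") (auto simp: cell_coef_def)
  next
    case False
    then show ?thesis by (simp add: in_keys_iff)
  qed
  show "mdvd (greedy_mono_tab u) u" using le by (simp add: mdvd_def)
  have desc: "?K n m \<le> ?K (n - k) m" if "k \<le> n" for k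
    using that
  proof (induction k)
    case (Suc k)
    then have "?K (n - k) m \<le> ?K (n - Suc k) m" using greedy_mono[of "cell_coef u" t "n - Suc k" m]
      by (simp add: Suc_diff_Suc)
    then show ?case using Suc by simp
  qed simp
  have "?K (Suc i) m = t" if "i < n" for i
    using desc[of "n - Suc i"] that full greedy_le[of "cell_coef u" t "Suc i" m] by simp
  then have "\<forall>i<n. F (greedy_mono_tab u) i m = t" using F_greedy_tab by simp
  moreover have "F (greedy_mono_tab u) (Suc i) (Suc j) \<le> F (greedy_mono_tab u) i j" if "Suc i < n" "j < m" for i j
  proof -
    have "F (greedy_mono_tab u) (Suc i) (Suc j) = ?K (Suc (Suc i)) (Suc j)"
      by (rule F_greedy_tab) (use that in auto)
    also have "\<dots> \<le> ?K (Suc i) j" by simp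
    also have "\<dots> = F (greedy_mono_tab u) i j" using that by (subst F_greedy_tab) auto
    finally show ?thesis .
  qed
  moreover have "supp (greedy_mono_tab u) \<subseteq> (\<lambda>(i, j). \<xi> i j) ` L"
  proof
    fix v assume "v \<in> supp (greedy_mono_tab u)"
    then have "coef (greedy_mono_tab u) v \<noteq> 0" by (simp add: in_keys_iff)
    then show "v \<in> (\<lambda>(i, j). \<xi> i j) ` L" using le by blast
  qed
  ultimately show "greedy_mono_tab u \<in> tableaux" unfolding tableaux_def by blast
qed

lemma tableau_divisor_full:
  assumes "\<tau> \<in> tableaux" "mdvd \<tau> u"
  shows "greedy (cell_coef u) t n m = t"
proof -
  have "t = F \<tau> (n - 1) m" using assms(1) n by (simp add: tableaux_def)
  also have "\<dots> \<le> greedy (cell_coef u) t (Suc (n - 1)) m" using F_le_greedy[OF assms, of "n - 1" m] n by simp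
  finally show ?thesis using n greedy_le[of "cell_coef u" t n m] by simp
qed

text \<open>The greedy tableau is the only one of lowest rank that divides \<open>u\<close>.\<close>

lemma tableau_unique:
  assumes "\<tau> \<in> tableaux" "mdvd \<tau> u" "rank \<tau> \<le> rank (greedy_mono_tab u)"
  shows "\<tau> = greedy_mono_tab u"
proof -
  note full = tableau_divisor_full[OF assms(1,2)]
  have le: "F \<tau> i j \<le> F (greedy_mono_tab u) i j" if "i < n" "j < m" for i j
    using F_le_greedy[OF assms(1,2)] F_greedy_tab that by simp
  show ?thesis
  proof (rule tableau_eqI[OF assms(1) greedy_tab(1)[OF full]])
    fix i j assume ij: "i < n" "j < m"
    show "F \<tau> i j = F (greedy_mono_tab u) i j"
    proof (rule ccontr)
      assume "F \<tau> i j \<noteq> F (greedy_mono_tab u) i j"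
      then have "F \<tau> i j < F (greedy_mono_tab u) i j" using le[OF ij] by simp
      then have "rank (greedy_mono_tab u) < rank \<tau>" using rank_strict[OF greedy_tab(1)[OF full] le ij] by blast
      then show False using assms(3) by simp
    qed
  qed
qed

text \<open>In the first row in which \<open>\<tau>'\<close> gets ahead of \<open>\<tau>\<close>, the cell where it does so can replace the next cell
  of \<open>\<tau>\<close> in that row.\<close>

lemma tableau_linear_quotients:
  assumes \<tau>: "\<tau> \<in> tableaux" and \<tau>': "\<tau>' \<in> tableaux" and dv: "mdvd \<tau>' (\<tau> + \<rho>)" and rk: "rank \<tau>' < rank \<tau>"
  shows "\<exists>y\<in>supp \<rho>. \<exists>\<tau>''\<in>tableaux. mdvd \<tau>'' (\<tau> + vmono y) \<and> rank \<tau>'' < rank \<tau>"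
proof -
  define ahead where "ahead i \<longleftrightarrow> i < n \<and> (\<exists>j\<le>m. F \<tau> i j < F \<tau>' i j)" for i
  have "\<exists>i. ahead i"
  proof (rule ccontr)
    assume "\<not> (\<exists>i. ahead i)"
    then have "F \<tau>' i j \<le> F \<tau> i j" if "i < n" "j < m" for i j
      using that unfolding ahead_def by (meson less_imp_le not_le_imp_less)
    then have "rank \<tau> \<le> rank \<tau>'" by (rule rank_mono)
    then show False using rk by simp
  qed
  then obtain i where i: "ahead i" and imin: "\<And>i'. i' < i \<Longrightarrow> \<not> ahead i'" using exists_least_iff[of ahead] by blast
  have i_n: "i < n" using i by (simp add: ahead_def)
  have above: "F \<tau>' i' j \<le> F \<tau> i' j" if "i' < i" "j \<le> m" for i' j
    using imin[OF that(1)] that i_n unfolding ahead_def by (meson less_trans not_le_imp_less)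
  obtain j0 where j0: "j0 \<le> m \<and> F \<tau> i j0 < F \<tau>' i j0"
    and j0min: "\<And>j'. j' < j0 \<Longrightarrow> \<not> (j' \<le> m \<and> F \<tau> i j' < F \<tau>' i j')"
    using i exists_least_iff[of "\<lambda>j. j \<le> m \<and> F \<tau> i j < F \<tau>' i j"] unfolding ahead_def by blast
  then obtain j where j: "j0 = Suc j" by (cases j0) auto
  have jm: "j < m" using j0 j by simp
  have lt: "F \<tau> i (Suc j) < F \<tau>' i (Suc j)" using j0 j by simp
  have "F \<tau>' i j \<le> F \<tau> i j" using j0min[of j] j jm by simp
  then have cell: "coef \<tau> (\<xi> i j) < coef \<tau>' (\<xi> i j)" using lt by simp
  have "coef \<tau>' (\<xi> i j) \<le> coef \<tau> (\<xi> i j) + coef \<rho> (\<xi> i j)" using dv by (simp add: mdvd_def lookup_add)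
  then have y: "\<xi> i j \<in> supp \<rho>" using cell by (simp add: in_keys_iff)
  have ijL: "(i, j) \<in> L" using tableau_off_ladder[OF \<tau>' i_n jm] cell by fastforce
  have tF: "F \<tau> i m = t" "F \<tau>' i (Suc j) \<le> t" using \<tau> F_le_t[OF \<tau>' i_n, of "Suc j"] jm i_n by (auto simp: tableaux_def)
  have "\<exists>j'. Suc j \<le> j' \<and> j' < m \<and> coef \<tau> (\<xi> i j') > 0"
  proof (rule ccontr)
    assume no: "\<not> (\<exists>j'. Suc j \<le> j' \<and> j' < m \<and> coef \<tau> (\<xi> i j') > 0)"
    have "F \<tau> i (Suc j + k) = F \<tau> i (Suc j)" if "Suc j + k \<le> m" for k
      using that
    proof (induction k)
      case (Suc k)
      then have "coef \<tau> (\<xi> i (Suc j + k)) = 0" using no by auto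
      then show ?case using Suc by simp
    qed simp
    from this[of "m - Suc j"] have "F \<tau> i m = F \<tau> i (Suc j)" using jm by simp
    then show False using lt tF by simp
  qed
  then obtain j' where j': "Suc j \<le> j' \<and> j' < m \<and> coef \<tau> (\<xi> i j') > 0"
    and j'min: "\<And>l. l < j' \<Longrightarrow> \<not> (Suc j \<le> l \<and> l < m \<and> coef \<tau> (\<xi> i l) > 0)"
    using exists_least_iff[of "\<lambda>j'. Suc j \<le> j' \<and> j' < m \<and> coef \<tau> (\<xi> i j') > 0"] by blast
  have const: "F \<tau> i l = F \<tau> i (Suc j)" if "Suc j \<le> l" "l \<le> j'" for l
    using that
  proof (induction l rule: dec_induct)
    case (step l)
    then have "coef \<tau> (\<xi> i l) = 0" using j'min[of l] j' by auto
    then show ?case using step by simp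
  qed simp
  define \<tau>'' where "\<tau>'' = (\<tau> - vmono (\<xi> i j')) + vmono (\<xi> i j)"
  have coef'': "coef \<tau>'' (\<xi> i' l) = coef \<tau> (\<xi> i' l) + (if i' = i \<and> l = j then 1 else 0) - (if i' = i \<and> l = j' then 1 else 0)"
    if "i' < n" "l < m" for i' l
  proof -
    have "\<xi> i' l = \<xi> i j \<longleftrightarrow> i' = i \<and> l = j" "\<xi> i' l = \<xi> i j' \<longleftrightarrow> i' = i \<and> l = j'"
      using inj[OF that i_n, of j] inj[OF that i_n, of j'] jm j' by auto
    then show ?thesis using j' by (auto simp: \<tau>''_def lookup_add lookup_minus coef_vmono)
  qed
  have F'': "F \<tau>'' i' l = F \<tau> i' l + (if i' = i \<and> Suc j \<le> l \<and> l \<le> j' then 1 else 0)" if "i' < n" "l \<le> m" for i' l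
    using that(2)
  proof (induction l)
    case (Suc l)
    then have IH: "F \<tau>'' i' l = F \<tau> i' l + (if i' = i \<and> Suc j \<le> l \<and> l \<le> j' then 1 else 0)" by simp
    have c: "coef \<tau>'' (\<xi> i' l) = coef \<tau> (\<xi> i' l) + (if i' = i \<and> l = j then 1 else 0) - (if i' = i \<and> l = j' then 1 else 0)"
      using coef''[OF that(1)] Suc.prems by simp
    consider "i' \<noteq> i" | "i' = i" "l < j" | "i' = i" "l = j" | "i' = i" "j < l" "l < j'" | "i' = i" "l = j'" | "i' = i" "j' < l"
      by linarith
    then show ?case using IH c j' by cases auto
  qed simp
  have t'': "\<tau>'' \<in> tableaux"
    unfolding tableaux_def
  proof (intro CollectI conjI allI impI)
    show "supp \<tau>'' \<subseteq> (\<lambda>(i, j). \<xi> i j) ` L"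
      using \<tau> ijL by (fastforce simp: \<tau>''_def supp_mono_add tableaux_def in_keys_iff lookup_minus)
    show "F \<tau>'' i' m = t" if "i' < n" for i' using F''[OF that, of m] \<tau> that j' by (auto simp: tableaux_def)
    fix i' l assume il: "Suc i' < n" "l < m"
    have base: "F \<tau> (Suc i') (Suc l) \<le> F \<tau> i' l" using \<tau> il by (auto simp: tableaux_def simp del: F_simps)
    show "F \<tau>'' (Suc i') (Suc l) \<le> F \<tau>'' i' l"
    proof (cases "Suc i' = i \<and> Suc j \<le> Suc l \<and> Suc l \<le> j'")
      case True
      have "F \<tau>'' (Suc i') (Suc l) = F \<tau> i (Suc j) + 1"
        using F''[OF il(1), of "Suc l"] const[of "Suc l"] True il(2) by (simp del: F_simps)
      also have "\<dots> \<le> F \<tau>' i (Suc j)" using lt by simp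
      also have "\<dots> \<le> F \<tau>' i' j" using \<tau>' True il jm by (auto simp: tableaux_def simp del: F_simps)
      also have "\<dots> \<le> F \<tau> i' j" using above[of i' j] True jm by simp
      also have "\<dots> \<le> F \<tau> i' l" using F_mono True by simp
      also have "\<dots> \<le> F \<tau>'' i' l" using F''[of i' l] il by simp
      finally show ?thesis .
    next
      case False
      then have "F \<tau>'' (Suc i') (Suc l) = F \<tau> (Suc i') (Suc l)" using F''[OF il(1), of "Suc l"] il(2) by auto
      also have "\<dots> \<le> F \<tau>'' i' l" using base F''[of i' l] il by simp
      finally show ?thesis .
    qed
  qed
  have "rank \<tau>'' < rank \<tau>"
    by (rule rank_strict[OF t'' _ i_n, of \<tau> "Suc j"]) (use F'' i_n j' in \<open>auto simp del: F_simps\<close>)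
  moreover have "mdvd \<tau>'' (\<tau> + vmono (\<xi> i j))"
    by (auto simp: mdvd_def \<tau>''_def lookup_add lookup_minus)
  ultimately show ?thesis using y t'' by blast
qed

text \<open>The converse of the obvious fact that each of the \<open>t\<close> chains of a tableau meets every cut: if \<open>u\<close> has degree at
  least \<open>t\<close> on every cut, then the greedy choice of \<open>t\<close> chains succeeds.\<close>

lemma cut_condition_imp_tableau:
  assumes "\<And>D. D \<subseteq> {..<m} \<Longrightarrow> card D = n - 1 \<Longrightarrow>
    t \<le> (\<Sum>j\<in>{..<m} - D. cell_coef u (card {x\<in>D. x < j}) j)"
  shows "\<exists>\<tau>\<in>tableaux. mdvd \<tau> u"
proof -
  have "greedy (cell_coef u) t n m = t"
  proof (rule ccontr)
    assume "greedy (cell_coef u) t n m \<noteq> t"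
    then have lt: "greedy (cell_coef u) t (Suc (n - 1)) m < t" using greedy_le[of "cell_coef u" t n m] n by simp
    have "n - 1 \<le> m" using n by simp
    from greedy_cut[OF lt this] obtain D where D: "D \<subseteq> {..<m}" "card D = n - 1"
      "(\<Sum>l\<in>{..<m} - D. cell_coef u (card {x\<in>D. x < l}) l) \<le> greedy (cell_coef u) t (Suc (n - 1)) m"
      by (elim exE conjE)
    show False using assms[OF D(1,2)] D(3) lt by linarith
  qed
  then show ?thesis by (intro bexI[of _ "greedy_mono_tab u"] greedy_tab)
qed

lemma mdeg_tableau:
  assumes "\<tau> \<in> tableaux"
  shows "mdeg \<tau> = n * t"
proof -
  let ?g = "\<lambda>(i, j). \<xi> i j"
  have injg: "inj_on ?g ({..<n} \<times> {..<m})"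
  proof (rule inj_onI)
    fix x y assume "x \<in> {..<n} \<times> {..<m}" "y \<in> {..<n} \<times> {..<m}" "?g x = ?g y"
    then show "x = y" using inj[of "fst x" "snd x" "fst y" "snd y"] by (auto simp: case_prod_beta prod_eq_iff)
  qed
  have "supp \<tau> \<subseteq> ?g ` L" using assms by (simp add: tableaux_def)
  then have "supp \<tau> \<subseteq> ?g ` ({..<n} \<times> {..<m})" using image_mono[OF L, of ?g] by (rule order_trans)
  then have "mdeg \<tau> = (\<Sum>v\<in>?g ` ({..<n} \<times> {..<m}). coef \<tau> v)"
    unfolding mdeg_def by (subst weight_superset) auto
  also have "\<dots> = (\<Sum>(i, j)\<in>{..<n} \<times> {..<m}. coef \<tau> (\<xi> i j))"
    by (subst sum.reindex[OF injg]) (simp add: case_prod_beta)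
  also have "\<dots> = (\<Sum>i<n. F \<tau> i m)" by (simp add: sum.cartesian_product F_def)
  also have "\<dots> = n * t" using assms by (simp add: tableaux_def)
  finally show ?thesis .
qed

text \<open>The \<open>s\<close>-th chain consists of the \<open>s\<close>-th cell of each row, counted from the left with multiplicity.\<close>

lemma tableau_chains:
  assumes \<tau>: "\<tau> \<in> tableaux"
  shows "\<exists>a :: nat \<Rightarrow> nat \<Rightarrow> nat. (\<forall>s<t. \<forall>i<n. (i, a s i) \<in> L) \<and> (\<forall>s<t. \<forall>i. Suc i < n \<longrightarrow> a s i < a s (Suc i)) \<and>
    (\<Sum>s<t. \<Sum>i<n. vmono (\<xi> i (a s i))) = \<tau>"
proof -
  define a where "a s i = (LEAST j. s < F \<tau> i (Suc j))" for s i
  have m: "1 \<le> m" using n by simp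
  have tot: "F \<tau> i m = t" if "i < n" for i using \<tau> that by (simp add: tableaux_def)
  have a_least: "s < F \<tau> i (Suc (a s i))" if "i < n" "s < t" for s i
    unfolding a_def by (rule LeastI[of _ "m - 1"]) (use tot[OF that(1)] that m in \<open>simp del: F_simps\<close>)
  have a_le: "a s i \<le> j \<longleftrightarrow> s < F \<tau> i (Suc j)" if "i < n" "s < t" for s i j
  proof
    assume "a s i \<le> j"
    then show "s < F \<tau> i (Suc j)" using a_least[OF that] F_mono[of "Suc (a s i)" "Suc j" \<tau> i] by simp
  next
    assume "s < F \<tau> i (Suc j)"
    then show "a s i \<le> j" unfolding a_def by (rule Least_le)
  qed
  have a_m: "a s i < m" if "i < n" "s < t" for s i
    using a_le[OF that, of "m - 1"] tot[OF that(1)] that m by (simp del: F_simps)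
  have a_eq: "a s i = j \<longleftrightarrow> F \<tau> i j \<le> s \<and> s < F \<tau> i (Suc j)" if "i < n" "s < t" for s i j
  proof (cases j)
    case 0
    then show ?thesis using a_le[OF that, of 0] by (simp del: F_simps(2))
  next
    case (Suc j')
    have "a s i = j \<longleftrightarrow> a s i \<le> j \<and> \<not> a s i \<le> j'" using Suc by auto
    then show ?thesis using a_le[OF that, of j] a_le[OF that, of j'] Suc by (simp del: F_simps) auto
  qed
  have inL: "(i, a s i) \<in> L" if "i < n" "s < t" for s i
  proof (rule ccontr)
    assume "(i, a s i) \<notin> L"
    then have "coef \<tau> (\<xi> i (a s i)) = 0" using tableau_off_ladder[OF \<tau> that(1) a_m[OF that]] by blast
    then show False using a_eq[OF that, of "a s i"] by auto
  qed
  have incr: "a s i < a s (Suc i)" if "Suc i < n" "s < t" for s i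
  proof -
    let ?j = "a s (Suc i)"
    have "s < F \<tau> (Suc i) (Suc ?j)" using a_least that by simp
    also have "\<dots> \<le> F \<tau> i ?j" using \<tau> that a_m[OF that] by (auto simp: tableaux_def simp del: F_simps)
    finally have "s < F \<tau> i ?j" .
    then obtain j' where "?j = Suc j'" by (cases ?j) auto
    then show ?thesis using a_le[of i s j'] that \<open>s < F \<tau> i ?j\<close> by (simp del: F_simps)
  qed
  have "(\<Sum>s<t. \<Sum>i<n. vmono (\<xi> i (a s i))) = \<tau>"
  proof (rule Poly_Mapping.poly_mapping_eqI)
    fix v
    show "coef (\<Sum>s<t. \<Sum>i<n. vmono (\<xi> i (a s i))) v = coef \<tau> v"
    proof (cases "\<exists>i<n. \<exists>j<m. v = \<xi> i j")
      case True
      then obtain i j where ij: "i < n" "j < m" "v = \<xi> i j" by blast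
      have "(\<Sum>i'<n. coef (vmono (\<xi> i' (a s i'))) v) = (if a s i = j then 1 else 0)" if s: "s < t" for s
      proof -
        have "(\<Sum>i'<n. coef (vmono (\<xi> i' (a s i'))) v) = (\<Sum>i'<n. if i' = i then (if a s i = j then 1 else 0) else 0)"
        proof (rule sum.cong[OF refl])
          fix i' assume i': "i' \<in> {..<n}"
          then have "\<xi> i j = \<xi> i' (a s i') \<longleftrightarrow> i' = i \<and> a s i = j"
            using inj[OF ij(1,2), of i' "a s i'"] a_m[of i' s] s by auto
          then show "coef (vmono (\<xi> i' (a s i'))) v = (if i' = i then (if a s i = j then 1 else 0) else 0)"
            by (auto simp: coef_vmono ij(3))
        qed
        then show ?thesis using ij(1) by simp
      qed
      then have "coef (\<Sum>s<t. \<Sum>i<n. vmono (\<xi> i (a s i))) v = (\<Sum>s<t. if a s i = j then 1 else 0)"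
        by (simp add: coef_sum)
      also have "\<dots> = card {s \<in> {..<t}. a s i = j}" by (simp add: sum.If_cases Int_def)
      also have "{s \<in> {..<t}. a s i = j} = {F \<tau> i j..<F \<tau> i (Suc j)}"
      proof (rule Set.set_eqI)
        fix s
        have "F \<tau> i (Suc j) \<le> t" using F_le_t[OF \<tau> ij(1), of "Suc j"] ij(2) by simp
        then show "s \<in> {s \<in> {..<t}. a s i = j} \<longleftrightarrow> s \<in> {F \<tau> i j..<F \<tau> i (Suc j)}"
          using a_eq[OF ij(1), of s j] by (cases "s < t") (simp_all del: F_simps)
      qed
      also have "card \<dots> = coef \<tau> v" by (simp add: ij(3))
      finally show ?thesis .
    next
      case False
      have "v \<notin> (\<lambda>(i, j). \<xi> i j) ` L"
      proof
        assume "v \<in> (\<lambda>(i, j). \<xi> i j) ` L"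
        then obtain i j where "(i, j) \<in> L" "v = \<xi> i j" by auto
        then show False using False L by blast
      qed
      then have "v \<notin> supp \<tau>" using \<tau> unfolding tableaux_def by blast
      then have "coef \<tau> v = 0" by (simp add: in_keys_iff)
      moreover have "coef (vmono (\<xi> i (a s i))) v = 0" if "i < n" "s < t" for s i
      proof -
        have "v \<noteq> \<xi> i (a s i)" using False a_m[OF that] that(1) by blast
        then show ?thesis by (simp add: coef_vmono)
      qed
      ultimately show ?thesis by (simp add: coef_sum)
    qed
  qed
  then show ?thesis using inL incr by blast
qed

end


section \<open>Powers of ideals of polynomials\<close>

text \<open>The ideal generated by \<open>P\<close>, see \<open>genideal_eq_combinations\<close>.\<close>

inductive_set combinations :: "'v set \<Rightarrow> ('v, 'k::field) mpoly set \<Rightarrow> ('v, 'k) mpoly set"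
  for V and P where
  zero: "0 \<in> combinations V P"
| step: "p \<in> polys V \<Longrightarrow> q \<in> P \<Longrightarrow> f \<in> combinations V P \<Longrightarrow> p * q + f \<in> combinations V P"

lemma combinations_add: "f \<in> combinations V P \<Longrightarrow> g \<in> combinations V P \<Longrightarrow> f + g \<in> combinations V P"
  by (induction rule: combinations.induct) (auto simp: add.assoc intro: combinations.step)

lemma combinations_mult: "f \<in> combinations V P \<Longrightarrow> r \<in> polys V \<Longrightarrow> r * f \<in> combinations V P"
proof (induction rule: combinations.induct)
  case (step p q f)
  then have "(r * p) * q + r * f \<in> combinations V P" by (intro combinations.step polys_mult) auto
  then show ?case by (simp add: algebra_simps)
qed (simp add: combinations.zero)

lemma combinations_generator:
  assumes "q \<in> P"
  shows "q \<in> combinations V P"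
  using combinations.step[OF polys_one assms combinations.zero, of V] by simp

lemma combinations_polys:
  assumes "P \<subseteq> polys V" "f \<in> combinations V P"
  shows "f \<in> polys V"
  using assms(2) by (induction rule: combinations.induct) (use assms(1) in \<open>auto intro!: polys_add polys_mult\<close>)

lemma combinations_least:
  assumes "ideal I (mpoly_ring V)" "P \<subseteq> I" "f \<in> combinations V P"
  shows "f \<in> I"
  using assms(3)
proof (induction rule: combinations.induct)
  case (step p q f)
  then show ?case using assms(2) ideal_closed(2,5)[OF assms(1)] by blast
qed (rule ideal_closed(1)[OF assms(1)])

lemma combinations_ideal:
  fixes P :: "('v, 'k::field) mpoly set"
  assumes "P \<subseteq> polys V"
  shows "ideal (combinations V P) (mpoly_ring V)"
proof (rule idealI[OF mpoly_ring_ring])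
  show "subgroup (combinations V P) (add_monoid (mpoly_ring V))"
  proof (rule subgroup.intro)
    fix f assume f: "f \<in> combinations V P"
    have "inv\<^bsub>add_monoid (mpoly_ring V)\<^esub> f = (- 1) * f"
      using mpoly_ring_a_inv[OF combinations_polys[OF assms f]] by (simp add: a_inv_def)
    then show "inv\<^bsub>add_monoid (mpoly_ring V)\<^esub> f \<in> combinations V P"
      using combinations_mult[OF f polys_uminus[OF polys_one]] by simp
  qed (use combinations_polys[OF assms] in \<open>auto intro: combinations_add combinations.zero\<close>)
next
  fix a x :: "('v, 'k) mpoly" assume "a \<in> combinations V P" "x \<in> polys V"
  from combinations_mult[OF this]
  show "x \<otimes>\<^bsub>mpoly_ring V\<^esub> a \<in> combinations V P" "a \<otimes>\<^bsub>mpoly_ring V\<^esub> x \<in> combinations V P"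
    by (simp_all add: mult.commute[of a x])
qed

lemma genideal_eq_combinations:
  assumes "P \<subseteq> polys V"
  shows "Idl\<^bsub>mpoly_ring V\<^esub> P = combinations V P"
proof
  show "Idl\<^bsub>mpoly_ring V\<^esub> P \<subseteq> combinations V P"
    by (rule ring.genideal_minimal[OF mpoly_ring_ring combinations_ideal[OF assms]])
       (blast intro: combinations_generator)
  show "combinations V P \<subseteq> Idl\<^bsub>mpoly_ring V\<^esub> P"
    using combinations_least[OF ring.genideal_ideal[OF mpoly_ring_ring assms] ring.genideal_self[OF mpoly_ring_ring assms]]
    by blast
qed

lemma polys_mono: "V \<subseteq> W \<Longrightarrow> p \<in> polys V \<Longrightarrow> p \<in> polys W"
  unfolding mem_polys by (meson order_trans)

definition products :: "nat \<Rightarrow> ('v, 'k::field) mpoly set \<Rightarrow> ('v, 'k) mpoly set" where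
  "products t S = {(\<Prod>s<t. g s) | g. \<forall>s<t. g s \<in> S}"

lemma products_polys: "S \<subseteq> polys V \<Longrightarrow> products t S \<subseteq> polys V"
  by (auto simp: products_def intro!: polys_prod)

lemma products_Suc:
  assumes "f \<in> products t S" "g \<in> S"
  shows "f * g \<in> products (Suc t) S"
proof -
  obtain h where h: "f = (\<Prod>s<t. h s)" "\<forall>s<t. h s \<in> S" using assms(1) by (auto simp: products_def)
  have "f * g = (\<Prod>s<Suc t. if s < t then h s else g)" by (simp add: h(1))
  moreover have "\<forall>s<Suc t. (if s < t then h s else g) \<in> S" using h(2) assms(2) by simp
  ultimately show ?thesis unfolding products_def by (intro CollectI exI[of _ "\<lambda>s. if s < t then h s else g"]) simp
qed

theorem genideal_power:
  fixes S :: "('v, 'k::field) mpoly set"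
  assumes "S \<subseteq> polys V"
  shows "(Idl\<^bsub>mpoly_ring V\<^esub> S) [^]\<^bsub>ideals_set (mpoly_ring V)\<^esub> t = combinations V (products t S)"
proof (induction t)
  case 0
  have "f \<in> combinations V {1}" if "f \<in> polys V" for f :: "('v, 'k) mpoly"
    using combinations_mult[OF combinations_generator[of 1 "{1}"] that] by simp
  moreover have "f \<in> polys V" if "f \<in> combinations V {1}" for f :: "('v, 'k) mpoly"
    using combinations_polys[OF _ that] by simp
  moreover have "products 0 S = {1}" by (auto simp: products_def)
  ultimately show ?case by (auto simp: ideals_set_def nat_pow_def)
next
  case (Suc t)
  let ?R = "mpoly_ring V :: ('v, 'k) mpoly ring"
  let ?A = "combinations V (products t S)" and ?B = "combinations V S"
  have idA: "ideal ?A ?R" and idB: "ideal ?B ?R"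
    by (intro combinations_ideal products_polys assms)+
  have "f \<in> combinations V (products (Suc t) S)" if "f \<in> ideal_prod ?R ?A ?B" for f
    using that
  proof (induction rule: ideal_prod.induct)
    case (prod i j)
    have gen: "q * j \<in> combinations V (products (Suc t) S)" if q: "q \<in> products t S" for q
      using prod(2)
    proof (induction rule: combinations.induct)
      case (step p g f)
      have "p * (q * g) + q * f \<in> combinations V (products (Suc t) S)"
        by (intro combinations.step products_Suc step q)
      then show ?case by (simp add: algebra_simps)
    qed (simp add: combinations.zero)
    have "i * j \<in> combinations V (products (Suc t) S)"
      using prod(1)
    proof (induction rule: combinations.induct)
      case (step p q f)
      have "p * (q * j) + f * j \<in> combinations V (products (Suc t) S)"
        by (intro combinations_add combinations_mult gen step)
      then show ?case by (simp add: algebra_simps)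
    qed (simp add: combinations.zero)
    then show ?case by simp
  next
    case (sum f g)
    then show ?case by (simp add: combinations_add)
  qed
  moreover have "products (Suc t) S \<subseteq> ideal_prod ?R ?A ?B"
  proof
    fix f assume "f \<in> products (Suc t) S"
    then obtain g where g: "f = (\<Prod>s<Suc t. g s)" "\<forall>s<Suc t. g s \<in> S" by (auto simp: products_def)
    have "(\<Prod>s<t. g s) \<in> products t S" using g(2) by (auto simp: products_def)
    then have "(\<Prod>s<t. g s) \<otimes>\<^bsub>?R\<^esub> g t \<in> ideal_prod ?R ?A ?B"
      using g(2) by (intro ideal_prod.prod combinations_generator) auto
    then show "f \<in> ideal_prod ?R ?A ?B" by (simp add: g(1))
  qed
  then have "f \<in> ideal_prod ?R ?A ?B" if "f \<in> combinations V (products (Suc t) S)" for f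
    using combinations_least[OF ring.ideal_prod_is_ideal[OF mpoly_ring_ring idA idB] _ that] by blast
  ultimately have "ideal_prod ?R ?A ?B = combinations V (products (Suc t) S)" by blast
  then show ?case using Suc by (simp add: nat_pow_def ideals_set_def genideal_eq_combinations[OF assms])
qed

lemma combinations_hcomp:
  assumes "\<And>q. q \<in> P \<Longrightarrow> homogeneous_poly d q" "f \<in> combinations V P"
  shows "hcomp k f \<in> combinations V P"
  using assms(2)
proof (induction rule: combinations.induct)
  case (step p q f)
  then show ?case
    by (cases "d \<le> k") (auto simp: hcomp_add hcomp_mult_homogeneous[OF assms(1)] intro: combinations.step polys_hcomp)
qed (simp add: combinations.zero)

lemma combinations_low_degree:
  assumes "\<And>q. q \<in> P \<Longrightarrow> homogeneous_poly d q" "f \<in> combinations V P" "mdeg u < d"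
  shows "coef f u = 0"
  using assms(2)
proof (induction rule: combinations.induct)
  case (step p q f)
  have "u \<notin> supp (p * q)"
  proof
    assume "u \<in> supp (p * q)"
    then obtain a b where "b \<in> supp q" "u = a + b" using supp_poly_mult_cases by blast
    then show False using assms(1)[OF step(2)] assms(3) by (auto simp: homogeneous_poly_iff)
  qed
  then show ?case using step by (simp add: lookup_add in_keys_iff)
qed simp

lemma combinations_explicit:
  assumes "f \<in> combinations V P"
  shows "\<exists>(K::nat) p q. (\<forall>k<K. p k \<in> polys V \<and> q k \<in> P) \<and> f = (\<Sum>k<K. p k * q k)"
  using assms
proof (induction rule: combinations.induct)
  case zero
  then show ?case by (intro exI[of _ 0]) simp
next
  case (step p0 q0 f)
  then obtain K :: nat and p q where h: "\<forall>k<K. p k \<in> polys V \<and> q k \<in> P" "f = (\<Sum>k<K. p k * q k)" by blast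
  let ?p = "p(K := p0)" and ?q = "q(K := q0)"
  have "(\<Sum>k<K. ?p k * ?q k) = f" unfolding h(2) by (rule sum.cong) auto
  then have "p0 * q0 + f = (\<Sum>k<Suc K. ?p k * ?q k)" by (simp add: add.commute)
  moreover have "\<forall>k<Suc K. ?p k \<in> polys V \<and> ?q k \<in> P" using h(1) step(1,2) by (simp add: less_Suc_eq)
  ultimately show ?case by blast
qed

lemma combinations_explicit_homogeneous:
  assumes P: "\<And>q. q \<in> P \<Longrightarrow> homogeneous_poly d q" and f: "f \<in> combinations V P" "homogeneous_poly e f"
  shows "\<exists>(K::nat) p q. (\<forall>k<K. p k \<in> polys V \<and> q k \<in> P \<and> d \<le> e \<and> homogeneous_poly (e - d) (p k)) \<and>
    f = (\<Sum>k<K. p k * q k)"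
proof (cases "d \<le> e")
  case True
  obtain K :: nat and p q where h: "\<forall>k<K. p k \<in> polys V \<and> q k \<in> P" "f = (\<Sum>k<K. p k * q k)"
    using combinations_explicit[OF f(1)] by blast
  have "f = hcomp e f" using f(2) by (simp add: hcomp_homogeneous)
  also have "\<dots> = (\<Sum>k<K. hcomp e (p k * q k))" by (simp add: h(2) hcomp_sum)
  also have "\<dots> = (\<Sum>k<K. hcomp (e - d) (p k) * q k)"
    by (rule sum.cong[OF refl]) (use h(1) True in \<open>simp add: hcomp_mult_homogeneous[OF P]\<close>)
  finally show ?thesis using h(1) True
    by (intro exI[of _ K] exI[of _ "\<lambda>k. hcomp (e - d) (p k)"] exI[of _ q]) (simp add: polys_hcomp)
next
  case False
  have "f = 0"
  proof (rule Poly_Mapping.poly_mapping_eqI)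
    fix u
    show "coef f u = coef 0 u"
    proof (cases "u \<in> supp f")
      case True
      then have "mdeg u < d" using f(2) False by (simp add: homogeneous_poly_iff)
      from combinations_low_degree[OF P f(1) this] show ?thesis by simp
    qed (simp add: in_keys_iff)
  qed
  then show ?thesis by (intro exI[of _ 0]) simp
qed

lemma homogeneous_prod:
  assumes "\<And>x. x \<in> A \<Longrightarrow> homogeneous_poly d (f x)"
  shows "homogeneous_poly (card A * d) (prod f A)"
  using assms
proof (induction A rule: infinite_finite_induct)
  case (insert x A)
  have "homogeneous_poly (d + card A * d) (f x * prod f A)"
    by (rule homogeneous_mult) (use insert in auto)
  then show ?case using insert by simp
qed auto

lemma homogeneous_det:
  fixes M :: "('v, 'k::field) mpoly mat"
  assumes "M \<in> carrier_mat n n" "\<And>i j. i < n \<Longrightarrow> j < n \<Longrightarrow> homogeneous_poly 1 (M $$ (i, j))"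
  shows "homogeneous_poly n (det M)"
  unfolding det_def'[OF assms(1)]
proof (rule homogeneous_sum)
  fix \<pi> assume "\<pi> \<in> {\<pi>. \<pi> permutes {0..<n}}"
  then have "homogeneous_poly 1 (M $$ (i, \<pi> i))" if "i \<in> {0..<n}" for i
    using assms(2)[of i "\<pi> i"] that permutes_in_image[of \<pi> "{0..<n}" i] by simp
  then have "homogeneous_poly (card {0..<n} * 1) (\<Prod>i = 0..<n. M $$ (i, \<pi> i))" by (rule homogeneous_prod)
  then show "homogeneous_poly n (signof \<pi> * (\<Prod>i = 0..<n. M $$ (i, \<pi> i)))"
    by (cases "sign \<pi> = 1") (auto simp: sign_def homogeneous_uminus)
qed

lemma polys_det:
  fixes M :: "('v, 'k::field) mpoly mat"
  assumes "M \<in> carrier_mat n n" "\<And>i j. i < n \<Longrightarrow> j < n \<Longrightarrow> M $$ (i, j) \<in> polys V"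
  shows "det M \<in> polys V"
  unfolding det_def'[OF assms(1)]
proof (rule polys_sum)
  fix \<pi> assume "\<pi> \<in> {\<pi>. \<pi> permutes {0..<n}}"
  then have "M $$ (i, \<pi> i) \<in> polys V" if "i \<in> {0..<n}" for i
    using assms(2)[of i "\<pi> i"] that permutes_in_image[of \<pi> "{0..<n}" i] by simp
  then have "(\<Prod>i = 0..<n. M $$ (i, \<pi> i)) \<in> polys V" by (rule polys_prod)
  then show "signof \<pi> * (\<Prod>i = 0..<n. M $$ (i, \<pi> i)) \<in> polys V"
    by (cases "sign \<pi> = 1") (auto simp: sign_def polys_uminus)
qed

lemma subst_mono_var: "subst_mono var e = (mterm e 1 :: ('v, 'k::field) mpoly)"
proof -
  have pow: "var v ^ k = (mterm (mterm v k) 1 :: ('v, 'k) mpoly)" for v :: 'v and k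
    by (induction k) (simp_all add: var_def mult_single single_add[symmetric])
  have "(\<Prod>v\<in>A. mterm (g v) 1) = (mterm (\<Sum>v\<in>A. g v) 1 :: ('v, 'k) mpoly)" for A and g :: "'v \<Rightarrow> 'v \<Rightarrow>\<^sub>0 nat"
    by (induction A rule: infinite_finite_induct) (simp_all add: mult_single)
  then have "subst_mono var e = (mterm (\<Sum>v\<in>supp e. mterm v (coef e v)) 1 :: ('v, 'k) mpoly)"
    by (simp add: subst_mono_def pow)
  then show ?thesis using poly_as_sum[of e] by simp
qed

lemma coef_subst_restrict:
  fixes p :: "('v, 'k::field) mpoly"
  shows "coef (subst (\<lambda>v. if Q v then var v else 0) p) u = (if \<forall>v\<in>supp u. Q v then coef p u else 0)"
proof (induction p rule: poly_induct)
  case (mterm e c)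
  let ?\<psi> = "\<lambda>v. if Q v then var v else (0 :: ('v, 'k) mpoly)"
  show ?case
  proof (cases "\<forall>v\<in>supp e. Q v")
    case True
    then have "subst_mono ?\<psi> e = subst_mono var e"
      unfolding subst_mono_def by (intro prod.cong) auto
    then show ?thesis using True
      by (auto simp: subst_term subst_mono_var const_poly_def mult_single coef_term)
  next
    case False
    then obtain v where v: "v \<in> supp e" "\<not> Q v" by blast
    then have "?\<psi> v ^ coef e v = 0" by (simp add: in_keys_iff zero_power)
    then have "subst_mono ?\<psi> e = 0"
      unfolding subst_mono_def using v(1) by (intro prod_zero finite_keys) blast
    then show ?thesis using False by (auto simp: subst_term coef_term)
  qed
qed (simp_all add: subst_add lookup_add)


section \<open>Maximal minors of a ladder\<close>

lemma weight_int: "weight (\<lambda>v. int (w v)) u = int (weight w u)"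
  by (simp add: weight_def)

lemma weight_le:
  fixes w :: "'v \<Rightarrow> int"
  assumes "\<And>v. v \<in> supp u \<Longrightarrow> w v \<le> B"
  shows "weight w u \<le> int (mdeg u) * B"
proof -
  have "weight w u \<le> (\<Sum>v\<in>supp u. B * int (coef u v))"
    unfolding weight_def by (rule sum_mono) (use assms in \<open>auto intro: mult_right_mono\<close>)
  also have "\<dots> = int (mdeg u) * B" by (simp add: mdeg_def weight_def sum_distrib_left mult.commute)
  finally show ?thesis .
qed

text \<open>The function \<open>max 0\<close> is convex, and the arguments on the right have the same sum but lie further apart.\<close>

lemma convex_positive_part:
  fixes a a' b b' :: int
  assumes "a \<le> a'" "b \<le> b'"
  shows "max 0 (a - b) + max 0 (a' - b') \<le> max 0 (a - b') + max 0 (a' - b)"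
  using assms by (simp add: max_def)

text \<open>The rows are renumbered by the involution \<open>\<rho>\<close> in such a way that the bounds of the ladder increase. It will
  be the identity or the reversal of the rows.\<close>

locale ladder_minors =
  fixes n m t :: nat and \<rho> :: "nat \<Rightarrow> nat" and \<alpha> \<beta> :: "nat \<Rightarrow> int" and ty :: "'k::field itself"
  assumes n: "1 \<le> n" "n \<le> m"
    and \<rho>: "\<And>i. i < n \<Longrightarrow> \<rho> i < n" "\<And>i. i < n \<Longrightarrow> \<rho> (\<rho> i) = i"
    and mono: "\<And>i i'. i \<le> i' \<Longrightarrow> i' < n \<Longrightarrow> \<alpha> i \<le> \<alpha> i'" "\<And>i i'. i \<le> i' \<Longrightarrow> i' < n \<Longrightarrow> \<beta> i \<le> \<beta> i'"
begin

definition "L = {(i, j). i < n \<and> j < m \<and> \<alpha> i \<le> int j \<and> int j \<le> \<beta> i}"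

abbreviation "V \<equiv> {..<n} \<times> {..<m}"

definition \<xi> :: "nat \<Rightarrow> nat \<Rightarrow> nat \<times> nat" where "\<xi> i j = (\<rho> i, j)"

text \<open>The weight of the entry in the renumbered row \<open>i\<close> and column \<open>j\<close> is \<open>i * j\<close>, so that the diagonal of every minor
  has the highest weight.\<close>

definition \<omega> :: "nat \<times> nat \<Rightarrow> nat" where "\<omega> v = \<rho> (fst v) * snd v"

lemma \<xi>_inj:
  assumes "i < n" "j < m" "i' < n" "j' < m" "\<xi> i j = \<xi> i' j'"
  shows "i = i' \<and> j = j'"
proof -
  have "\<rho> i = \<rho> i' \<and> j = j'" using assms(5) by (simp add: \<xi>_def)
  then show ?thesis using \<rho>(2)[OF assms(1)] \<rho>(2)[OF assms(3)] by metis
qed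

lemma L_subset: "L \<subseteq> V"
  by (auto simp: L_def)

sublocale ladder_tableaux n m t \<xi> L
proof
  fix i j i' j' assume "i < n" "j < m" "i' < n" "j' < m" "\<xi> i j = \<xi> i' j'"
  then show "i = i' \<and> j = j'" by (rule \<xi>_inj)
qed (rule n(1) n(2) L_subset)+

definition ladder_matrix :: "(nat \<Rightarrow> nat) \<Rightarrow> (nat \<times> nat, 'k) mpoly mat" where
  "ladder_matrix a = mat n n (\<lambda>(i, l). if (i, a l) \<in> L then var (\<xi> i (a l)) else 0)"

definition lminors :: "(nat \<times> nat, 'k) mpoly set" where
  "lminors = {det (ladder_matrix a) | a. (\<forall>l<n. a l < m) \<and> (\<forall>l l'. l < l' \<longrightarrow> l' < n \<longrightarrow> a l < a l')}"

lemma ladder_matrix_carrier: "ladder_matrix a \<in> carrier_mat n n"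
  by (simp add: ladder_matrix_def)

lemma lminors_polys: "lminors \<subseteq> polys V"
proof
  fix g assume "g \<in> lminors"
  then obtain a where a: "g = det (ladder_matrix a)" by (auto simp: lminors_def)
  show "g \<in> polys V"
    unfolding a
    by (rule polys_det[OF ladder_matrix_carrier])
       (auto simp: ladder_matrix_def \<xi>_def L_def \<rho> intro!: polys_var)
qed

lemma lminors_homogeneous:
  assumes "g \<in> lminors"
  shows "homogeneous_poly n g"
proof -
  obtain a where a: "g = det (ladder_matrix a)" using assms by (auto simp: lminors_def)
  show ?thesis
    unfolding a by (rule homogeneous_det[OF ladder_matrix_carrier]) (auto simp: ladder_matrix_def simp del: One_nat_def)
qed

lemma products_homogeneous:
  assumes "q \<in> products t lminors"
  shows "homogeneous_poly (n * t) q"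
proof -
  obtain g where g: "q = (\<Prod>s<t. g s)" "\<forall>s<t. g s \<in> lminors" using assms by (auto simp: products_def)
  have "homogeneous_poly (card {..<t} * n) (\<Prod>s<t. g s)"
    by (rule homogeneous_prod) (use g(2) lminors_homogeneous in auto)
  then show ?thesis by (simp add: g(1) mult.commute)
qed

definition "J = combinations V (products t lminors)"

lemma J_ideal: "ideal J (mpoly_ring V)"
  unfolding J_def by (intro combinations_ideal products_polys lminors_polys)

text \<open>The generic matrix that completes the ladder: the new variables sit in new rows.\<close>

definition \<xi>' :: "nat \<Rightarrow> nat \<Rightarrow> nat \<times> nat" where
  "\<xi>' i j = (if (i, j) \<in> L then \<xi> i j else (\<rho> i + n, j))"

text \<open>For a row that meets the ladder, the distance of the cell from the ladder within that row. Because the bounds increase, subtracting a multiple of it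
  from the weights still favours the diagonals.\<close>

definition off :: "nat \<Rightarrow> nat \<Rightarrow> int" where
  "off i j = max 0 (\<alpha> i - int j) + max 0 (int j - \<beta> i)"

definition \<omega>' :: "int \<Rightarrow> nat \<times> nat \<Rightarrow> int" where
  "\<omega>' N v = (if fst v < n then int (\<omega> v) else int (\<rho> (fst v - n) * snd v) - N * off (\<rho> (fst v - n)) (snd v))"

lemma off_L: "i < n \<Longrightarrow> j < m \<Longrightarrow> off i j = 0 \<longleftrightarrow> (i, j) \<in> L" and off_nonneg: "0 \<le> off i j"
  by (auto simp: off_def L_def max_def)

lemma \<omega>'_\<xi>':
  assumes "i < n" "j < m"
  shows "\<omega>' N (\<xi>' i j) = int (i * j) - N * off i j"
proof (cases "(i, j) \<in> L")
  case True
  then have "off i j = 0" using off_L[OF assms] by simp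
  then show ?thesis using True assms \<rho> by (simp add: \<xi>'_def \<omega>'_def \<xi>_def \<omega>_def)
next
  case False
  then show ?thesis using assms \<rho> by (simp add: \<xi>'_def \<omega>'_def)
qed

lemma \<xi>'_inj:
  assumes "i < n" "j < m" "i' < n" "j' < m" "\<xi>' i j = \<xi>' i' j'"
  shows "i = i' \<and> j = j'"
proof -
  have "\<rho> i < n" "\<rho> i' < n" using assms \<rho>(1) by auto
  then have "\<rho> i = \<rho> i' \<and> j = j'" using assms(5) by (auto simp: \<xi>'_def \<xi>_def split: if_splits)
  then show ?thesis using \<rho>(2)[OF assms(1)] \<rho>(2)[OF assms(3)] by metis
qed

lemma \<omega>'_monge:
  assumes "0 \<le> N" "i < i'" "i' < n" "j < j'" "j' < m"
  shows "\<omega>' N (\<xi>' i j') + \<omega>' N (\<xi>' i' j) < \<omega>' N (\<xi>' i j) + \<omega>' N (\<xi>' i' j')"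
proof -
  have "\<alpha> i \<le> \<alpha> i'" "\<beta> i \<le> \<beta> i'" "int j \<le> int j'" using mono[of i i'] assms by auto
  then have "off i j + off i' j' \<le> off i j' + off i' j"
    using convex_positive_part[of "\<alpha> i" "\<alpha> i'" "int j" "int j'"] convex_positive_part[of "int j" "int j'" "\<beta> i" "\<beta> i'"]
    by (simp add: off_def)
  then have "N * (off i j + off i' j') \<le> N * (off i j' + off i' j)" using assms(1) by (rule mult_left_mono)
  moreover have "int (i * j') + int (i' * j) < int (i * j) + int (i' * j')"
  proof -
    have "0 < (int i' - int i) * (int j' - int j)" using assms by simp
    then show ?thesis by (simp add: algebra_simps)
  qed
  ultimately show ?thesis using assms by (simp add: \<omega>'_\<xi>' distrib_left)
qed

text \<open>An element of the power of the ideal of the ladder is the restriction to the ladder of an element of the same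
  power for a generic matrix. The new variables get weights so low that the terms of highest weight do not change,
  and the cut inequalities for the generic matrix apply.\<close>

lemma initial_tableau:
  assumes f: "f \<in> J" "homogeneous_poly e f" and u: "u \<in> supp f" "\<And>u'. u' \<in> supp f \<Longrightarrow> weight \<omega> u' \<le> weight \<omega> u"
  shows "\<exists>\<tau>\<in>tableaux. mdvd \<tau> u"
proof -
  obtain K :: nat and p q where
    Kpq: "\<And>k. k < K \<Longrightarrow> p k \<in> polys V \<and> q k \<in> products t lminors \<and> n * t \<le> e \<and> homogeneous_poly (e - n * t) (p k)"
    and f_eq: "f = (\<Sum>k<K. p k * q k)"
    using combinations_explicit_homogeneous[OF products_homogeneous f(1)[unfolded J_def] f(2)] by blast
  have "\<exists>a. (\<forall>s<t. (\<forall>l<n. a s l < m)) \<and> q k = (\<Prod>s<t. det (ladder_matrix (a s)))" if k: "k < K" for k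
  proof -
    have "q k \<in> products t lminors" using Kpq[OF k] by blast
    then obtain g where g: "q k = (\<Prod>s<t. g s)" "\<forall>s<t. g s \<in> lminors"
      unfolding products_def by blast
    have "\<exists>a. s < t \<longrightarrow> g s = det (ladder_matrix a) \<and> (\<forall>l<n. a l < m)" for s
    proof (cases "s < t")
      case True
      then have "g s \<in> lminors" using g(2) by blast
      then show ?thesis unfolding lminors_def by blast
    qed blast
    then have "\<forall>s. \<exists>a. s < t \<longrightarrow> g s = det (ladder_matrix a) \<and> (\<forall>l<n. a l < m)" by (rule allI)
    then obtain a where a: "\<forall>s. s < t \<longrightarrow> g s = det (ladder_matrix (a s)) \<and> (\<forall>l<n. a s l < m)" by metis
    then show ?thesis by (intro exI[of _ a]) (simp add: g(1))
  qed
  then have "\<forall>k. \<exists>a. k < K \<longrightarrow> (\<forall>s<t. (\<forall>l<n. a s l < m)) \<and> q k = (\<Prod>s<t. det (ladder_matrix (a s)))" by blast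
  then obtain a where a: "\<forall>k. k < K \<longrightarrow> (\<forall>s<t. (\<forall>l<n. a k s l < m)) \<and> q k = (\<Prod>s<t. det (ladder_matrix (a k s)))"
    by metis
  have a_m: "a k s l < m" if "k < K" "s < t" "l < n" for k s l using a that by blast
  define gm :: "(nat \<Rightarrow> nat) \<Rightarrow> (nat \<times> nat, 'k) mpoly" where
    "gm b = det (mat n n (\<lambda>(i, l). var (\<xi>' i (b l))))" for b
  define f' where "f' = (\<Sum>k<K. p k * (\<Prod>s<t. gm (a k s)))"
  define \<sigma> :: "(nat \<times> nat, 'k) mpoly \<Rightarrow> (nat \<times> nat, 'k) mpoly" where
    "\<sigma> = subst (\<lambda>v. if fst v < n then var v else 0)"
  have coef_\<sigma>: "coef (\<sigma> g) x = (if \<forall>v\<in>supp x. fst v < n then coef g x else 0)" for g x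
    unfolding \<sigma>_def by (rule coef_subst_restrict)
  have \<sigma>_p: "\<sigma> g = g" if g: "g \<in> polys V" for g
  proof (rule Poly_Mapping.poly_mapping_eqI)
    fix x
    have "\<forall>v\<in>supp x. fst v < n" if "x \<in> supp g" using g that by (fastforce simp: mem_polys)
    then show "coef (\<sigma> g) x = coef g x" by (cases "x \<in> supp g") (auto simp: coef_\<sigma> in_keys_iff)
  qed
  have \<sigma>_gm: "\<sigma> (gm b) = det (ladder_matrix b)" for b
  proof -
    have "map_mat \<sigma> (mat n n (\<lambda>(i, l). var (\<xi>' i (b l)))) = ladder_matrix b"
      by (rule eq_matI) (auto simp: \<sigma>_def ladder_matrix_def \<xi>'_def \<xi>_def \<rho>)
    then show ?thesis by (simp add: gm_def \<sigma>_def subst_det)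
  qed
  have \<sigma>_prod: "\<sigma> (\<Prod>s<t'. h s) = (\<Prod>s<t'. \<sigma> (h s))" for h and t' :: nat
    by (induction t') (simp_all add: \<sigma>_def subst_mult)
  have \<sigma>f: "\<sigma> f' = f"
  proof -
    have "\<sigma> f' = (\<Sum>k<K. \<sigma> (p k) * (\<Prod>s<t. \<sigma> (gm (a k s))))"
      unfolding f'_def \<sigma>_prod[symmetric] by (simp add: \<sigma>_def subst_sum subst_mult)
    also have "\<dots> = (\<Sum>k<K. p k * q k)"
    proof (rule sum.cong[OF refl])
      fix k assume "k \<in> {..<K}"
      then have k: "k < K" by simp
      have "q k = (\<Prod>s<t. det (ladder_matrix (a k s)))" using a k by blast
      then show "\<sigma> (p k) * (\<Prod>s<t. \<sigma> (gm (a k s))) = p k * q k" using \<sigma>_p Kpq[OF k] by (simp add: \<sigma>_gm)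
    qed
    finally show ?thesis by (simp add: f_eq)
  qed
  have hom': "homogeneous_poly e f'"
    unfolding f'_def
  proof (rule homogeneous_sum)
    fix k assume "k \<in> {..<K}"
    then have k: "k < K" by simp
    have "homogeneous_poly n (gm b)" for b
      unfolding gm_def by (rule homogeneous_det) (auto simp del: One_nat_def)
    then have "homogeneous_poly (card {..<t} * n) (\<Prod>s<t. gm (a k s))" by (intro homogeneous_prod)
    then have "homogeneous_poly (e - n * t + n * t) (p k * (\<Prod>s<t. gm (a k s)))"
      using Kpq[OF k] by (intro homogeneous_mult) (auto simp: mult.commute)
    then show "homogeneous_poly e (p k * (\<Prod>s<t. gm (a k s)))" using Kpq[OF k] by simp
  qed
  have vars': "\<exists>i<n. \<exists>j<m. v = \<xi> i j \<or> v = \<xi>' i j" if x: "x \<in> supp f'" "v \<in> supp x" for x v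
  proof -
    let ?W = "{v. \<exists>i<n. \<exists>j<m. v = \<xi> i j \<or> v = \<xi>' i j}"
    have VW: "V \<subseteq> ?W"
    proof
      fix y assume y: "y \<in> V"
      then have "y = \<xi> (\<rho> (fst y)) (snd y)" "\<rho> (fst y) < n" "snd y < m" using \<rho> by (auto simp: \<xi>_def)
      then show "y \<in> ?W" by blast
    qed
    have "f' \<in> polys ?W"
      unfolding f'_def
    proof (rule polys_sum)
      fix k assume "k \<in> {..<K}"
      then have k: "k < K" by simp
      have "p k \<in> polys ?W" using polys_mono[OF VW] Kpq[OF k] by blast
      moreover have "gm (a k s) \<in> polys ?W" if "s < t" for s
        unfolding gm_def
      proof (rule polys_det)
        fix i l assume "i < n" "l < n"
        then have "\<xi>' i (a k s l) \<in> ?W" using a_m[OF k that \<open>l < n\<close>]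
          by (intro CollectI exI[of _ i] conjI exI[of _ "a k s l"] disjI2 refl)
        from polys_var[OF this] show "mat n n (\<lambda>(i, l). var (\<xi>' i (a k s l))) $$ (i, l) \<in> polys ?W"
          using \<open>i < n\<close> \<open>l < n\<close> by (simp only: index_mat prod.case)
      qed simp
      ultimately show "p k * (\<Prod>s<t. gm (a k s)) \<in> polys ?W" by (intro polys_mult polys_prod) auto
    qed
    then have "supp x \<subseteq> ?W" unfolding mem_polys by (rule bspec[OF _ x(1)])
    from subsetD[OF this x(2)] show ?thesis by (rule CollectD)
  qed
  \<comment> \<open>A monomial of degree \<open>e\<close> that contains a new variable has negative weight.\<close>
  define N where "N = int (e * (n * m)) + 1"
  have N: "0 \<le> N" by (simp add: N_def)
  have old_u: "\<forall>v\<in>supp u. fst v < n" and u': "u \<in> supp f'"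
    using u(1) coef_\<sigma>[of f' u] unfolding \<sigma>f by (auto simp: in_keys_iff split: if_splits)
  have weight_old: "weight (\<omega>' N) x = int (weight \<omega> x)" if "\<forall>v\<in>supp x. fst v < n" for x
    using that unfolding weight_def by (simp add: \<omega>'_def)
  have top: "weight (\<omega>' N) x \<le> weight (\<omega>' N) u" if x: "x \<in> supp f'" for x
  proof (cases "\<forall>v\<in>supp x. fst v < n")
    case True
    then have "x \<in> supp f" using x coef_\<sigma>[of f' x] unfolding \<sigma>f by (simp add: in_keys_iff)
    then show ?thesis using u(2) weight_old[OF True] weight_old[OF old_u] by simp
  next
    case False
    then obtain v where v: "v \<in> supp x" "\<not> fst v < n" by blast
    have small: "\<omega>' N v' \<le> int (n * m)" if v': "v' \<in> supp x" for v'
    proof -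
      obtain i j where ij: "i < n" "j < m" "v' = \<xi> i j \<or> v' = \<xi>' i j" using vars'[OF x v'] by blast
      have "\<omega>' N v' \<le> int (i * j)"
      proof (cases "v' = \<xi>' i j")
        case True
        then show ?thesis using \<omega>'_\<xi>'[OF ij(1,2), of N] N off_nonneg[of i j] by simp
      next
        case False
        then show ?thesis using ij \<rho> by (simp add: \<omega>'_def \<xi>_def \<omega>_def)
      qed
      also have "\<dots> \<le> int (n * m)" using ij(1,2) by (simp only: of_nat_le_iff) (intro mult_le_mono, auto)
      finally show ?thesis .
    qed
    have new: "\<omega>' N v \<le> int (n * m) - N"
    proof -
      obtain i j where ij: "i < n" "j < m" "v = \<xi> i j \<or> v = \<xi>' i j" using vars'[OF x v(1)] by blast
      have v': "v = \<xi>' i j" "(i, j) \<notin> L" using ij v(2) \<rho>(1)[of i] by (auto simp: \<xi>_def \<xi>'_def split: if_splits)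
      then have "1 \<le> off i j" using off_L[OF ij(1,2)] off_nonneg[of i j] by linarith
      then have "N * 1 \<le> N * off i j" using N by (rule mult_left_mono)
      moreover have "int (i * j) \<le> int (n * m)" using ij(1,2) by (simp only: of_nat_le_iff) (intro mult_le_mono, auto)
      ultimately show ?thesis using \<omega>'_\<xi>'[OF ij(1,2), of N] v'(1) by simp
    qed
    have deg: "mdeg x = e" using hom' x by (simp add: homogeneous_poly_iff)
    obtain y where y: "x = vmono v + y" using mdvd_diff_add[of "vmono v" x] v(1)
      by (metis mdvd_vmono)
    have "mdeg y + 1 = e" using deg by (simp add: y mdeg_vmono)
    moreover have "weight (\<omega>' N) y \<le> int (mdeg y) * int (n * m)"
      by (rule weight_le) (use small in \<open>auto simp: y supp_mono_add\<close>)
    ultimately have "weight (\<omega>' N) x \<le> int (n * m) - N + int (mdeg y) * int (n * m)"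
      using new unfolding y weight_add weight_vmono by linarith
    also have "\<dots> = int ((mdeg y + 1) * (n * m)) - N" by (simp add: algebra_simps)
    also have "\<dots> = int (e * (n * m)) - N" unfolding \<open>mdeg y + 1 = e\<close> ..
    also have "\<dots> \<le> weight (\<omega>' N) u" using weight_old[OF old_u] by (simp add: N_def)
    finally show ?thesis .
  qed
  show ?thesis
  proof (rule cut_condition_imp_tableau)
    fix D assume D: "D \<subseteq> {..<m}" "card D = n - 1"
    interpret cut: generic_matrix_cut n m \<xi>' "\<omega>' N" D "TYPE('k)"
    proof
      show "1 \<le> n" by (rule n)
      show "D \<subseteq> {..<m}" "card D = n - 1" by (rule D)+
      fix i j i' j' assume "i < n" "j < m" "i' < n" "j' < m" "\<xi>' i j = \<xi>' i' j'"
      then show "i = i' \<and> j = j'" by (rule \<xi>'_inj)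
    next
      fix i j i' j' assume "i < i'" "i' < n" "j < j'" "j' < m"
      then show "\<omega>' N (\<xi>' i j') + \<omega>' N (\<xi>' i' j) < \<omega>' N (\<xi>' i j) + \<omega>' N (\<xi>' i' j')"
        by (rule \<omega>'_monge[OF N])
    qed
    have "gm = cut.gminor" by (rule ext) (simp add: gm_def cut.gminor_def)
    then have "f' = (\<Sum>k<K. p k * (\<Prod>s<t. cut.gminor (a k s)))" by (simp add: f'_def)
    from cut.cut_inequality[OF this _ hom' u' top] have "t \<le> cut.cut_deg u" using a_m by blast
    also have "\<dots> = (\<Sum>j\<in>{..<m} - D. cell_coef u (card {x \<in> D. x < j}) j)"
      unfolding cut.cut_deg_def
    proof (rule sum.cong[OF refl])
      fix j assume "j \<in> {..<m} - D"
      have "coef u (\<xi>' i j) = cell_coef u i j" for i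
      proof (cases "(i, j) \<in> L")
        case False
        have "\<xi>' i j \<notin> supp u" using old_u False by (auto simp: \<xi>'_def)
        then show ?thesis using False by (simp add: cell_coef_def in_keys_iff)
      qed (simp add: \<xi>'_def cell_coef_def)
      then show "coef u (\<xi>' (cut.cut_row j) j) = cell_coef u (card {x \<in> D. x < j}) j" by (simp add: cut.cut_row_def)
    qed
    finally show "t \<le> (\<Sum>j\<in>{..<m} - D. cell_coef u (card {x \<in> D. x < j}) j)" .
  qed
qed

text \<open>The product of the minors in the columns of the \<open>t\<close> chains has the tableau as its leading monomial.\<close>

lemma tableau_generator:
  assumes \<tau>: "\<tau> \<in> tableaux"
  shows "\<exists>g\<in>J. homogeneous_poly (n * t) g \<and> coef g \<tau> = 1 \<and> (\<forall>u\<in>supp g. u = \<tau> \<or> weight \<omega> u < weight \<omega> \<tau>)"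
proof -
  obtain a :: "nat \<Rightarrow> nat \<Rightarrow> nat" where a: "\<And>s i. s < t \<Longrightarrow> i < n \<Longrightarrow> (i, a s i) \<in> L"
    "\<And>s i. s < t \<Longrightarrow> Suc i < n \<Longrightarrow> a s i < a s (Suc i)" and sum: "(\<Sum>s<t. \<Sum>i<n. vmono (\<xi> i (a s i))) = \<tau>"
    using tableau_chains[OF \<tau>] by blast
  have incr: "a s l < a s l'" if "s < t" "l < l'" "l' < n" for s l l'
  proof -
    have "a s l < a s (Suc (l + k))" if "Suc (l + k) < n" for k
      using that
    proof (induction k)
      case (Suc k)
      then show ?case using a(2)[OF \<open>s < t\<close>, of "Suc (l + k)"] by simp
    qed (use a(2) \<open>s < t\<close> in simp)
    from this[of "l' - Suc l"] that show ?thesis by simp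
  qed
  have a_m: "a s l < m" if "s < t" "l < n" for s l using a(1)[OF that] by (simp add: L_def)
  define g where "g = (\<Prod>s<t. det (ladder_matrix (a s)))"
  have g_prod: "g \<in> products t lminors"
    unfolding g_def products_def lminors_def using a_m incr by blast
  have "has_lead (\<lambda>v. int (\<omega> v)) (det (ladder_matrix (a s))) (\<Sum>i<n. vmono (\<xi> i (a s i)))" if s: "s < t" for s
  proof (rule det_has_lead[OF ladder_matrix_carrier, where \<eta> = "\<lambda>i l. \<xi> i (a s l)"])
    show "ladder_matrix (a s) $$ (i, l) = var (\<xi> i (a s l)) \<or> ladder_matrix (a s) $$ (i, l) = 0"
      if "i < n" "l < n" for i l using that by (simp add: ladder_matrix_def)
    show "ladder_matrix (a s) $$ (i, i) = var (\<xi> i (a s i))" if "i < n" for i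
      using that a(1)[OF s that] by (simp add: ladder_matrix_def)
    show "strictly_monge n (\<lambda>i l. int (\<omega> (\<xi> i (a s l))))"
      unfolding strictly_monge_def
    proof (intro allI impI)
      fix i i' l l' assume *: "i < i'" "i' < n" "l < l'" "l' < n"
      have "0 < (int i' - int i) * (int (a s l') - int (a s l))" using * incr[OF s, of l l'] by simp
      then show "int (\<omega> (\<xi> i (a s l'))) + int (\<omega> (\<xi> i' (a s l))) < int (\<omega> (\<xi> i (a s l))) + int (\<omega> (\<xi> i' (a s l')))"
        using * \<rho>(2) by (simp add: \<omega>_def \<xi>_def algebra_simps)
    qed
  qed
  then have "has_lead (\<lambda>v. int (\<omega> v)) g (\<Sum>s<t. \<Sum>i<n. vmono (\<xi> i (a s i)))"
    unfolding g_def by (intro has_lead_prod) auto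
  then have lead: "coef g \<tau> \<noteq> 0" "\<And>u. u \<in> supp g \<Longrightarrow> u = \<tau> \<or> weight \<omega> u < weight \<omega> \<tau>"
    unfolding sum has_lead_def weight_int of_nat_less_iff by blast+
  define h where "h = const_poly (1 / coef g \<tau>) * g"
  have coef_h: "coef h u = 1 / coef g \<tau> * coef g u" for u by (simp add: h_def coef_const_mult)
  have "h \<in> J" unfolding h_def J_def by (intro combinations_mult combinations_generator g_prod polys_const)
  moreover have "homogeneous_poly (n * t) h"
    using homogeneous_mult[OF homogeneous_const products_homogeneous[OF g_prod]] by (simp add: h_def)
  moreover have "coef h \<tau> = 1" using lead(1) by (simp add: coef_h)
  moreover have "u = \<tau> \<or> weight \<omega> u < weight \<omega> \<tau>" if "u \<in> supp h" for u
    using that lead(2)[of u] by (simp add: in_keys_iff coef_h)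
  ultimately show ?thesis by blast
qed

lemma groebner:
  assumes vs: "distinct vs" "set vs = V"
  shows "groebner_linear_quotients vs tableaux rank (n * t) J \<omega>"
proof (intro groebner_linear_quotients.intro linear_quotients.intro groebner_linear_quotients_axioms.intro)
  show "distinct vs" by (rule vs)
  show "ideal J (mpoly_ring (set vs))" unfolding vs(2) by (rule J_ideal)
  fix \<tau> assume \<tau>: "\<tau> \<in> tableaux"
  have "(\<lambda>(i, j). \<xi> i j) ` L \<subseteq> V" using \<rho> by (auto simp: \<xi>_def L_def)
  then show "supp \<tau> \<subseteq> set vs" using \<tau> unfolding vs(2) tableaux_def by blast
  show "mdeg \<tau> = n * t" by (rule mdeg_tableau[OF \<tau>])
  show "\<exists>g\<in>J. homogeneous_poly (n * t) g \<and> coef g \<tau> = 1 \<and> (\<forall>u\<in>supp g. u = \<tau> \<or> weight \<omega> u < weight \<omega> \<tau>)"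
    by (rule tableau_generator[OF \<tau>])
  fix \<tau>' assume \<tau>': "\<tau>' \<in> tableaux"
  {
    fix u assume u: "mdvd \<tau> u" "mdvd \<tau>' u" and min: "\<And>\<tau>''. \<tau>'' \<in> tableaux \<Longrightarrow> mdvd \<tau>'' u \<Longrightarrow> rank \<tau> \<le> rank \<tau>''"
      and rk: "rank \<tau>' = rank \<tau>"
    have le: "rank \<tau> \<le> rank (greedy_mono_tab u)"
      by (intro min greedy_tab tableau_divisor_full[OF \<tau> u(1)])
    then show "\<tau>' = \<tau>" using tableau_unique[OF \<tau> u(1)] tableau_unique[OF \<tau>' u(2)] rk by simp
  }
  show "\<exists>y\<in>supp \<rho>'. \<exists>\<tau>''\<in>tableaux. mdvd \<tau>'' (\<tau> + vmono y) \<and> rank \<tau>'' < rank \<tau>"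
    if "mdvd \<tau>' (\<tau> + \<rho>')" "rank \<tau>' < rank \<tau>" for \<rho>'
    by (rule tableau_linear_quotients[OF \<tau> \<tau>' that])
qed (rule initial_tableau)

end


section \<open>The Golod property\<close>

context ladder_minors
begin

lemma J_low_degree: "f \<in> J \<Longrightarrow> mdeg u < n * t \<Longrightarrow> coef f u = 0"
  unfolding J_def by (rule combinations_low_degree[OF products_homogeneous])

lemma J_hcomp: "f \<in> J \<Longrightarrow> hcomp k f \<in> J"
  unfolding J_def by (rule combinations_hcomp[OF products_homogeneous])

lemma J_homogeneous: "homogeneous_ideal V J"
  unfolding homogeneous_ideal_def
proof (intro exI conjI)
  have P: "products t lminors \<subseteq> polys V" by (intro products_polys lminors_polys)
  then show "products t lminors \<subseteq> homogeneous_elements V"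
    using products_homogeneous unfolding homogeneous_elements_def by blast
  show "J = Idl\<^bsub>mpoly_ring V\<^esub> (products t lminors)" unfolding J_def genideal_eq_combinations[OF P] ..
qed

text \<open>The bound excludes ideals that contain linear forms.\<close>

lemma golod_of_degree_ge_2:
  assumes d: "2 \<le> n * t"
  shows "golod V J"
proof -
  obtain vs where vs: "distinct vs" "set vs = V" using finite_distinct_list[of V] by auto
  interpret G: groebner_linear_quotients vs tableaux rank "n * t" J \<omega> by (rule groebner[OF vs])
  have "0 < n * t" using d by linarith
  then have const: "coef f 0 = 0" if "f \<in> J" for f by (intro J_low_degree[OF that]) simp
  interpret K: koszul_quotient V J vs
  proof (rule koszul_quotient.intro)
    show "ideal J (mpoly_ring V)" by (rule J_ideal)
    show "set vs \<subseteq> V" using vs by simp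
    show "coef p 0 = 0" if "p \<in> J" for p by (rule const[OF that])
    show "hcomp k p \<in> J" if "p \<in> J" for p k by (rule J_hcomp[OF that])
  qed
  interpret linear_koszul_quotient V J vs "n * t"
  proof (intro linear_koszul_quotient.intro linear_koszul_quotient_axioms.intro)
    show "koszul_quotient V J vs" by (rule K.koszul_quotient_axioms)
    show "finite V" by simp
    show "2 \<le> n * t" by (rule d)
    fix i e :: nat and z :: "nat set \<Rightarrow> (nat \<times> nat, 'k) mpoly"
    assume h: "1 \<le> i" "e \<noteq> n * t - 1" "z \<in> K.chains" "in_comp i z" "\<And>U. homogeneous_poly e (z U)"
      and kd: "\<And>W. kd K.fs z W \<in> J"
    have e: "Suc e \<noteq> n * t" using h(2) d by linarith
    have z: "z U \<in> polys (set vs)" for U using K.chainsD[OF h(3)] vs(2) by simp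
    have z0: "z U = 0" if "\<not> U \<subseteq> {..<length vs}" for U using h(3) that by (simp add: K.chains_def)
    have kd': "kd G.fs z W \<in> J" for W using kd by (simp add: G.fs_def K.fs_def)
    have "\<exists>y. (\<forall>U. y U \<in> polys (set vs)) \<and> (\<forall>U. \<not> U \<subseteq> {..<length vs} \<longrightarrow> y U = 0) \<and> (\<forall>W. z W - kd G.fs y W \<in> J)"
      by (rule G.strand_modulo[OF const J_hcomp h(1) e z z0 h(4,5) kd'])
    then obtain y where y: "\<forall>U. y U \<in> polys (set vs)" "\<forall>U. \<not> U \<subseteq> {..<length vs} \<longrightarrow> y U = 0"
        "\<forall>W. z W - kd G.fs y W \<in> J"
      by (elim exE conjE)
    have "y \<in> K.chains" using y(1,2) vs(2) by (simp add: K.chains_def)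
    then show "\<exists>y\<in>K.chains. \<forall>W. z W - kd K.fs y W \<in> J"
      using y(3) by (intro bexI[of _ y]) (simp_all add: G.fs_def K.fs_def)
  qed
  show ?thesis
  proof (rule golod_J[OF J_homogeneous vs(1)])
    show "var v \<in> J" if "v \<in> V" "v \<notin> set vs" for v using that vs(2) by simp
    show "coef p (vmono v) = 0" if "p \<in> J" "v \<in> set vs" for p v
      by (rule J_low_degree[OF that(1)]) (use d in simp)
  qed
qed

end

text \<open>Modulo an ideal of variables the Koszul complex is that of a polynomial ring, which has no homology in
  positive degrees; the value \<open>2\<close> for the degree of the linear strand is arbitrary.\<close>

lemma golod_ideal_of_variables:
  fixes P :: "('v, 'k::field) mpoly set"
  assumes "finite V" "S \<subseteq> V" and P: "P \<subseteq> insert 0 (var ` S)" "var ` S \<subseteq> P"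
  shows "golod V (combinations V P)"
proof -
  let ?J = "combinations V P"
  define \<sigma> :: "('v, 'k) mpoly \<Rightarrow> ('v, 'k) mpoly" where "\<sigma> = subst (\<lambda>v. if v \<notin> S then var v else 0)"
  have coef_\<sigma>: "coef (\<sigma> p) u = (if \<forall>v\<in>supp u. v \<notin> S then coef p u else 0)" for p u
    unfolding \<sigma>_def by (rule coef_subst_restrict)
  have P_polys: "P \<subseteq> polys V" using P(1) assms(2) by (auto intro!: polys_var)
  have P_hom: "homogeneous_poly 1 q" if "q \<in> P" for q using that P(1) by (auto simp del: One_nat_def)
  have J: "ideal ?J (mpoly_ring V)" by (rule combinations_ideal[OF P_polys])
  have var_J: "var v \<in> ?J" if "v \<in> S" for v using P(2) that by (intro combinations_generator) blast
  have \<sigma>_J: "\<sigma> f = 0" if "f \<in> ?J" for f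
    using that
  proof (induction rule: combinations.induct)
    case (step p q f)
    have "\<sigma> q = 0" using step(2) P(1) by (auto simp: \<sigma>_def)
    then show ?case using step(4) by (simp add: \<sigma>_def subst_add subst_mult)
  qed (simp add: \<sigma>_def)
  have diff_J: "p - \<sigma> p \<in> ?J" if p: "p \<in> polys V" for p
  proof -
    have "p - \<sigma> p = (\<Sum>e\<in>{e\<in>supp p. \<exists>v\<in>supp e. v \<in> S}. mterm e (coef p e))"
      by (rule Poly_Mapping.poly_mapping_eqI) (auto simp: lookup_minus coef_\<sigma> coef_sum coef_term in_keys_iff)
    also have "\<dots> \<in> ?J"
    proof (rule ideal_sum_closed[OF J])
      fix e assume "e \<in> {e\<in>supp p. \<exists>v\<in>supp e. v \<in> S}"
      then obtain v where v: "e \<in> supp p" "v \<in> supp e" "v \<in> S" by blast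
      have e: "e - vmono v + vmono v = e" by (rule mdvd_diff_add2) (simp add: mdvd_vmono v(2))
      have "supp (e - vmono v) \<subseteq> supp (e - vmono v + vmono v)" by (auto simp: supp_mono_add)
      then have "supp (e - vmono v) \<subseteq> V" using p v(1) unfolding e by (auto simp: mem_polys)
      then have "mterm (e - vmono v) (coef p e) * var v \<in> ?J" by (intro combinations_mult var_J v(3) polys_term)
      then show "mterm e (coef p e) \<in> ?J" by (simp add: var_eq mult_single e)
    qed
    finally show ?thesis .
  qed
  have coef_J: "coef f u = 0" if "f \<in> ?J" "\<forall>v\<in>supp u. v \<notin> S" for f u
  proof -
    have "coef f u = coef (\<sigma> f) u" using that(2) by (simp add: coef_\<sigma>)
    then show ?thesis by (simp add: \<sigma>_J[OF that(1)])
  qed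
  \<comment> \<open>Only the variables outside of the ideal generate the maximal ideal of the quotient minimally.\<close>
  obtain vs where vs: "distinct vs" "set vs = V - S" using finite_distinct_list[of "V - S"] assms(1) by auto
  interpret K: koszul_quotient V ?J vs
  proof (rule koszul_quotient.intro)
    show "ideal ?J (mpoly_ring V)" by (rule J)
    show "set vs \<subseteq> V" using vs by auto
    show "coef p 0 = 0" if "p \<in> ?J" for p by (rule coef_J[OF that]) simp
    show "hcomp k p \<in> ?J" if "p \<in> ?J" for p k using P_hom that by (rule combinations_hcomp)
  qed
  interpret linear_koszul_quotient V ?J vs 2
  proof (intro linear_koszul_quotient.intro linear_koszul_quotient_axioms.intro)
    show "koszul_quotient V ?J vs" by (rule K.koszul_quotient_axioms)
    show "finite V" by fact
    show "2 \<le> (2::nat)" by simp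
    fix i e :: nat and z :: "nat set \<Rightarrow> ('v, 'k) mpoly"
    assume h: "1 \<le> i" "e \<noteq> 2 - 1" "z \<in> K.chains" "in_comp i z" "\<And>U. homogeneous_poly e (z U)"
      and kd: "\<And>W. kd K.fs z W \<in> ?J"
    define z' where "z' U = \<sigma> (z U)" for U
    have z: "z U \<in> polys V" for U by (rule K.chainsD[OF h(3)])
    have z0: "z U = 0" if "\<not> U \<subseteq> {..<length vs}" for U using h(3) that by (simp add: K.chains_def)
    have a: "z' U \<in> polys (set vs)" for U
      unfolding mem_polys
    proof
      fix u assume "u \<in> supp (z' U)"
      then have "coef (z U) u \<noteq> 0" "\<forall>v\<in>supp u. v \<notin> S"
        by (simp_all add: z'_def in_keys_iff coef_\<sigma> split: if_splits)
      moreover from this(1) have "u \<in> supp (z U)" by (simp add: in_keys_iff)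
      then have "supp u \<subseteq> V" by (rule bspec[OF z[of U, unfolded mem_polys]])
      ultimately show "supp u \<subseteq> set vs" unfolding vs(2) by blast
    qed
    have b: "z' U = 0" if "\<not> U \<subseteq> {..<length vs}" for U using z0[OF that] by (simp add: z'_def \<sigma>_def)
    have c: "in_comp i z'" using h(4) by (simp add: in_comp_def z'_def \<sigma>_def)
    have d: "homogeneous_poly e (z' U)" for U
    proof -
      have "supp (z' U) \<subseteq> supp (z U)" by (auto simp: z'_def in_keys_iff coef_\<sigma> split: if_splits)
      then show ?thesis using h(5)[of U] unfolding homogeneous_poly_iff by blast
    qed
    have kd': "kd K.fs z' W = \<sigma> (kd K.fs z W)" for W
    proof -
      have sg: "\<sigma> ((- 1) ^ k) = (- 1) ^ k" for k
      proof -
        have "\<sigma> (- 1) + \<sigma> 1 = \<sigma> (- 1 + 1)" unfolding \<sigma>_def by (rule subst_add[symmetric])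
        then have "\<sigma> (- 1) = - 1" by (simp add: \<sigma>_def eq_neg_iff_add_eq_0)
        then show ?thesis by (cases "even k") (simp_all add: \<sigma>_def)
      qed
      have v: "\<sigma> (map var vs ! l) = map var vs ! l" if "l < length vs" for l
        using nth_mem[OF that] vs(2) that by (auto simp: \<sigma>_def)
      have mul: "\<sigma> (p * q) = \<sigma> p * \<sigma> q" for p q by (simp add: \<sigma>_def subst_mult)
      have sum: "\<sigma> (sum f A) = (\<Sum>x\<in>A. \<sigma> (f x))" for f and A :: "nat set" by (simp add: \<sigma>_def subst_sum)
      have zero: "\<sigma> 0 = 0" by (simp add: \<sigma>_def)
      show ?thesis
      proof (cases "W \<subseteq> {..<length vs}")
        case True
        have "\<sigma> (kd K.fs z W) = (\<Sum>l\<in>{..<length vs} - W. \<sigma> ((- 1) ^ card {v\<in>W. v < l} * (map var vs ! l * z (insert l W))))"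
          using True unfolding kd_def K.fs_def by (simp add: sum)
        also have "\<dots> = (\<Sum>l\<in>{..<length vs} - W. (- 1) ^ card {v\<in>W. v < l} * (map var vs ! l * z' (insert l W)))"
          by (rule sum.cong[OF refl]) (simp only: mul sg v z'_def Diff_iff lessThan_iff)
        also have "\<dots> = kd K.fs z' W" using True unfolding kd_def K.fs_def by simp
        finally show ?thesis by (rule sym)
      qed (simp add: kd_def zero)
    qed
    have k: "kd (map var vs) z' W = 0" for W using kd'[of W] \<sigma>_J[OF kd[of W]] by (simp add: K.fs_def)
    obtain y where y: "\<forall>U. y U \<in> polys (set vs)" "\<forall>U. \<not> U \<subseteq> {..<length vs} \<longrightarrow> y U = 0"
        "\<forall>W. kd (map var vs) y W = z' W"
      using koszul_polynomial_ring_exact[OF vs(1) h(1) a b c d k] by blast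
    have "y \<in> K.chains" using y(1,2) polys_mono[of "set vs" V] vs(2) unfolding K.chains_def by blast
    moreover have "z W - kd K.fs y W \<in> ?J" for W using diff_J[OF z[of W]] y(3) by (simp add: K.fs_def z'_def)
    ultimately show "\<exists>y\<in>K.chains. \<forall>W. z W - kd K.fs y W \<in> ?J" by blast
  qed
  show ?thesis
  proof (rule golod_J[OF _ vs(1)])
    show "homogeneous_ideal V ?J"
      unfolding homogeneous_ideal_def
    proof (intro exI conjI)
      show "P \<subseteq> homogeneous_elements V" using P_polys P_hom unfolding homogeneous_elements_def by blast
      show "?J = Idl\<^bsub>mpoly_ring V\<^esub> P" unfolding genideal_eq_combinations[OF P_polys] ..
    qed
    show "var v \<in> ?J" if "v \<in> V" "v \<notin> set vs" for v using that vs(2) var_J by blast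
    show "coef p (vmono v) = 0" if "p \<in> ?J" "v \<in> set vs" for p v
      by (rule coef_J[OF that(1)]) (use that(2) vs(2) in simp)
  qed
qed

lemma (in ladder_minors) golod_single_row:
  assumes "n = 1" "t = 1"
  shows "golod V J"
proof -
  have \<rho>0: "\<rho> 0 = 0" using \<rho>(1)[of 0] assms(1) by simp
  have det: "det (ladder_matrix a) = (if (0, a 0) \<in> L then var (0, a 0) else 0)" for a
  proof -
    have "det (ladder_matrix a) = ladder_matrix a $$ (0, 0)"
      by (rule det_single) (use ladder_matrix_carrier assms(1) in simp)
    also have "\<dots> = (if (0, a 0) \<in> L then var (0, a 0) else 0)" using n(1) by (simp add: ladder_matrix_def \<xi>_def \<rho>0)
    finally show ?thesis .
  qed
  have prods: "products t lminors = lminors"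
  proof
    show "products t lminors \<subseteq> lminors" using assms(2) by (auto simp: products_def)
    show "lminors \<subseteq> products t lminors"
    proof
      fix x assume "x \<in> lminors"
      then show "x \<in> products t lminors" unfolding products_def using assms(2)
        by (intro CollectI exI[of _ "\<lambda>_. x"]) simp
    qed
  qed
  have below: "lminors \<subseteq> insert 0 (var ` L)" unfolding lminors_def det by auto
  have above: "var ` L \<subseteq> lminors"
  proof
    fix x :: "(nat \<times> nat, 'k) mpoly" assume "x \<in> var ` L"
    then obtain i j where ij: "(i, j) \<in> L" "x = var (i, j)" by auto
    from subsetD[OF L_subset ij(1)] have "i = 0" "j < m" using assms(1) by simp_all
    then have "x = det (ladder_matrix (\<lambda>_. j))" "j < m" using ij unfolding det by simp_all
    then show "x \<in> lminors" unfolding lminors_def using assms(1) by (intro CollectI exI[of _ "\<lambda>_. j"]) simp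
  qed
  show ?thesis
    unfolding J_def prods by (rule golod_ideal_of_variables[OF _ L_subset below above]) simp
qed


section \<open>Powers of ideals of maximal minors of a two-sided ladder\<close>

text \<open>Permuting the rows changes all maximal minors by the same sign.\<close>

lemma minors_eq_row_permuted_minors:
  fixes Y :: "'a::comm_ring_1 mat"
  assumes Y: "Y \<in> carrier_mat n m" and \<rho>: "\<And>i. i < n \<Longrightarrow> \<rho> i < n" "\<And>i. i < n \<Longrightarrow> \<rho> (\<rho> i) = i"
  defines "M \<equiv> \<lambda>a. det (mat n n (\<lambda>(i, l). Y $$ (\<rho> i, a l)))"
  shows "\<exists>s::'a. (s = 1 \<or> s = - 1) \<and>
    minors n Y = {s * M a | a. (\<forall>l<n. a l < m) \<and> (\<forall>l l'. l < l' \<longrightarrow> l' < n \<longrightarrow> a l < a l')}"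
proof -
  define p where "p i = (if i < n then \<rho> i else i)" for i
  have pp: "p (p i) = i" for i using \<rho> by (simp add: p_def)
  have p: "p permutes {0..<n}"
    unfolding permutes_def
  proof (intro conjI allI impI)
    show "p x = x" if "x \<notin> {0..<n}" for x using that by (simp add: p_def)
    show "\<exists>!x. p x = y" for y using pp by metis
  qed
  let ?s = "signof p :: 'a"
  have s: "?s = 1 \<or> ?s = - 1" by (simp add: sign_def)
  have ss: "?s * ?s = 1" by (simp add: sign_def)
  have sub: "det (submatrix Y {..<n} A) = ?s * M (pick A)" if A: "A \<subseteq> {..<m}" "card A = n" for A
  proof -
    have pick_row: "pick {..<n} i = i" if "i < n" for i
    proof -
      have "{a \<in> {..<n}. a < i} = {..<i}" using that by auto
      then show ?thesis using pick_card_in_set[of i "{..<n}"] that by simp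
    qed
    have "{i. i < n \<and> i \<in> {..<n}} = {..<n}" "{j. j < m \<and> j \<in> A} = A" using A by auto
    then have B: "submatrix Y {..<n} A = mat n n (\<lambda>(i, l). Y $$ (i, pick A l))"
      using Y A(2) unfolding submatrix_def by (intro eq_matI) (auto simp: pick_row)
    let ?B = "mat n n (\<lambda>(i, l). Y $$ (i, pick A l))"
    have "mat n n (\<lambda>(i, j). ?B $$ (p i, j)) = mat n n (\<lambda>(i, l). Y $$ (\<rho> i, pick A l))"
      by (rule eq_matI) (auto simp: p_def \<rho>)
    then have "M (pick A) = ?s * det ?B" using det_permute_rows[of ?B n p] p by (simp add: M_def)
    then show ?thesis unfolding B by (simp add: mult.assoc[symmetric] ss)
  qed
  have "minors n Y = {?s * M a | a. (\<forall>l<n. a l < m) \<and> (\<forall>l l'. l < l' \<longrightarrow> l' < n \<longrightarrow> a l < a l')}" (is "_ = ?R")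
  proof
    show "minors n Y \<subseteq> ?R"
    proof
      fix x assume "x \<in> minors n Y"
      then obtain I A where IA: "x = det (submatrix Y I A)" "I \<subseteq> {..<n}" "A \<subseteq> {..<m}" "card I = n" "card A = n"
        using Y unfolding minors_def by auto
      have "I = {..<n}" using card_subset_eq[of "{..<n}" I] IA(2,4) by simp
      then have "x = ?s * M (pick A)" using sub IA by simp
      moreover have "pick A l < m" if "l < n" for l using pick_in_set_le[of l A] that IA(3,5) by auto
      moreover have "pick A l < pick A l'" if "l < l'" "l' < n" for l l' using pick_mono_le[of l' A l] that IA(5) by simp
      ultimately show "x \<in> ?R" by blast
    qed
    show "?R \<subseteq> minors n Y"
    proof
      fix x assume "x \<in> ?R"
      then obtain a where a: "x = ?s * M a" "\<forall>l<n. a l < m" "\<forall>l l'. l < l' \<longrightarrow> l' < n \<longrightarrow> a l < a l'" by blast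
      let ?A = "a ` {..<n}"
      have inj: "inj_on a {..<n}"
        by (rule inj_onI) (metis a(3) lessThan_iff less_irrefl linorder_neqE_nat)
      have A: "?A \<subseteq> {..<m}" "card ?A = n" using a(2) inj by (auto simp: card_image)
      have "pick ?A l = a l" if l: "l < n" for l
      proof -
        have "{x \<in> ?A. x < a l} = a ` {..<l}"
        proof
          show "{x \<in> ?A. x < a l} \<subseteq> a ` {..<l}"
          proof
            fix x assume "x \<in> {x \<in> ?A. x < a l}"
            then obtain l' where l': "l' < n" "x = a l'" "a l' < a l" by auto
            then have "l' < l" using a(3) l by (metis less_asym less_irrefl linorder_neqE_nat)
            then show "x \<in> a ` {..<l}" using l'(2) by blast
          qed
          show "a ` {..<l} \<subseteq> {x \<in> ?A. x < a l}" using a(3) l by auto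
        qed
        moreover have "card (a ` {..<l}) = l" using card_image[of a "{..<l}"] inj_on_subset[OF inj, of "{..<l}"] l by simp
        ultimately show ?thesis using pick_card_in_set[of "a l" ?A] l by simp
      qed
      then have "M (pick ?A) = M a" unfolding M_def by (intro arg_cong[of _ _ det] eq_matI) auto
      then have x: "x = det (submatrix Y {..<n} ?A)" using sub[OF A] a(1) by simp
      have "dim_row Y = n" "dim_col Y = m" using Y by auto
      then have "{..<n} \<subseteq> {..<dim_row Y} \<and> ?A \<subseteq> {..<dim_col Y} \<and> card {..<n} = n \<and> card ?A = n"
        using A by simp
      with x show "x \<in> minors n Y"
        unfolding minors_def by (intro CollectI) (rule exI[of _ "{..<n}"], rule exI[of _ ?A], rule conjI)
    qed
  qed
  with s show ?thesis by (intro exI[of _ ?s] conjI)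
qed

theorem theorem6p6:
  fixes n m t :: nat
    and X' :: "(nat \<times> nat, 'k::field) mpoly mat"
  assumes "1 \<le> n" and "n \<le> m"
    and "X' \<in> carrier_mat n m"
    and "\<And>i j. i < n \<Longrightarrow> j < m \<Longrightarrow> X' $$ (i, j) = generic_matrix n m $$ (i, j) \<or> X' $$ (i, j) = 0"
    and "two_sided_ladder n m (nonzero_positions X')"
    and "1 \<le> t"
  defines "R \<equiv> mpoly_ring ({..<n} \<times> {..<m}) :: (nat \<times> nat, 'k) mpoly ring"
  shows "golod ({..<n} \<times> {..<m}) ((Idl\<^bsub>R\<^esub> (minors n X')) [^]\<^bsub>ideals_set R\<^esub> t)"
proof -
  have "\<exists>\<alpha> \<beta> :: nat \<Rightarrow> int. \<exists>\<rho>. (\<forall>i<n. \<rho> i < n \<and> \<rho> (\<rho> i) = i) \<and>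
    (\<forall>i i'. i \<le> i' \<longrightarrow> i' < n \<longrightarrow> \<alpha> i \<le> \<alpha> i' \<and> \<beta> i \<le> \<beta> i') \<and>
    (\<forall>i<n. \<forall>j<m. (\<rho> i, j) \<in> nonzero_positions X' \<longleftrightarrow> \<alpha> i \<le> int j \<and> int j \<le> \<beta> i)"
  proof -
    obtain \<alpha> \<beta> :: "nat \<Rightarrow> int" where
      mono: "mono_on {..<n} \<alpha> \<and> mono_on {..<n} \<beta> \<or> antimono_on {..<n} \<alpha> \<and> antimono_on {..<n} \<beta>"
      and pos: "nonzero_positions X' = {(i, j). i < n \<and> j < m \<and> \<alpha> i \<le> int j \<and> int j \<le> \<beta> i}"
      using assms(5) unfolding two_sided_ladder_def by blast
    show ?thesis
    proof (cases "mono_on {..<n} \<alpha> \<and> mono_on {..<n} \<beta>")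
      case True
      then have up: "mono_on {..<n} \<alpha>" "mono_on {..<n} \<beta>" by auto
      have le: "\<alpha> i \<le> \<alpha> i' \<and> \<beta> i \<le> \<beta> i'" if "i \<le> i'" "i' < n" for i i'
        using monotone_onD[OF up(1), of i i'] monotone_onD[OF up(2), of i i'] that by simp
      show ?thesis unfolding pos
        by (rule exI[of _ \<alpha>], rule exI[of _ \<beta>], rule exI[of _ "\<lambda>i. i"]) (use le in simp)
    next
      case False
      then have down: "antimono_on {..<n} \<alpha>" "antimono_on {..<n} \<beta>" using mono by auto
      have le: "\<alpha> (n - 1 - i) \<le> \<alpha> (n - 1 - i') \<and> \<beta> (n - 1 - i) \<le> \<beta> (n - 1 - i')" if "i \<le> i'" "i' < n" for i i'
        using monotone_onD[OF down(1), of "n - 1 - i'" "n - 1 - i"] monotone_onD[OF down(2), of "n - 1 - i'" "n - 1 - i"]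
          that by simp
      show ?thesis
      proof (rule exI[of _ "\<lambda>i. \<alpha> (n - 1 - i)"], rule exI[of _ "\<lambda>i. \<beta> (n - 1 - i)"],
          rule exI[of _ "\<lambda>i. n - 1 - i"], intro conjI allI impI)
        fix i j assume "i < n" "j < m"
        then show "(n - 1 - i, j) \<in> nonzero_positions X' \<longleftrightarrow> \<alpha> (n - 1 - i) \<le> int j \<and> int j \<le> \<beta> (n - 1 - i)"
          unfolding pos by simp
      qed (use le in auto)
    qed
  qed
  then obtain \<alpha> \<beta> :: "nat \<Rightarrow> int" and \<rho> where h: "\<forall>i<n. \<rho> i < n \<and> \<rho> (\<rho> i) = i"
    "\<forall>i i'. i \<le> i' \<longrightarrow> i' < n \<longrightarrow> \<alpha> i \<le> \<alpha> i' \<and> \<beta> i \<le> \<beta> i'"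
    "\<forall>i<n. \<forall>j<m. (\<rho> i, j) \<in> nonzero_positions X' \<longleftrightarrow> \<alpha> i \<le> int j \<and> int j \<le> \<beta> i"
    by (elim exE conjE)
  have \<rho>: "\<rho> i < n" "\<rho> (\<rho> i) = i" if "i < n" for i using h(1) that by simp_all
  have mono: "\<alpha> i \<le> \<alpha> i'" "\<beta> i \<le> \<beta> i'" if "i \<le> i'" "i' < n" for i i' using h(2) that by simp_all
  have pos: "(\<rho> i, j) \<in> nonzero_positions X' \<longleftrightarrow> \<alpha> i \<le> int j \<and> int j \<le> \<beta> i" if "i < n" "j < m" for i j
    using h(3) that by simp
  interpret ladder_minors n m t \<rho> \<alpha> \<beta> "TYPE('k)"
    by (intro ladder_minors.intro assms(1,2) \<rho> mono)
  have entry: "X' $$ (\<rho> i, j) = (if (i, j) \<in> L then var (\<xi> i j) else 0)" if ij: "i < n" "j < m" for i j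
  proof -
    have "X' $$ (\<rho> i, j) = var (\<xi> i j) \<or> X' $$ (\<rho> i, j) = 0"
      using assms(4)[OF \<rho>(1)[OF ij(1)] ij(2)] \<rho>(1)[OF ij(1)] ij(2) by (simp add: generic_matrix_def \<xi>_def)
    moreover have "X' $$ (\<rho> i, j) \<noteq> 0 \<longleftrightarrow> (i, j) \<in> L"
      using pos[OF ij] \<rho>(1)[OF ij(1)] ij assms(3) by (auto simp: nonzero_positions_def L_def)
    ultimately show ?thesis by auto
  qed
  have "\<exists>s :: (nat \<times> nat, 'k) mpoly. (s = 1 \<or> s = - 1) \<and>
      minors n X' = {s * det (mat n n (\<lambda>(i, l). X' $$ (\<rho> i, a l))) | a.
        (\<forall>l<n. a l < m) \<and> (\<forall>l l'. l < l' \<longrightarrow> l' < n \<longrightarrow> a l < a l')}"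
    by (rule minors_eq_row_permuted_minors[OF assms(3) \<rho>])
  then obtain s :: "(nat \<times> nat, 'k) mpoly" where s: "s = 1 \<or> s = - 1" and
    min: "minors n X' = {s * det (mat n n (\<lambda>(i, l). X' $$ (\<rho> i, a l))) | a.
      (\<forall>l<n. a l < m) \<and> (\<forall>l l'. l < l' \<longrightarrow> l' < n \<longrightarrow> a l < a l')}"
    by (elim exE conjE)
  have mat: "mat n n (\<lambda>(i, l). X' $$ (\<rho> i, a l)) = ladder_matrix a" if "\<forall>l<n. a l < m" for a
    using that by (intro eq_matI) (auto simp: entry ladder_matrix_def)
  have min': "minors n X' = (\<lambda>g. s * g) ` lminors"
    unfolding min lminors_def
  proof (intro equalityI subsetI)
    fix x assume "x \<in> {s * det (mat n n (\<lambda>(i, l). X' $$ (\<rho> i, a l))) | a.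
      (\<forall>l<n. a l < m) \<and> (\<forall>l l'. l < l' \<longrightarrow> l' < n \<longrightarrow> a l < a l')}"
    then obtain a where a: "x = s * det (mat n n (\<lambda>(i, l). X' $$ (\<rho> i, a l)))" "\<forall>l<n. a l < m"
      "\<forall>l l'. l < l' \<longrightarrow> l' < n \<longrightarrow> a l < a l'" by (elim CollectE exE conjE)
    show "x \<in> (\<lambda>g. s * g) ` {det (ladder_matrix a) |a. (\<forall>l<n. a l < m) \<and> (\<forall>l l'. l < l' \<longrightarrow> l' < n \<longrightarrow> a l < a l')}"
      unfolding a(1) mat[OF a(2)] by (rule imageI, rule CollectI, rule exI[of _ a]) (intro conjI refl a)
  next
    fix x assume "x \<in> (\<lambda>g. s * g) ` {det (ladder_matrix a) |a. (\<forall>l<n. a l < m) \<and> (\<forall>l l'. l < l' \<longrightarrow> l' < n \<longrightarrow> a l < a l')}"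
    then obtain a where a: "x = s * det (ladder_matrix a)" "\<forall>l<n. a l < m"
      "\<forall>l l'. l < l' \<longrightarrow> l' < n \<longrightarrow> a l < a l'" by (elim imageE CollectE exE conjE) simp
    show "x \<in> {s * det (mat n n (\<lambda>(i, l). X' $$ (\<rho> i, a l))) | a.
      (\<forall>l<n. a l < m) \<and> (\<forall>l l'. l < l' \<longrightarrow> l' < n \<longrightarrow> a l < a l')}"
      unfolding a(1) mat[OF a(2), symmetric] by (rule CollectI, rule exI[of _ a]) (intro conjI refl a)
  qed
  have s_polys: "s \<in> polys V" using s by (auto intro: polys_uminus)
  have M_polys: "minors n X' \<subseteq> polys V" using lminors_polys s_polys unfolding min'
    by (intro image_subsetI polys_mult) (rule s_polys, rule subsetD)
  have "combinations V (minors n X') = combinations V lminors"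
  proof
    have "minors n X' \<subseteq> combinations V lminors"
      unfolding min'
    proof (rule image_subsetI)
      fix g assume "g \<in> lminors"
      from combinations_mult[OF combinations_generator[OF this] s_polys] show "s * g \<in> combinations V lminors" .
    qed
    from combinations_least[OF combinations_ideal[OF lminors_polys] this]
    show "combinations V (minors n X') \<subseteq> combinations V lminors" by (rule subsetI)
    have "lminors \<subseteq> combinations V (minors n X')"
    proof (rule subsetI)
      fix g assume g: "g \<in> lminors"
      have "s * (s * g) \<in> combinations V (minors n X')"
        unfolding min' by (rule combinations_mult[OF combinations_generator[OF imageI[OF g]] s_polys])
      moreover have "s * (s * g) = g" using s by auto
      ultimately show "g \<in> combinations V (minors n X')" by simp
    qed
    from combinations_least[OF combinations_ideal[OF M_polys] this]
    show "combinations V lminors \<subseteq> combinations V (minors n X')" by (rule subsetI)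
  qed
  then have "Idl\<^bsub>R\<^esub> (minors n X') = Idl\<^bsub>R\<^esub> lminors"
    unfolding R_def genideal_eq_combinations[OF M_polys] genideal_eq_combinations[OF lminors_polys] .
  then have J: "(Idl\<^bsub>R\<^esub> (minors n X')) [^]\<^bsub>ideals_set R\<^esub> t = J"
    unfolding R_def J_def by (simp only: genideal_power[OF lminors_polys])
  show ?thesis
    unfolding J
  proof (cases "2 \<le> n * t")
    case True
    then show "golod V J" by (rule golod_of_degree_ge_2)
  next
    case False
    then have "n = 1" "t = 1" using assms(1,6) mult_le_mono[of 2 n 1 t] mult_le_mono[of 1 n 2 t] by force+
    then show "golod V J" by (rule golod_single_row)
  qed
qed

end
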